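(* Let $(M,J)=\mathbb{P}(\mathcal{O}\oplus\mathcal{O}_E(1))\to\mathbb{F}_n$, where $E=(\mathcal{O}\oplus\mathcal{O}(n))\to\mathbb{CP}^1$ and $\mathbb{F}_n=\mathbb{P}(E)$ is the $n$-th Hirzebruch complex surface. Denote by $K$ the generator of the $S^1$-action on $M$ corresponding to diagonal multiplications on the $\mathcal{O}_E(1)$-factor. Then $(M,J)$ admits no Kähler metric of constant $(bK,q,a)$-scalar curvature for any values of $b$ and $q$.
   Context: $\mathcal{O}_E(1)$ denotes the (fibrewise degree one) dual of the tautological line bundle on $\mathbb{P}(E)=\mathbb{F}_n$; the $S^1$-action on $M$ is induced by $(w_0,w_1)\mapsto(w_0,e^{i\theta}w_1)$ on $\mathcal{O}\oplus\mathcal{O}_E(1)$. Here $b$ and $q$ are real numbers and $a>0$ is a real normalization constant as below. Let $g$ be a $J$-compatible Kähler metric on a compact complex manifold $(M,J)$ of complex dimension $m$, with Kähler form $\omega=g(J\cdot,\cdot)$ and volume form $v_\omega=\omega^m/m!$, and let $X$ be a Killing vector field of $g$ with zeroes. Then there is a smooth function $f$, unique up to an additive constant, with $\imath_X\omega=-df$; for $a>0$, $f_{(X,\omega,a)}$ is the one normalized by $\int_M f_{(X,\omega,a)}v_\omega=a$, and $a$ is always required to be such that $f_{(X,\omega,a)}>0$ on $M$. For $q\in\mathbb{R}$ the $(X,q,a)$-scalar curvature of $g$ is $$\mathrm{S}_{(X,q,a)}(g)=f_{(X,\omega,a)}^2\,\mathrm{Scal}_g+2q\,f_{(X,\omega,a)}\,\Delta_g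 f_{(X,\omega,a)}-q(q-1)|X|_g^2,$$ where $\mathrm{Scal}_g$ is the usual scalar curvature and $\Delta_g=\delta d$ is the (non-negative) Riemannian Laplacian. "A Kähler metric of constant $(bK,q,a)$-scalar curvature" means a Kähler metric $g$ on $(M,J)$ for which $bK$ is Killing, $f_{(bK,\omega,a)}>0$, and $\mathrm{S}_{(bK,q,a)}(g)$ is constant.
   Formalization: The formal theorem assumes n ≥ 1; for n = 0 one has M = CP¹ × F₁ with K rotating the fibres of F₁, and metrics of constant (bK,0,a)-scalar curvature exist there, so the claim fails. *)

theory Defs
  imports "HOL-Analysis.Analysis"
begin

section \<open>Riemannian geometry in a coordinate chart\<close>

text \<open>
  A metric in a chart is a function \<open>h\<close> with \<open>h x u v\<close> the inner product at \<open>x\<close> of the tangent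
  vectors \<open>u\<close> and \<open>v\<close>. Vectors \<open>u\<close>, \<open>v\<close>, \<open>w\<close>, \<open>y\<close> below are read as constant (hence commuting)
  coordinate vector fields wherever they are differentiated along.
\<close>

abbreviation dir_deriv :: "('v::euclidean_space \<Rightarrow> 'w::real_normed_vector) \<Rightarrow> 'v \<Rightarrow> 'v \<Rightarrow> 'w" where
  "dir_deriv F x u \<equiv> frechet_derivative F (at x) u"

primrec Ck :: "nat \<Rightarrow> ('v::euclidean_space \<Rightarrow> 'w::real_normed_vector) \<Rightarrow> bool" where
  "Ck 0 F \<longleftrightarrow> continuous_on UNIV F"
| "Ck (Suc k) F \<longleftrightarrow> (\<forall>x. F differentiable at x) \<and> (\<forall>u. Ck k (\<lambda>x. dir_deriv F x u))"

definition smooth :: "('v::euclidean_space \<Rightarrow> 'w::real_normed_vector) \<Rightarrow> bool" where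
  "smooth F \<longleftrightarrow> (\<forall>k. Ck k F)"

type_synonym 'v metric = "'v \<Rightarrow> 'v \<Rightarrow> 'v \<Rightarrow> real"

definition sharp :: "'v::euclidean_space metric \<Rightarrow> 'v \<Rightarrow> ('v \<Rightarrow> real) \<Rightarrow> 'v" where
  "sharp h x \<eta> = (THE w. \<forall>y. h x w y = \<eta> y)"

text \<open>The Levi-Civita derivative of the constant field \<open>v\<close> along \<open>u\<close>, by the Koszul formula.\<close>

definition christoffel :: "'v::euclidean_space metric \<Rightarrow> 'v \<Rightarrow> 'v \<Rightarrow> 'v \<Rightarrow> 'v" where
  "christoffel h x u v = sharp h x (\<lambda>y.
     (dir_deriv (\<lambda>z. h z v y) x u + dir_deriv (\<lambda>z. h z u y) x v - dir_deriv (\<lambda>z. h z u v) x y) / 2)"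

text \<open>\<open>R(u,v)w = \<nabla>\<^sub>u \<nabla>\<^sub>v w - \<nabla>\<^sub>v \<nabla>\<^sub>u w\<close>\<close>

definition curvature :: "'v::euclidean_space metric \<Rightarrow> 'v \<Rightarrow> 'v \<Rightarrow> 'v \<Rightarrow> 'v \<Rightarrow> 'v" where
  "curvature h x u v w =
     dir_deriv (\<lambda>z. christoffel h z v w) x u - dir_deriv (\<lambda>z. christoffel h z u w) x v
     + christoffel h x u (christoffel h x v w) - christoffel h x v (christoffel h x u w)"

definition ricci :: "'v::euclidean_space metric \<Rightarrow> 'v \<Rightarrow> 'v \<Rightarrow> 'v \<Rightarrow> real" where
  "ricci h x v w = (\<Sum>b\<in>Basis. curvature h x b v w \<bullet> b)"

text \<open>\<open>Basis\<close> is merely the coordinate basis; \<open>sharp h x (\<lambda>y. y \<bullet> b)\<close> is the \<open>b\<close>-th row of the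
  inverse metric, so this is the usual contraction \<open>g\<^sup>a\<^sup>b B\<^sub>a\<^sub>b\<close>.\<close>

definition metric_trace :: "'v::euclidean_space metric \<Rightarrow> 'v \<Rightarrow> ('v \<Rightarrow> 'v \<Rightarrow> real) \<Rightarrow> real" where
  "metric_trace h x B = (\<Sum>b\<in>Basis. B b (sharp h x (\<lambda>y. y \<bullet> b)))"

definition scal :: "'v::euclidean_space metric \<Rightarrow> 'v \<Rightarrow> real" where
  "scal h x = metric_trace h x (ricci h x)"

definition cov_deriv_form ::
  "'v::euclidean_space metric \<Rightarrow> ('v \<Rightarrow> 'v \<Rightarrow> real) \<Rightarrow> 'v \<Rightarrow> 'v \<Rightarrow> 'v \<Rightarrow> real" where
  "cov_deriv_form h \<eta> x u v = dir_deriv (\<lambda>z. \<eta> z v) x u - \<eta> x (christoffel h x u v)"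

definition codifferential :: "'v::euclidean_space metric \<Rightarrow> ('v \<Rightarrow> 'v \<Rightarrow> real) \<Rightarrow> 'v \<Rightarrow> real" where
  "codifferential h \<eta> x = - metric_trace h x (cov_deriv_form h \<eta> x)"

definition laplacian :: "'v::euclidean_space metric \<Rightarrow> ('v \<Rightarrow> real) \<Rightarrow> 'v \<Rightarrow> real" where
  "laplacian h F x = codifferential h (\<lambda>z. frechet_derivative F (at z)) x"

definition lie_deriv_metric ::
  "'v::euclidean_space metric \<Rightarrow> ('v \<Rightarrow> 'v) \<Rightarrow> 'v \<Rightarrow> 'v \<Rightarrow> 'v \<Rightarrow> real" where
  "lie_deriv_metric h X x u v =
     dir_deriv (\<lambda>z. h z u v) x (X x) + h x (dir_deriv X x u) v + h x u (dir_deriv X x v)"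


section \<open>Kaehler metrics on complex manifolds\<close>

text \<open>
  A complex manifold of dimension \<open>CARD('m)\<close> is given by a set of points \<open>M\<close> and a family of
  holomorphically compatible parametrizations \<open>\<psi> \<alpha>\<close>, each defined on all of complex \<open>'m\<close>-space
  (which is enough here). Tensors are families of chart expressions indexed by \<open>\<alpha>\<close>;
  the complex structure \<open>J\<close> is multiplication by \<open>\<i>\<close> in every chart.
\<close>

definition transition :: "('i \<Rightarrow> complex^'m \<Rightarrow> 'p) \<Rightarrow> 'i \<Rightarrow> 'i \<Rightarrow> complex^'m \<Rightarrow> complex^'m" where
  "transition \<psi> \<alpha> \<beta> = inv (\<psi> \<beta>) \<circ> \<psi> \<alpha>"

definition holomorphic_atlas :: "'p set \<Rightarrow> ('i \<Rightarrow> complex^'m \<Rightarrow> 'p) \<Rightarrow> bool" where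
  "holomorphic_atlas M \<psi> \<longleftrightarrow>
     (\<Union>\<alpha>. range (\<psi> \<alpha>)) = M \<and> (\<forall>\<alpha>. inj (\<psi> \<alpha>)) \<and>
     (\<forall>\<alpha> \<beta>. open {z. \<psi> \<alpha> z \<in> range (\<psi> \<beta>)} \<and>
        (\<forall>z. \<psi> \<alpha> z \<in> range (\<psi> \<beta>) \<longrightarrow>
          (\<exists>D. (transition \<psi> \<alpha> \<beta> has_derivative D) (at z) \<and> (\<forall>u. D (\<i> *s u) = \<i> *s D u))))"

definition kaehler_form :: "(complex^'m) metric \<Rightarrow> complex^'m \<Rightarrow> complex^'m \<Rightarrow> complex^'m \<Rightarrow> real" where
  "kaehler_form h z u v = h z (\<i> *s u) v"

definition kaehler_metric ::
  "('i \<Rightarrow> complex^'m \<Rightarrow> 'p) \<Rightarrow> ('i \<Rightarrow> (complex^'m) metric) \<Rightarrow> bool" where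
  "kaehler_metric \<psi> g \<longleftrightarrow>
     (\<forall>\<alpha> u v. smooth (\<lambda>z. g \<alpha> z u v)) \<and>
     (\<forall>\<alpha> z. bilinear (g \<alpha> z) \<and> (\<forall>u v. g \<alpha> z u v = g \<alpha> z v u) \<and> (\<forall>u. u \<noteq> 0 \<longrightarrow> g \<alpha> z u u > 0)) \<and>
     (\<forall>\<alpha> \<beta> z u v. \<psi> \<alpha> z \<in> range (\<psi> \<beta>) \<longrightarrow>
        g \<alpha> z u v = g \<beta> (transition \<psi> \<alpha> \<beta> z)
          (dir_deriv (transition \<psi> \<alpha> \<beta>) z u) (dir_deriv (transition \<psi> \<alpha> \<beta>) z v)) \<and>
     (\<forall>\<alpha> z u v. g \<alpha> z (\<i> *s u) (\<i> *s v) = g \<alpha> z u v) \<and>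
     (\<forall>\<alpha> z u v w.
        dir_deriv (\<lambda>x. kaehler_form (g \<alpha>) x v w) z u +
        dir_deriv (\<lambda>x. kaehler_form (g \<alpha>) x w u) z v +
        dir_deriv (\<lambda>x. kaehler_form (g \<alpha>) x u v) z w = 0)"

definition killing ::
  "('i \<Rightarrow> (complex^'m) metric) \<Rightarrow> ('i \<Rightarrow> complex^'m \<Rightarrow> complex^'m) \<Rightarrow> bool" where
  "killing g X \<longleftrightarrow> (\<forall>\<alpha> z u v. lie_deriv_metric (g \<alpha>) (X \<alpha>) z u v = 0)"

text \<open>
  The value of \<open>\<omega>\<^sup>m / m!\<close> on the oriented coordinate frame \<open>e\<^sub>1, J e\<^sub>1, \<dots>, e\<^sub>m, J e\<^sub>m\<close>, i.e. its
  density with respect to Lebesgue measure. The frame is indexed by \<open>'m \<times> bool\<close>; no order on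
  \<open>'m\<close> is needed, as permuting the pairs \<open>(e\<^sub>i, J e\<^sub>i)\<close> is even. The factor \<open>2^m\<close> comes from
  evaluating an \<open>m\<close>-fold wedge product of 2-forms as an alternating sum over all permutations.
\<close>

definition frame_vec :: "'m \<times> bool \<Rightarrow> complex^'m" where
  "frame_vec p = axis (fst p) (if snd p then \<i> else 1)"

definition volume_density :: "(complex^'m) metric \<Rightarrow> complex^'m \<Rightarrow> real" where
  "volume_density h z =
     (\<Sum>\<sigma> | \<sigma> permutes (UNIV :: ('m \<times> bool) set). of_int (sign \<sigma>) *
        (\<Prod>i\<in>(UNIV :: 'm set).
           kaehler_form h z (frame_vec (\<sigma> (i, False))) (frame_vec (\<sigma> (i, True)))))
     / (2 ^ CARD('m) * fact CARD('m))"

text \<open>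
  The integral of \<open>f v\<^sub>\<omega>\<close> over a manifold with finitely many charts. The weights
  1 / (number of charts containing the point) form a measurable partition of unity
  subordinate to the atlas.
\<close>

definition volume_integral ::
  "('i::finite \<Rightarrow> complex^'m \<Rightarrow> 'p) \<Rightarrow> ('i \<Rightarrow> (complex^'m) metric) \<Rightarrow> ('p \<Rightarrow> real) \<Rightarrow> real" where
  "volume_integral \<psi> g f =
     (\<Sum>\<alpha>\<in>UNIV. \<integral>z. f (\<psi> \<alpha> z) * volume_density (g \<alpha>) z
        / real (card {\<beta>. \<psi> \<alpha> z \<in> range (\<psi> \<beta>)}) \<partial>lborel)"

definition normalized_killing_potential ::
  "('i::finite \<Rightarrow> complex^'m \<Rightarrow> 'p) \<Rightarrow> ('i \<Rightarrow> (complex^'m) metric) \<Rightarrow>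
   ('i \<Rightarrow> complex^'m \<Rightarrow> complex^'m) \<Rightarrow> real \<Rightarrow> ('p \<Rightarrow> real) \<Rightarrow> bool" where
  "normalized_killing_potential \<psi> g X a f \<longleftrightarrow>
     (\<forall>\<alpha>. smooth (f \<circ> \<psi> \<alpha>)) \<and>
     (\<forall>\<alpha> z v. kaehler_form (g \<alpha>) z (X \<alpha> z) v = - dir_deriv (f \<circ> \<psi> \<alpha>) z v) \<and>
     volume_integral \<psi> g f = a"

definition weighted_scal ::
  "(complex^'m) metric \<Rightarrow> (complex^'m \<Rightarrow> complex^'m) \<Rightarrow> (complex^'m \<Rightarrow> real) \<Rightarrow> real \<Rightarrow> complex^'m \<Rightarrow> real" where
  "weighted_scal h X F q z =
     (F z)\<^sup>2 * scal h z + 2 * q * F z * laplacian h F z - q * (q - 1) * h z (X z) (X z)"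

text \<open>The potential \<open>f\<close> is unique if \<open>M\<close> is connected.\<close>

definition constant_weighted_scal_metric ::
  "'p set \<Rightarrow> ('i::finite \<Rightarrow> complex^'m \<Rightarrow> 'p) \<Rightarrow> ('i \<Rightarrow> complex^'m \<Rightarrow> complex^'m) \<Rightarrow>
   real \<Rightarrow> real \<Rightarrow> ('i \<Rightarrow> (complex^'m) metric) \<Rightarrow> bool" where
  "constant_weighted_scal_metric M \<psi> X q a g \<longleftrightarrow>
     kaehler_metric \<psi> g \<and> killing g X \<and>
     (\<exists>f. normalized_killing_potential \<psi> g X a f \<and> (\<forall>p\<in>M. f p > 0) \<and>
        (\<exists>c. \<forall>\<alpha> z. weighted_scal (g \<alpha>) (X \<alpha>) (f \<circ> \<psi> \<alpha>) q z = c))"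

definition action_generator ::
  "('i \<Rightarrow> complex^'m \<Rightarrow> 'p) \<Rightarrow> (real \<Rightarrow> 'p \<Rightarrow> 'p) \<Rightarrow> 'i \<Rightarrow> complex^'m \<Rightarrow> complex^'m" where
  "action_generator \<psi> \<Phi> \<alpha> z = vector_derivative (\<lambda>\<theta>. inv (\<psi> \<alpha>) (\<Phi> \<theta> (\<psi> \<alpha> z))) (at 0)"


section \<open>The projective bundle over the Hirzebruch surface\<close>

text \<open>
  Every rank two bundle occurring here is a sum of the trivial line bundle and a line bundle
  \<open>F\<close>, so its vectors are pairs of a complex number and a vector of \<open>F\<close>. Scalar
  multiplication is passed explicitly, because the vectors of \<open>F\<close> are functions.
\<close>

definition scale_fun :: "complex \<Rightarrow> ('x \<Rightarrow> complex) \<Rightarrow> 'x \<Rightarrow> complex" where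
  "scale_fun t \<phi> = (\<lambda>x. t * \<phi> x)"

definition scale_sum :: "(complex \<Rightarrow> 'v \<Rightarrow> 'v) \<Rightarrow> complex \<Rightarrow> complex \<times> 'v \<Rightarrow> complex \<times> 'v" where
  "scale_sum s t v = (t * fst v, s t (snd v))"

abbreviation scaleC2 :: "complex \<Rightarrow> complex \<times> complex \<Rightarrow> complex \<times> complex" where
  "scaleC2 \<equiv> scale_sum (*)"

abbreviation scaleF :: "complex \<Rightarrow> complex \<times> ('x \<Rightarrow> complex) \<Rightarrow> complex \<times> ('x \<Rightarrow> complex)" where
  "scaleF \<equiv> scale_sum scale_fun"

definition line :: "(complex \<Rightarrow> 'v \<Rightarrow> 'v) \<Rightarrow> 'v \<Rightarrow> 'v set" where
  "line s v = range (\<lambda>t. s t v)"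

text \<open>The condition \<open>v \<noteq> s 0 v\<close> says that \<open>v\<close> is not the zero vector.\<close>

definition projectivization :: "(complex \<Rightarrow> 'v \<Rightarrow> 'v) \<Rightarrow> 'v set \<Rightarrow> 'v set set" where
  "projectivization s V = {line s v | v. v \<in> V \<and> v \<noteq> s 0 v}"

text \<open>
  The \<open>n\<close>-th tensor power of the dual of a line \<open>L\<close>: functions on \<open>L\<close> that are homogeneous of
  degree \<open>n\<close>, extended by zero off \<open>L\<close> so that they are determined by their values on \<open>L\<close>.
  For \<open>n = 1\<close> these are the linear functionals on \<open>L\<close>.
\<close>

definition dual_power :: "(complex \<Rightarrow> 'v \<Rightarrow> 'v) \<Rightarrow> nat \<Rightarrow> 'v set \<Rightarrow> ('v \<Rightarrow> complex) set" where
  "dual_power s n L = {\<phi>. (\<forall>v\<in>L. \<forall>t. \<phi> (s t v) = t ^ n * \<phi> v) \<and> (\<forall>v. v \<notin> L \<longrightarrow> \<phi> v = 0)}"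

definition CP1 :: "(complex \<times> complex) set set" where
  "CP1 = projectivization scaleC2 UNIV"

text \<open>The fibre of \<open>\<O> \<oplus> \<O>(n)\<close> at \<open>l\<close>; the fibre of the tautological bundle \<open>\<O>(-1)\<close> at \<open>l\<close> is \<open>l\<close>.\<close>

definition E_fibre ::
  "nat \<Rightarrow> (complex \<times> complex) set \<Rightarrow> (complex \<times> (complex \<times> complex \<Rightarrow> complex)) set" where
  "E_fibre n l = UNIV \<times> dual_power scaleC2 n l"

type_synonym E_vec = "complex \<times> (complex \<times> complex \<Rightarrow> complex)"
type_synonym hirzebruch_point = "(complex \<times> complex) set \<times> E_vec set"
type_synonym tower_point =
  "(complex \<times> complex) set \<times> E_vec set \<times> (complex \<times> (E_vec \<Rightarrow> complex)) set"

definition hirzebruch :: "nat \<Rightarrow> hirzebruch_point set" where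
  "hirzebruch n = {(l, L). l \<in> CP1 \<and> L \<in> projectivization scaleF (E_fibre n l)}"

text \<open>The fibre of \<open>\<O>\<^sub>E(1)\<close> at \<open>(l, L)\<close> is the dual of the line \<open>L\<close>.\<close>

definition tower :: "nat \<Rightarrow> tower_point set" where
  "tower n = {(l, L, N). (l, L) \<in> hirzebruch n \<and>
     N \<in> projectivization scaleF (UNIV \<times> dual_power scaleF 1 L)}"

text \<open>
  Charts. \<open>dual_frame s n v\<close> is the element of \<open>dual_power s n (line s v)\<close> with value 1 at \<open>v\<close>.
  For a nonzero vector \<open>\<phi>\<close> of \<open>F\<close>, \<open>affine_vec s i \<phi> t\<close> has homogeneous coordinates \<open>(1, t)\<close> or
  \<open>(t, 1)\<close> in the frame of the sum given by 1 and \<open>\<phi>\<close>. In this way holomorphic frames of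
  \<open>\<O>(-1)\<close>, \<open>\<O>(n)\<close>, \<open>\<O>\<^sub>E(-1)\<close> and \<open>\<O>\<^sub>E(1)\<close> are obtained successively over the standard affine
  charts.
\<close>

definition dual_frame :: "(complex \<Rightarrow> 'v \<Rightarrow> 'v) \<Rightarrow> nat \<Rightarrow> 'v \<Rightarrow> 'v \<Rightarrow> complex" where
  "dual_frame s n v w = (if w \<in> line s v then (THE t. w = s t v) ^ n else 0)"

definition affine_vec :: "(complex \<Rightarrow> 'v \<Rightarrow> 'v) \<Rightarrow> bool \<Rightarrow> 'v \<Rightarrow> complex \<Rightarrow> complex \<times> 'v" where
  "affine_vec s i \<phi> t = (if i then (t, \<phi>) else (1, s t \<phi>))"

type_synonym chart_index = "bool \<times> bool \<times> bool"

definition tower_chart :: "nat \<Rightarrow> chart_index \<Rightarrow> complex^3 \<Rightarrow> tower_point" where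
  "tower_chart n = (\<lambda>(i, j, k) z.
     let v1 = affine_vec (*) i 1 (z $ 1);
         v2 = affine_vec scale_fun j (dual_frame scaleC2 n v1) (z $ 2);
         v3 = affine_vec scale_fun k (dual_frame scaleF 1 v2) (z $ 3)
     in (line scaleC2 v1, line scaleF v2, line scaleF v3))"

text \<open>The circle action induced by \<open>(w\<^sub>0, w\<^sub>1) \<mapsto> (w\<^sub>0, e\<^sup>i\<^sup>\<theta> w\<^sub>1)\<close> on \<open>\<O> \<oplus> \<O>\<^sub>E(1)\<close>.\<close>

definition tower_action :: "real \<Rightarrow> tower_point \<Rightarrow> tower_point" where
  "tower_action \<theta> = (\<lambda>(l, L, N). (l, L, (\<lambda>(w0, w1). (w0, scale_fun (cis \<theta>) w1)) ` N))"

definition tower_K :: "nat \<Rightarrow> chart_index \<Rightarrow> complex^3 \<Rightarrow> complex^3" where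
  "tower_K n = action_generator (tower_chart n) tower_action"


section \<open>The charts form a holomorphic atlas\<close>

definition scalar_action :: "(complex \<Rightarrow> 'v \<Rightarrow> 'v) \<Rightarrow> bool" where
  "scalar_action s \<longleftrightarrow> (\<forall>t u v. s t (s u v) = s (t * u) v) \<and> (\<forall>v. s 1 v = v)"

definition free_vec :: "(complex \<Rightarrow> 'v \<Rightarrow> 'v) \<Rightarrow> 'v \<Rightarrow> bool" where
  "free_vec s v \<longleftrightarrow> inj (\<lambda>t. s t v)"

lemma scalar_action_mult: "scalar_action (*)"
  by (simp add: scalar_action_def mult.assoc)

lemma scalar_action_scale_fun: "scalar_action scale_fun"
  by (simp add: scalar_action_def scale_fun_def mult.assoc)

lemma scalar_action_scale_sum: "scalar_action s \<Longrightarrow> scalar_action (scale_sum s)"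
  by (auto simp add: scalar_action_def scale_sum_def mult.assoc)

lemma free_vecD: "free_vec s v \<Longrightarrow> s t v = s u v \<longleftrightarrow> t = u"
  by (auto simp: free_vec_def inj_def)

lemma free_vec_one: "free_vec (*) (1::complex)"
  by (simp add: free_vec_def)

lemma free_affine_vec: "free_vec s \<phi> \<Longrightarrow> scalar_action s \<Longrightarrow> free_vec (scale_sum s) (affine_vec s i \<phi> t)"
  by (auto simp: free_vec_def inj_def affine_vec_def scale_sum_def)

lemma self_in_line: "scalar_action s \<Longrightarrow> v \<in> line s v"
  unfolding line_def scalar_action_def by (metis rangeI)

lemma dual_frame_scale:
  assumes "free_vec s v" shows "dual_frame s n v (s t v) = t ^ n"
proof -
  have "(THE u. s t v = s u v) = t" using free_vecD[OF assms] by auto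
  then show ?thesis by (auto simp: dual_frame_def line_def)
qed

lemma dual_frame_self: "free_vec s v \<Longrightarrow> scalar_action s \<Longrightarrow> dual_frame s n v v = 1"
  using dual_frame_scale[of s v n 1] by (simp add: scalar_action_def)

lemma free_dual_frame: "free_vec s v \<Longrightarrow> scalar_action s \<Longrightarrow> free_vec scale_fun (dual_frame s n v)"
  unfolding free_vec_def[of scale_fun] inj_def scale_fun_def
  by (metis dual_frame_self mult.right_neutral)

lemma dual_frame_in: "free_vec s v \<Longrightarrow> scalar_action s \<Longrightarrow> dual_frame s n v \<in> dual_power s n (line s v)"
proof -
  assume *: "free_vec s v" "scalar_action s"
  have "dual_frame s n v (s t (s u v)) = t ^ n * dual_frame s n v (s u v)" for t u
  proof -
    have "s t (s u v) = s (t*u) v" using * by (simp add: scalar_action_def)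
    then show ?thesis using * by (simp add: dual_frame_scale power_mult_distrib)
  qed
  then show ?thesis by (auto simp: dual_power_def line_def[of s v] dual_frame_def)
qed

lemma dual_power_eq:
  assumes "\<phi> \<in> dual_power s n (line s v)" "free_vec s v" "scalar_action s"
  shows "\<phi> = scale_fun (\<phi> v) (dual_frame s n v)"
proof
  fix w
  show "\<phi> w = scale_fun (\<phi> v) (dual_frame s n v) w"
  proof (cases "w \<in> line s v")
    case True
    then obtain t where "w = s t v" by (auto simp: line_def)
    then show ?thesis
      using assms self_in_line[OF assms(3), of v] dual_frame_scale[OF assms(2)]
      by (auto simp: dual_power_def scale_fun_def)
  next
    case False
    then show ?thesis using assms(1) by (auto simp: dual_power_def scale_fun_def dual_frame_def)
  qed
qed

lemma line_scale: 
  assumes "scalar_action s" "c \<noteq> 0" shows "line s (s c v) = line s v"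
proof
  show "line s (s c v) \<subseteq> line s v"
    using assms by (auto simp: line_def scalar_action_def)
  show "line s v \<subseteq> line s (s c v)"
  proof
    fix w
    assume "w \<in> line s v"
    then obtain t where "w = s t v" by (auto simp: line_def)
    then have "w = s (t / c) (s c v)" using assms by (simp add: scalar_action_def)
    then show "w \<in> line s (s c v)" by (auto simp: line_def)
  qed
qed

lemma free_vec_scale:
  assumes "scalar_action s" "c \<noteq> 0" "free_vec s v" shows "free_vec s (s c v)"
proof -
  have "s t (s c v) = s (t * c) v" for t using assms by (simp add: scalar_action_def)
  then show ?thesis using assms free_vecD[OF assms(3)] by (simp add: free_vec_def[of s "s c v"] inj_def)
qed

lemma dual_frame_scaled:
  assumes "scalar_action s" "c \<noteq> 0" "free_vec s v"
  shows "dual_frame s n v = scale_fun (c ^ n) (dual_frame s n (s c v))"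
proof -
  have "dual_frame s n v \<in> dual_power s n (line s (s c v))"
    using dual_frame_in[OF assms(3,1)] line_scale[OF assms(1,2)] by simp
  from dual_power_eq[OF this free_vec_scale[OF assms] assms(1)]
  show ?thesis unfolding dual_frame_scale[OF assms(3)] .
qed

text \<open>Changing the affine coordinate from index \<open>i\<close> to \<open>i'\<close>, and rescaling the second summand.\<close>

definition swap_coord :: "bool \<Rightarrow> bool \<Rightarrow> complex \<Rightarrow> complex" where
  "swap_coord i i' t = (if i = i' then t else inverse t)"

definition swap_factor :: "bool \<Rightarrow> bool \<Rightarrow> complex \<Rightarrow> complex" where
  "swap_factor i i' t = (if i = i' then 1 else t)"

lemma affine_vec_swap:
  assumes "scalar_action s" "i \<noteq> i' \<longrightarrow> t \<noteq> 0"
  shows "affine_vec s i \<phi> t = scale_sum s (swap_factor i i' t) (affine_vec s i' \<phi> (swap_coord i i' t))"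
  using assms by (auto simp: affine_vec_def scale_sum_def swap_factor_def swap_coord_def scalar_action_def)

lemma affine_vec_scaled:
  assumes "scalar_action s" "c \<noteq> 0"
  shows "affine_vec s i (s c \<phi>) t =
    scale_sum s (if i then c else 1) (affine_vec s i \<phi> (if i then t * inverse c else t * c))"
  using assms by (auto simp: affine_vec_def scale_sum_def scalar_action_def)

lemma affine_line_eq:
  assumes "scalar_action s" "free_vec s \<phi>"
    and "line (scale_sum s) (affine_vec s i \<phi> t) = line (scale_sum s) (affine_vec s i' \<phi> t')"
  shows "(i \<noteq> i' \<longrightarrow> t \<noteq> 0) \<and> t' = swap_coord i i' t"
proof -
  have "affine_vec s i \<phi> t \<in> line (scale_sum s) (affine_vec s i' \<phi> t')"
    using assms self_in_line[OF scalar_action_scale_sum] by metis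
  then obtain c where c: "affine_vec s i \<phi> t = scale_sum s c (affine_vec s i' \<phi> t')"
    by (auto simp: line_def)
  have 1: "s u \<phi> = \<phi> \<longleftrightarrow> u = 1" "\<phi> = s u \<phi> \<longleftrightarrow> u = 1" for u
    using free_vecD[OF assms(2), of u 1] assms(1) unfolding scalar_action_def by metis+
  show ?thesis using c assms(1) 1 free_vecD[OF assms(2)]
    by (cases i; cases i') (auto simp: affine_vec_def scale_sum_def scalar_action_def swap_coord_def
        inverse_eq_divide eq_divide_eq mult.commute)
qed

lemma affine_line_iff:
  assumes "scalar_action s" "free_vec s \<phi>"
  shows "line (scale_sum s) (affine_vec s i \<phi> t) = line (scale_sum s) (affine_vec s i' \<phi> t') \<longleftrightarrow>
    (i \<noteq> i' \<longrightarrow> t \<noteq> 0) \<and> t' = swap_coord i i' t" (is "?l \<longleftrightarrow> ?r")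
proof
  show "?l \<Longrightarrow> ?r" by (rule affine_line_eq[OF assms])
next
  assume r: ?r
  then have "swap_factor i i' t \<noteq> 0" by (simp add: swap_factor_def)
  from line_scale[OF scalar_action_scale_sum[OF assms(1)] this]
  show ?l using affine_vec_swap[OF assms(1), of i i' t \<phi>] r by simp
qed

lemma affine_line_exists:
  assumes "scalar_action s" "free_vec s \<phi>" and "v \<in> UNIV \<times> range (\<lambda>t. s t \<phi>)"
    and "v \<noteq> scale_sum s 0 v"
  shows "\<exists>i t. line (scale_sum s) v = line (scale_sum s) (affine_vec s i \<phi> t)"
proof -
  obtain a b where v: "v = (a, s b \<phi>)" using assms(3) by auto
  have s0: "s c (s d \<phi>) = s (c*d) \<phi>" for c d using assms(1) by (simp add: scalar_action_def)
  show ?thesis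
  proof (cases "a = 0")
    case False
    have "v = scale_sum s a (affine_vec s False \<phi> (b / a))"
      using False by (simp add: v affine_vec_def scale_sum_def s0)
    then show ?thesis using line_scale[OF scalar_action_scale_sum[OF assms(1)] False] by metis
  next
    case True
    have b: "b \<noteq> 0" using assms(4) True by (auto simp: v scale_sum_def s0)
    have "v = scale_sum s b (affine_vec s True \<phi> 0)"
      using True by (simp add: v affine_vec_def scale_sum_def)
    then show ?thesis using line_scale[OF scalar_action_scale_sum[OF assms(1)] b] by metis
  qed
qed

lemma affine_vec_mem:
  assumes "scalar_action s" "free_vec s \<phi>"
  shows "affine_vec s i \<phi> t \<in> UNIV \<times> range (\<lambda>t. s t \<phi>)"
    "affine_vec s i \<phi> t \<noteq> scale_sum s 0 (affine_vec s i \<phi> t)"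
proof -
  have "\<phi> = s 1 \<phi>" "s 0 \<phi> \<noteq> \<phi>"
    using assms free_vecD[OF assms(2), of 0 1] by (auto simp: scalar_action_def)
  then show "affine_vec s i \<phi> t \<in> UNIV \<times> range (\<lambda>t. s t \<phi>)"
    "affine_vec s i \<phi> t \<noteq> scale_sum s 0 (affine_vec s i \<phi> t)"
    by (auto simp: affine_vec_def scale_sum_def)
qed

lemma projectivization_eq_affine:
  assumes "scalar_action s" "free_vec s \<phi>"
  shows "projectivization (scale_sum s) (UNIV \<times> range (\<lambda>t. s t \<phi>)) =
    {line (scale_sum s) (affine_vec s i \<phi> t) | i t. True}"
  unfolding projectivization_def
  using affine_line_exists[OF assms] affine_vec_mem[OF assms] by blast

lemma dual_power_eq_range:
  assumes "scalar_action s" "free_vec s v"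
  shows "dual_power s n (line s v) = range (\<lambda>t. scale_fun t (dual_frame s n v))"
proof -
  have "scale_fun t \<phi> \<in> dual_power s n L" if "\<phi> \<in> dual_power s n L" for t \<phi> L
    using that by (auto simp: scale_fun_def dual_power_def)
  then show ?thesis using dual_power_eq[OF _ assms(2,1)] dual_frame_in[OF assms(2,1)] by blast
qed

lemmas tower_scalar_actions =
  scalar_action_mult scalar_action_scale_fun scalar_action_scale_sum[OF scalar_action_mult]
  scalar_action_scale_sum[OF scalar_action_scale_fun]

lemma tower_eq_charts: "tower n = (\<Union>\<alpha>. range (tower_chart n \<alpha>))"
proof -
  note sa = tower_scalar_actions
  note fr = free_vec_one free_affine_vec free_dual_frame
  let ?v1 = "\<lambda>i t. affine_vec (*) i 1 t"
  let ?v2 = "\<lambda>i t j u. affine_vec scale_fun j (dual_frame scaleC2 n (?v1 i t)) u"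
  let ?v3 = "\<lambda>i t j u k w. affine_vec scale_fun k (dual_frame scaleF 1 (?v2 i t j u)) w"
  have U: "(UNIV :: (complex \<times> complex) set) = UNIV \<times> range (\<lambda>t. t * 1)" by auto
  have 1: "CP1 = {line scaleC2 (?v1 i t) | i t. True}"
    unfolding CP1_def using projectivization_eq_affine[OF sa(1) fr(1)] unfolding U[symmetric] .
  have 2: "projectivization scaleF (E_fibre n (line scaleC2 (?v1 i t))) =
      {line scaleF (?v2 i t j u) | j u. True}" for i t
    unfolding E_fibre_def by (simp add: projectivization_eq_affine dual_power_eq_range sa fr)
  have 3: "projectivization scaleF (UNIV \<times> dual_power scaleF 1 (line scaleF (?v2 i t j u))) =
      {line scaleF (?v3 i t j u k w) | k w. True}" for i t j u
    by (simp add: projectivization_eq_affine dual_power_eq_range[OF sa(4)] sa fr del: One_nat_def)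
  have m1: "p \<in> tower n \<longleftrightarrow> (\<exists>i t j u k w. p = (line scaleC2 (?v1 i t), line scaleF (?v2 i t j u),
      line scaleF (?v3 i t j u k w)))" for p
  proof -
    obtain l L N where p: "p = (l, L, N)" by (cases p)
    define A where "A = (\<lambda>i t. line scaleC2 (?v1 i t))"
    define B where "B = (\<lambda>i t j u. line scaleF (?v2 i t j u))"
    define C where "C = (\<lambda>i t j u k w. line scaleF (?v3 i t j u k w))"
    have "p \<in> tower n \<longleftrightarrow> l \<in> CP1 \<and> L \<in> projectivization scaleF (E_fibre n l) \<and>
      N \<in> projectivization scaleF (UNIV \<times> dual_power scaleF 1 L)"
      by (simp add: tower_def hirzebruch_def p)
    also have "\<dots> \<longleftrightarrow> (\<exists>i t j u k w. l = A i t \<and> L = B i t j u \<and> N = C i t j u k w)" (is "?l \<longleftrightarrow> ?r")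
    proof
      assume l: ?l
      then obtain i t where l1: "l = A i t" unfolding 1 A_def by blast
      with l have "L \<in> projectivization scaleF (E_fibre n (A i t))" by blast
      then obtain j u where l2: "L = B i t j u" unfolding A_def 2 B_def by blast
      with l have "N \<in> projectivization scaleF (UNIV \<times> dual_power scaleF 1 (B i t j u))" by blast
      then obtain k w where "N = C i t j u k w" unfolding B_def 3 C_def by blast
      with l1 l2 show ?r by blast
    next
      assume ?r
      then obtain i t j u k w where e: "l = A i t" "L = B i t j u" "N = C i t j u k w" by blast
      have "A i t \<in> CP1" unfolding 1 A_def by blast
      moreover have "B i t j u \<in> projectivization scaleF (E_fibre n (A i t))"
        unfolding A_def 2 B_def by blast
      moreover have "C i t j u k w \<in> projectivization scaleF (UNIV \<times> dual_power scaleF 1 (B i t j u))"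
        unfolding B_def 3 C_def by blast
      ultimately show ?l unfolding e by blast
    qed
    finally show ?thesis unfolding p A_def B_def C_def by simp
  qed
  have m2: "p \<in> (\<Union>\<alpha>. range (tower_chart n \<alpha>)) \<longleftrightarrow>
     (\<exists>i t j u k w. p = (line scaleC2 (?v1 i t), line scaleF (?v2 i t j u),
      line scaleF (?v3 i t j u k w)))" for p
  proof
    assume "p \<in> (\<Union>\<alpha>. range (tower_chart n \<alpha>))"
    then obtain i j k z where "p = tower_chart n (i, j, k) z" by auto
    then have "p = (line scaleC2 (?v1 i (z $ 1)), line scaleF (?v2 i (z $ 1) j (z $ 2)),
      line scaleF (?v3 i (z $ 1) j (z $ 2) k (z $ 3)))" by (simp add: tower_chart_def Let_def)
    then show "\<exists>i t j u k w. p = (line scaleC2 (?v1 i t), line scaleF (?v2 i t j u),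
      line scaleF (?v3 i t j u k w))" by (intro exI)
  next
    assume "\<exists>i t j u k w. p = (line scaleC2 (?v1 i t), line scaleF (?v2 i t j u),
      line scaleF (?v3 i t j u k w))"
    then obtain i t j u k w where "p = (line scaleC2 (?v1 i t), line scaleF (?v2 i t j u),
      line scaleF (?v3 i t j u k w))" by (elim exE)
    then have "p = tower_chart n (i,j,k) (vector [t,u,w])"
      by (simp add: tower_chart_def Let_def)
    then show "p \<in> (\<Union>\<alpha>. range (tower_chart n \<alpha>))" by (intro UN_I[OF UNIV_I]) (rule range_eqI)
  qed
  show ?thesis by (rule set_eqI, rule trans[OF m1 m2[symmetric]])
qed

text \<open>The overlaps and the transition maps.\<close>

definition twist :: "bool \<Rightarrow> complex \<Rightarrow> complex \<Rightarrow> complex" where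
  "twist j c t = (if j then t * inverse c else t * c)"

definition twist_factor :: "bool \<Rightarrow> complex \<Rightarrow> complex" where
  "twist_factor j c = (if j then c else 1)"

definition tower_overlap :: "chart_index \<Rightarrow> chart_index \<Rightarrow> complex^3 \<Rightarrow> bool" where
  "tower_overlap = (\<lambda>(i, j, k) (i', j', k') z.
     (i \<noteq> i' \<longrightarrow> z $ 1 \<noteq> 0) \<and> (j \<noteq> j' \<longrightarrow> z $ 2 \<noteq> 0) \<and> (k \<noteq> k' \<longrightarrow> z $ 3 \<noteq> 0))"

definition tower_transition :: "nat \<Rightarrow> chart_index \<Rightarrow> chart_index \<Rightarrow> complex^3 \<Rightarrow> complex^3" where
  "tower_transition n = (\<lambda>(i, j, k) (i', j', k') z.
     let c1 = inverse (swap_factor i i' (z $ 1) ^ n);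
         y2 = twist j c1 (z $ 2);
         c2 = inverse (twist_factor j c1 * swap_factor j j' y2);
         y3 = twist k c2 (z $ 3)
     in vector [swap_coord i i' (z $ 1), swap_coord j j' y2, swap_coord k k' y3])"

lemma swap_factor_nz: "(i \<noteq> i' \<longrightarrow> t \<noteq> 0) \<Longrightarrow> swap_factor i i' t \<noteq> 0"
  by (simp add: swap_factor_def)

lemma twist_nz: "c \<noteq> 0 \<Longrightarrow> twist j c t \<noteq> 0 \<longleftrightarrow> t \<noteq> 0"
  by (simp add: twist_def)

lemma twist_factor_nz: "c \<noteq> 0 \<Longrightarrow> twist_factor j c \<noteq> 0"
  by (simp add: twist_factor_def)

text \<open>One step: passing to a rescaled vector below rescales the frame, hence the vector above.\<close>

lemma dual_frame_rescale:
  assumes "scalar_action s" "c \<noteq> 0" "free_vec s v'" "v = s c v'"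
  shows "dual_frame s n v = scale_fun (inverse (c ^ n)) (dual_frame s n v')"
proof
  fix w
  have "dual_frame s n v' = scale_fun (c ^ n) (dual_frame s n v)"
    unfolding assms(4) by (rule dual_frame_scaled[OF assms(1-3)])
  then have "dual_frame s n v' w = scale_fun (c ^ n) (dual_frame s n v) w" by (simp only:)
  then show "dual_frame s n v w = scale_fun (inverse (c ^ n)) (dual_frame s n v') w"
    using assms(2) unfolding scale_fun_def by simp
qed

lemma affine_step:
  fixes \<phi>' :: "'x \<Rightarrow> complex"
  assumes "\<phi> = scale_fun c \<phi>'" "c \<noteq> 0" "j \<noteq> j' \<longrightarrow> t \<noteq> 0"
  shows "affine_vec scale_fun j \<phi> t =
    scaleF (twist_factor j c * swap_factor j j' (twist j c t))
      (affine_vec scale_fun j' \<phi>' (swap_coord j j' (twist j c t)))"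
proof -
  have "affine_vec scale_fun j \<phi> t = scaleF (twist_factor j c) (affine_vec scale_fun j \<phi>' (twist j c t))"
    unfolding assms(1) twist_def twist_factor_def
    by (rule affine_vec_scaled[OF scalar_action_scale_fun assms(2)])
  also have "\<dots> = scaleF (twist_factor j c) (scaleF (swap_factor j j' (twist j c t))
      (affine_vec scale_fun j' \<phi>' (swap_coord j j' (twist j c t))))"
    by (rule arg_cong[OF affine_vec_swap[OF scalar_action_scale_fun]])
      (use assms(3) twist_nz[OF assms(2), of j t] in blast)
  also have "\<dots> = scaleF (twist_factor j c * swap_factor j j' (twist j c t))
      (affine_vec scale_fun j' \<phi>' (swap_coord j j' (twist j c t)))"
    by (rule tower_scalar_actions(4)[unfolded scalar_action_def, THEN conjunct1, rule_format])
  finally show ?thesis .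
qed

lemma tower_chart_eq_iff:
  "tower_chart n \<alpha> z = tower_chart n \<beta> z' \<longleftrightarrow>
     tower_overlap \<alpha> \<beta> z \<and> z' = tower_transition n \<alpha> \<beta> z"
proof -
  obtain i j k where \<alpha>: "\<alpha> = (i,j,k)" by (cases \<alpha>)
  obtain i' j' k' where \<beta>: "\<beta> = (i',j',k')" by (cases \<beta>)
  note sa = tower_scalar_actions
  note fr = free_vec_one free_affine_vec free_dual_frame
  define v1 where "v1 = affine_vec (*) i 1 (z $ 1)"
  define v2 where "v2 = affine_vec scale_fun j (dual_frame scaleC2 n v1) (z $ 2)"
  define v3 where "v3 = affine_vec scale_fun k (dual_frame scaleF 1 v2) (z $ 3)"
  define v1' where "v1' = affine_vec (*) i' 1 (z' $ 1)"
  define v2' where "v2' = affine_vec scale_fun j' (dual_frame scaleC2 n v1') (z' $ 2)"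
  define v3' where "v3' = affine_vec scale_fun k' (dual_frame scaleF 1 v2') (z' $ 3)"
  define c1 where "c1 = inverse (swap_factor i i' (z $ 1) ^ n)"
  define y2 where "y2 = twist j c1 (z $ 2)"
  define d2 where "d2 = twist_factor j c1 * swap_factor j j' y2"
  define y3 where "y3 = twist k (inverse d2) (z $ 3)"
  have f1: "free_vec scaleC2 v1" "free_vec scaleC2 v1'"
    unfolding v1_def v1'_def by (rule fr(2)[OF fr(1) sa(1)])+
  have f2: "free_vec scaleF v2" "free_vec scaleF v2'"
    unfolding v2_def v2'_def by (rule fr(2)[OF fr(3)[OF f1(1) sa(3)] sa(2)], rule fr(2)[OF fr(3)[OF f1(2) sa(3)] sa(2)])
  note f = f1 f2
  have T: "z' = tower_transition n \<alpha> \<beta> z \<longleftrightarrow>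
     z' $ 1 = swap_coord i i' (z $ 1) \<and> z' $ 2 = swap_coord j j' y2 \<and> z' $ 3 = swap_coord k k' y3"
    unfolding tower_transition_def \<alpha> \<beta> Let_def c1_def y2_def d2_def y3_def
    by (simp add: vec_eq_iff forall_3)
  have E: "tower_chart n \<alpha> z = tower_chart n \<beta> z' \<longleftrightarrow>
     line scaleC2 v1 = line scaleC2 v1' \<and> line scaleF v2 = line scaleF v2' \<and> line scaleF v3 = line scaleF v3'"
    unfolding tower_chart_def \<alpha> \<beta> Let_def v1_def v2_def v3_def v1'_def v2'_def v3'_def by simp
  have s1: "line scaleC2 v1 = line scaleC2 v1' \<longleftrightarrow>
     (i \<noteq> i' \<longrightarrow> z $ 1 \<noteq> 0) \<and> z' $ 1 = swap_coord i i' (z $ 1)"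
    unfolding v1_def v1'_def by (rule affine_line_iff[OF sa(1) fr(1)])
  have s2: "line scaleF v2 = line scaleF v2' \<longleftrightarrow>
      (j \<noteq> j' \<longrightarrow> z $ 2 \<noteq> 0) \<and> z' $ 2 = swap_coord j j' y2"
    and c1: "c1 \<noteq> 0"
    if "(i \<noteq> i' \<longrightarrow> z $ 1 \<noteq> 0) \<and> z' $ 1 = swap_coord i i' (z $ 1)"
  proof -
    show c1: "c1 \<noteq> 0" unfolding c1_def using that swap_factor_nz by simp
    have v1: "v1 = scaleC2 (swap_factor i i' (z $ 1)) v1'"
      using affine_vec_swap[OF sa(1), of i i' "z $ 1" 1] that by (simp add: v1_def v1'_def)
    have \<phi>: "dual_frame scaleC2 n v1 = scale_fun c1 (dual_frame scaleC2 n v1')"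
      unfolding c1_def using dual_frame_rescale[OF sa(3) swap_factor_nz f(2) v1] that by blast
    have "v2 = scaleF (twist_factor j c1) (affine_vec scale_fun j (dual_frame scaleC2 n v1') y2)"
      unfolding v2_def \<phi> y2_def twist_def twist_factor_def by (rule affine_vec_scaled[OF sa(2) c1])
    then have l: "line scaleF v2 = line scaleF (affine_vec scale_fun j (dual_frame scaleC2 n v1') y2)"
      using line_scale[OF sa(4) twist_factor_nz[OF c1]] by metis
    show "line scaleF v2 = line scaleF v2' \<longleftrightarrow>
      (j \<noteq> j' \<longrightarrow> z $ 2 \<noteq> 0) \<and> z' $ 2 = swap_coord j j' y2"
      unfolding l v2'_def affine_line_iff[OF sa(2) fr(3)[OF f(2) sa(3)]]
      unfolding y2_def twist_nz[OF c1] ..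
  qed
  have s3: "line scaleF v3 = line scaleF v3' \<longleftrightarrow>
      (k \<noteq> k' \<longrightarrow> z $ 3 \<noteq> 0) \<and> z' $ 3 = swap_coord k k' y3"
    if h1: "(i \<noteq> i' \<longrightarrow> z $ 1 \<noteq> 0) \<and> z' $ 1 = swap_coord i i' (z $ 1)"
      and h2: "(j \<noteq> j' \<longrightarrow> z $ 2 \<noteq> 0) \<and> z' $ 2 = swap_coord j j' y2"
  proof -
    note c1 = c1[OF h1]
    have v1: "v1 = scaleC2 (swap_factor i i' (z $ 1)) v1'"
      using affine_vec_swap[OF sa(1), of i i' "z $ 1" 1] h1 by (simp add: v1_def v1'_def)
    have \<phi>: "dual_frame scaleC2 n v1 = scale_fun c1 (dual_frame scaleC2 n v1')"
      unfolding c1_def using dual_frame_rescale[OF sa(3) swap_factor_nz f(2) v1] h1 by blast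
    have v2: "v2 = scaleF d2 v2'"
      using affine_step[OF \<phi> c1, of j j' "z $ 2"] h2 unfolding v2_def v2'_def d2_def y2_def by simp
    have d2: "d2 \<noteq> 0"
      using swap_factor_nz[of j j' y2] twist_factor_nz[OF c1, of j] h2 twist_nz[OF c1, of j "z $ 2"]
      by (auto simp: d2_def y2_def)
    have \<mu>: "dual_frame scaleF 1 v2 = scale_fun (inverse d2) (dual_frame scaleF 1 v2')"
      using dual_frame_rescale[OF sa(4) d2 f(4) v2, of 1] by simp
    have i2: "inverse d2 \<noteq> 0" using d2 by simp
    have "v3 = scaleF (twist_factor k (inverse d2)) (affine_vec scale_fun k (dual_frame scaleF 1 v2') y3)"
      unfolding v3_def \<mu> y3_def twist_def twist_factor_def by (rule affine_vec_scaled[OF sa(2) i2])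
    then have l: "line scaleF v3 = line scaleF (affine_vec scale_fun k (dual_frame scaleF 1 v2') y3)"
      using line_scale[OF sa(4) twist_factor_nz[OF i2]] by metis
    show ?thesis
      unfolding l v3'_def affine_line_iff[OF sa(2) fr(3)[OF f(4) sa(4)]]
      unfolding y3_def twist_nz[OF i2] ..
  qed
  have O: "tower_overlap \<alpha> \<beta> z \<longleftrightarrow>
     (i \<noteq> i' \<longrightarrow> z $ 1 \<noteq> 0) \<and> (j \<noteq> j' \<longrightarrow> z $ 2 \<noteq> 0) \<and> (k \<noteq> k' \<longrightarrow> z $ 3 \<noteq> 0)"
    by (simp add: tower_overlap_def \<alpha> \<beta>)
  show ?thesis unfolding E T O using s1 s2 s3 by blast
qed

lemma tower_transition_self: "tower_transition n \<alpha> \<alpha> z = z"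
  by (cases \<alpha>) (simp add: tower_transition_def Let_def swap_factor_def swap_coord_def twist_def
      twist_factor_def vec_eq_iff forall_3)

lemma inj_tower_chart: "inj (tower_chart n \<alpha>)"
  by (rule injI) (simp add: tower_chart_eq_iff tower_transition_self)

lemma tower_chart_in_range: "tower_chart n \<alpha> z \<in> range (tower_chart n \<beta>) \<longleftrightarrow> tower_overlap \<alpha> \<beta> z"
  by (auto simp: image_iff tower_chart_eq_iff)

lemma transition_tower_chart:
  "tower_overlap \<alpha> \<beta> z \<Longrightarrow> transition (tower_chart n) \<alpha> \<beta> z = tower_transition n \<alpha> \<beta> z"
  unfolding transition_def comp_def
  by (rule inv_f_eq[OF inj_tower_chart]) (metis tower_chart_eq_iff)

lemma open_tower_overlap: "open {z. tower_overlap \<alpha> \<beta> z}"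
proof -
  have 1: "open {z :: complex^3. z $ l \<noteq> 0}" for l
    by (intro open_Collect_neq continuous_intros)
  have "open {z :: complex^3. Q \<longrightarrow> z $ l \<noteq> 0}" for l Q by (cases Q) (simp_all add: 1)
  then show ?thesis
    by (cases \<alpha>; cases \<beta>) (simp add: tower_overlap_def open_Collect_conj)
qed

definition cdiff :: "(complex^3 \<Rightarrow> complex) \<Rightarrow> complex^3 \<Rightarrow> bool" where
  "cdiff F z \<longleftrightarrow> (\<exists>D. (F has_derivative D) (at z) \<and> (\<forall>u. D (\<i> *s u) = \<i> * D u))"

lemma cdiff_const: "cdiff (\<lambda>_. c) z"
  unfolding cdiff_def by (rule exI[of _ "\<lambda>_. 0"]) simp

lemma cdiff_nth: "cdiff (\<lambda>z. z $ l) z"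
  unfolding cdiff_def
  by (rule exI[of _ "\<lambda>u. u $ l"]) (simp add: bounded_linear_imp_has_derivative bounded_linear_vec_nth)

lemma cdiff_mult: assumes "cdiff F z" "cdiff G z" shows "cdiff (\<lambda>z. F z * G z) z"
proof -
  obtain D D' where "(F has_derivative D) (at z)" "\<forall>u. D (\<i> *s u) = \<i> * D u"
    "(G has_derivative D') (at z)" "\<forall>u. D' (\<i> *s u) = \<i> * D' u"
    using assms by (auto simp: cdiff_def)
  then show ?thesis unfolding cdiff_def
    by (intro exI[of _ "\<lambda>h. F z * D' h + D h * G z"]) (simp add: has_derivative_mult, simp add: algebra_simps)
qed

lemma cdiff_inverse: assumes "cdiff F z" "F z \<noteq> 0" shows "cdiff (\<lambda>z. inverse (F z)) z"
proof -
  obtain D where "(F has_derivative D) (at z)" "\<forall>u. D (\<i> *s u) = \<i> * D u"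
    using assms by (auto simp: cdiff_def)
  then have "((\<lambda>z. inverse (F z)) has_derivative (\<lambda>h. - (inverse (F z) * D h * inverse (F z)))) (at z)"
    and "\<forall>u. - (inverse (F z) * D (\<i> *s u) * inverse (F z)) = \<i> * - (inverse (F z) * D u * inverse (F z))"
    by (simp_all add: Deriv.has_derivative_inverse assms(2))
  then show ?thesis unfolding cdiff_def by blast
qed

lemma cdiff_power: "cdiff F z \<Longrightarrow> cdiff (\<lambda>z. F z ^ n) z"
  by (induction n) (simp_all add: cdiff_const cdiff_mult)

lemma cdiff_vector:
  assumes "cdiff F z" "cdiff G z" "cdiff H z"
  shows "\<exists>D. ((\<lambda>z. vector [F z, G z, H z] :: complex^3) has_derivative D) (at z) \<and> (\<forall>u. D (\<i> *s u) = \<i> *s D u)"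
proof -
  obtain A B C where D: "(F has_derivative A) (at z)" "\<forall>u. A (\<i> *s u) = \<i> * A u"
    "(G has_derivative B) (at z)" "\<forall>u. B (\<i> *s u) = \<i> * B u"
    "(H has_derivative C) (at z)" "\<forall>u. C (\<i> *s u) = \<i> * C u"
    using assms by (auto simp: cdiff_def)
  have e: "(vector [a, b, c] :: complex^3) = axis 1 a + axis 2 b + axis 3 c" for a b c
    by (simp add: vec_eq_iff forall_3 axis_def)
  have ax: "bounded_linear (axis l :: complex \<Rightarrow> complex^3)" for l
    by (intro linear_conv_bounded_linear[THEN iffD1] linearI) (auto simp: axis_def vec_eq_iff)
  have "((\<lambda>z. vector [F z, G z, H z] :: complex^3) has_derivative (\<lambda>u. vector [A u, B u, C u])) (at z)"
    unfolding e by (intro has_derivative_add bounded_linear.has_derivative[OF ax] D)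
  moreover have "vector [A (\<i> *s u), B (\<i> *s u), C (\<i> *s u)] = \<i> *s (vector [A u, B u, C u] :: complex^3)" for u
    using D by (simp add: vec_eq_iff forall_3)
  ultimately show ?thesis by blast
qed

lemma tower_transition_holomorphic:
  assumes "tower_overlap \<alpha> \<beta> z"
  shows "\<exists>D. (tower_transition n \<alpha> \<beta> has_derivative D) (at z) \<and> (\<forall>u. D (\<i> *s u) = \<i> *s D u)"
proof -
  obtain i j k where \<alpha>: "\<alpha> = (i,j,k)" by (cases \<alpha>)
  obtain i' j' k' where \<beta>: "\<beta> = (i',j',k')" by (cases \<beta>)
  have nz: "i \<noteq> i' \<longrightarrow> z $ 1 \<noteq> 0" "j \<noteq> j' \<longrightarrow> z $ 2 \<noteq> 0" "k \<noteq> k' \<longrightarrow> z $ 3 \<noteq> 0"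
    using assms by (auto simp: tower_overlap_def \<alpha> \<beta>)
  define c1 where "c1 = (\<lambda>z :: complex^3. inverse (swap_factor i i' (z $ 1) ^ n))"
  define y2 where "y2 = (\<lambda>z. twist j (c1 z) (z $ 2))"
  define c2 where "c2 = (\<lambda>z. inverse (twist_factor j (c1 z) * swap_factor j j' (y2 z)))"
  define y3 where "y3 = (\<lambda>z. twist k (c2 z) (z $ 3))"
  have T: "tower_transition n \<alpha> \<beta> =
      (\<lambda>z. vector [swap_coord i i' (z $ 1), swap_coord j j' (y2 z), swap_coord k k' (y3 z)])"
    unfolding tower_transition_def \<alpha> \<beta> Let_def c1_def y2_def c2_def y3_def by simp
  have sf: "cdiff (\<lambda>z. swap_factor i i' (F z)) z" if "cdiff F z" for F i i'
    using that by (cases "i = i'") (simp_all add: swap_factor_def cdiff_const)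
  have sc: "cdiff (\<lambda>z. swap_coord i i' (F z)) z" if "cdiff F z" "i \<noteq> i' \<longrightarrow> F z \<noteq> 0" for F i i'
    using that by (cases "i = i'") (auto simp add: swap_coord_def cdiff_inverse)
  have tw: "cdiff (\<lambda>z. twist j (F z) (G z)) z" if "cdiff F z" "F z \<noteq> 0" "cdiff G z" for F G j
    using that by (cases j) (auto simp add: twist_def intro: cdiff_mult cdiff_inverse)
  have tf: "cdiff (\<lambda>z. twist_factor j (F z)) z" if "cdiff F z" for F j
    using that by (cases j) (simp_all add: twist_factor_def cdiff_const)
  have c1: "cdiff c1 z" "c1 z \<noteq> 0" unfolding c1_def
    using swap_factor_nz[OF nz(1)] by (auto intro!: cdiff_inverse cdiff_power sf cdiff_nth)
  have y2: "cdiff y2 z" "y2 z \<noteq> 0 \<longleftrightarrow> z $ 2 \<noteq> 0"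
    unfolding y2_def by (rule tw[OF c1 cdiff_nth], rule twist_nz[OF c1(2)])
  have p: "twist_factor j (c1 z) * swap_factor j j' (y2 z) \<noteq> 0"
    using twist_factor_nz[OF c1(2), of j] swap_factor_nz[of j j' "y2 z"] y2(2) nz(2) by auto
  then have c2: "cdiff c2 z" "c2 z \<noteq> 0"
    unfolding c2_def by (auto intro!: cdiff_inverse cdiff_mult sf tf c1 y2)
  have y3: "cdiff y3 z" "y3 z \<noteq> 0 \<longleftrightarrow> z $ 3 \<noteq> 0"
    unfolding y3_def by (rule tw[OF c2 cdiff_nth], rule twist_nz[OF c2(2)])
  show ?thesis unfolding T
    by (intro cdiff_vector sc cdiff_nth y2 y3) (use nz y2 y3 in auto)
qed

theorem tower_holomorphic_atlas: "holomorphic_atlas (tower n) (tower_chart n)"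
proof -
  have "\<exists>D. (transition (tower_chart n) \<alpha> \<beta> has_derivative D) (at z) \<and> (\<forall>u. D (\<i> *s u) = \<i> *s D u)"
    if o: "tower_overlap \<alpha> \<beta> z" for \<alpha> \<beta> z
  proof -
    obtain D where D: "(tower_transition n \<alpha> \<beta> has_derivative D) (at z)" "\<forall>u. D (\<i> *s u) = \<i> *s D u"
      using tower_transition_holomorphic[OF o] by blast
    have "(transition (tower_chart n) \<alpha> \<beta> has_derivative D) (at z)"
      by (rule has_derivative_transform_within_open[OF D(1) open_tower_overlap[of \<alpha> \<beta>]])
        (use o in \<open>simp_all add: transition_tower_chart\<close>)
    with D(2) show ?thesis by blast
  qed
  then show ?thesis
    unfolding holomorphic_atlas_def tower_chart_in_range
    using tower_eq_charts inj_tower_chart open_tower_overlap by blast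
qed

text \<open>The generator of the circle action in the charts.\<close>

lemma tower_action_chart:
  "tower_action \<theta> (tower_chart n (i, j, k) z) =
   tower_chart n (i, j, k) (vector [z $ 1, z $ 2, (if k then cis (- \<theta>) else cis \<theta>) * z $ 3])"
proof -
  let ?R = "\<lambda>w :: complex \<times> (E_vec \<Rightarrow> complex). (fst w, scale_fun (cis \<theta>) (snd w))"
  define \<mu> where "\<mu> = dual_frame scaleF 1 (affine_vec scale_fun j (dual_frame scaleC2 n (affine_vec (*) i 1 (z $ 1))) (z $ 2))"
  have R: "?R ` line scaleF v = line scaleF (?R v)" for v
    by (auto simp: line_def image_image scale_sum_def scale_fun_def algebra_simps)
  let ?t = "(if k then cis (- \<theta>) else cis \<theta>) * z $ 3"
  have "?R (affine_vec scale_fun k \<mu> (z $ 3)) =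
      scaleF (if k then cis \<theta> else 1) (affine_vec scale_fun k \<mu> ?t)"
    by (auto simp: affine_vec_def scale_sum_def scale_fun_def cis_mult mult.assoc[symmetric])
  then have "?R ` line scaleF (affine_vec scale_fun k \<mu> (z $ 3)) =
      line scaleF (scaleF (if k then cis \<theta> else 1) (affine_vec scale_fun k \<mu> ?t))"
    unfolding R by (rule arg_cong)
  also have "\<dots> = line scaleF (affine_vec scale_fun k \<mu> ?t)"
    by (rule line_scale[OF tower_scalar_actions(4)]) simp
  finally have "?R ` line scaleF (affine_vec scale_fun k \<mu> (z $ 3)) =
      line scaleF (affine_vec scale_fun k \<mu> ?t)" .
  then show ?thesis
    by (simp add: tower_action_def tower_chart_def Let_def \<mu>_def case_prod_beta)
qed

lemma tower_K_eq: "tower_K n (i, j, k) z = axis 3 ((if k then - \<i> else \<i>) * z $ 3)"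
proof -
  let ?e = "if k then - 1 else 1 :: real"
  have v: "vector [z $ 1, z $ 2, c] = vector [z $ 1, z $ 2, 0] + (axis 3 c :: complex^3)" for c
    by (simp add: vec_eq_iff forall_3 axis_def)
  have ax: "bounded_linear (axis 3 :: complex \<Rightarrow> complex^3)"
    by (intro linear_conv_bounded_linear[THEN iffD1] linearI) (auto simp: axis_def vec_eq_iff)
  have c: "((\<lambda>\<theta>. cis (?e * \<theta>) * z $ 3) has_vector_derivative (?e *\<^sub>R \<i>) * z $ 3) (at 0)"
  proof -
    have "cis (?e * \<theta>) = exp (\<theta> *\<^sub>R (?e *\<^sub>R \<i>))" for \<theta>
      by (simp add: cis_conv_exp scaleR_conv_of_real mult.commute)
    moreover have "((\<lambda>\<theta>. exp (\<theta> *\<^sub>R (?e *\<^sub>R \<i>)) * z $ 3) has_vector_derivative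
        (exp (0 *\<^sub>R (?e *\<^sub>R \<i>)) * (?e *\<^sub>R \<i>)) * z $ 3) (at 0)"
      by (rule has_vector_derivative_mult_left[OF exp_scaleR_has_vector_derivative_right])
    ultimately show ?thesis by simp
  qed
  have "tower_K n (i, j, k) z = vector_derivative
      (\<lambda>\<theta>. vector [z $ 1, z $ 2, cis (?e * \<theta>) * z $ 3] :: complex^3) (at 0)"
  proof -
    have "(if k then cis (- \<theta>) else cis \<theta>) = cis (?e * \<theta>)" for \<theta> by simp
    then show ?thesis
      unfolding tower_K_def action_generator_def tower_action_chart inv_f_f[OF inj_tower_chart] by simp
  qed
  also have "\<dots> = axis 3 ((?e *\<^sub>R \<i>) * z $ 3)"
  proof (rule vector_derivative_at)
    show "((\<lambda>\<theta>. vector [z $ 1, z $ 2, cis (?e * \<theta>) * z $ 3] :: complex^3)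
        has_vector_derivative axis 3 ((?e *\<^sub>R \<i>) * z $ 3)) (at 0)"
      unfolding v[of "cis _ * _"]
      using has_vector_derivative_add[OF has_vector_derivative_const
          bounded_linear.has_vector_derivative[OF ax c]] by simp
  qed
  finally show ?thesis by auto
qed

end

theory Submission
  imports Defs "HOL-Complex_Analysis.Complex_Analysis"
begin

text \<open>
  This is a weighted Matsushima--Lichnerowicz argument. A nonzero section of \<open>\<O>(n)\<close> acts on
  \<open>E = \<O> \<oplus> \<O>(n)\<close> by unipotent automorphisms and so generates a holomorphic vector field \<open>Z\<close> on
  \<open>M\<close> that commutes with \<open>K\<close> and vanishes on a rational curve \<open>C\<close>. Solving the Cauchy-Riemann
  equations along the fibres of the two projections gives a global complex potential \<open>F\<close> of \<open>Z\<close>,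
  vanishing on \<open>C\<close>. Let \<open>W\<close> be the gradient field of the conjugate of \<open>F\<close>. If the weighted scalar curvature is
  constant, then \<open>f\<^sup>q\<close> times the square of the norm of \<open>\<partial>\<close>-bar \<open>W\<close> is a divergence, and Stokes' theorem on the
  eight unit polydiscs that tile \<open>M\<close> shows that \<open>W\<close> is holomorphic. Along \<open>C\<close> its components
  normal to \<open>C\<close> are sections of \<open>\<O>(-n)\<close>, hence zero as \<open>n \<ge> 1\<close>, and then \<open>W = 0\<close> on \<open>C\<close>. Comparing
  third derivatives of \<open>F\<close> at a point of \<open>C\<close> where \<open>Z\<close> vanishes to second order gives a contradiction.
\<close>

section \<open>Smooth functions\<close>

text \<open>In classical terms, constant weighted scalar curvature makes the holomorphic fields
  commuting with \<open>K\<close> a reductive Lie algebra, while \<open>Z\<close> is unipotent and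
  has no opposite root. No Lie algebra is used here: \<open>W\<close> plays the part of the opposite
  root vector, and its existence is refuted locally. The weighted Lichnerowicz operator is not real
  in general. That it treats \<open>F\<close> like a real potential rests on the vanishing of the
  Poisson bracket of \<open>f\<close> and \<open>F\<close>, the counterpart of commuting with
  \<open>K\<close>. This bracket is a holomorphic function on a compact manifold and is zero on
  \<open>C\<close>, where both fields vanish. The zero of \<open>Z\<close> also pins down
  \<open>F\<close>: the form to be integrated vanishes on \<open>C\<close>, so no equation is left
  to solve on the base. Every chart is all of C^3, so tensors are tuples of smooth functions on C^3,
  and curvature identities become algebra in a commutative ring with derivations. Adjacent charts
  differ by monomial maps, whose factors have modulus one on the faces of the polydiscs;
  neighbouring faces are therefore matched by rotations, and no partition of unity is
  needed.\<close>

lemma Ck_local: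
  assumes "\<And>x. \<exists>G U. open U \<and> x \<in> U \<and> (\<forall>y\<in>U. F y = G y) \<and> Ck k G"
  shows "Ck k F"
  using assms
proof (induction k arbitrary: F)
  case 0
  have "isCont F x" for x
  proof -
    obtain G U where G: "open U" "x \<in> U" "\<forall>y\<in>U. F y = G y" "Ck 0 G" using 0 by blast
    then have "isCont G x" by (simp add: continuous_on_eq_continuous_at)
    moreover have "eventually (\<lambda>y. F y = G y) (nhds x)"
      using G eventually_nhds by blast
    ultimately show ?thesis by (simp add: isCont_cong)
  qed
  then show ?case by (simp add: continuous_at_imp_continuous_on)
next
  case (Suc k)
  have *: "\<exists>G U. open U \<and> x \<in> U \<and> (\<forall>y\<in>U. F y = G y) \<and> Ck (Suc k) G
    \<and> (\<forall>y\<in>U. (F has_derivative frechet_derivative G (at y)) (at y))" for x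
  proof -
    obtain G U where G: "open U" "x \<in> U" "\<forall>y\<in>U. F y = G y" "Ck (Suc k) G" using Suc.prems by blast
    have "(F has_derivative frechet_derivative G (at y)) (at y)" if "y \<in> U" for y
      by (rule has_derivative_transform_within_open[of G _ _ _ U])
        (use G that frechet_derivative_works in auto)
    then show ?thesis using G by blast
  qed
  have d: "F differentiable at x" for x using *[of x] by (auto simp: differentiable_def)
  have "Ck k (\<lambda>x. dir_deriv F x u)" for u
  proof (rule Suc.IH)
    fix x
    obtain G U where G: "open U" "x \<in> U" "Ck (Suc k) G"
      "\<forall>y\<in>U. (F has_derivative frechet_derivative G (at y)) (at y)" using *[of x] by blast
    then have "\<forall>y\<in>U. dir_deriv F y u = dir_deriv G y u" by (metis frechet_derivative_at)
    with G show "\<exists>G U. open U \<and> x \<in> U \<and> (\<forall>y\<in>U. dir_deriv F y u = G y) \<and> Ck k G"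
      by (intro exI[of _ "\<lambda>y. dir_deriv G y u"] exI[of _ U]) auto
  qed
  then show ?case using d by simp
qed

lemma Ck_SucD: "Ck (Suc k) F \<Longrightarrow> Ck k F"
proof (induction k arbitrary: F)
  case 0
  then show ?case
    by (auto intro!: continuous_at_imp_continuous_on differentiable_imp_continuous_within)
next
  case (Suc k)
  have "\<forall>x. F differentiable at x" "\<And>u. Ck (Suc k) (\<lambda>x. dir_deriv F x u)"
    using Suc.prems by simp_all
  then show ?case using Suc.IH by (simp only: Ck.simps(2)[of k]) blast
qed

lemma Ck_const: "Ck k (\<lambda>x. c)"
  by (induction k arbitrary: c) (auto simp: frechet_derivative_const)

lemma Ck_dD: "Ck (Suc k) F \<Longrightarrow> (F has_derivative frechet_derivative F (at x)) (at x)"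
  by (simp add: frechet_derivative_works)

lemma Ck_SucI:
  assumes "\<And>x. (F has_derivative F' x) (at x)" "\<And>u. Ck k (\<lambda>x. F' x u)"
  shows "Ck (Suc k) F"
proof -
  have "frechet_derivative F (at x) = F' x" for x using assms(1) by (metis frechet_derivative_at)
  then show ?thesis using assms by (auto simp: differentiable_def)
qed

lemma Ck_bounded_linear: "bounded_linear L \<Longrightarrow> Ck k L"
proof (cases k)
  case (Suc m)
  assume L: "bounded_linear L"
  show ?thesis unfolding Suc
    by (rule Ck_SucI[where F'="\<lambda>x. L"]) (rule bounded_linear_imp_has_derivative[OF L] Ck_const)+
qed (simp add: linear_continuous_on)

lemma Ck_bounded_linear_compose: "bounded_linear L \<Longrightarrow> Ck k F \<Longrightarrow> Ck k (\<lambda>x. L (F x))"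
proof (induction k arbitrary: F)
  case 0
  then show ?case by (auto intro: bounded_linear.continuous_on)
next
  case (Suc k)
  show ?case
  proof (rule Ck_SucI[where F'="\<lambda>x u. L (dir_deriv F x u)"])
    show "((\<lambda>x. L (F x)) has_derivative (\<lambda>u. L (dir_deriv F x u))) (at x)" for x
      by (rule bounded_linear.has_derivative[OF Suc.prems(1) Ck_dD[OF Suc.prems(2)]])
  qed (use Suc in simp)
qed

lemma Ck_add: "Ck k F \<Longrightarrow> Ck k G \<Longrightarrow> Ck k (\<lambda>x. F x + G x)"
proof (induction k arbitrary: F G)
  case 0
  then show ?case by (auto intro: continuous_intros)
next
  case (Suc k)
  show ?case
  proof (rule Ck_SucI[where F'="\<lambda>x u. dir_deriv F x u + dir_deriv G x u"])
    show "((\<lambda>x. F x + G x) has_derivative (\<lambda>u. dir_deriv F x u + dir_deriv G x u)) (at x)" for x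
      by (rule has_derivative_add[OF Ck_dD[OF Suc.prems(1)] Ck_dD[OF Suc.prems(2)]])
  qed (use Suc in simp)
qed

lemma Ck_bilinear:
  assumes "bounded_bilinear pr"
  shows "Ck k F \<Longrightarrow> Ck k G \<Longrightarrow> Ck k (\<lambda>x. pr (F x) (G x))"
proof (induction k arbitrary: F G)
  case 0
  then show ?case by (auto intro: bounded_bilinear.continuous_on[OF assms])
next
  case (Suc k)
  show ?case
  proof (rule Ck_SucI[where F'="\<lambda>x u. pr (F x) (dir_deriv G x u) + pr (dir_deriv F x u) (G x)"])
    show "((\<lambda>x. pr (F x) (G x)) has_derivative (\<lambda>u. pr (F x) (dir_deriv G x u) + pr (dir_deriv F x u) (G x))) (at x)" for x
      using Suc.prems by (intro bounded_bilinear.FDERIV[OF assms]) (auto intro!: Ck_dD)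
    show "Ck k (\<lambda>x. pr (F x) (dir_deriv G x u) + pr (dir_deriv F x u) (G x))" for u
      using Suc.prems Ck_SucD[OF Suc.prems(1)] Ck_SucD[OF Suc.prems(2)]
      by (intro Ck_add Suc.IH) auto
  qed
qed

lemma Ck_sum: "finite A \<Longrightarrow> (\<And>a. a \<in> A \<Longrightarrow> Ck k (F a)) \<Longrightarrow> Ck k (\<lambda>x. \<Sum>a\<in>A. F a x)"
  by (induction A rule: finite_induct) (auto intro: Ck_add Ck_const)

lemma Ck_compose:
  fixes H :: "'u::euclidean_space \<Rightarrow> 'v::euclidean_space"
  shows "Ck k G \<Longrightarrow> Ck k H \<Longrightarrow> Ck k (\<lambda>x. G (H x))"
proof (induction k arbitrary: G)
  case 0
  then show ?case by (auto intro: continuous_on_compose2)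
next
  case (Suc k)
  show ?case
  \<comment> \<open>The direction \<open>dir_deriv H x u\<close> moves with \<open>x\<close>,
    whereas \<open>Ck\<close> speaks of constant directions only; hence the expansion in
    \<open>Basis\<close>.\<close>
  proof (rule Ck_SucI[where F'="\<lambda>x u. \<Sum>b\<in>Basis. (dir_deriv H x u \<bullet> b) *\<^sub>R dir_deriv G (H x) b"])
    fix x
    have lin: "linear (frechet_derivative G (at (H x)))"
      using Ck_dD[OF Suc.prems(1)] has_derivative_linear by blast
    have "((\<lambda>x. G (H x)) has_derivative (\<lambda>u. dir_deriv G (H x) (dir_deriv H x u))) (at x)"
      using has_derivative_compose[OF Ck_dD[OF Suc.prems(2)] Ck_dD[OF Suc.prems(1)]] .
    also have "(\<lambda>u. dir_deriv G (H x) (dir_deriv H x u)) =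
       (\<lambda>u. \<Sum>b\<in>Basis. (dir_deriv H x u \<bullet> b) *\<^sub>R dir_deriv G (H x) b)"
    proof
      fix u
      show "dir_deriv G (H x) (dir_deriv H x u) = (\<Sum>b\<in>Basis. (dir_deriv H x u \<bullet> b) *\<^sub>R dir_deriv G (H x) b)"
        by (subst (1) euclidean_representation[symmetric, of "dir_deriv H x u"])
          (simp add: linear_sum[OF lin] linear_scale[OF lin])
    qed
    finally show "((\<lambda>x. G (H x)) has_derivative
       (\<lambda>u. \<Sum>b\<in>Basis. (dir_deriv H x u \<bullet> b) *\<^sub>R dir_deriv G (H x) b)) (at x)" .
  next
    fix u
    show "Ck k (\<lambda>x. \<Sum>b\<in>Basis. (dir_deriv H x u \<bullet> b) *\<^sub>R dir_deriv G (H x) b)"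
      using Suc.prems Ck_SucD[OF Suc.prems(2)]
      by (intro Ck_sum Ck_bilinear[OF bounded_bilinear_scaleR] Suc.IH
          Ck_bounded_linear_compose[OF bounded_linear_inner_left]) auto
  qed
qed

text \<open>Smoothness is only defined for functions on the whole space. A function with different
  formulas on different regions is therefore compared near each point with a globally smooth one;
  the Cauchy transforms below are handled in this way.\<close>

lemma smooth_local:
  assumes "\<And>x. \<exists>G U. open U \<and> x \<in> U \<and> (\<forall>y\<in>U. F y = G y) \<and> smooth G"
  shows "smooth F"
  unfolding smooth_def
proof (intro allI Ck_local)
  fix k x
  obtain G U where "open U" "x \<in> U" "\<forall>y\<in>U. F y = G y" "smooth G" using assms by blast
  then show "\<exists>G U. open U \<and> x \<in> U \<and> (\<forall>y\<in>U. F y = G y) \<and> Ck k G"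
    unfolding smooth_def by blast
qed

lemma smooth_const: "smooth (\<lambda>x. c)" by (simp add: smooth_def Ck_const)
lemma smooth_bounded_linear: "bounded_linear L \<Longrightarrow> smooth L"
  by (simp add: smooth_def Ck_bounded_linear)
lemma smooth_bounded_linear_compose: "bounded_linear L \<Longrightarrow> smooth F \<Longrightarrow> smooth (\<lambda>x. L (F x))"
  by (simp add: smooth_def Ck_bounded_linear_compose)
lemma smooth_add: "smooth F \<Longrightarrow> smooth G \<Longrightarrow> smooth (\<lambda>x. F x + G x)"
  by (simp add: smooth_def Ck_add)
lemma smooth_bilinear: "bounded_bilinear pr \<Longrightarrow> smooth F \<Longrightarrow> smooth G \<Longrightarrow> smooth (\<lambda>x. pr (F x) (G x))"
  by (simp add: smooth_def Ck_bilinear)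
lemma smooth_sum: "finite A \<Longrightarrow> (\<And>a. a \<in> A \<Longrightarrow> smooth (F a)) \<Longrightarrow> smooth (\<lambda>x. \<Sum>a\<in>A. F a x)"
  by (simp add: smooth_def Ck_sum)
lemma smooth_compose:
  fixes H :: "'u::euclidean_space \<Rightarrow> 'v::euclidean_space"
  shows "smooth G \<Longrightarrow> smooth H \<Longrightarrow> smooth (\<lambda>x. G (H x))"
  by (simp add: smooth_def Ck_compose)
lemma smooth_dir_deriv: "smooth F \<Longrightarrow> smooth (\<lambda>x. dir_deriv F x u)"
  unfolding smooth_def using Ck.simps(2)[of _ F] by blast
lemma smooth_has_derivative: "smooth F \<Longrightarrow> (F has_derivative frechet_derivative F (at x)) (at x)"
  unfolding smooth_def using Ck_dD by blast
lemma smooth_differentiable: "smooth F \<Longrightarrow> F differentiable at x"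
  using smooth_has_derivative differentiable_def by blast
lemma smooth_continuous: "smooth F \<Longrightarrow> continuous_on A F"
  unfolding smooth_def using Ck.simps(1)[of F] continuous_on_subset[of UNIV F A] by blast
lemma smooth_minus: "smooth F \<Longrightarrow> smooth (\<lambda>x. - F x)"
  using smooth_bounded_linear_compose[OF bounded_linear_minus[OF bounded_linear_ident]] by blast
lemma smooth_diff: "smooth F \<Longrightarrow> smooth G \<Longrightarrow> smooth (\<lambda>x. F x - G x)"
  using smooth_add[of F "\<lambda>x. - G x"] smooth_minus[of G] by simp
lemma smooth_mult: 
  fixes F :: "'v::euclidean_space \<Rightarrow> 'a::real_normed_algebra"
  shows "smooth F \<Longrightarrow> smooth G \<Longrightarrow> smooth (\<lambda>x. F x * G x)"
  by (rule smooth_bilinear[OF bounded_bilinear_mult])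
lemma smooth_ident: "smooth (\<lambda>x. x)"
  by (rule smooth_bounded_linear) simp
no_notation fps_nth (infixl "$" 75)

section \<open>Derivatives along lines and the symmetry of second derivatives\<close>

lemma has_vector_derivative_along:
  assumes "F differentiable at (x + t *\<^sub>R v)"
  shows "((\<lambda>s. F (x + s *\<^sub>R v)) has_vector_derivative dir_deriv F (x + t *\<^sub>R v) v) (at t within S)"
proof -
  have F: "(F has_derivative frechet_derivative F (at (x + t *\<^sub>R v))) (at (x + t *\<^sub>R v))"
    using assms frechet_derivative_works by blast
  have "((\<lambda>s. x + s *\<^sub>R v) has_derivative (\<lambda>s. s *\<^sub>R v)) (at t within S)"
    by (auto intro!: derivative_eq_intros)
  from has_derivative_compose[OF this, of F] F
  have "((\<lambda>s. F (x + s *\<^sub>R v)) has_derivative (\<lambda>s. dir_deriv F (x + t *\<^sub>R v) (s *\<^sub>R v))) (at t within S)"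
    using has_derivative_at_withinI by blast
  then show ?thesis
    unfolding has_vector_derivative_def linear_scale[OF has_derivative_linear[OF F]] .
qed

lemma integral_dir_deriv:
  fixes F :: "'v::euclidean_space \<Rightarrow> 'w::banach"
  assumes "smooth F" "0 \<le> t"
  shows "integral {0..t} (\<lambda>\<tau>. dir_deriv F (x + \<tau> *\<^sub>R v) v) = F (x + t *\<^sub>R v) - F x"
proof -
  have "((\<lambda>\<tau>. dir_deriv F (x + \<tau> *\<^sub>R v) v) has_integral F (x + t *\<^sub>R v) - F (x + 0 *\<^sub>R v)) {0..t}"
    by (intro fundamental_theorem_of_calculus has_vector_derivative_along smooth_differentiable assms)
  then show ?thesis by (simp add: integral_unique)
qed

text \<open>The increment of \<open>F\<close> along \<open>v\<close> is the integral of its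
  \<open>v\<close>-derivative. Differentiating this in direction \<open>u\<close> under the integral
  sign, and then in the length \<open>t\<close> of the segment at \<open>t = 0\<close>, gives both
  orders of differentiation.\<close>

lemma dir_deriv_commute:
  fixes F :: "'v::euclidean_space \<Rightarrow> 'w::banach"
  assumes F: "smooth F"
  shows "dir_deriv (\<lambda>y. dir_deriv F y u) x v = dir_deriv (\<lambda>y. dir_deriv F y v) x u"
proof -
  define A where "A = (\<lambda>y. dir_deriv F y u)"
  define B where "B = (\<lambda>y. dir_deriv F y v)"
  have A: "smooth A" and B: "smooth B" unfolding A_def B_def by (rule smooth_dir_deriv[OF F])+
  have Bu: "smooth (\<lambda>y. dir_deriv B y u)" by (rule smooth_dir_deriv[OF B])
  have eq: "A (x + t *\<^sub>R v) = A x + integral {0..t} (\<lambda>\<tau>. dir_deriv B (x + \<tau> *\<^sub>R v) u)" if t: "0 \<le> t" for t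
  proof -
    have l: "((\<lambda>s. F ((x + t *\<^sub>R v) + s *\<^sub>R u)) has_vector_derivative A (x + t *\<^sub>R v)) (at 0)"
      using has_vector_derivative_along[of F "x + t *\<^sub>R v" 0 u UNIV] smooth_differentiable[OF F]
      by (simp add: A_def)
    have 1: "((\<lambda>s. F (x + s *\<^sub>R u)) has_vector_derivative A x) (at 0)"
      using has_vector_derivative_along[of F x 0 u UNIV] smooth_differentiable[OF F]
      by (simp add: A_def)
    have 2: "((\<lambda>s. integral (cbox 0 t) (\<lambda>\<tau>. B ((x + \<tau> *\<^sub>R v) + s *\<^sub>R u))) has_vector_derivative
        integral (cbox 0 t) (\<lambda>\<tau>. dir_deriv B ((x + \<tau> *\<^sub>R v) + 0 *\<^sub>R u) u)) (at 0 within UNIV)"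
    proof (rule leibniz_rule_vector_derivative)
      show "((\<lambda>s. B ((x + \<tau> *\<^sub>R v) + s *\<^sub>R u)) has_vector_derivative dir_deriv B ((x + \<tau> *\<^sub>R v) + s *\<^sub>R u) u) (at s within UNIV)" for s \<tau>
        by (rule has_vector_derivative_along[OF smooth_differentiable[OF B]])
      show "(\<lambda>\<tau>. B ((x + \<tau> *\<^sub>R v) + s *\<^sub>R u)) integrable_on cbox 0 t" for s
        by (intro integrable_continuous continuous_on_compose2[OF smooth_continuous[OF B, of UNIV]] continuous_intros) auto
      show "continuous_on (UNIV \<times> cbox 0 t) (\<lambda>(s, \<tau>). dir_deriv B ((x + \<tau> *\<^sub>R v) + s *\<^sub>R u) u)"
        unfolding case_prod_unfold
        by (intro continuous_on_compose2[OF smooth_continuous[OF Bu, of UNIV]] continuous_intros) auto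
    qed auto
    have "F ((x + t *\<^sub>R v) + s *\<^sub>R u) = F (x + s *\<^sub>R u) + integral (cbox 0 t) (\<lambda>\<tau>. B ((x + \<tau> *\<^sub>R v) + s *\<^sub>R u))" for s
      using integral_dir_deriv[OF F t, of "x + s *\<^sub>R u" v] by (simp add: B_def algebra_simps)
    then have "((\<lambda>s. F ((x + t *\<^sub>R v) + s *\<^sub>R u)) has_vector_derivative
       A x + integral (cbox 0 t) (\<lambda>\<tau>. dir_deriv B ((x + \<tau> *\<^sub>R v) + 0 *\<^sub>R u) u)) (at 0)"
      using has_vector_derivative_add[OF 1 2] by presburger
    from vector_derivative_unique_at[OF l this] show ?thesis by simp
  qed
  \<comment> \<open>The integral formula \<open>eq\<close> needs \<open>0 \<le> t\<close>, so the
    comparison is between one-sided derivatives at 0.\<close>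
  have "((\<lambda>t. A (x + t *\<^sub>R v)) has_vector_derivative dir_deriv A (x + 0 *\<^sub>R v) v) (at 0 within {0..1})"
    by (rule has_vector_derivative_along[OF smooth_differentiable[OF A]])
  moreover have "((\<lambda>t. A (x + t *\<^sub>R v)) has_vector_derivative dir_deriv B (x + 0 *\<^sub>R v) u) (at 0 within {0..1})"
  proof -
    have c: "continuous_on {0..1} (\<lambda>\<tau>. dir_deriv B (x + \<tau> *\<^sub>R v) u)"
      by (intro continuous_on_compose2[OF smooth_continuous[OF Bu, of UNIV]] continuous_intros) auto
    have "((\<lambda>t. A x + integral {0..t} (\<lambda>\<tau>. dir_deriv B (x + \<tau> *\<^sub>R v) u)) has_vector_derivative
       0 + dir_deriv B (x + 0 *\<^sub>R v) u) (at 0 within {0..1})"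
      by (intro has_vector_derivative_add has_vector_derivative_const integral_has_vector_derivative[OF c]) auto
    then have "((\<lambda>t. A x + integral {0..t} (\<lambda>\<tau>. dir_deriv B (x + \<tau> *\<^sub>R v) u)) has_vector_derivative
       dir_deriv B (x + 0 *\<^sub>R v) u) (at 0 within {0..1})" by simp
    then show ?thesis
      by (rule has_vector_derivative_transform[rotated 2]) (auto simp: eq)
  qed
  ultimately have "dir_deriv A (x + 0 *\<^sub>R v) v = dir_deriv B (x + 0 *\<^sub>R v) u"
    by (rule vector_derivative_unique_within[rotated]) (simp add: trivial_limit_within islimpt_Icc)
  then show ?thesis by (simp add: A_def B_def)
qed

subsection \<open>Wirtinger derivatives\<close>

definition wd :: "3 \<Rightarrow> (complex^3 \<Rightarrow> complex) \<Rightarrow> complex^3 \<Rightarrow> complex" where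
  "wd j F z = (dir_deriv F z (axis j 1) - \<i> * dir_deriv F z (axis j \<i>)) / 2"

definition wdb :: "3 \<Rightarrow> (complex^3 \<Rightarrow> complex) \<Rightarrow> complex^3 \<Rightarrow> complex" where
  "wdb j F z = (dir_deriv F z (axis j 1) + \<i> * dir_deriv F z (axis j \<i>)) / 2"

lemma vec_axis_decomp:
  "(u :: complex^3) = (\<Sum>j\<in>UNIV. Re (u $ j) *\<^sub>R axis j 1 + Im (u $ j) *\<^sub>R axis j \<i>)"
proof -
  have "(\<Sum>j\<in>UNIV. Re (u $ j) *\<^sub>R axis j 1 + Im (u $ j) *\<^sub>R axis j \<i>) $ i = u $ i" for i
  proof -
    have "(\<Sum>j\<in>UNIV. Re (u $ j) *\<^sub>R axis j 1 + Im (u $ j) *\<^sub>R (axis j \<i> :: complex^3)) $ i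
       = (\<Sum>j\<in>UNIV. if j = i then u $ i else 0)"
      unfolding sum_component by (rule sum.cong) (auto simp: axis_def complex_eq_iff)
    then show ?thesis by simp
  qed
  then show ?thesis by (simp add: vec_eq_iff)
qed

lemma dir_deriv_wirtinger:
  assumes "F differentiable at z"
  shows "dir_deriv F z u = (\<Sum>j\<in>UNIV. u $ j * wd j F z + cnj (u $ j) * wdb j F z)"
proof -
  have l: "linear (frechet_derivative F (at z))"
    using assms linear_frechet_derivative by blast
  have "dir_deriv F z u = (\<Sum>j\<in>UNIV. Re (u $ j) *\<^sub>R dir_deriv F z (axis j 1) + Im (u $ j) *\<^sub>R dir_deriv F z (axis j \<i>))"
    by (subst vec_axis_decomp[of u]) (simp add: linear_sum[OF l] linear_add[OF l] linear_scale[OF l])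
  also have "\<dots> = (\<Sum>j\<in>UNIV. u $ j * wd j F z + cnj (u $ j) * wdb j F z)"
    by (rule sum.cong) (auto simp: wd_def wdb_def complex_eq_iff field_simps)
  finally show ?thesis .
qed

text \<open>A real linear map has unique complex linear and antilinear parts. The rules below all
  differentiate as usual and then read off the two families of coefficients.\<close>

lemma wirtinger_unique:
  assumes "(F has_derivative (\<lambda>u. \<Sum>j\<in>UNIV. u $ j * a j + cnj (u $ j) * b j)) (at z)"
  shows "wd j F z = a j" "wdb j F z = b j"
proof -
  have e: "frechet_derivative F (at z) = (\<lambda>u. \<Sum>j\<in>UNIV. u $ j * a j + cnj (u $ j) * b j)"
    by (rule frechet_derivative_at[OF assms, symmetric])
  have ax: "(\<Sum>i\<in>UNIV. axis j c $ i * a i + cnj (axis j c $ i) * b i) = c * a j + cnj c * b j" for c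
  proof -
    have "(\<Sum>i\<in>UNIV. axis j c $ i * a i + cnj (axis j c $ i) * b i) = 
      (\<Sum>i\<in>UNIV. if i = j then c * a j + cnj c * b j else 0)"
      by (rule sum.cong) (auto simp: axis_def)
    then show ?thesis by simp
  qed
  show "wd j F z = a j" "wdb j F z = b j"
    unfolding wd_def wdb_def e ax by (simp_all add: algebra_simps)
qed

lemma has_derivative_wirtinger:
  assumes "F differentiable at z"
  shows "(F has_derivative (\<lambda>u. \<Sum>j\<in>UNIV. u $ j * wd j F z + cnj (u $ j) * wdb j F z)) (at z)"
  using assms dir_deriv_wirtinger[OF assms] frechet_derivative_works[of F "at z"]
  by presburger

lemma wirtinger_cong:
  assumes "open U" "z \<in> U" "\<And>y. y \<in> U \<Longrightarrow> F y = G y"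
  shows "wd j F z = wd j G z" "wdb j F z = wdb j G z"
proof -
  have 1: "(F has_derivative D) (at z) \<longleftrightarrow> (G has_derivative D) (at z)" for D
    using has_derivative_transform_within_open[OF _ assms(1,2)] assms(3) by metis
  have "dir_deriv F z u = dir_deriv G z u" for u
    unfolding frechet_derivative_def 1 ..
  then show "wd j F z = wd j G z" "wdb j F z = wdb j G z" by (auto simp: wd_def wdb_def)
qed

lemma wirtinger_add:
  assumes "F differentiable at z" "G differentiable at z"
  shows "wd j (\<lambda>z. F z + G z) z = wd j F z + wd j G z" "wdb j (\<lambda>z. F z + G z) z = wdb j F z + wdb j G z"
proof -
  have "((\<lambda>z. F z + G z) has_derivative (\<lambda>u. \<Sum>j\<in>UNIV. u $ j * (wd j F z + wd j G z) + cnj (u $ j) * (wdb j F z + wdb j G z))) (at z)"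
    using has_derivative_add[OF assms[THEN has_derivative_wirtinger]]
    by (simp add: sum.distrib[symmetric] algebra_simps)
  from wirtinger_unique[OF this] show "wd j (\<lambda>z. F z + G z) z = wd j F z + wd j G z" "wdb j (\<lambda>z. F z + G z) z = wdb j F z + wdb j G z" .
qed

lemma wirtinger_mult:
  assumes "F differentiable at z" "G differentiable at z"
  shows "wd j (\<lambda>z. F z * G z) z = wd j F z * G z + F z * wd j G z"
    "wdb j (\<lambda>z. F z * G z) z = wdb j F z * G z + F z * wdb j G z"
proof -
  have "((\<lambda>z. F z * G z) has_derivative (\<lambda>u. \<Sum>j\<in>UNIV. u $ j * (wd j F z * G z + F z * wd j G z) + cnj (u $ j) * (wdb j F z * G z + F z * wdb j G z))) (at z)"
    using has_derivative_mult[OF assms[THEN has_derivative_wirtinger]]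
    by (simp add: sum.distrib[symmetric] sum_distrib_left sum_distrib_right algebra_simps)
  from wirtinger_unique[OF this] show "wd j (\<lambda>z. F z * G z) z = wd j F z * G z + F z * wd j G z"
    "wdb j (\<lambda>z. F z * G z) z = wdb j F z * G z + F z * wdb j G z" .
qed

lemma wirtinger_cnj:
  assumes "F differentiable at z"
  shows "wd j (\<lambda>z. cnj (F z)) z = cnj (wdb j F z)" "wdb j (\<lambda>z. cnj (F z)) z = cnj (wd j F z)"
proof -
  have "((\<lambda>z. cnj (F z)) has_derivative (\<lambda>u. \<Sum>j\<in>UNIV. u $ j * cnj (wdb j F z) + cnj (u $ j) * cnj (wd j F z))) (at z)"
    using has_derivative_cnj[OF has_derivative_wirtinger[OF assms]]
    by (simp add: algebra_simps)
  from wirtinger_unique[OF this] show "wd j (\<lambda>z. cnj (F z)) z = cnj (wdb j F z)" "wdb j (\<lambda>z. cnj (F z)) z = cnj (wd j F z)" .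
qed

lemma wirtinger_const: "wd j (\<lambda>z. c) z = 0" "wdb j (\<lambda>z. c) z = 0"
  by (auto simp: wd_def wdb_def frechet_derivative_const)

lemma wirtinger_nth: "wd j (\<lambda>z. z $ l) z = (if j = l then 1 else 0)" "wdb j (\<lambda>z. z $ l) z = 0"
proof -
  have "((\<lambda>z. z $ l) has_derivative (\<lambda>u. \<Sum>j\<in>UNIV. u $ j * (if j = l then 1 else 0) + cnj (u $ j) * 0)) (at z)"
  proof -
    have "(\<lambda>u. \<Sum>j\<in>UNIV. u $ j * (if j = l then 1 else 0) + cnj (u $ j) * 0) = (\<lambda>u::complex^3. \<Sum>j\<in>UNIV. if j = l then u $ l else 0)"
      by (intro ext sum.cong) auto
    then show ?thesis by (simp add: bounded_linear_imp_has_derivative bounded_linear_vec_nth)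
  qed
  from wirtinger_unique[OF this] show "wd j (\<lambda>z. z $ l) z = (if j = l then 1 else 0)" "wdb j (\<lambda>z. z $ l) z = 0" .
qed

lemma smooth_wd: "smooth F \<Longrightarrow> smooth (wd j F)" and smooth_wdb: "smooth F \<Longrightarrow> smooth (wdb j F)"
proof -
  assume F: "smooth F"
  have "smooth (\<lambda>z. (1/2) * (dir_deriv F z (axis j 1) - \<i> * dir_deriv F z (axis j \<i>)))"
       "smooth (\<lambda>z. (1/2) * (dir_deriv F z (axis j 1) + \<i> * dir_deriv F z (axis j \<i>)))"
    by (intro smooth_mult smooth_diff smooth_add smooth_const smooth_dir_deriv F)+
  then show "smooth (wd j F)" "smooth (wdb j F)"
    by (simp_all add: wd_def[abs_def] wdb_def[abs_def])
qed

lemma wirtinger_commute: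
  assumes F: "smooth F"
  shows "wd j (wd k F) z = wd k (wd j F) z" "wdb j (wdb k F) z = wdb k (wdb j F) z"
    "wd j (wdb k F) z = wdb k (wd j F) z"
proof -
  define P where "P = (\<lambda>u v. dir_deriv (\<lambda>y. dir_deriv F y u) z v)"
  have P: "P u v = P v u" for u v unfolding P_def by (rule dir_deriv_commute[OF F])
  have D: "dir_deriv (\<lambda>z. (dir_deriv F z u + c * dir_deriv F z w) / 2) z v = (P u v + c * P w v) / 2" for u w v c
  proof -
    have d: "((\<lambda>y. dir_deriv F y u) has_derivative frechet_derivative (\<lambda>y. dir_deriv F y u) (at z)) (at z)" for u
      by (rule smooth_has_derivative[OF smooth_dir_deriv[OF F]])
    have "((\<lambda>z. (dir_deriv F z u + c * dir_deriv F z w) / 2) has_derivative (\<lambda>v. (P u v + c * P w v) / 2)) (at z)"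
      unfolding P_def by (auto intro!: derivative_eq_intros d)
    from frechet_derivative_at[OF this, symmetric] show ?thesis by simp
  qed
  have W: "wd k F = (\<lambda>z. (dir_deriv F z (axis k 1) + (-\<i>) * dir_deriv F z (axis k \<i>)) / 2)"
          "wdb k F = (\<lambda>z. (dir_deriv F z (axis k 1) + \<i> * dir_deriv F z (axis k \<i>)) / 2)" for k
    by (auto simp: wd_def[abs_def] wdb_def[abs_def])
  have 1: "wd j (wd k F) z = ((P (axis k 1) (axis j 1) + (-\<i>) * P (axis k \<i>) (axis j 1)) / 2 - \<i> * ((P (axis k 1) (axis j \<i>) + (-\<i>) * P (axis k \<i>) (axis j \<i>)) / 2)) / 2" for j k
    by (subst wd_def, subst (1 2) W(1)) (simp only: D)
  have 2: "wdb j (wdb k F) z = ((P (axis k 1) (axis j 1) + \<i> * P (axis k \<i>) (axis j 1)) / 2 + \<i> * ((P (axis k 1) (axis j \<i>) + \<i> * P (axis k \<i>) (axis j \<i>)) / 2)) / 2" for j k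
    by (subst wdb_def, subst (1 2) W(2)) (simp only: D)
  have 3: "wd j (wdb k F) z = ((P (axis k 1) (axis j 1) + \<i> * P (axis k \<i>) (axis j 1)) / 2 - \<i> * ((P (axis k 1) (axis j \<i>) + \<i> * P (axis k \<i>) (axis j \<i>)) / 2)) / 2" for j k
    by (subst wd_def, subst (1 2) W(2)) (simp only: D)
  have 4: "wdb k (wd j F) z = ((P (axis j 1) (axis k 1) + (-\<i>) * P (axis j \<i>) (axis k 1)) / 2 + \<i> * ((P (axis j 1) (axis k \<i>) + (-\<i>) * P (axis j \<i>) (axis k \<i>)) / 2)) / 2" for j k
    by (subst wdb_def, subst (1 2) W(1)) (simp only: D)
  show "wd j (wd k F) z = wd k (wd j F) z" "wdb j (wdb k F) z = wdb k (wdb j F) z"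
    "wd j (wdb k F) z = wdb k (wd j F) z"
    unfolding 1 2 3 4
    using P[of "axis k 1" "axis j 1"] P[of "axis k 1" "axis j \<i>"] P[of "axis k \<i>" "axis j 1"]
      P[of "axis k \<i>" "axis j \<i>"] by (simp_all add: field_simps)
qed

subsection \<open>The ring of smooth functions\<close>

text \<open>With smoothness built into a type, tensor calculus in a chart takes place in a
  commutative ring with six commuting derivations \<open>dd j\<close>, \<open>db j\<close> and the
  conjugation \<open>cj\<close>. Differentiability conditions disappear and identities are left to
  \<open>algebra_simps\<close>.\<close>

typedef sfun = "{F :: complex^3 \<Rightarrow> complex. smooth F}"
  morphisms val mk_sfun by (rule exI[of _ "\<lambda>_. 0"]) (simp add: smooth_const)

setup_lifting type_definition_sfun

instantiation sfun :: comm_ring_1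
begin
lift_definition zero_sfun :: sfun is "\<lambda>_. 0" by (rule smooth_const)
lift_definition one_sfun :: sfun is "\<lambda>_. 1" by (rule smooth_const)
lift_definition plus_sfun :: "sfun \<Rightarrow> sfun \<Rightarrow> sfun" is "\<lambda>F G z. F z + G z" by (rule smooth_add)
lift_definition minus_sfun :: "sfun \<Rightarrow> sfun \<Rightarrow> sfun" is "\<lambda>F G z. F z - G z" by (rule smooth_diff)
lift_definition uminus_sfun :: "sfun \<Rightarrow> sfun" is "\<lambda>F z. - F z" by (rule smooth_minus)
lift_definition times_sfun :: "sfun \<Rightarrow> sfun \<Rightarrow> sfun" is "\<lambda>F G z. F z * G z" by (rule smooth_mult)
instance
  by standard (transfer; auto simp: algebra_simps fun_eq_iff)+
end

lift_definition dd :: "3 \<Rightarrow> sfun \<Rightarrow> sfun" is wd by (rule smooth_wd)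
lift_definition db :: "3 \<Rightarrow> sfun \<Rightarrow> sfun" is wdb by (rule smooth_wdb)
lift_definition cj :: "sfun \<Rightarrow> sfun" is "\<lambda>F z. cnj (F z)"
  by (rule smooth_bounded_linear_compose[OF bounded_linear_cnj])
lift_definition cst :: "complex \<Rightarrow> sfun" is "\<lambda>c z. c" by (rule smooth_const)
lift_definition coord :: "3 \<Rightarrow> sfun" is "\<lambda>j z. z $ j"
  by (rule smooth_bounded_linear[OF bounded_linear_vec_nth])

lemma val_simps [simp]:
  "val 0 z = 0" "val 1 z = 1" "val (F + G) z = val F z + val G z" "val (F - G) z = val F z - val G z"
  "val (- F) z = - val F z" "val (F * G) z = val F z * val G z"
  "val (dd j F) z = wd j (val F) z" "val (db j F) z = wdb j (val F) z"
  "val (cj F) z = cnj (val F z)" "val (cst c) z = c" "val (coord j) z = z $ j"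
  by (transfer; simp)+

lemma val_sum [simp]: "val (\<Sum>a\<in>A. F a) z = (\<Sum>a\<in>A. val (F a) z)"
  by (induction A rule: infinite_finite_induct) auto

lemma val_smooth: "smooth (val F)" using val by blast

lemma val_mk: "smooth F \<Longrightarrow> val (mk_sfun F) = F" by (simp add: mk_sfun_inverse)

lemma val_diff: "val F differentiable at z" by (rule smooth_differentiable[OF val_smooth])

lemma sfun_eqI: "(\<And>z. val F z = val G z) \<Longrightarrow> F = G"
  by (simp add: val_inject[symmetric] fun_eq_iff)

lemma d_add [simp]: "dd j (F + G) = dd j F + dd j G" "db j (F + G) = db j F + db j G"
  by (rule sfun_eqI, simp add: plus_sfun.rep_eq wirtinger_add val_diff)+

lemma d_mult [simp]: "dd j (F * G) = dd j F * G + F * dd j G" "db j (F * G) = db j F * G + F * db j G"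
  by (rule sfun_eqI, simp add: times_sfun.rep_eq wirtinger_mult val_diff)+

lemma d_cst [simp]: "dd j (cst c) = 0" "db j (cst c) = 0" "dd j 0 = 0" "db j 0 = 0" "dd j 1 = 0" "db j 1 = 0"
  by (rule sfun_eqI, simp add: cst.rep_eq zero_sfun.rep_eq one_sfun.rep_eq wirtinger_const)+

lemma cj_d [simp]: "cj (dd j F) = db j (cj F)" "cj (db j F) = dd j (cj F)"
  by (rule sfun_eqI, simp add: cj.rep_eq wirtinger_cnj val_diff)+

lemma cj_simps [simp]: "cj (F + G) = cj F + cj G" "cj (F * G) = cj F * cj G" "cj (F - G) = cj F - cj G"
  "cj (- F) = - cj F" "cj 0 = 0" "cj 1 = 1" "cj (cst c) = cst (cnj c)" "cj (cj F) = F"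
  by (rule sfun_eqI, simp)+

lemma cj_sum [simp]: "cj (\<Sum>a\<in>A. F a) = (\<Sum>a\<in>A. cj (F a))"
  by (induction A rule: infinite_finite_induct) auto

lemma d_uminus [simp]: "dd j (- F) = - dd j F" "db j (- F) = - db j F"
proof -
  have "dd j F + dd j (- F) = 0" "db j F + db j (- F) = 0"
    unfolding d_add[symmetric] by simp_all
  then show "dd j (- F) = - dd j F" "db j (- F) = - db j F" by (simp_all add: add_eq_0_iff)
qed

lemma d_diff [simp]: "dd j (F - G) = dd j F - dd j G" "db j (F - G) = db j F - db j G"
  using d_add[of j F "- G"] by simp_all

lemma d_sum [simp]: "dd j (\<Sum>a\<in>A. F a) = (\<Sum>a\<in>A. dd j (F a))" "db j (\<Sum>a\<in>A. F a) = (\<Sum>a\<in>A. db j (F a))"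
  by (induction A rule: infinite_finite_induct) auto

lemma dd_dd: "dd j (dd k F) = dd k (dd j F)" and db_db: "db j (db k F) = db k (db j F)"
  and dd_db: "dd j (db k F) = db k (dd j F)"
  by (rule sfun_eqI, simp only: val_simps dd.rep_eq db.rep_eq wirtinger_commute(1)[OF val_smooth]
      wirtinger_commute(2)[OF val_smooth] wirtinger_commute(3)[OF val_smooth])+

lemma d_coord [simp]: "dd j (coord l) = (if j = l then 1 else 0)" "db j (coord l) = 0"
  by (rule sfun_eqI, simp add: coord.rep_eq wirtinger_nth)+

section \<open>The weighted Lichnerowicz identity in a chart\<close>

lemma delta_sum [simp]:
  "(\<Sum>j\<in>UNIV. (if i = j then 1 else 0) * F j) = (F (i::3) :: sfun)"
  "(\<Sum>j\<in>UNIV. (if j = i then 1 else 0) * F j) = (F (i::3) :: sfun)"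
  "(\<Sum>j\<in>UNIV. F j * (if i = j then 1 else 0)) = (F (i::3) :: sfun)"
  "(\<Sum>j\<in>UNIV. F j * (if j = i then 1 else 0)) = (F (i::3) :: sfun)"
proof -
  have "(if P then 1 else 0) * x = (if P then x else 0)" "x * (if P then 1 else 0) = (if P then x else 0)"
    for P and x :: sfun by simp_all
  then show "(\<Sum>j\<in>UNIV. (if i = j then 1 else 0) * F j) = F i" "(\<Sum>j\<in>UNIV. (if j = i then 1 else 0) * F j) = F i"
    "(\<Sum>j\<in>UNIV. F j * (if i = j then 1 else 0)) = F i" "(\<Sum>j\<in>UNIV. F j * (if j = i then 1 else 0)) = F i"
    by simp_all
qed

text \<open>\<open>g j k\<close> is the Hermitian matrix of the metric, with the second index
  conjugate; \<open>gi\<close> is its inverse with both indices in the same places. The determinant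
  \<open>D\<close> enters axiomatically, through Jacobi's formula \<open>dD\<close>.\<close>

locale kaehler_chart =
  fixes g gi :: "3 \<Rightarrow> 3 \<Rightarrow> sfun" and D Di :: sfun
  assumes inv1: "(\<Sum>k\<in>UNIV. gi j k * g l k) = (if j = l then 1 else 0)"
    and inv2: "(\<Sum>j\<in>UNIV. gi j k * g j m) = (if k = m then 1 else 0)"
    and herm: "cj (g j k) = g k j" and hermi: "cj (gi j k) = gi k j"
    and kah: "dd l (g j k) = dd j (g l k)"
    and DDi: "D * Di = 1" and cjD: "cj D = D"
    and dD: "dd k D = D * (\<Sum>j\<in>UNIV. \<Sum>m\<in>UNIV. gi j m * dd k (g j m))"
begin

lemma kahb: "db l (g j k) = db k (g j l)"
proof -
  have "cj (dd l (g k j)) = cj (dd k (g l j))" by (simp only: kah[of l])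
  then show ?thesis by (simp add: herm)
qed

text \<open>The derivative of log \<open>D\<close>, by Jacobi's formula (\<open>psi_D\<close>). The
  Ricci curvature is obtained from \<open>db m (psi k)\<close>.\<close>

definition psi where "psi k = (\<Sum>j\<in>UNIV. \<Sum>m\<in>UNIV. gi j m * dd k (g j m))"
definition psib where "psib k = cj (psi k)"
definition box where "box u = (\<Sum>j\<in>UNIV. \<Sum>k\<in>UNIV. gi j k * dd j (db k u))"

lemma dDi: "dd k Di = - (Di * psi k)"
proof -
  have "dd k (D * Di) = 0" by (simp add: DDi)
  then have "D * (psi k * Di + dd k Di) = 0" by (simp add: dD psi_def algebra_simps)
  then have "Di * (D * (psi k * Di + dd k Di)) = 0" by simp
  then have "(D * Di) * (psi k * Di + dd k Di) = 0" by (simp only: mult_ac)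
  then show ?thesis by (simp add: DDi add_eq_0_iff2 mult.commute)
qed

lemma psi_D: "psi k = Di * dd k D"
proof -
  have "Di * dd k D = (D * Di) * psi k" by (simp add: dD psi_def[symmetric] mult_ac)
  then show ?thesis by (simp add: DDi)
qed

lemma cjDi: "cj Di = Di"
proof -
  have "cj (D * Di) = 1" by (simp add: DDi)
  then have "Di * (D * cj Di) = Di" by (simp add: cjD)
  then have "(D * Di) * cj Di = Di" by (simp only: mult_ac)
  then show ?thesis by (simp add: DDi)
qed

lemma psib_D: "psib k = Di * db k D" by (simp add: psib_def psi_D cjDi cjD)

lemma db_psi: "db m (psi k) = dd k (psib m)"
proof -
  have a: "dd k Di = - (Di * Di * dd k D)" by (simp add: dDi psi_D mult_ac)
  have "cj (dd m Di) = cj (- (Di * psi m))" by (simp only: dDi)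
  then have b: "db m Di = - (Di * Di * db m D)" by (simp add: cjDi psib_def[symmetric] psib_D mult_ac)
  show ?thesis unfolding psi_D psib_D by (simp add: a b dd_db algebra_simps)
qed

lemma dgi: "dd l (gi j k) = - (\<Sum>a\<in>UNIV. \<Sum>b\<in>UNIV. gi j b * gi a k * dd l (g a b))"
proof -
  have 0: "(\<Sum>b\<in>UNIV. dd l (gi j b) * g a b) = - (\<Sum>b\<in>UNIV. gi j b * dd l (g a b))" for a
  proof -
    have "dd l (\<Sum>b\<in>UNIV. gi j b * g a b) = 0" unfolding inv1 by simp
    then show ?thesis by (simp add: sum.distrib add_eq_0_iff2)
  qed
  have "dd l (gi j k) = (\<Sum>b\<in>UNIV. dd l (gi j b) * (\<Sum>a\<in>UNIV. gi a k * g a b))"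
    unfolding inv2 by simp
  also have "\<dots> = (\<Sum>a\<in>UNIV. gi a k * (\<Sum>b\<in>UNIV. dd l (gi j b) * g a b))"
    by (simp add: sum_distrib_left mult_ac) (rule sum.swap)
  also have "\<dots> = - (\<Sum>a\<in>UNIV. \<Sum>b\<in>UNIV. gi j b * gi a k * dd l (g a b))"
    unfolding 0 by (simp add: sum_distrib_left sum_negf mult_ac)
  finally show ?thesis .
qed

lemma dgib: "db l (gi j k) = - (\<Sum>a\<in>UNIV. \<Sum>b\<in>UNIV. gi j b * gi a k * db l (g a b))"
proof -
  have "cj (dd l (gi k j)) = cj (- (\<Sum>a\<in>UNIV. \<Sum>b\<in>UNIV. gi k b * gi a j * dd l (g a b)))" by (simp only: dgi)
  then have "db l (gi j k) = - (\<Sum>a\<in>UNIV. \<Sum>b\<in>UNIV. gi b k * gi j a * db l (g b a))"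
    by (simp add: herm hermi)
  also have "\<dots> = - (\<Sum>a\<in>UNIV. \<Sum>b\<in>UNIV. gi a k * gi j b * db l (g a b))" by (subst sum.swap) simp
  finally show ?thesis by (simp add: mult_ac)
qed

text \<open>Divided by \<open>D\<close>, this is the divergence of \<open>D * gi\<close>. The
  derivative of the inverse matrix produces derivatives of \<open>g\<close> whose indices are
  exchanged by the Kaehler condition, and then the trace \<open>psi\<close> appears. It is the
  reason why Laplacians on a Kaehler manifold contain no first derivatives of the metric.\<close>

lemma div_gi: "(\<Sum>j\<in>UNIV. dd j (gi j k) + psi j * gi j k) = 0"
proof -
  have "(\<Sum>j\<in>UNIV. dd j (gi j k)) = - (\<Sum>j\<in>UNIV. \<Sum>a\<in>UNIV. \<Sum>b\<in>UNIV. gi j b * gi a k * dd a (g j b))"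
    unfolding dgi sum_negf by (simp only: kah)
  also have "\<dots> = - (\<Sum>a\<in>UNIV. \<Sum>j\<in>UNIV. \<Sum>b\<in>UNIV. gi j b * gi a k * dd a (g j b))"
    by (subst sum.swap) simp
  also have "\<dots> = - (\<Sum>a\<in>UNIV. psi a * gi a k)"
    by (simp add: psi_def sum_distrib_left sum_distrib_right mult_ac)
  finally show ?thesis by (simp add: sum.distrib)
qed

lemma div_gib: "(\<Sum>k\<in>UNIV. db k (gi j k) + psib k * gi j k) = 0"
proof -
  have "cj (\<Sum>k\<in>UNIV. dd k (gi k j) + psi k * gi k j) = 0" by (simp only: div_gi cj_simps)
  then show ?thesis by (simp add: psib_def hermi del: cj_d) (simp add: hermi)
qed

lemma cj_box: "cj (box u) = box (cj u)"
  by (simp add: box_def hermi dd_db) (rule sum.swap)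

end

text \<open>\<open>v\<close> stands for the weight f^q, known through its logarithmic derivative.
  \<open>Y\<close> and \<open>Z\<close> are holomorphic fields with potentials \<open>f\<close> and
  \<open>F\<close>; \<open>YZ\<close> says that they commute and \<open>YF\<close> that the Poisson
  bracket of the potentials vanishes.\<close>

locale weighted_chart = kaehler_chart +
  fixes f fi v :: sfun and q :: real and Y Z :: "3 \<Rightarrow> sfun" and F :: sfun and c :: complex
  assumes cjf: "cj f = f" and ffi: "f * fi = 1" and cjv: "cj v = v"
    and dv: "dd k v = cst (of_real q) * fi * dd k f * v"
    and df: "db k f = (\<Sum>j\<in>UNIV. g j k * Y j)" and dbY: "db m (Y j) = 0"
    and dF: "db k F = (\<Sum>j\<in>UNIV. g j k * Z j)" and dbZ: "db m (Z j) = 0"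
    and YF: "(\<Sum>j\<in>UNIV. Y j * dd j F) = (\<Sum>j\<in>UNIV. Z j * dd j f)"
    and YZ: "(\<Sum>l\<in>UNIV. Y l * dd l (Z j)) = (\<Sum>l\<in>UNIV. Z l * dd l (Y j))"
begin

definition Q where "Q = cst (of_real q) * fi"
text \<open>The derivative of the logarithm of the weighted density D f^q; \<open>dv\<close> and
  \<open>dvb\<close> are the divergences for this density of fields of type (1,0) and (0,1).\<close>

definition Psi where "Psi k = psi k + Q * dd k f"
definition Psib where "Psib k = psib k + Q * db k f"
text \<open>The mixed Hessian of log (D f^q), up to sign and normalization a weighted Ricci form.
  Hence it is Hermitian (\<open>cjR\<close>) and closed (\<open>dbR\<close>).\<close>

definition R where "R j m = db m (Psi j)"
definition dv where "dv P = (\<Sum>k\<in>UNIV. dd k (P k) + Psi k * P k)"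
definition dvb where "dvb P = (\<Sum>k\<in>UNIV. db k (P k) + Psib k * P k)"
definition Yb where "Yb k = cj (Y k)"
definition up where "up u j = (\<Sum>k\<in>UNIV. gi j k * db k u)"
definition upb where "upb u k = (\<Sum>j\<in>UNIV. gi j k * dd j u)"
text \<open>\<open>Wb\<close> is the gradient of type (0,1) of \<open>F\<close>. Its conjugate
  \<open>W\<close> is the gradient of \<open>cj F\<close> of type (1,0), the field that is to be
  shown holomorphic.\<close>

abbreviation "Wb \<equiv> upb F"
definition W where "W j = cj (Wb j)"
definition app where "app P u = (\<Sum>j\<in>UNIV. P j * dd j u)"
definition appb where "appb P u = (\<Sum>j\<in>UNIV. P j * db j u)"

lemma cjfi: "cj fi = fi"
proof -
  have "cj (f * fi) = 1" by (simp add: ffi)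
  then have "fi * (f * cj fi) = fi" by (simp add: cjf)
  then have "(f * fi) * cj fi = fi" by (simp only: mult_ac)
  then show ?thesis by (simp add: ffi)
qed

lemma cjQ: "cj Q = Q" by (simp add: Q_def cjfi)

lemma dfi: "dd k fi = - (fi * fi * dd k f)"
proof -
  have "dd k (f * fi) = 0" by (simp add: ffi)
  then have "fi * (f * dd k fi) = - (fi * (dd k f * fi))" by (simp add: add_eq_0_iff2 distrib_left[symmetric])
  then have "(f * fi) * dd k fi = - (fi * fi * dd k f)" by (simp only: mult_ac)
  then show ?thesis by (simp add: ffi)
qed

lemma dfib: "db k fi = - (fi * fi * db k f)"
proof -
  have "cj (dd k fi) = cj (- (fi * fi * dd k f))" by (simp only: dfi)
  then show ?thesis by (simp add: cjfi cjf)
qed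

lemma cjPsi: "cj (Psi k) = Psib k" "cj (Psib k) = Psi k"
  by (simp_all add: Psi_def Psib_def psib_def cjQ cjf)

lemma R_sym: "R j m = dd j (Psib m)"
  unfolding R_def Psi_def Psib_def by (simp add: db_psi Q_def dfi dfib dd_db algebra_simps)

lemma cjR: "cj (R j m) = R m j"
  unfolding R_def[of j] R_sym[of m] by (simp add: cjPsi)

lemma dbR: "db k (R j m) = db m (R j k)" by (simp add: R_def db_db)

lemma cj_dv: "cj (dv P) = dvb (\<lambda>k. cj (P k))"
  by (simp add: dv_def dvb_def cjPsi)

lemma cj_up: "cj (up u j) = upb (cj u) j" and cj_upb: "cj (upb u j) = up (cj u) j"
  by (simp_all add: up_def upb_def hermi)

lemma upZ: "up F j = Z j"
proof -
  have "up F j = (\<Sum>l\<in>UNIV. (\<Sum>k\<in>UNIV. gi j k * g l k) * Z l)"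
    unfolding up_def dF by (simp add: sum_distrib_left sum_distrib_right mult_ac) (rule sum.swap)
  then show ?thesis unfolding inv1 by simp
qed

lemma upY: "up f j = Y j"
proof -
  have "up f j = (\<Sum>l\<in>UNIV. (\<Sum>k\<in>UNIV. gi j k * g l k) * Y l)"
    unfolding up_def df by (simp add: sum_distrib_left sum_distrib_right mult_ac) (rule sum.swap)
  then show ?thesis unfolding inv1 by simp
qed

lemma upbY: "upb f j = Yb j" unfolding Yb_def upY[symmetric] cj_up cjf ..

text \<open>By \<open>div_gib\<close> all derivatives of the inverse metric drop out. This weighted
  Laplacian and the one in \<open>dv_up\<close> differ only in whether \<open>Y\<close> or
  \<open>Yb\<close> acts on \<open>u\<close>; the hypothesis \<open>YF\<close> makes them agree on
  \<open>F\<close>.\<close>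

lemma dvb_upb: "dvb (upb u) = box u + Q * app Y u"
proof -
  have "dvb (upb u) = (\<Sum>k\<in>UNIV. \<Sum>j\<in>UNIV. gi j k * dd j (db k u) + (db k (gi j k) + psib k * gi j k) * dd j u + Q * db k f * gi j k * dd j u)"
    unfolding dvb_def upb_def Psib_def
    by (simp add: sum.distrib[symmetric] sum_distrib_left dd_db algebra_simps)
  also have "\<dots> = (\<Sum>j\<in>UNIV. \<Sum>k\<in>UNIV. gi j k * dd j (db k u) + (db k (gi j k) + psib k * gi j k) * dd j u + Q * db k f * gi j k * dd j u)"
    by (rule sum.swap)
  also have "\<dots> = box u + (\<Sum>j\<in>UNIV. (\<Sum>k\<in>UNIV. db k (gi j k) + psib k * gi j k) * dd j u) + Q * (\<Sum>j\<in>UNIV. up f j * dd j u)"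
    unfolding box_def up_def by (simp add: sum.distrib sum_distrib_left sum_distrib_right algebra_simps)
  finally show ?thesis unfolding div_gib upY app_def by simp
qed

lemma dv_up: "dv (up u) = box u + Q * appb Yb u"
proof -
  have "cj (dvb (upb (cj u))) = cj (box (cj u) + Q * app Y (cj u))" by (simp only: dvb_upb)
  moreover have "cj (dvb P) = dv (\<lambda>k. cj (P k))" for P by (simp add: dv_def dvb_def cjPsi)
  ultimately show ?thesis by (simp add: cj_box cjQ cj_upb app_def appb_def Yb_def)
qed

lemma appbYF: "appb Yb F = app Z f" 
proof -
  have "appb Yb F = (\<Sum>k\<in>UNIV. \<Sum>j\<in>UNIV. gi j k * dd j f * db k F)"
    unfolding appb_def upbY[symmetric] upb_def by (simp add: sum_distrib_right)
  also have "\<dots> = (\<Sum>j\<in>UNIV. \<Sum>k\<in>UNIV. gi j k * dd j f * db k F)" by (rule sum.swap)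
  also have "\<dots> = app Z f" unfolding app_def upZ[symmetric] up_def by (simp add: sum_distrib_left sum_distrib_right mult_ac)
  finally show ?thesis .
qed

lemma appYF: "app Y F = appb Yb F"
  unfolding appbYF using YF by (simp add: app_def)

lemma appY_swap: "app Y u = appb (upb u) f"
proof -
  have "app Y u = (\<Sum>j\<in>UNIV. \<Sum>k\<in>UNIV. gi j k * db k f * dd j u)"
    unfolding app_def upY[symmetric] up_def by (simp add: sum_distrib_right)
  also have "\<dots> = (\<Sum>k\<in>UNIV. \<Sum>j\<in>UNIV. gi j k * db k f * dd j u)" by (rule sum.swap)
  also have "\<dots> = appb (upb u) f" unfolding appb_def upb_def by (simp add: sum_distrib_left sum_distrib_right mult_ac)
  finally show ?thesis .
qed

lemma appYf: "app Y f = appb Yb f"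
  unfolding appY_swap appb_def upbY ..

definition phi where "phi = dvb Wb"
definition theta where "theta = dv Y"

text \<open>The two weighted Laplacians agree on \<open>F\<close>. The gain is that \<open>Z\<close>
  is holomorphic: applying \<open>db\<close> to its divergence leaves only the contraction of
  \<open>R\<close> with \<open>Z\<close>, see \<open>db_phi\<close>.\<close>

lemma phi_Z: "phi = dv Z"
proof -
  have "up F = Z" by (rule ext) (rule upZ)
  then show ?thesis using dv_up[of F] by (simp add: phi_def dvb_upb appYF)
qed

lemma theta_Yb: "theta = dvb Yb"
proof -
  have "up f = Y" "upb f = Yb" by (auto simp: upY upbY)
  then show ?thesis using dv_up[of f] dvb_upb[of f] by (simp add: theta_def appYf)
qed

lemma db_phi: "db j phi = (\<Sum>m\<in>UNIV. Z m * R m j)"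
  by (simp add: phi_Z dv_def dd_db[symmetric] dbZ R_def mult.commute)

lemma db_theta: "db j theta = (\<Sum>m\<in>UNIV. Y m * R m j)"
  by (simp add: theta_def dv_def dd_db[symmetric] dbY R_def mult.commute)

lemma dYb: "dd m (Yb j) = 0"
proof -
  have "cj (db m (Y j)) = 0" by (simp only: dbY cj_simps)
  then show ?thesis by (simp add: Yb_def)
qed

lemma dd_theta: "dd j theta = (\<Sum>m\<in>UNIV. Yb m * R j m)"
  by (simp add: theta_Yb dvb_def dd_db dYb R_sym mult.commute)

lemma app_Y_divZ: "app Y (\<Sum>j\<in>UNIV. dd j (Z j)) = app Z (\<Sum>j\<in>UNIV. dd j (Y j))"
proof -
  have 1: "app P (\<Sum>j\<in>UNIV. dd j (P' j)) = (\<Sum>j\<in>UNIV. dd j (app P (P' j))) - (\<Sum>j\<in>UNIV. \<Sum>l\<in>UNIV. dd j (P l) * dd l (P' j))" for P P'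
  proof -
    have "app P (\<Sum>j\<in>UNIV. dd j (P' j)) = (\<Sum>j\<in>UNIV. \<Sum>l\<in>UNIV. P l * dd j (dd l (P' j)))"
      unfolding app_def by (subst sum.swap) (simp add: sum_distrib_left dd_dd)
    then show ?thesis unfolding app_def by (simp add: sum.distrib)
  qed
  have 2: "app Y (Z j) = app Z (Y j)" for j using YZ by (simp add: app_def)
  have "(\<Sum>j\<in>UNIV. \<Sum>l\<in>UNIV. dd j (Y l) * dd l (Z j)) = (\<Sum>j\<in>UNIV. \<Sum>l\<in>UNIV. dd j (Z l) * dd l (Y j))"
    by (subst sum.swap) (simp add: mult_ac)
  then show ?thesis unfolding 1 2 by simp
qed

lemma app_Psi: "app P (Psi j) = (\<Sum>l\<in>UNIV. P l * dd j (Psi l))"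
proof -
  have "dd l (Psi j) = dd j (Psi l)" for l
    unfolding Psi_def psi_D by (simp add: dDi psi_D Q_def dfi dd_dd algebra_simps)
  then show ?thesis by (simp add: app_def)
qed

text \<open>Both sides equal \<open>app Z theta\<close>. On the left, \<open>phi\<close> and
  \<open>theta\<close> are the divergences of the commuting fields \<open>Z\<close> and
  \<open>Y\<close>, and each field may be exchanged with the other; on the right,
  \<open>db_phi\<close> and \<open>dd_theta\<close> give the same contraction of \<open>R\<close>
  with \<open>Z\<close> and \<open>Yb\<close>.\<close>

lemma Y_phi: "app Y phi = appb Yb phi"
proof -
  have 1: "app P (dv P') = app P (\<Sum>j\<in>UNIV. dd j (P' j)) + (\<Sum>j\<in>UNIV. Psi j * app P (P' j)) + (\<Sum>j\<in>UNIV. \<Sum>l\<in>UNIV. P l * dd j (Psi l) * P' j)" for P P'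
  proof -
    have a: "app P (A + B) = app P A + app P B" for A B by (simp add: app_def algebra_simps sum.distrib)
    have m: "app P (A * B) = A * app P B + app P A * B" for A B
      by (simp add: app_def algebra_simps sum.distrib sum_distrib_left)
    have s: "app P (\<Sum>j\<in>UNIV. A j) = (\<Sum>j\<in>UNIV. app P (A j))" for A :: "3 \<Rightarrow> sfun"
      unfolding app_def by (subst sum.swap) (simp add: sum_distrib_left)
    show ?thesis unfolding dv_def sum.distrib a s m app_Psi by (simp add: sum.distrib sum_distrib_right)
  qed
  have 2: "app Y (Z j) = app Z (Y j)" for j using YZ by (simp add: app_def)
  have dPsi: "dd l (Psi j) = dd j (Psi l)" for j l
    unfolding Psi_def psi_D by (simp add: dDi psi_D Q_def dfi dd_dd algebra_simps)
  have "(\<Sum>j\<in>UNIV. \<Sum>l\<in>UNIV. Y l * dd j (Psi l) * Z j) = (\<Sum>j\<in>UNIV. \<Sum>l\<in>UNIV. Z l * dd j (Psi l) * Y j)"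
    by (subst sum.swap) (simp add: dPsi mult_ac)
  then have "app Y phi = app Z theta"
    unfolding phi_Z theta_def 1 app_Y_divZ 2 by simp
  also have "\<dots> = (\<Sum>j\<in>UNIV. \<Sum>m\<in>UNIV. Z j * (Yb m * R j m))"
    unfolding app_def dd_theta by (simp add: sum_distrib_left)
  also have "\<dots> = (\<Sum>m\<in>UNIV. \<Sum>j\<in>UNIV. Z j * (Yb m * R j m))" by (rule sum.swap)
  also have "\<dots> = appb Yb phi" unfolding appb_def db_phi by (simp add: sum_distrib_left mult_ac)
  finally show ?thesis .
qed

definition trR where "trR = (\<Sum>j\<in>UNIV. \<Sum>k\<in>UNIV. gi j k * R j k)"

lemma cj_trR: "cj trR = trR"
  unfolding trR_def by (simp add: hermi cjR) (rule sum.swap)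

definition rho where "rho u k = (\<Sum>j\<in>UNIV. gi j k * (\<Sum>m\<in>UNIV. R j m * upb u m))"

lemma dvb_contract:
  "dvb (\<lambda>k. \<Sum>j\<in>UNIV. gi j k * P j) = (\<Sum>j\<in>UNIV. \<Sum>k\<in>UNIV. gi j k * db k (P j)) + Q * (\<Sum>j\<in>UNIV. Y j * P j)"
proof -
  have "dvb (\<lambda>k. \<Sum>j\<in>UNIV. gi j k * P j) = (\<Sum>k\<in>UNIV. \<Sum>j\<in>UNIV. gi j k * db k (P j) + (db k (gi j k) + psib k * gi j k) * P j + Q * db k f * gi j k * P j)"
    unfolding dvb_def Psib_def
    by (simp add: sum.distrib[symmetric] sum_distrib_left algebra_simps)
  also have "\<dots> = (\<Sum>j\<in>UNIV. \<Sum>k\<in>UNIV. gi j k * db k (P j) + (db k (gi j k) + psib k * gi j k) * P j + Q * db k f * gi j k * P j)"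
    by (rule sum.swap)
  also have "\<dots> = (\<Sum>j\<in>UNIV. \<Sum>k\<in>UNIV. gi j k * db k (P j)) + (\<Sum>j\<in>UNIV. (\<Sum>k\<in>UNIV. db k (gi j k) + psib k * gi j k) * P j) + Q * (\<Sum>j\<in>UNIV. up f j * P j)"
    unfolding up_def by (simp add: sum.distrib sum_distrib_left sum_distrib_right algebra_simps)
  finally show ?thesis unfolding div_gib upY by simp
qed

definition S where "S u = (\<Sum>j\<in>UNIV. \<Sum>k\<in>UNIV. \<Sum>m\<in>UNIV. \<Sum>p\<in>UNIV. gi j k * gi p m * R j m * dd p (db k u))"

lemma db_upb: "db k (upb u m) = (\<Sum>p\<in>UNIV. gi p m * dd p (db k u)) - (\<Sum>a\<in>UNIV. \<Sum>b\<in>UNIV. gi a m * db b (g a k) * upb u b)"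
proof -
  have "(\<Sum>p\<in>UNIV. db k (gi p m) * dd p u) = - (\<Sum>p\<in>UNIV. \<Sum>a\<in>UNIV. \<Sum>b\<in>UNIV. gi a m * db b (g a k) * (gi p b * dd p u))"
    unfolding dgib kahb[of k] by (simp add: sum_negf sum_distrib_left sum_distrib_right mult_ac)
  also have "\<dots> = - (\<Sum>a\<in>UNIV. \<Sum>b\<in>UNIV. \<Sum>p\<in>UNIV. gi a m * db b (g a k) * (gi p b * dd p u))"
    by (subst sum.swap, subst (2) sum.swap) simp
  also have "\<dots> = - (\<Sum>a\<in>UNIV. \<Sum>b\<in>UNIV. gi a m * db b (g a k) * upb u b)"
    by (simp add: upb_def sum_distrib_left)
  finally have "(\<Sum>p\<in>UNIV. db k (gi p m) * dd p u) = - (\<Sum>a\<in>UNIV. \<Sum>b\<in>UNIV. gi a m * db b (g a k) * upb u b)" .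
  then show ?thesis unfolding upb_def[of u m] by (simp add: sum.distrib dd_db)
qed

text \<open>A contracted Bianchi identity for the weighted Ricci form: closedness of
  \<open>R\<close> moves the divergence onto the trace \<open>trR\<close>, \<open>S\<close> pairs
  \<open>R\<close> with the mixed Hessian of \<open>u\<close>, and the weight contributes
  \<open>theta\<close>.\<close>

lemma dvb_rho: "dvb (rho u) = appb (upb u) trR + S u + Q * appb (upb u) theta"
proof -
  have "dvb (rho u) = (\<Sum>j\<in>UNIV. \<Sum>k\<in>UNIV. gi j k * db k (\<Sum>m\<in>UNIV. R j m * upb u m)) + Q * (\<Sum>j\<in>UNIV. Y j * (\<Sum>m\<in>UNIV. R j m * upb u m))"
    unfolding rho_def[abs_def] by (rule dvb_contract)
  moreover have "(\<Sum>j\<in>UNIV. Y j * (\<Sum>m\<in>UNIV. R j m * upb u m)) = appb (upb u) theta"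
    unfolding appb_def db_theta by (simp add: sum_distrib_left mult_ac) (rule sum.swap)
  moreover have "(\<Sum>j\<in>UNIV. \<Sum>k\<in>UNIV. gi j k * db k (\<Sum>m\<in>UNIV. R j m * upb u m)) = appb (upb u) trR + S u"
  proof -
    define A1 where "A1 = (\<Sum>j\<in>UNIV. \<Sum>k\<in>UNIV. \<Sum>m\<in>UNIV. gi j k * db m (R j k) * upb u m)"
    define A2 where "A2 = (\<Sum>j\<in>UNIV. \<Sum>k\<in>UNIV. \<Sum>m\<in>UNIV. db m (gi j k) * R j k * upb u m)"
    have 1: "(\<Sum>j\<in>UNIV. \<Sum>k\<in>UNIV. gi j k * db k (\<Sum>m\<in>UNIV. R j m * upb u m)) =
       A1 + (\<Sum>j\<in>UNIV. \<Sum>k\<in>UNIV. \<Sum>m\<in>UNIV. gi j k * R j m * db k (upb u m))"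
      unfolding A1_def by (simp add: dbR sum.distrib sum_distrib_left algebra_simps)
    have "(\<Sum>j\<in>UNIV. \<Sum>k\<in>UNIV. \<Sum>m\<in>UNIV. gi j k * R j m * db k (upb u m)) =
      S u - (\<Sum>j\<in>UNIV. \<Sum>k\<in>UNIV. \<Sum>m\<in>UNIV. \<Sum>a\<in>UNIV. \<Sum>b\<in>UNIV. gi j k * R j m * (gi a m * db b (g a k) * upb u b))"
      unfolding db_upb S_def by (simp add: sum_subtractf sum_distrib_left right_diff_distrib mult_ac)
    \<comment> \<open>By \<open>dgib\<close>, the Christoffel terms from \<open>db_upb\<close>
      recombine into the derivative of \<open>gi\<close>, which completes the derivative of
      \<open>trR\<close> in \<open>A1 + A2\<close>.\<close>
    moreover have "(\<Sum>k\<in>UNIV. \<Sum>m\<in>UNIV. \<Sum>a\<in>UNIV. \<Sum>b\<in>UNIV. gi j k * R j m * (gi a m * db b (g a k) * upb u b))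
       = - (\<Sum>m\<in>UNIV. \<Sum>b\<in>UNIV. db b (gi j m) * R j m * upb u b)" for j
    proof -
      have "(\<Sum>k\<in>UNIV. \<Sum>m\<in>UNIV. \<Sum>a\<in>UNIV. \<Sum>b\<in>UNIV. gi j k * R j m * (gi a m * db b (g a k) * upb u b)) =
        (\<Sum>m\<in>UNIV. \<Sum>k\<in>UNIV. \<Sum>b\<in>UNIV. \<Sum>a\<in>UNIV. gi j k * R j m * (gi a m * db b (g a k) * upb u b))"
        by (subst sum.swap) (intro sum.cong refl sum.swap)
      also have "\<dots> = (\<Sum>m\<in>UNIV. \<Sum>b\<in>UNIV. \<Sum>k\<in>UNIV. \<Sum>a\<in>UNIV. gi j k * R j m * (gi a m * db b (g a k) * upb u b))"
        by (intro sum.cong refl sum.swap)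
      also have "\<dots> = (\<Sum>m\<in>UNIV. \<Sum>b\<in>UNIV. \<Sum>a\<in>UNIV. \<Sum>k\<in>UNIV. gi j k * R j m * (gi a m * db b (g a k) * upb u b))"
        by (intro sum.cong refl sum.swap)
      also have "\<dots> = - (\<Sum>m\<in>UNIV. \<Sum>b\<in>UNIV. db b (gi j m) * R j m * upb u b)"
        unfolding dgib by (simp add: sum_negf sum_distrib_left sum_distrib_right mult_ac)
      finally show ?thesis .
    qed
    ultimately have 2: "(\<Sum>j\<in>UNIV. \<Sum>k\<in>UNIV. \<Sum>m\<in>UNIV. gi j k * R j m * db k (upb u m)) = S u + A2"
      unfolding A2_def by (simp add: sum_negf)
    have "appb (upb u) trR = (\<Sum>m\<in>UNIV. \<Sum>j\<in>UNIV. \<Sum>k\<in>UNIV. (gi j k * db m (R j k) + db m (gi j k) * R j k) * upb u m)"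
      unfolding appb_def trR_def by (simp add: sum_distrib_left algebra_simps)
    also have "\<dots> = (\<Sum>j\<in>UNIV. \<Sum>k\<in>UNIV. \<Sum>m\<in>UNIV. (gi j k * db m (R j k) + db m (gi j k) * R j k) * upb u m)"
      by (subst sum.swap) (intro sum.cong refl sum.swap)
    also have "\<dots> = A1 + A2" unfolding A1_def A2_def by (simp add: distrib_right sum.distrib)
    finally show ?thesis unfolding 1 2 by simp
  qed
  ultimately show ?thesis by simp
qed

lemma cj_S: "cj (S (cj u)) = S u"
proof -
  have "cj (S (cj u)) = (\<Sum>j\<in>UNIV. \<Sum>k\<in>UNIV. \<Sum>m\<in>UNIV. \<Sum>p\<in>UNIV. gi k j * gi m p * R m j * dd k (db p u))"
    unfolding S_def by (simp add: hermi cjR dd_db)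
  also have "\<dots> = (\<Sum>k\<in>UNIV. \<Sum>j\<in>UNIV. \<Sum>p\<in>UNIV. \<Sum>m\<in>UNIV. gi k j * gi m p * R m j * dd k (db p u))"
    by (subst sum.swap) (intro sum.cong refl sum.swap)
  also have "\<dots> = (\<Sum>k\<in>UNIV. \<Sum>p\<in>UNIV. \<Sum>j\<in>UNIV. \<Sum>m\<in>UNIV. gi k j * gi m p * R m j * dd k (db p u))"
    by (intro sum.cong refl sum.swap)
  also have "\<dots> = (\<Sum>k\<in>UNIV. \<Sum>p\<in>UNIV. \<Sum>m\<in>UNIV. \<Sum>j\<in>UNIV. gi k j * gi m p * R m j * dd k (db p u))"
    by (intro sum.cong refl sum.swap)
  also have "\<dots> = (\<Sum>k\<in>UNIV. \<Sum>m\<in>UNIV. \<Sum>p\<in>UNIV. \<Sum>j\<in>UNIV. gi k j * gi m p * R m j * dd k (db p u))"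
    by (intro sum.cong refl sum.swap)
  also have "\<dots> = (\<Sum>m\<in>UNIV. \<Sum>p\<in>UNIV. \<Sum>k\<in>UNIV. \<Sum>j\<in>UNIV. gi k j * gi m p * R m j * dd k (db p u))"
    by (subst sum.swap) (intro sum.cong refl sum.swap)
  also have "\<dots> = (\<Sum>m\<in>UNIV. \<Sum>p\<in>UNIV. \<Sum>j\<in>UNIV. \<Sum>k\<in>UNIV. gi k j * gi m p * R m j * dd k (db p u))"
    by (intro sum.cong refl sum.swap)
  also have "\<dots> = S u" unfolding S_def by (simp add: mult_ac)
  finally show ?thesis .
qed

text \<open>The weighted divergence of \<open>dd j Wb\<close>, as step 2 of \<open>div_V\<close>
  shows: moving \<open>dd j\<close> past the divergence costs the curvature term.\<close>

definition cc where "cc j = dd j phi - (\<Sum>m\<in>UNIV. R j m * Wb m)"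

text \<open>This is the fourth order weighted Lichnerowicz operator on \<open>F\<close>. The
  conjugate of the Bianchi identity for \<open>cj F\<close> gives a second expression for
  \<open>box phi\<close>; comparing the two leaves only \<open>Z\<close> and \<open>Wb\<close>
  acting on \<open>trR\<close> and \<open>theta\<close>. These fields agree on \<open>f\<close>,
  hence on every function of \<open>f\<close>, and \<open>trR + Q * theta\<close> is such a function
  by constancy of the curvature.\<close>

lemma dvb_cc:
  assumes const: "trR + Q * theta = cst c * fi * fi"
  shows "dvb (\<lambda>k. \<Sum>j\<in>UNIV. gi j k * cc j) = 0"
proof -
  have dvbd: "dvb (\<lambda>k. A k - B k) = dvb A - dvb B" for A B
    by (simp add: dvb_def sum_subtractf[symmetric] algebra_simps)
  have "(\<lambda>k. \<Sum>j\<in>UNIV. gi j k * cc j) = (\<lambda>k. upb phi k - rho F k)"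
    by (simp add: cc_def upb_def[of phi] rho_def right_diff_distrib sum_subtractf)
  then have 1: "dvb (\<lambda>k. \<Sum>j\<in>UNIV. gi j k * cc j) = box phi + Q * app Y phi - (appb Wb trR + S F + Q * appb Wb theta)"
    by (simp only: dvbd dvb_upb dvb_rho)
  \<comment> \<open>Here the holomorphy of \<open>Z\<close> enters, through \<open>db_phi\<close>:
    contracting the curvature with \<open>Z\<close> and raising the index gives the gradient of
    \<open>phi\<close>.\<close>
  have cj_rho: "cj (rho (cj F) k) = up phi k" for k
  proof -
    have "cj (rho (cj F) k) = (\<Sum>j\<in>UNIV. gi k j * (\<Sum>m\<in>UNIV. R m j * Z m))"
      by (simp add: rho_def hermi cjR cj_upb upZ)
    then show ?thesis by (simp add: up_def db_phi mult.commute)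
  qed
  have "cj (dvb (rho (cj F))) = dv (up phi)"
    by (simp add: dv_def dvb_def cjPsi cj_rho)
  also have "\<dots> = box phi + Q * appb Yb phi" by (rule dv_up)
  finally have a: "cj (dvb (rho (cj F))) = box phi + Q * appb Yb phi" .
  have ct: "cj theta = theta"
    unfolding theta_def cj_dv Yb_def[abs_def, symmetric] theta_Yb[symmetric] by (simp add: theta_def)
  have "cj (dvb (rho (cj F))) = app Z trR + S F + Q * app Z theta"
    unfolding dvb_rho by (simp add: appb_def app_def cj_S cj_trR cjQ cj_upb upZ ct)
  then have 2: "box phi + Q * appb Yb phi = app Z trR + S F + Q * app Z theta" using a by simp
  have cs: "appb Wb (trR + Q * theta) = app Z (trR + Q * theta)"
  proof -
    have e: "appb Wb f = app Z f" using appY_swap[of F] appYF appbYF by simp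
    have "appb Wb (cst c * fi * fi) = - (2 * cst c * fi * fi * fi * appb Wb f)"
      "app Z (cst c * fi * fi) = - (2 * cst c * fi * fi * fi * app Z f)"
      unfolding appb_def app_def by (simp_all add: dfi dfib sum_distrib_left sum_negf[symmetric] algebra_simps)
    then show ?thesis unfolding const e by simp
  qed
  have dQ: "appb Wb Q = app Z Q"
  proof -
    have e: "appb Wb f = app Z f" using appY_swap[of F] appYF appbYF by simp
    have "appb Wb Q = - (Q * fi * appb Wb f)" "app Z Q = - (Q * fi * app Z f)"
      unfolding appb_def app_def by (simp_all add: Q_def dfi dfib sum_distrib_left sum_negf[symmetric] algebra_simps)
    then show ?thesis using e by simp
  qed
  have "appb Wb (trR + Q * theta) = appb Wb trR + Q * appb Wb theta + appb Wb Q * theta"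
    "app Z (trR + Q * theta) = app Z trR + Q * app Z theta + app Z Q * theta"
    unfolding appb_def app_def by (simp_all add: sum.distrib sum_distrib_left sum_distrib_right algebra_simps)
  with cs dQ have "appb Wb trR + Q * appb Wb theta = app Z trR + Q * app Z theta" by simp
  then show ?thesis unfolding 1 Y_phi using 2 by (simp add: algebra_simps)
qed

text \<open>The integrand \<open>v |A|\<^sup>2\<close> of the Lichnerowicz argument is an exact divergence.\<close>

definition V where "V m = v * ((\<Sum>j\<in>UNIV. W j * dd j (Wb m)) - cj F * (\<Sum>j\<in>UNIV. gi j m * cc j))"

lemma W_up: "W j = up (cj F) j" by (simp add: W_def cj_upb)

text \<open>By the product rule the first part of \<open>V\<close> yields the integrand and a term
  \<open>W j * cc j\<close>. The second part of \<open>V\<close> is there to cancel this term, since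
  \<open>W\<close> is the gradient of \<open>cj F\<close>, and its own remainder vanishes by
  \<open>dvb_cc\<close>.\<close>

lemma div_V:
  assumes const: "trR + Q * theta = cst c * fi * fi"
  shows "(\<Sum>m\<in>UNIV. db m (D * V m)) = D * v * (\<Sum>j\<in>UNIV. \<Sum>m\<in>UNIV. db m (W j) * dd j (Wb m))"
proof -
  define P where "P m = (\<Sum>j\<in>UNIV. W j * dd j (Wb m)) - cj F * (\<Sum>j\<in>UNIV. gi j m * cc j)" for m
  have dbv: "db k v = Q * db k f * v" for k
  proof -
    have "cj (dd k v) = cj (Q * dd k f * v)" by (simp only: dv Q_def)
    then show ?thesis by (simp add: cjv cjQ cjf)
  qed
  have dbD: "db k D = D * psib k" for k
  proof -
    have "cj (dd k D) = cj (D * psi k)" by (simp only: dD psi_def)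
    then show ?thesis by (simp add: cjD psib_def)
  qed
  have 1: "(\<Sum>m\<in>UNIV. db m (D * V m)) = D * v * dvb P"
    unfolding V_def P_def[symmetric] dvb_def Psib_def
    by (simp add: dbv dbD sum_distrib_left algebra_simps)
  have 2: "dvb (\<lambda>m. dd j (Wb m)) = cc j" for j
  proof -
    have "dd j phi = (\<Sum>m\<in>UNIV. db m (dd j (Wb m)) + Psib m * dd j (Wb m)) + (\<Sum>m\<in>UNIV. R j m * Wb m)"
      unfolding phi_def dvb_def by (simp add: dd_db R_sym sum.distrib algebra_simps)
    then show ?thesis by (simp add: cc_def dvb_def)
  qed
  have "dvb P = (\<Sum>m\<in>UNIV. \<Sum>j\<in>UNIV. db m (W j) * dd j (Wb m)) + (\<Sum>m\<in>UNIV. \<Sum>j\<in>UNIV. W j * (db m (dd j (Wb m)) + Psib m * dd j (Wb m)))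
     - (\<Sum>m\<in>UNIV. \<Sum>j\<in>UNIV. gi j m * db m (cj F) * cc j) - cj F * dvb (\<lambda>k. \<Sum>j\<in>UNIV. gi j k * cc j)"
    unfolding P_def dvb_def
    by (simp add: sum.distrib[symmetric] sum_subtractf[symmetric] sum_distrib_left algebra_simps)
  also have "(\<Sum>m\<in>UNIV. \<Sum>j\<in>UNIV. W j * (db m (dd j (Wb m)) + Psib m * dd j (Wb m))) = (\<Sum>j\<in>UNIV. W j * cc j)"
    unfolding 2[symmetric] dvb_def by (subst sum.swap) (simp add: sum_distrib_left)
  also have "(\<Sum>m\<in>UNIV. \<Sum>j\<in>UNIV. gi j m * db m (cj F) * cc j) = (\<Sum>j\<in>UNIV. W j * cc j)"
    unfolding W_up up_def by (subst sum.swap) (simp add: sum_distrib_right)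
  finally have "dvb P = (\<Sum>m\<in>UNIV. \<Sum>j\<in>UNIV. db m (W j) * dd j (Wb m))"
    by (simp add: dvb_cc[OF const])
  also have "\<dots> = (\<Sum>j\<in>UNIV. \<Sum>m\<in>UNIV. db m (W j) * dd j (Wb m))" by (rule sum.swap)
  finally show ?thesis unfolding 1 by simp
qed

end

section \<open>Riemannian curvature of a Kaehler metric\<close>

lemma smooth_inverse:
  fixes F :: "'v::euclidean_space \<Rightarrow> 'a::real_normed_field"
  assumes "smooth F" "\<And>x. F x \<noteq> 0"
  shows "smooth (\<lambda>x. inverse (F x))"
proof -
  have "Ck k (\<lambda>x. inverse (F x))" for k
  proof (induction k)
    case 0
    then show ?case using smooth_continuous[OF assms(1), of UNIV] assms(2)
      by (auto intro: continuous_intros)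
  next
    case (Suc k)
    show ?case
    proof (rule Ck_SucI[where F'="\<lambda>x u. - (inverse (F x) * dir_deriv F x u * inverse (F x))"])
      show "((\<lambda>x. inverse (F x)) has_derivative (\<lambda>u. - (inverse (F x) * dir_deriv F x u * inverse (F x)))) (at x)" for x
        by (rule Deriv.has_derivative_inverse[OF assms(2) smooth_has_derivative[OF assms(1)]])
      show "Ck k (\<lambda>x. - (inverse (F x) * dir_deriv F x u * inverse (F x)))" for u
        using Suc smooth_dir_deriv[OF assms(1), of u] unfolding smooth_def
        by (intro Ck_bounded_linear_compose[OF bounded_linear_minus[OF bounded_linear_ident]]
          Ck_bilinear[OF bounded_bilinear_mult]) auto
    qed
  qed
  then show ?thesis by (simp add: smooth_def)
qed

lemma smooth_powr:
  fixes F :: "'v::euclidean_space \<Rightarrow> real"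
  assumes "smooth F" "\<And>x. F x > 0"
  shows "smooth (\<lambda>x. F x powr q)"
proof -
  have "Ck k (\<lambda>x. F x powr q)" for k
  proof (induction k)
    case 0
    then show ?case using smooth_continuous[OF assms(1), of UNIV] assms(2)
      by (auto intro!: continuous_intros simp: less_imp_neq[symmetric])
  next
    case (Suc k)
    have nz: "F x \<noteq> 0" for x using assms(2)[of x] by simp
    show ?case
    proof (rule Ck_SucI[where F'="\<lambda>x u. F x powr q * (q * (inverse (F x) * dir_deriv F x u))"])
      show "((\<lambda>x. F x powr q) has_derivative (\<lambda>u. F x powr q * (q * (inverse (F x) * dir_deriv F x u)))) (at x)" for x
        using assms(2)[of x]
        by (auto intro!: derivative_eq_intros smooth_has_derivative assms(1) simp: field_simps)
      show "Ck k (\<lambda>x. F x powr q * (q * (inverse (F x) * dir_deriv F x u)))" for u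
        using Suc smooth_dir_deriv[OF assms(1), of u] smooth_inverse[OF assms(1) nz] unfolding smooth_def
        by (intro Ck_bilinear[OF bounded_bilinear_mult] Ck_const) auto
    qed
  qed
  then show ?thesis by (simp add: smooth_def)
qed

lemma smooth_of_real: "smooth F \<Longrightarrow> smooth (\<lambda>x. complex_of_real (F x))"
  by (rule smooth_bounded_linear_compose[OF bounded_linear_of_real])

lemma dir_deriv_compose_linear:
  assumes "bounded_linear L" "F differentiable at x"
  shows "dir_deriv (\<lambda>z. L (F z)) x u = L (dir_deriv F x u)"
proof -
  have "(F has_derivative frechet_derivative F (at x)) (at x)" using assms(2) frechet_derivative_works by blast
  from bounded_linear.has_derivative[OF assms(1) this] have
    "((\<lambda>z. L (F z)) has_derivative (\<lambda>u. L (dir_deriv F x u))) (at x)" .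
  from frechet_derivative_at[OF this, symmetric] show ?thesis by simp
qed

lemma sum_Basis_complex_vec:
  fixes Q :: "complex^3 \<Rightarrow> 'a::comm_monoid_add"
  shows "(\<Sum>b\<in>Basis. Q b) = (\<Sum>j\<in>UNIV. Q (axis j 1) + Q (axis j \<i>))"
proof -
  have inj: "inj_on (\<lambda>(j, u). axis j u :: complex^3) (UNIV \<times> Basis)"
    by (auto simp: inj_on_def axis_eq_axis Basis_complex_def)
  have "(Basis :: (complex^3) set) = (\<lambda>(j, u). axis j u) ` (UNIV \<times> Basis)"
    by (auto simp: Basis_vec_def)
  then have "(\<Sum>b\<in>Basis. Q b) = (\<Sum>(j,u)\<in>UNIV \<times> Basis. Q (axis j u))"
    using sum.reindex[OF inj, of Q] by (simp only: comp_def case_prod_unfold)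
  also have "\<dots> = (\<Sum>j\<in>UNIV. \<Sum>u\<in>Basis. Q (axis j u))" by (simp add: sum.cartesian_product)
  finally show ?thesis by (simp add: Basis_complex_def)
qed

lemma inner_axis_complex: "(x :: complex^3) \<bullet> axis j c = Re (x $ j * cnj c)"
  by (simp add: inner_axis inner_complex_def)

lemma vec_sum_axis: "(u :: complex^3) = (\<Sum>j\<in>UNIV. axis j (u $ j))"
proof -
  have "(\<Sum>j\<in>UNIV. axis j (u $ j) :: complex^3) $ i = (\<Sum>j\<in>UNIV. if j = i then u $ i else 0)" for i
    unfolding sum_component by (rule sum.cong) (auto simp: axis_def)
  then show ?thesis by (simp add: vec_eq_iff)
qed

section \<open>Cofactors and determinants of three by three matrices\<close>

text \<open>The cyclic successor; with cyclic indices the cofactors carry no signs.\<close>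

definition nx :: "3 \<Rightarrow> 3" where "nx j = (if j = 1 then 2 else if j = 2 then 3 else 1)"

lemma nx_simps [simp]: "nx 1 = 2" "nx 2 = 3" "nx 3 = 1" by (auto simp: nx_def)

definition cof :: "(3 \<Rightarrow> 3 \<Rightarrow> 'a::comm_ring_1) \<Rightarrow> 3 \<Rightarrow> 3 \<Rightarrow> 'a" where
  "cof g j k = g (nx j) (nx k) * g (nx (nx j)) (nx (nx k)) - g (nx j) (nx (nx k)) * g (nx (nx j)) (nx k)"

definition det3 :: "(3 \<Rightarrow> 3 \<Rightarrow> 'a::comm_ring_1) \<Rightarrow> 'a" where "det3 g = (\<Sum>k\<in>UNIV. g 3 k * cof g 3 k)"

lemma cof_row: "(\<Sum>k\<in>UNIV. cof g j k * g l k) = (if j = l then det3 g else 0)"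
  using exhaust_3[of j] exhaust_3[of l]
  by (elim disjE) (simp_all add: sum_3 cof_def det3_def algebra_simps)

lemma cof_col: "(\<Sum>j\<in>UNIV. cof g j k * g j m) = (if k = m then det3 g else 0)"
  using exhaust_3[of k] exhaust_3[of m]
  by (elim disjE) (simp_all add: sum_3 cof_def det3_def algebra_simps)

lemma dd_det3: "dd k (det3 g) = (\<Sum>j\<in>UNIV. \<Sum>m\<in>UNIV. cof g j m * dd k (g j m))"
  by (simp add: sum_3 cof_def det3_def algebra_simps)

lemma cj_cof: "(\<And>j k. cj (g j k) = g k j) \<Longrightarrow> cj (cof g j k) = cof g k j"
  by (simp add: cof_def algebra_simps)

lemma cj_det3: "(\<And>j k. cj (g j k) = g k j) \<Longrightarrow> cj (det3 g) = det3 g"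
  by (simp add: det3_def cof_def sum_3 algebra_simps)

lemma val_cof: "val (cof g j k) z = cof (\<lambda>j k. val (g j k) z) j k"
  by (simp add: cof_def)

lemma val_det3: "val (det3 g) z = det3 (\<lambda>j k. val (g j k) z)"
  by (simp add: det3_def val_cof)

text \<open>Evaluating the form on a vector of cofactors gives the product of two consecutive
  principal minors, so positivity passes from \<open>g 1 1\<close> to the two by two minor
  \<open>cof g 3 3\<close> and on to the determinant.\<close>

lemma det3_pos:
  assumes herm: "\<And>j k. cnj (g j k) = g k j"
    and pos: "\<And>u :: complex^3. u \<noteq> 0 \<Longrightarrow> Re (\<Sum>j\<in>UNIV. \<Sum>k\<in>UNIV. g j k * u $ j * cnj (u $ k)) > 0"
  shows "Re (det3 g) > 0" "Im (det3 g) = 0"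
proof -
  have r: "Im (g j j) = 0" for j using herm[of j j] by (simp add: complex_eq_iff)
  have contr: "(\<Sum>j\<in>UNIV. \<Sum>k\<in>UNIV. g j k * u $ j * cnj (u $ k)) = (\<Sum>k\<in>UNIV. (\<Sum>j\<in>UNIV. g j k * u $ j) * cnj (u $ k))" for u :: "complex^3"
    by (subst sum.swap) (simp add: sum_distrib_right)
  have g1: "Re (g 1 1) > 0"
    using pos[of "axis 1 1"] by (simp add: sum_3 axis_def vec_eq_iff)
  have c33: "Re (cof g 3 3) > 0"
  proof -
    define u where "u = (vector [- g 2 1, g 1 1, 0] :: complex^3)"
    have "u \<noteq> 0" using g1 by (auto simp: u_def vec_eq_iff forall_3)
    from pos[OF this] have "0 < Re (cof g 3 3 * cnj (g 1 1))"
      unfolding contr by (simp add: sum_3 u_def cof_def algebra_simps)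
    then show ?thesis using g1 r[of 1] by (simp add: zero_less_mult_iff)
  qed
  have ic: "Im (cof g 3 3) = 0"
  proof -
    have "cnj (cof g 3 3) = cof g 3 3" by (simp add: cof_def herm algebra_simps)
    then show ?thesis by (simp add: complex_eq_iff)
  qed
  define u where "u = (\<chi> j. cof g j 3)"
  have "u $ 3 \<noteq> 0" using c33 by (auto simp: u_def)
  then have "u \<noteq> 0" by auto
  from pos[OF this] have "0 < Re (det3 g * cnj (cof g 3 3))"
    unfolding contr by (simp add: u_def mult.commute[of "g _ _"] cof_col) (simp add: sum_3)
  then show "Re (det3 g) > 0" using c33 ic by (simp add: zero_less_mult_iff)
  have "cnj (det3 g) = det3 g" by (simp add: det3_def cof_def sum_3 herm algebra_simps)
  then show "Im (det3 g) = 0" by (simp add: complex_eq_iff)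
qed

section \<open>The Hermitian matrix of a Kaehler metric in one chart\<close>

locale kaehler_local =
  fixes h :: "(complex^3) metric"
  assumes sm: "smooth (\<lambda>z. h z u v)"
    and bil: "bilinear (h z)" and sym: "h z u v = h z v u" and pos: "u \<noteq> 0 \<Longrightarrow> h z u u > 0"
    and Jinv: "h z (\<i> *s u) (\<i> *s v) = h z u v"
    and closed: "dir_deriv (\<lambda>x. kaehler_form h x v w) z u +
        dir_deriv (\<lambda>x. kaehler_form h x w u) z v +
        dir_deriv (\<lambda>x. kaehler_form h x u v) z w = 0"
begin

text \<open>The metric is the real part of this Hermitian form, without a factor 1/2
  (\<open>h_eq\<close>). This convention leads to the factors \<open>- 4\<close> in
  \<open>scal_eq\<close> and \<open>laplacian_eq\<close>.\<close>

definition g :: "3 \<Rightarrow> 3 \<Rightarrow> sfun" where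
  "g j k = mk_sfun (\<lambda>z. of_real (h z (axis j 1) (axis k 1)) + \<i> * of_real (h z (axis j 1) (axis k \<i>)))"

lemma val_g: "val (g j k) z = of_real (h z (axis j 1) (axis k 1)) + \<i> * of_real (h z (axis j 1) (axis k \<i>))"
  unfolding g_def by (subst val_mk) (intro smooth_add smooth_mult smooth_const smooth_of_real sm, simp)

lemma J_left: "h z (\<i> *s u) v = - h z u (\<i> *s v)"
proof -
  have "h z u (\<i> *s v) = h z (\<i> *s u) (\<i> *s (\<i> *s v))" by (rule Jinv[symmetric])
  also have "\<i> *s (\<i> *s v) = - v" by (simp add: vec_eq_iff)
  finally show ?thesis using bilinear_rneg[OF bil, of z "\<i> *s u" v] by simp
qed

lemma i_axis: "\<i> *s axis j c = (axis j (\<i> * c) :: complex^3)"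
  by (auto simp: vec_eq_iff axis_def)

lemma J_axis: "h z (axis j \<i>) (axis k 1) = - h z (axis j 1) (axis k \<i>)"
  "h z (axis j \<i>) (axis k \<i>) = h z (axis j 1) (axis k 1)"
  using J_left[of z "axis j 1" "axis k 1"] Jinv[of z "axis j 1" "axis k 1"] by (simp_all add: i_axis)

lemma h_axis: "h z (axis j a) (axis k b) = Re (val (g j k) z * a * cnj b)"
proof -
  have d: "(axis j c :: complex^3) = Re c *\<^sub>R axis j 1 + Im c *\<^sub>R axis j \<i>" for j c
    by (auto simp: vec_eq_iff axis_def complex_eq_iff)
  have "h z (axis j a) (axis k b) = h z (Re a *\<^sub>R axis j 1 + Im a *\<^sub>R axis j \<i>) (Re b *\<^sub>R axis k 1 + Im b *\<^sub>R axis k \<i>)"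
    by (subst d[of j a], subst d[of k b]) (rule refl)
  also have "\<dots> = Re a * Re b * h z (axis j 1) (axis k 1) + Re a * Im b * h z (axis j 1) (axis k \<i>)
     + Im a * Re b * h z (axis j \<i>) (axis k 1) + Im a * Im b * h z (axis j \<i>) (axis k \<i>)"
    by (simp add: bilinear_ladd[OF bil] bilinear_radd[OF bil] bilinear_lmul[OF bil] bilinear_rmul[OF bil])
      (simp add: algebra_simps)
  finally show ?thesis by (simp add: J_axis val_g algebra_simps)
qed

lemma h_eq: "h z u v = Re (\<Sum>j\<in>UNIV. \<Sum>k\<in>UNIV. val (g j k) z * u $ j * cnj (v $ k))"
proof -
  have "h z u v = h z (\<Sum>j\<in>UNIV. axis j (u $ j)) (\<Sum>k\<in>UNIV. axis k (v $ k))"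
    using vec_sum_axis[of u] vec_sum_axis[of v] by simp
  also have "\<dots> = (\<Sum>j\<in>UNIV. \<Sum>k\<in>UNIV. h z (axis j (u $ j)) (axis k (v $ k)))"
    by (simp add: bilinear_sum[OF bil] sum.cartesian_product)
  finally show ?thesis by (simp add: h_axis)
qed

lemma herm: "cj (g j k) = g k j"
  by (rule sfun_eqI) (simp add: val_g sym[of _ "axis k 1"] J_axis complex_eq_iff)

lemma val_herm: "cnj (val (g j k) z) = val (g k j) z"
  unfolding herm[of j k, symmetric] by simp

text \<open>Closedness is evaluated on coordinate vectors, for suitable choices of real and
  imaginary directions. Of the four real identities, 1 and 2 combine to the real part of the claim
  and 3 and 4 to the imaginary part, the third terms cancelling.\<close>

lemma kah: "dd l (g j k) = dd j (g l k)"
proof (rule sfun_eqI)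
  fix z
  define H where "H w u v = dir_deriv (\<lambda>x. h x u v) z w" for w u v
  have Hsym: "H w u v = H w v u" for w u v unfolding H_def sym[of _ u] ..
  have HJ: "H w (axis a \<i>) (axis b 1) = - H w (axis a 1) (axis b \<i>)"
    "H w (axis a \<i>) (axis b \<i>) = H w (axis a 1) (axis b 1)" for w a b
    unfolding H_def J_axis
    using dir_deriv_compose_linear[OF bounded_linear_minus[OF bounded_linear_ident] smooth_differentiable[OF sm]]
    by simp_all
  have Hneg: "H w (- u) v = - H w u v" for w u v
    unfolding H_def bilinear_lneg[OF bil]
    using dir_deriv_compose_linear[OF bounded_linear_minus[OF bounded_linear_ident] smooth_differentiable[OF sm]]
    by simp
  have cl: "H u (\<i> *s v) w + H v (\<i> *s w) u + H w (\<i> *s u) v = 0" for u v w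
    using closed[of v w z u] by (simp add: H_def kaehler_form_def)
  have ii: "axis a (- 1) = - (axis a 1 :: complex^3)" for a by (auto simp: vec_eq_iff axis_def)
  have D: "dir_deriv (val (g j k)) z w = of_real (H w (axis j 1) (axis k 1)) + \<i> * of_real (H w (axis j 1) (axis k \<i>))" for j k w
  proof -
    have "((\<lambda>z. of_real (h z (axis j 1) (axis k 1)) + \<i> * of_real (h z (axis j 1) (axis k \<i>))) has_derivative
      (\<lambda>w. of_real (H w (axis j 1) (axis k 1)) + \<i> * of_real (H w (axis j 1) (axis k \<i>)))) (at z)"
      unfolding H_def
      by (intro has_derivative_add has_derivative_mult_right has_derivative_of_real smooth_has_derivative sm)
    from frechet_derivative_at[OF this, symmetric] show ?thesis by (simp add: val_g[abs_def])
  qed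
  have *: "Re (wd l (val (g j k)) z) = (H (axis l 1) (axis j 1) (axis k 1) + H (axis l \<i>) (axis j 1) (axis k \<i>)) / 2"
    "Im (wd l (val (g j k)) z) = (H (axis l 1) (axis j 1) (axis k \<i>) - H (axis l \<i>) (axis j 1) (axis k 1)) / 2" for l j k
    unfolding wd_def D by simp_all
  note c = cl[unfolded i_axis]
  have 1: "H (axis l 1) (axis j 1) (axis k 1) - H (axis j 1) (axis l 1) (axis k 1) + H (axis k \<i>) (axis l \<i>) (axis j 1) = 0"
    using cl[of "axis l 1" "axis j 1" "axis k \<i>"] Hsym[of "axis j 1" "axis k 1" "axis l 1"] by (simp add: i_axis HJ Hneg ii)
  have 2: "H (axis l \<i>) (axis j 1) (axis k \<i>) - H (axis j \<i>) (axis l 1) (axis k \<i>) - H (axis k \<i>) (axis l \<i>) (axis j 1) = 0"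
    using cl[of "axis l \<i>" "axis j \<i>" "axis k \<i>"] Hsym[of "axis j \<i>" "axis k 1" "axis l \<i>"] by (simp add: i_axis HJ Hneg ii)
  have 3: "- H (axis l 1) (axis j 1) (axis k \<i>) + H (axis j 1) (axis l 1) (axis k \<i>) + H (axis k 1) (axis l \<i>) (axis j 1) = 0"
    using cl[of "axis l 1" "axis j 1" "axis k 1"] Hsym[of "axis j 1" "axis k \<i>" "axis l 1"] by (simp add: i_axis HJ Hneg ii)
  have 4: "- H (axis l \<i>) (axis j 1) (axis k 1) + H (axis j \<i>) (axis l 1) (axis k 1) + H (axis k 1) (axis l \<i>) (axis j 1) = 0"
    using cl[of "axis l \<i>" "axis j \<i>" "axis k 1"] Hsym[of "axis j \<i>" "axis k 1" "axis l 1"] by (simp add: i_axis HJ Hneg ii)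
  show "val (dd l (g j k)) z = val (dd j (g l k)) z"
    using 1 2 3 4 by (simp add: complex_eq_iff *)
qed

definition D where "D = det3 g"
definition Di where "Di = mk_sfun (\<lambda>z. inverse (val D z))"
definition gi where "gi j k = cof g j k * Di"

lemma D_pos: "Re (val D z) > 0" "Im (val D z) = 0"
proof -
  define G where "G = (\<lambda>j k. val (g j k) z)"
  have p: "0 < Re (\<Sum>j\<in>UNIV. \<Sum>k\<in>UNIV. G j k * u $ j * cnj (u $ k))" if "u \<noteq> 0" for u
    using pos[OF that, of z] by (simp only: h_eq G_def)
  have G: "cnj (G j k) = G k j" for j k by (simp only: G_def val_herm)
  have e: "val D z = det3 G" by (simp only: D_def val_det3 G_def)
  show "Re (val D z) > 0" unfolding e by (rule det3_pos(1)[of G, OF G p])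
  show "Im (val D z) = 0" unfolding e by (rule det3_pos(2)[of G, OF G p])
qed

lemma D_nz: "val D z \<noteq> 0" using D_pos[of z] by auto

lemma DDi: "D * Di = 1"
  by (rule sfun_eqI) (simp add: Di_def val_mk[OF smooth_inverse[OF val_smooth D_nz]] D_nz)

sublocale kaehler_chart g gi D Di
proof
  have c: "cof g j k * D * Di = cof g j k" for j k by (simp add: mult.assoc DDi)
  show "(\<Sum>k\<in>UNIV. gi j k * g l k) = (if j = l then 1 else 0)" for j l
  proof -
    have "(\<Sum>k\<in>UNIV. gi j k * g l k) = (\<Sum>k\<in>UNIV. cof g j k * g l k) * Di"
      by (simp add: gi_def sum_distrib_left sum_distrib_right mult_ac)
    then show ?thesis by (simp add: cof_row D_def[symmetric] DDi)
  qed
  show "(\<Sum>j\<in>UNIV. gi j k * g j m) = (if k = m then 1 else 0)" for k m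
  proof -
    have "(\<Sum>j\<in>UNIV. gi j k * g j m) = (\<Sum>j\<in>UNIV. cof g j k * g j m) * Di"
      by (simp add: gi_def sum_distrib_left sum_distrib_right mult_ac)
    then show ?thesis by (simp add: cof_col D_def[symmetric] DDi)
  qed
  show cD: "cj D = D" unfolding D_def by (rule cj_det3[OF herm])
  show "cj (gi j k) = gi k j" for j k
  proof -
    have "cj (D * Di) = 1" by (simp add: DDi)
    then have "D * cj Di = 1" by (simp add: cD)
    then have "cj Di = (D * Di) * cj Di" "(D * cj Di) * Di = Di" by (simp_all add: DDi)
    then have "cj Di = Di" by (simp only: mult_ac)
    then show ?thesis by (simp add: gi_def cj_cof[OF herm])
  qed
  show "dd k D = D * (\<Sum>j\<in>UNIV. \<Sum>m\<in>UNIV. gi j m * dd k (g j m))" for k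
  proof -
    have "D * (\<Sum>j\<in>UNIV. \<Sum>m\<in>UNIV. gi j m * dd k (g j m)) = (D * Di) * (\<Sum>j\<in>UNIV. \<Sum>m\<in>UNIV. cof g j m * dd k (g j m))"
      by (simp add: gi_def sum_distrib_left mult_ac)
    then show ?thesis by (simp add: DDi dd_det3[symmetric] D_def[symmetric])
  qed
qed (rule herm kah DDi)+

end

lemma sum3_swap13: "(\<Sum>a\<in>A. \<Sum>b\<in>B. \<Sum>c\<in>C. F a b c) = (\<Sum>c\<in>C. \<Sum>b\<in>B. \<Sum>a\<in>A. (F a b c :: 'z::comm_monoid_add))"
proof -
  have "(\<Sum>a\<in>A. \<Sum>b\<in>B. \<Sum>c\<in>C. F a b c) = (\<Sum>a\<in>A. \<Sum>c\<in>C. \<Sum>b\<in>B. F a b c)"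
    by (intro sum.cong refl sum.swap)
  also have "\<dots> = (\<Sum>c\<in>C. \<Sum>a\<in>A. \<Sum>b\<in>B. F a b c)" by (rule sum.swap)
  also have "\<dots> = (\<Sum>c\<in>C. \<Sum>b\<in>B. \<Sum>a\<in>A. F a b c)" by (intro sum.cong refl sum.swap)
  finally show ?thesis .
qed

lemma sum3_rot: "(\<Sum>a\<in>A. \<Sum>b\<in>B. \<Sum>c\<in>C. F a b c) = (\<Sum>b\<in>B. \<Sum>c\<in>C. \<Sum>a\<in>A. (F a b c :: 'z::comm_monoid_add))"
  by (subst sum.swap) (intro sum.cong refl sum.swap)

section \<open>Connection, curvature and Laplacian in complex coordinates\<close>

context kaehler_local
begin

lemma val_inv1: "(\<Sum>k\<in>UNIV. val (gi j k) x * val (g l k) x) = (if j = l then 1 else 0)"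
  using arg_cong[OF inv1[of j l], of "\<lambda>F. val F x"] by simp

lemma val_inv2: "(\<Sum>j\<in>UNIV. val (gi j k) x * val (g j m) x) = (if k = m then 1 else 0)"
  using arg_cong[OF inv2[of k m], of "\<lambda>F. val F x"] by simp

lemma sharp_eq:
  assumes "\<And>y. \<eta> y = Re (\<Sum>k\<in>UNIV. a k * cnj (y $ k))"
  shows "sharp h x \<eta> = (\<chi> j. \<Sum>k\<in>UNIV. val (gi j k) x * a k)"
  unfolding sharp_def
proof (rule the_equality)
  show w: "\<forall>y. h x (\<chi> j. \<Sum>k\<in>UNIV. val (gi j k) x * a k) y = \<eta> y"
  proof
    fix y
    have "(\<Sum>j\<in>UNIV. \<Sum>k\<in>UNIV. val (g j k) x * (\<Sum>l\<in>UNIV. val (gi j l) x * a l) * cnj (y $ k))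
      = (\<Sum>j\<in>UNIV. \<Sum>k\<in>UNIV. \<Sum>l\<in>UNIV. (val (gi j l) x * val (g j k) x) * (a l * cnj (y $ k)))"
      by (simp add: sum_distrib_left sum_distrib_right mult_ac)
    also have "\<dots> = (\<Sum>k\<in>UNIV. \<Sum>l\<in>UNIV. (\<Sum>j\<in>UNIV. val (gi j l) x * val (g j k) x) * (a l * cnj (y $ k)))"
      unfolding sum_distrib_right by (rule sum3_rot)
    also have "\<dots> = (\<Sum>k\<in>UNIV. \<Sum>l\<in>UNIV. if l = k then a l * cnj (y $ k) else 0)"
      unfolding val_inv2 by (intro sum.cong) auto
    finally show "h x (\<chi> j. \<Sum>k\<in>UNIV. val (gi j k) x * a k) y = \<eta> y"
      by (subst h_eq) (simp add: assms)
  qed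
  fix w' assume w': "\<forall>y. h x w' y = \<eta> y"
  let ?w = "\<chi> j. \<Sum>k\<in>UNIV. val (gi j k) x * a k"
  have "h x (w' - ?w) (w' - ?w) = 0"
    using w w' by (simp add: bilinear_lsub[OF bil])
  then show "w' = ?w" using pos[of "w' - ?w" x] by force
qed

lemma dir_deriv_val:
  "dir_deriv (val S) x u = (\<Sum>l\<in>UNIV. u $ l * val (dd l S) x + cnj (u $ l) * val (db l S) x)"
  by (simp add: dir_deriv_wirtinger[OF val_diff])

lemma dir_deriv_Re_val: "dir_deriv (\<lambda>z. Re (val S z)) x u = Re (dir_deriv (val S) x u)"
  by (rule dir_deriv_compose_linear[OF bounded_linear_Re val_diff])

text \<open>\<open>Pt\<close> and \<open>Nt\<close> are the parts of the derivative of the metric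
  that are complex linear and antilinear in the direction \<open>u\<close>, before real parts are
  taken. The Kaehler condition becomes their symmetries \<open>Pt_sym\<close>, \<open>Nt_sym\<close>
  and \<open>cnj_Nt\<close>, and the Koszul formula needs nothing else.\<close>

definition Pt where "Pt x u v y = (\<Sum>j\<in>UNIV. \<Sum>k\<in>UNIV. \<Sum>l\<in>UNIV. val (dd l (g j k)) x * (u $ l * v $ j * cnj (y $ k)))"
definition Nt where "Nt x u v y = (\<Sum>j\<in>UNIV. \<Sum>k\<in>UNIV. \<Sum>l\<in>UNIV. val (db l (g j k)) x * (cnj (u $ l) * v $ j * cnj (y $ k)))"

lemma dir_deriv_h: "dir_deriv (\<lambda>z. h z v y) x u = Re (Pt x u v y + Nt x u v y)"
proof -
  define S where "S = (\<Sum>j\<in>UNIV. \<Sum>k\<in>UNIV. g j k * cst (v $ j * cnj (y $ k)))"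
  have e: "(\<lambda>z. h z v y) = (\<lambda>z. Re (val S z))" by (simp add: S_def h_eq mult.assoc)
  have "dir_deriv (val S) x u = (\<Sum>l\<in>UNIV. \<Sum>j\<in>UNIV. \<Sum>k\<in>UNIV. val (dd l (g j k)) x * (u $ l * v $ j * cnj (y $ k)) + val (db l (g j k)) x * (cnj (u $ l) * v $ j * cnj (y $ k)))"
    unfolding dir_deriv_val by (simp add: S_def sum_distrib_left sum.distrib[symmetric] mult_ac del: val_simps(7,8))
  also have "\<dots> = Pt x u v y + Nt x u v y"
    unfolding Pt_def Nt_def by (subst sum3_rot) (simp add: sum.distrib)
  finally show ?thesis unfolding e dir_deriv_Re_val by simp
qed

lemma Pt_sym: "Pt x u v y = Pt x v u y"
proof -
  have "Pt x u v y = (\<Sum>l\<in>UNIV. \<Sum>k\<in>UNIV. \<Sum>j\<in>UNIV. val (dd l (g j k)) x * (u $ l * v $ j * cnj (y $ k)))"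
    unfolding Pt_def by (rule sum3_swap13)
  also have "\<dots> = (\<Sum>l\<in>UNIV. \<Sum>k\<in>UNIV. \<Sum>j\<in>UNIV. val (dd j (g l k)) x * (u $ l * v $ j * cnj (y $ k)))"
    by (intro sum.cong refl arg_cong2[of _ _ _ _ "(*)"]) (simp only: kah)
  also have "\<dots> = Pt x v u y" unfolding Pt_def by (simp add: mult_ac del: val_simps(7,8))
  finally show ?thesis .
qed

lemma Nt_sym: "Nt x u v y = Nt x y v u"
proof -
  have "Nt x u v y = (\<Sum>j\<in>UNIV. \<Sum>l\<in>UNIV. \<Sum>k\<in>UNIV. val (db l (g j k)) x * (cnj (u $ l) * v $ j * cnj (y $ k)))"
    unfolding Nt_def by (intro sum.cong refl sum.swap)
  also have "\<dots> = (\<Sum>j\<in>UNIV. \<Sum>l\<in>UNIV. \<Sum>k\<in>UNIV. val (db k (g j l)) x * (cnj (u $ l) * v $ j * cnj (y $ k)))"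
    by (intro sum.cong refl arg_cong2[of _ _ _ _ "(*)"]) (simp only: kahb)
  also have "\<dots> = Nt x y v u" unfolding Nt_def by (simp add: mult_ac)
  finally show ?thesis .
qed

lemma cnj_Nt: "cnj (Nt x u v y) = Pt x y u v"
proof -
  have "cnj (val (db l (g j k)) x) = val (dd l (g k j)) x" for l j k
    using arg_cong[OF cj_d(2)[of l "g j k"], of "\<lambda>F. val F x"] by (simp only: val_simps(9) herm)
  then have "cnj (Nt x u v y) = (\<Sum>j\<in>UNIV. \<Sum>k\<in>UNIV. \<Sum>l\<in>UNIV. val (dd l (g k j)) x * (u $ l * cnj (v $ j) * y $ k))"
    unfolding Nt_def by (simp del: val_simps(7,8))
  also have "\<dots> = (\<Sum>j\<in>UNIV. \<Sum>k\<in>UNIV. \<Sum>l\<in>UNIV. val (dd k (g l j)) x * (u $ l * cnj (v $ j) * y $ k))"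
    by (intro sum.cong refl arg_cong2[of _ _ _ _ "(*)"]) (simp only: kah)
  also have "\<dots> = (\<Sum>l\<in>UNIV. \<Sum>k\<in>UNIV. \<Sum>j\<in>UNIV. val (dd k (g l j)) x * (u $ l * cnj (v $ j) * y $ k))"
    by (rule sum3_swap13)
  also have "\<dots> = (\<Sum>l\<in>UNIV. \<Sum>j\<in>UNIV. \<Sum>k\<in>UNIV. val (dd k (g l j)) x * (u $ l * cnj (v $ j) * y $ k))"
    by (intro sum.cong refl sum.swap)
  also have "\<dots> = Pt x y u v" unfolding Pt_def by (simp add: mult_ac)
  finally show ?thesis .
qed

definition chr where "chr l j m = (\<Sum>k\<in>UNIV. gi l k * dd j (g m k))"

text \<open>The symmetries of \<open>Pt\<close> and \<open>Nt\<close> collapse the Koszul expression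
  to the real part of \<open>Pt x u v y\<close>. The Levi-Civita connection is thus the Chern
  connection, with complex bilinear Christoffel symbols.\<close>

lemma christoffel_eq:
  "christoffel h x u v = (\<chi> l. \<Sum>j\<in>UNIV. \<Sum>m\<in>UNIV. val (chr l j m) x * (u $ j * v $ m))"
proof -
  define a where "a k = (\<Sum>j\<in>UNIV. \<Sum>m\<in>UNIV. val (dd j (g m k)) x * (u $ j * v $ m))" for k
  have "(dir_deriv (\<lambda>z. h z v y) x u + dir_deriv (\<lambda>z. h z u y) x v - dir_deriv (\<lambda>z. h z u v) x y) / 2
     = Re (\<Sum>k\<in>UNIV. a k * cnj (y $ k))" for y
  proof -
    have r: "Re (Pt x y u v) = Re (Nt x u v y)" unfolding cnj_Nt[symmetric] by simp
    have "(\<Sum>k\<in>UNIV. a k * cnj (y $ k)) = (\<Sum>k\<in>UNIV. \<Sum>j\<in>UNIV. \<Sum>m\<in>UNIV. val (dd j (g m k)) x * (u $ j * v $ m * cnj (y $ k)))"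
      unfolding a_def by (simp add: sum_distrib_right mult.assoc del: val_simps(7,8))
    also have "\<dots> = (\<Sum>m\<in>UNIV. \<Sum>j\<in>UNIV. \<Sum>k\<in>UNIV. val (dd j (g m k)) x * (u $ j * v $ m * cnj (y $ k)))"
      by (rule sum3_swap13)
    also have "\<dots> = Pt x u v y" unfolding Pt_def by (intro sum.cong refl sum.swap)
    finally have "(\<Sum>k\<in>UNIV. a k * cnj (y $ k)) = Pt x u v y" .
    then show ?thesis
      using r Nt_sym[of x y u v] Pt_sym[of x v u y] by (simp add: dir_deriv_h)
  qed
  then have "christoffel h x u v = (\<chi> l. \<Sum>k\<in>UNIV. val (gi l k) x * a k)"
    unfolding christoffel_def by (rule sharp_eq)
  also have "\<dots> = (\<chi> l. \<Sum>j\<in>UNIV. \<Sum>m\<in>UNIV. val (chr l j m) x * (u $ j * v $ m))"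
  proof -
    have "(\<Sum>k\<in>UNIV. val (gi l k) x * a k) = (\<Sum>j\<in>UNIV. \<Sum>m\<in>UNIV. val (chr l j m) x * (u $ j * v $ m))" for l
    proof -
      have "(\<Sum>k\<in>UNIV. val (gi l k) x * a k) = (\<Sum>k\<in>UNIV. \<Sum>j\<in>UNIV. \<Sum>m\<in>UNIV. val (gi l k * dd j (g m k)) x * (u $ j * v $ m))"
        unfolding a_def sum_distrib_left by (simp add: mult_ac)
      also have "\<dots> = (\<Sum>j\<in>UNIV. \<Sum>m\<in>UNIV. \<Sum>k\<in>UNIV. val (gi l k * dd j (g m k)) x * (u $ j * v $ m))"
        by (rule sum3_rot)
      finally show ?thesis unfolding chr_def val_sum sum_distrib_right .
    qed
    then show ?thesis by simp
  qed
  finally show ?thesis .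
qed

lemma dd_chr: "dd p (chr l j m) = (\<Sum>k\<in>UNIV. gi l k * dd p (dd j (g m k))) - (\<Sum>a\<in>UNIV. chr l p a * chr a j m)"
proof -
  have "dd p (gi l k) = - (\<Sum>a\<in>UNIV. chr l p a * gi a k)" for k
    unfolding dgi chr_def by (simp add: sum_distrib_left sum_distrib_right mult_ac)
  then have "(\<Sum>k\<in>UNIV. dd p (gi l k) * dd j (g m k)) = - (\<Sum>k\<in>UNIV. \<Sum>a\<in>UNIV. chr l p a * (gi a k * dd j (g m k)))"
    by (simp add: sum_negf sum_distrib_left sum_distrib_right mult_ac)
  also have "\<dots> = - (\<Sum>a\<in>UNIV. chr l p a * chr a j m)"
    unfolding chr_def[of _ j m] sum_distrib_left by (subst sum.swap) simp
  finally show ?thesis unfolding chr_def[of l j m] by (simp add: sum.distrib)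
qed

text \<open>The connection matrix is the inverse metric times the \<open>dd\<close>-derivative of
  the metric, a flat connection in holomorphic directions. Therefore only \<open>db\<close> of
  \<open>chr\<close> remains in \<open>curvature_eq\<close>.\<close>

lemma chr_flat:
  "dd p (chr l j m) + (\<Sum>a\<in>UNIV. chr l p a * chr a j m) = dd j (chr l p m) + (\<Sum>a\<in>UNIV. chr l j a * chr a p m)"
  unfolding dd_chr by (simp add: dd_dd)

lemma chr_trace: "(\<Sum>l\<in>UNIV. chr l l m) = psi m"
  unfolding chr_def psi_def kah[of _ m] by simp

lemma curvature_eq:
  "curvature h x u v w $ l = (\<Sum>p\<in>UNIV. \<Sum>j\<in>UNIV. \<Sum>m\<in>UNIV. val (db p (chr l j m)) x *
     ((cnj (u $ p) * v $ j - cnj (v $ p) * u $ j) * w $ m))"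
proof -
  define T where "T l v w = (\<Sum>j\<in>UNIV. \<Sum>m\<in>UNIV. chr l j m * cst (v $ j * w $ m))" for l and v w :: "complex^3"
  have chrT: "christoffel h z v w = (\<chi> l. val (T l v w) z)" for z v w
    unfolding christoffel_eq T_def by simp
  have dT: "dir_deriv (\<lambda>z. christoffel h z v w) x u $ l = dir_deriv (val (T l v w)) x u" for u v w
  proof -
    have ax: "bounded_linear (axis l :: complex \<Rightarrow> complex^3)" for l
      by (intro linear_conv_bounded_linear[THEN iffD1] linearI) (auto simp: axis_def vec_eq_iff)
    have "(\<lambda>z. christoffel h z v w) = (\<lambda>z. \<Sum>l\<in>UNIV. axis l (val (T l v w) z))"
      unfolding chrT using vec_sum_axis[of "\<chi> l. val (T l v w) _"] by (intro ext) simp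
    then have "smooth (\<lambda>z. christoffel h z v w)"
      by (simp add: smooth_sum smooth_bounded_linear_compose[OF ax] val_smooth)
    from dir_deriv_compose_linear[OF bounded_linear_vec_nth smooth_differentiable[OF this], of l x u]
    show ?thesis by (simp add: chrT)
  qed
  have dT2: "dir_deriv (val (T l v w)) x u = (\<Sum>p\<in>UNIV. \<Sum>j\<in>UNIV. \<Sum>m\<in>UNIV. val (dd p (chr l j m)) x * (u $ p * v $ j * w $ m)
      + val (db p (chr l j m)) x * (cnj (u $ p) * v $ j * w $ m))" for u v w
    unfolding dir_deriv_val T_def
    by (simp add: sum_distrib_left sum.distrib[symmetric] mult_ac del: val_simps(7,8))
  have comp: "christoffel h x u (christoffel h x v w) $ l = (\<Sum>p\<in>UNIV. \<Sum>j\<in>UNIV. \<Sum>m\<in>UNIV. val (\<Sum>a\<in>UNIV. chr l p a * chr a j m) x * (u $ p * v $ j * w $ m))" for u v w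
  proof -
    have "christoffel h x u (christoffel h x v w) $ l = (\<Sum>p\<in>UNIV. \<Sum>a\<in>UNIV. \<Sum>j\<in>UNIV. \<Sum>m\<in>UNIV. val (chr l p a) x * val (chr a j m) x * (u $ p * v $ j * w $ m))"
      unfolding christoffel_eq by (simp add: sum_distrib_left mult_ac)
    also have "\<dots> = (\<Sum>p\<in>UNIV. \<Sum>j\<in>UNIV. \<Sum>m\<in>UNIV. \<Sum>a\<in>UNIV. val (chr l p a) x * val (chr a j m) x * (u $ p * v $ j * w $ m))"
      by (intro sum.cong refl sum3_rot)
    finally show ?thesis by (simp add: sum_distrib_right)
  qed
  define K where "K p j m = val (dd p (chr l j m) + (\<Sum>a\<in>UNIV. chr l p a * chr a j m)) x" for p j m
  have Ks: "(\<Sum>p\<in>UNIV. \<Sum>j\<in>UNIV. \<Sum>m\<in>UNIV. K p j m * (u $ p * v $ j * w $ m)) = (\<Sum>p\<in>UNIV. \<Sum>j\<in>UNIV. \<Sum>m\<in>UNIV. K p j m * (v $ p * u $ j * w $ m))"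
    unfolding K_def by (subst sum.swap, subst chr_flat) (simp only: mult_ac)
  have "curvature h x u v w $ l =
      (\<Sum>p\<in>UNIV. \<Sum>j\<in>UNIV. \<Sum>m\<in>UNIV. K p j m * (u $ p * v $ j * w $ m)) + (\<Sum>p\<in>UNIV. \<Sum>j\<in>UNIV. \<Sum>m\<in>UNIV. val (db p (chr l j m)) x * (cnj (u $ p) * v $ j * w $ m))
     - ((\<Sum>p\<in>UNIV. \<Sum>j\<in>UNIV. \<Sum>m\<in>UNIV. K p j m * (v $ p * u $ j * w $ m)) + (\<Sum>p\<in>UNIV. \<Sum>j\<in>UNIV. \<Sum>m\<in>UNIV. val (db p (chr l j m)) x * (cnj (v $ p) * u $ j * w $ m)))"
    unfolding curvature_def vector_add_component vector_minus_component dT dT2 comp K_def val_simps(3)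
    by (simp only: distrib_right sum.distrib) simp
  also have "\<dots> = (\<Sum>p\<in>UNIV. \<Sum>j\<in>UNIV. \<Sum>m\<in>UNIV. val (db p (chr l j m)) x * (cnj (u $ p) * v $ j * w $ m))
     - (\<Sum>p\<in>UNIV. \<Sum>j\<in>UNIV. \<Sum>m\<in>UNIV. val (db p (chr l j m)) x * (cnj (v $ p) * u $ j * w $ m))"
    unfolding Ks by simp
  finally show ?thesis by (simp only: sum_subtractf[symmetric] left_diff_distrib right_diff_distrib mult.assoc)
qed

text \<open>Tracing over \<open>axis b 1\<close> together with \<open>axis b \<i>\<close> cancels
  the terms that are antilinear in the traced vector. In the others the trace of \<open>chr\<close>
  is \<open>psi\<close>.\<close>

lemma ricci_eq: "ricci h x v w = - 2 * Re (\<Sum>p\<in>UNIV. \<Sum>m\<in>UNIV. val (db p (psi m)) x * (cnj (v $ p) * w $ m))"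
proof -
  have "curvature h x (axis b 1) v w \<bullet> axis b 1 + curvature h x (axis b \<i>) v w \<bullet> axis b \<i>
    = - 2 * Re (\<Sum>p\<in>UNIV. \<Sum>m\<in>UNIV. val (db p (chr b b m)) x * (cnj (v $ p) * w $ m))" for b
  proof -
    define A where "A = (\<Sum>j\<in>UNIV. \<Sum>m\<in>UNIV. val (db b (chr b j m)) x * (v $ j * w $ m))"
    define B where "B = (\<Sum>p\<in>UNIV. \<Sum>m\<in>UNIV. val (db p (chr b b m)) x * (cnj (v $ p) * w $ m))"
    have "curvature h x (axis b c) v w $ b = cnj c * A - c * B" for c
    proof -
      have 1: "(\<Sum>p\<in>UNIV. \<Sum>j\<in>UNIV. \<Sum>m\<in>UNIV. val (db p (chr b j m)) x * (cnj (axis b c $ p) * v $ j * w $ m)) = cnj c * A"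
      proof -
        have "(\<Sum>p\<in>UNIV. \<Sum>j\<in>UNIV. \<Sum>m\<in>UNIV. val (db p (chr b j m)) x * (cnj (axis b c $ p) * v $ j * w $ m))
          = (\<Sum>p\<in>UNIV. if p = b then cnj c * A else 0)"
          by (intro sum.cong refl) (auto simp: axis_def A_def sum_distrib_left mult_ac)
        then show ?thesis by simp
      qed
      have 2: "(\<Sum>p\<in>UNIV. \<Sum>j\<in>UNIV. \<Sum>m\<in>UNIV. val (db p (chr b j m)) x * (cnj (v $ p) * axis b c $ j * w $ m)) = c * B"
      proof -
        have "(\<Sum>j\<in>UNIV. \<Sum>m\<in>UNIV. val (db p (chr b j m)) x * (cnj (v $ p) * axis b c $ j * w $ m))
          = (\<Sum>j\<in>UNIV. if j = b then c * (\<Sum>m\<in>UNIV. val (db p (chr b b m)) x * (cnj (v $ p) * w $ m)) else 0)" for p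
          by (intro sum.cong refl) (auto simp: axis_def sum_distrib_left mult_ac)
        then show ?thesis by (simp add: B_def sum_distrib_left)
      qed
      show ?thesis unfolding curvature_eq 1[symmetric] 2[symmetric]
        by (simp only: sum_subtractf[symmetric] left_diff_distrib right_diff_distrib mult.assoc)
    qed
    from this[of 1] this[of \<i>] show ?thesis unfolding B_def[symmetric] by (simp add: inner_axis_complex)
  qed
  then have "ricci h x v w = - 2 * Re (\<Sum>b\<in>UNIV. \<Sum>p\<in>UNIV. \<Sum>m\<in>UNIV. val (db p (chr b b m)) x * (cnj (v $ p) * w $ m))"
    unfolding ricci_def sum_Basis_complex_vec by (simp add: sum_distrib_left)
  also have "(\<Sum>b\<in>UNIV. \<Sum>p\<in>UNIV. \<Sum>m\<in>UNIV. val (db p (chr b b m)) x * (cnj (v $ p) * w $ m)) =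
    (\<Sum>p\<in>UNIV. \<Sum>m\<in>UNIV. val (db p (psi m)) x * (cnj (v $ p) * w $ m))"
    unfolding chr_trace[symmetric] d_sum val_sum sum_distrib_right by (rule sum3_rot)
  finally show ?thesis .
qed

lemma metric_trace_eq:
  "metric_trace h x B = (\<Sum>b\<in>UNIV. B (axis b 1) (\<chi> j. val (gi j b) x) + B (axis b \<i>) (\<chi> j. val (gi j b) x * \<i>))"
proof -
  have "sharp h x (\<lambda>y. y \<bullet> axis b c) = (\<chi> j. val (gi j b) x * c)" for b c
  proof -
    have "sharp h x (\<lambda>y. y \<bullet> axis b c) = (\<chi> j. \<Sum>k\<in>UNIV. val (gi j k) x * (if k = b then c else 0))"
    proof (rule sharp_eq)
      fix y :: "complex^3"
      have "(\<Sum>k\<in>UNIV. (if k = b then c else 0) * cnj (y $ k)) = (\<Sum>k\<in>UNIV. if k = b then c * cnj (y $ b) else 0)"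
        by (intro sum.cong) auto
      then show "y \<bullet> axis b c = Re (\<Sum>k\<in>UNIV. (if k = b then c else 0) * cnj (y $ k))"
        by (simp add: inner_axis_complex)
    qed
    moreover have "(\<Sum>k\<in>UNIV. val (gi j k) x * (if k = b then c else 0)) = (\<Sum>k\<in>UNIV. if k = b then val (gi j b) x * c else 0)" for j
      by (intro sum.cong) auto
    ultimately show ?thesis by simp
  qed
  then show ?thesis unfolding metric_trace_def sum_Basis_complex_vec by simp
qed

lemma scal_eq: "scal h x = - 4 * Re (val (\<Sum>j\<in>UNIV. \<Sum>k\<in>UNIV. gi j k * db k (psi j)) x)"
proof -
  have "ricci h x (axis b c) (\<chi> j. val (gi j b) x * c) = - 2 * Re (cnj c * c * (\<Sum>m\<in>UNIV. val (db b (psi m)) x * val (gi m b) x))" for b c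
  proof -
    have "(\<Sum>p\<in>UNIV. \<Sum>m\<in>UNIV. val (db p (psi m)) x * (cnj (axis b c $ p) * (val (gi m b) x * c)))
       = (\<Sum>p\<in>UNIV. if p = b then cnj c * c * (\<Sum>m\<in>UNIV. val (db b (psi m)) x * val (gi m b) x) else 0)"
      by (intro sum.cong refl) (auto simp: axis_def sum_distrib_left mult_ac)
    then show ?thesis unfolding ricci_eq by simp
  qed
  from this[of _ 1] this[of _ \<i>] have "scal h x = (\<Sum>b\<in>UNIV. - 4 * Re (\<Sum>m\<in>UNIV. val (db b (psi m)) x * val (gi m b) x))"
    unfolding scal_def metric_trace_eq by simp
  also have "\<dots> = - 4 * Re (\<Sum>b\<in>UNIV. \<Sum>m\<in>UNIV. val (gi m b) x * val (db b (psi m)) x)"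
    by (simp add: sum_distrib_left mult.commute del: val_simps(8))
  also have "(\<Sum>b\<in>UNIV. \<Sum>m\<in>UNIV. val (gi m b) x * val (db b (psi m)) x) = val (\<Sum>j\<in>UNIV. \<Sum>k\<in>UNIV. gi j k * db k (psi j)) x"
    by (subst sum.swap) (simp del: val_simps(8))
  finally show ?thesis .
qed

text \<open>Pairing each direction with its multiple by \<open>\<i>\<close> cancels the Christoffel
  correction, because \<open>christoffel\<close> is complex bilinear, and also the parts of the
  Hessian of type (2,0) and (0,2). Four times the real part of the mixed part remains.\<close>

lemma laplacian_eq:
  assumes fs: "val fs = (\<lambda>z. of_real (f z))" and f: "smooth f"
  shows "laplacian h f x = - 4 * Re (val (box fs) x)"
proof -
  have fr: "f = (\<lambda>z. Re (val fs z))" by (simp add: fs)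
  have df: "dir_deriv f z v = Re (val (\<Sum>l\<in>UNIV. cst (v $ l) * dd l fs + cst (cnj (v $ l)) * db l fs) z)" for z v
    unfolding fr dir_deriv_Re_val dir_deriv_val by simp
  have hess: "dir_deriv (\<lambda>z. dir_deriv f z v) x u = Re (\<Sum>p\<in>UNIV. \<Sum>l\<in>UNIV. 
      u $ p * v $ l * val (dd p (dd l fs)) x + cnj (u $ p) * cnj (v $ l) * val (db p (db l fs)) x
     + u $ p * cnj (v $ l) * val (dd p (db l fs)) x + cnj (u $ p) * v $ l * val (db p (dd l fs)) x)" for u v
    unfolding df dir_deriv_Re_val dir_deriv_val
    by (simp add: sum_distrib_left sum.distrib[symmetric] algebra_simps del: val_simps(7,8))
  have "cov_deriv_form h (\<lambda>z. frechet_derivative f (at z)) x (axis b 1) (\<chi> j. val (gi j b) x)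
     + cov_deriv_form h (\<lambda>z. frechet_derivative f (at z)) x (axis b \<i>) (\<chi> j. val (gi j b) x * \<i>)
     = 4 * Re (\<Sum>j\<in>UNIV. val (gi j b) x * val (dd j (db b fs)) x)" for b
  proof -
    have lin: "linear (frechet_derivative f (at x))"
      using smooth_has_derivative[OF f] has_derivative_linear by blast
    have "christoffel h x (axis b \<i>) (\<chi> j. val (gi j b) x * \<i>) = - christoffel h x (axis b 1) (\<chi> j. val (gi j b) x)"
    proof -
      have "axis b \<i> $ j * (y * \<i>) = - (axis b 1 $ j * y)" for j and y :: complex by (simp add: axis_def complex_eq_iff)
      then show ?thesis unfolding christoffel_eq by (simp add: vec_eq_iff sum_negf)
    qed
    then have c: "dir_deriv f x (christoffel h x (axis b 1) (\<chi> j. val (gi j b) x)) + dir_deriv f x (christoffel h x (axis b \<i>) (\<chi> j. val (gi j b) x * \<i>)) = 0"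
      by (simp add: linear_neg[OF lin])
    have s: "dir_deriv (\<lambda>z. dir_deriv f z (\<chi> j. val (gi j b) x * c)) x (axis b c) = 
       Re (\<Sum>l\<in>UNIV. c * c * (val (gi l b) x * val (dd b (dd l fs)) x) + cnj (c * c) * (cnj (val (gi l b) x) * val (db b (db l fs)) x)
        + c * cnj c * (cnj (val (gi l b) x) * val (dd b (db l fs)) x + val (gi l b) x * val (db b (dd l fs)) x))" for c
    proof -
      have "(\<Sum>p\<in>UNIV. \<Sum>l\<in>UNIV. 
        axis b c $ p * (val (gi l b) x * c) * val (dd p (dd l fs)) x + cnj (axis b c $ p) * cnj (val (gi l b) x * c) * val (db p (db l fs)) x
       + axis b c $ p * cnj (val (gi l b) x * c) * val (dd p (db l fs)) x + cnj (axis b c $ p) * (val (gi l b) x * c) * val (db p (dd l fs)) x)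
       = (\<Sum>p\<in>UNIV. if p = b then (\<Sum>l\<in>UNIV. c * c * (val (gi l b) x * val (dd b (dd l fs)) x) + cnj (c * c) * (cnj (val (gi l b) x) * val (db b (db l fs)) x)
        + c * cnj c * (cnj (val (gi l b) x) * val (dd b (db l fs)) x + val (gi l b) x * val (db b (dd l fs)) x)) else 0)"
        by (intro sum.cong refl) (auto simp: axis_def algebra_simps)
      then show ?thesis unfolding hess by simp
    qed
    have cf: "cj fs = fs" by (rule sfun_eqI) (simp add: fs)
    have "cnj (val (gi l b) x) * val (dd b (db l fs)) x = cnj (val (gi l b) x * val (db b (dd l fs)) x)" for l
    proof -
      have "dd b (db l fs) = cj (db b (dd l fs))" by (simp add: cf)
      then show ?thesis by (simp only: complex_cnj_mult val_simps(9))
    qed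
    then have r: "Re (cnj (val (gi l b) x) * val (dd b (db l fs)) x) = Re (val (gi l b) x * val (db b (dd l fs)) x)" for l
      by (simp only: cnj.sel)
    define M where "M l = Re (val (gi l b) x * val (db b (dd l fs)) x)" for l
    define N where "N l = Re (val (gi l b) x * val (dd b (dd l fs)) x) + Re (cnj (val (gi l b) x) * val (db b (db l fs)) x)" for l
    have e1: "dir_deriv (\<lambda>z. dir_deriv f z (\<chi> j. val (gi j b) x)) x (axis b 1) = (\<Sum>l\<in>UNIV. N l + 2 * M l)"
      using s[of 1] by (simp add: M_def N_def r del: val_simps(7,8) times_complex.sel)
    have e2: "dir_deriv (\<lambda>z. dir_deriv f z (\<chi> j. val (gi j b) x * \<i>)) x (axis b \<i>) = (\<Sum>l\<in>UNIV. - N l + 2 * M l)"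
      using s[of \<i>] by (simp add: M_def N_def r del: val_simps(7,8) times_complex.sel)
    have "4 * Re (\<Sum>j\<in>UNIV. val (gi j b) x * val (dd j (db b fs)) x) = (\<Sum>l\<in>UNIV. 4 * M l)"
      by (simp only: Re_sum M_def sum_distrib_left dd_db)
    then show ?thesis using c unfolding cov_deriv_form_def e1 e2
      by (simp add: sum.distrib sum_subtractf sum_negf sum_distrib_left[symmetric] del: val_simps(7,8) times_complex.sel)
  qed
  then have "laplacian h f x = - (\<Sum>b\<in>UNIV. 4 * Re (\<Sum>j\<in>UNIV. val (gi j b) x * val (dd j (db b fs)) x))"
    unfolding laplacian_def codifferential_def metric_trace_eq by simp
  also have "\<dots> = - 4 * Re (\<Sum>b\<in>UNIV. \<Sum>j\<in>UNIV. val (gi j b) x * val (dd j (db b fs)) x)"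
    by (simp only: Re_sum sum_distrib_left minus_mult_left[symmetric] sum_negf)
  also have "(\<Sum>b\<in>UNIV. \<Sum>j\<in>UNIV. val (gi j b) x * val (dd j (db b fs)) x) = val (box fs) x"
    unfolding box_def by (subst sum.swap) (simp del: val_simps(7,8))
  finally show ?thesis .
qed

end

section \<open>The Cauchy transform along a coordinate line\<close>

lemma Ck_continuous: "Ck k F \<Longrightarrow> continuous_on A F"
proof (induction k)
  case 0
  then show ?case using continuous_on_subset[of UNIV F A] by simp
next
  case (Suc k)
  then show ?case using Ck_SucD by blast
qed

lemma integral_param_derivative:
  fixes H :: "'v::euclidean_space \<times> 's::euclidean_space \<Rightarrow> 'w::euclidean_space"
  assumes H: "Ck (Suc k) H"
  shows "((\<lambda>x. integral (cbox a b) (\<lambda>s. H (x, s))) has_derivative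
    (\<lambda>u. integral (cbox a b) (\<lambda>s. dir_deriv H (x, s) (u, 0)))) (at x)"
proof -
  have d: "(H has_derivative frechet_derivative H (at p)) (at p)" for p by (rule Ck_dD[OF H])
  have c: "continuous_on UNIV (\<lambda>p. dir_deriv H p u)" for u
    by (rule Ck_continuous[of k]) (use H in \<open>simp only: Ck.simps\<close>)
  have cH: "continuous_on UNIV H"
    using H by (auto intro!: continuous_at_imp_continuous_on differentiable_imp_continuous_within)
  define fx where "fx x s = Blinfun (\<lambda>u. dir_deriv H (x, s) (u, 0))" for x s
  have bl: "bounded_linear (\<lambda>u. dir_deriv H (x, s) (u, 0))" for x s
    by (rule bounded_linear_compose[OF has_derivative_bounded_linear[OF d]])
      (rule bounded_linear_Pair[OF bounded_linear_ident bounded_linear_zero])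
  have fx: "blinfun_apply (fx x s) u = dir_deriv H (x, s) (u, 0)" for x s u
    unfolding fx_def by (simp add: bounded_linear_Blinfun_apply[OF bl])
  have cf: "continuous_on (UNIV \<times> cbox a b) (\<lambda>(x, s). fx x s)"
    unfolding case_prod_unfold
  proof (rule continuous_on_blinfun_componentwise)
    fix i :: 'v
    show "continuous_on (UNIV \<times> cbox a b) (\<lambda>p. blinfun_apply (fx (fst p) (snd p)) i)"
      unfolding fx prod.collapse by (rule continuous_on_subset[OF c]) simp
  qed
  have "((\<lambda>x. integral (cbox a b) (\<lambda>s. H (x, s))) has_derivative blinfun_apply (integral (cbox a b) (fx x))) (at x within UNIV)"
  proof (rule leibniz_rule[where fx=fx])
    fix x :: 'v and s :: 's
    have "((\<lambda>x. (x, s)) has_derivative (\<lambda>u. (u, 0))) (at x within UNIV)"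
      by (intro has_derivative_Pair has_derivative_ident has_derivative_const)
    from has_derivative_compose[OF this, of H] d[of "(x, s)"]
    have "((\<lambda>x. H (x, s)) has_derivative (\<lambda>u. dir_deriv H (x, s) (u, 0))) (at x within UNIV)" by blast
    moreover have "blinfun_apply (fx x s) = (\<lambda>u. dir_deriv H (x, s) (u, 0))" by (rule ext) (rule fx)
    ultimately show "((\<lambda>x. H (x, s)) has_derivative blinfun_apply (fx x s)) (at x within UNIV)" by simp
    show "(\<lambda>s. H (x, s)) integrable_on cbox a b"
      by (intro integrable_continuous continuous_on_compose2[OF cH] continuous_intros) auto
  qed (use cf in auto)
  moreover have "blinfun_apply (integral (cbox a b) (fx x)) = (\<lambda>u. integral (cbox a b) (\<lambda>s. dir_deriv H (x, s) (u, 0)))"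
  proof
    fix u
    have "continuous_on (cbox a b) (Pair x)" "Pair x ` cbox a b \<subseteq> UNIV \<times> cbox a b"
      by (auto intro!: continuous_intros)
    from continuous_on_compose2[OF cf this] have "fx x integrable_on cbox a b"
      by (intro integrable_continuous) simp
    then show "blinfun_apply (integral (cbox a b) (fx x)) u = integral (cbox a b) (\<lambda>s. dir_deriv H (x, s) (u, 0))"
      by (subst blinfun_apply_integral) (simp_all add: fx)
  qed
  ultimately show ?thesis by simp
qed

lemma smooth_integral:
  fixes H :: "'v::euclidean_space \<times> 's::euclidean_space \<Rightarrow> 'w::euclidean_space"
  assumes "smooth H"
  shows "smooth (\<lambda>x. integral (cbox a b) (\<lambda>s. H (x, s)))"
proof -
  have "Ck k H \<Longrightarrow> Ck k (\<lambda>x. integral (cbox a b) (\<lambda>s. H (x, s)))" for k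
  proof (induction k arbitrary: H)
    case 0
    have "continuous_on UNIV (\<lambda>x. integral (cbox a b) ((\<lambda>x s. H (x, s)) x))"
      by (rule integral_continuous_on_param) (use 0 in \<open>auto intro: continuous_on_subset\<close>)
    then show ?case by simp
  next
    case (Suc k)
    show ?case
    proof (rule Ck_SucI[OF integral_param_derivative[OF Suc.prems]])
      show "Ck k (\<lambda>x. integral (cbox a b) (\<lambda>s. dir_deriv H (x, s) (u, 0)))" for u
        by (rule Suc.IH) (use Suc.prems in simp)
    qed
  qed
  then show ?thesis using assms by (simp add: smooth_def)
qed

section \<open>Cutoffs built from the flat exponential\<close>

definition flat_exp :: "nat \<Rightarrow> real \<Rightarrow> real" where
  "flat_exp j x = (if x \<le> 0 then 0 else (1 / x) ^ j * exp (- (1 / x)))"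

lemma flat_exp_pos: "flat_exp j x > 0 \<longleftrightarrow> x > 0" and flat_exp_0: "x \<le> 0 \<Longrightarrow> flat_exp j x = 0"
  and flat_exp_nonneg: "flat_exp j x \<ge> 0"
  by (auto simp: flat_exp_def)

text \<open>The powers of \<open>1 / x\<close> make the family closed under differentiation up to
  linear combinations, so its smoothness is an induction over all \<open>j\<close> at once.\<close>

lemma flat_exp_deriv:
  "(flat_exp j has_real_derivative flat_exp (j + 2) x - real j * flat_exp (Suc j) x) (at x)"
proof (cases x "0::real" rule: linorder_cases)
  case less
  have "((\<lambda>x. 0) has_real_derivative 0) (at x)" by simp
  then have "(flat_exp j has_real_derivative 0) (at x)"
    by (rule DERIV_cong_ev[THEN iffD1, rotated 3])
      (use less eventually_nhds_in_open[of "{..<0}" x] in \<open>auto simp: flat_exp_def elim: eventually_mono\<close>)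
  then show ?thesis using less by (simp add: flat_exp_def)
next
  case equal
  have "((\<lambda>h. (flat_exp j (0 + h) - flat_exp j 0) / h) \<longlongrightarrow> 0) (at 0)"
  proof (rule filterlim_split_at)
    show "((\<lambda>h. (flat_exp j (0 + h) - flat_exp j 0) / h) \<longlongrightarrow> 0) (at_left 0)"
    proof (rule tendsto_eventually)
      show "\<forall>\<^sub>F h in at_left 0. (flat_exp j (0 + h) - flat_exp j 0) / h = 0"
        unfolding eventually_at_filter by (auto simp: flat_exp_def)
    qed
    have "((\<lambda>x. (inverse x) ^ Suc j / exp (inverse x)) \<longlongrightarrow> (0::real)) (at_right 0)"
      by (rule filterlim_compose[OF tendsto_power_div_exp_0 filterlim_inverse_at_top_right])
    then show "((\<lambda>h. (flat_exp j (0 + h) - flat_exp j 0) / h) \<longlongrightarrow> 0) (at_right 0)"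
      by (rule Lim_transform_eventually)
        (auto simp: eventually_at_filter flat_exp_def exp_minus field_simps)
  qed
  then show ?thesis using equal by (simp only: DERIV_def) (simp add: flat_exp_def)
next
  case greater
  define y where "y = 1 / x"
  have 1: "((\<lambda>y. y ^ j * exp (- y)) has_real_derivative (real j * y ^ (j - Suc 0) - y ^ j) * exp (- y)) (at (1 / x))"
    unfolding y_def[symmetric] by (auto intro!: derivative_eq_intros simp: algebra_simps)
  have 2: "((\<lambda>x. 1 / x) has_real_derivative - (y ^ 2)) (at x)"
    using greater by (auto intro!: derivative_eq_intros simp: y_def power2_eq_square field_simps)
  have 3: "(real j * y ^ (j - Suc 0) - y ^ j) * exp (- y) * - (y ^ 2) = flat_exp (j + 2) x - real j * flat_exp (Suc j) x"
    using greater by (cases j) (simp_all add: flat_exp_def y_def[symmetric] algebra_simps power2_eq_square)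
  have "((\<lambda>x. (1 / x) ^ j * exp (- (1 / x))) has_real_derivative flat_exp (j + 2) x - real j * flat_exp (Suc j) x) (at x)"
    using DERIV_chain2[OF 1 2] unfolding 3 .
  then show ?thesis
    by (rule DERIV_cong_ev[THEN iffD1, rotated 3])
      (use greater eventually_nhds_in_open[of "{0<..}" x] in \<open>auto simp: flat_exp_def elim: eventually_mono\<close>)
qed

lemma smooth_flat_exp: "smooth (flat_exp j)"
proof -
  have "Ck k (flat_exp j)" for k
  proof (induction k arbitrary: j)
    case 0
    show ?case using flat_exp_deriv by (auto intro!: continuous_at_imp_continuous_on DERIV_isCont)
  next
    case (Suc k)
    show ?case
    proof (rule Ck_SucI[where F'="\<lambda>x u. (flat_exp (j + 2) x - real j * flat_exp (Suc j) x) * u"])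
      show "(flat_exp j has_derivative (*) (flat_exp (j + 2) x - real j * flat_exp (Suc j) x)) (at x)" for x
        using flat_exp_deriv has_field_derivative_def by blast
      have "Ck k (\<lambda>x. (flat_exp (j + 2) x + (- real j) * flat_exp (Suc j) x) * u)" for u
        by (intro Ck_bilinear[OF bounded_bilinear_mult] Ck_add Ck_const Suc)
      then show "Ck k (\<lambda>x. (flat_exp (j + 2) x - real j * flat_exp (Suc j) x) * u)" for u by simp
    qed
  qed
  then show ?thesis by (simp add: smooth_def)
qed

lemma smooth_cnj: "smooth F \<Longrightarrow> smooth (\<lambda>x. cnj (F x))"
  by (rule smooth_bounded_linear_compose[OF bounded_linear_cnj])

lemma smooth_norm_sq: "smooth (\<lambda>t::complex. (cmod t)\<^sup>2)"
proof -
  have "smooth (\<lambda>t::complex. Re t * Re t + Im t * Im t)"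
    by (intro smooth_add smooth_mult smooth_bounded_linear bounded_linear_Re bounded_linear_Im)
  moreover have "(\<lambda>t. Re t * Re t + Im t * Im t) = (\<lambda>t. (cmod t)\<^sup>2)"
    by (rule ext) (simp add: cmod_power2[unfolded power2_eq_square] power2_eq_square)
  ultimately show ?thesis by simp
qed

text \<open>This changes sign under inversion of \<open>t\<close>, which makes \<open>chi\<close>
  and its inversion add up to 1. On the circle of radius 2 its value is 3/5, beyond the threshold
  1/3 from which \<open>chi\<close> is 0.\<close>

definition chi_arg :: "complex \<Rightarrow> real" where "chi_arg t = ((cmod t)\<^sup>2 - 1) / ((cmod t)\<^sup>2 + 1)"

definition chi :: "complex \<Rightarrow> real" where
  "chi t = flat_exp 0 (1/3 - chi_arg t) / (flat_exp 0 (1/3 - chi_arg t) + flat_exp 0 (1/3 + chi_arg t))"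

lemma chi_denom: "flat_exp 0 (1/3 - s) + flat_exp 0 (1/3 + s) > 0"
  using flat_exp_pos[of 0 "1/3 - s"] flat_exp_pos[of 0 "1/3 + s"] flat_exp_nonneg[of 0 "1/3 - s"] flat_exp_nonneg[of 0 "1/3 + s"]
  by (cases "s < 1/3") (auto intro: add_pos_nonneg add_nonneg_pos)

lemma chi_inverse: "t \<noteq> 0 \<Longrightarrow> chi t + chi (inverse t) = 1"
proof -
  assume t: "t \<noteq> 0"
  then have n: "(cmod t)\<^sup>2 > 0" by simp
  have "chi_arg (inverse t) = - chi_arg t"
  proof -
    have i: "(cmod (inverse t))\<^sup>2 = inverse ((cmod t)\<^sup>2)" by (simp only: norm_inverse power_inverse)
    have "(inverse s - 1) / (inverse s + 1) = - ((s - 1) / (s + 1))" if "s > 0" for s :: real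
      using that by (simp add: divide_simps)
    then show ?thesis unfolding chi_arg_def i using n by blast
  qed
  then have "chi (inverse t) = flat_exp 0 (1/3 + chi_arg t) / (flat_exp 0 (1/3 - chi_arg t) + flat_exp 0 (1/3 + chi_arg t))"
    by (simp add: chi_def add.commute)
  then show ?thesis using chi_denom[of "chi_arg t"] by (simp add: chi_def add_divide_distrib[symmetric])
qed

lemma chi_0: "cmod t \<ge> 2 \<Longrightarrow> chi t = 0"
proof -
  assume "cmod t \<ge> 2"
  then have "(cmod t)\<^sup>2 \<ge> 2\<^sup>2" by (intro power_mono) auto
  then have "chi_arg t \<ge> 1/3" by (simp add: chi_arg_def field_simps)
  then show ?thesis by (simp add: chi_def flat_exp_0)
qed

lemma smooth_chi: "smooth chi"
proof -
  have p: "(cmod t)\<^sup>2 + 1 \<noteq> 0" for t :: complex by (smt (verit) zero_le_power2)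
  have a: "smooth (\<lambda>t. ((cmod t)\<^sup>2 - 1) * inverse ((cmod t)\<^sup>2 + 1))"
    by (intro smooth_mult smooth_diff smooth_add smooth_const smooth_norm_sq smooth_inverse p)
  then have a: "smooth chi_arg" by (simp add: chi_arg_def[abs_def] divide_inverse)
  have "smooth (\<lambda>t. flat_exp 0 (1/3 - chi_arg t) * inverse (flat_exp 0 (1/3 - chi_arg t) + flat_exp 0 (1/3 + chi_arg t)))"
  proof -
    have 1: "smooth (\<lambda>t. flat_exp 0 (1/3 - chi_arg t))"
      by (rule smooth_compose[OF smooth_flat_exp smooth_diff[OF smooth_const a]])
    have 2: "smooth (\<lambda>t. flat_exp 0 (1/3 + chi_arg t))"
      by (rule smooth_compose[OF smooth_flat_exp smooth_add[OF smooth_const a]])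
    have nz: "flat_exp 0 (1/3 - chi_arg t) + flat_exp 0 (1/3 + chi_arg t) \<noteq> 0" for t
      using chi_denom[of "chi_arg t"] by simp
    show ?thesis
      by (rule smooth_mult[OF 1 smooth_inverse[OF smooth_add[OF 1 2] nz]])
  qed
  then show ?thesis unfolding divide_inverse[of "flat_exp _ _", symmetric] chi_def[abs_def, symmetric] .
qed

text \<open>Equal to \<open>1 / w\<close> for \<open>\<bar>w\<bar> \<ge> e\<close>, because the flat exponential vanishes on the non-positive reals.\<close>

definition sinv :: "real \<Rightarrow> complex \<Rightarrow> complex" where
  "sinv e w = cnj w * of_real (inverse ((cmod w)\<^sup>2 + flat_exp 0 (e\<^sup>2 - (cmod w)\<^sup>2)))"

lemma smooth_sinv: "e > 0 \<Longrightarrow> smooth (sinv e)"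
proof -
  assume e: "e > 0"
  have "(cmod w)\<^sup>2 + flat_exp 0 (e\<^sup>2 - (cmod w)\<^sup>2) > 0" for w
    using flat_exp_nonneg[of 0 "e\<^sup>2 - (cmod w)\<^sup>2"] flat_exp_pos[of 0 "e\<^sup>2 - (cmod w)\<^sup>2"] e
    by (cases "w = 0") (auto intro: add_pos_nonneg)
  then have nz: "(cmod w)\<^sup>2 + flat_exp 0 (e\<^sup>2 - (cmod w)\<^sup>2) \<noteq> 0" for w
    by (rule less_imp_neq[symmetric])
  have "smooth (\<lambda>w::complex. e\<^sup>2 - (cmod w)\<^sup>2)" by (intro smooth_diff smooth_const smooth_norm_sq)
  from smooth_compose[OF smooth_flat_exp this] nz
  have "smooth (\<lambda>w. inverse ((cmod w)\<^sup>2 + flat_exp 0 (e\<^sup>2 - (cmod w)\<^sup>2)))"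
    by (intro smooth_inverse smooth_add smooth_norm_sq)
  then show ?thesis unfolding sinv_def[abs_def]
    by (intro smooth_mult smooth_cnj smooth_ident smooth_of_real)
qed

lemma sinv_eq: "e > 0 \<Longrightarrow> e \<le> cmod w \<Longrightarrow> sinv e w = inverse w"
proof -
  assume e: "e > 0" "e \<le> cmod w"
  then have "e\<^sup>2 \<le> (cmod w)\<^sup>2" by (intro power_mono) auto
  moreover have "cnj w * w = of_real ((cmod w)\<^sup>2)" by (metis complex_norm_square mult.commute)
  moreover have "w \<noteq> 0" using e by auto
  ultimately show ?thesis by (simp add: sinv_def flat_exp_0 field_simps)
qed

lemma smooth_cis: "smooth cis"
proof -
  have "Ck k (\<lambda>t. c * cis t)" for k c
  proof (induction k arbitrary: c)
    case 0
    show ?case by (auto intro!: continuous_intros)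
  next
    case (Suc k)
    show ?case
    proof (rule Ck_SucI[where F'="\<lambda>t u. u *\<^sub>R ((c * \<i>) * cis t)"])
      show "((\<lambda>t. c * cis t) has_derivative (\<lambda>u. u *\<^sub>R ((c * \<i>) * cis t))) (at t)" for t
      proof -
        have "(cis has_vector_derivative \<i> * cis t) (at t)"
          using exp_scaleR_has_vector_derivative_right[of \<i> t UNIV]
          by (simp add: cis_conv_exp[abs_def] scaleR_conv_of_real mult.commute)
        then have "((\<lambda>t. c * cis t) has_vector_derivative c * (\<i> * cis t)) (at t)"
          by (rule has_vector_derivative_mult_right)
        then show ?thesis by (simp add: has_vector_derivative_def mult.assoc)
      qed
      show "Ck k (\<lambda>t. u *\<^sub>R ((c * \<i>) * cis t))" for u
        by (rule Ck_bounded_linear_compose[OF bounded_linear_scaleR_right Suc])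
    qed
  qed
  from this[of _ 1] show ?thesis by (simp add: smooth_def)
qed

section \<open>The Cauchy kernel in one coordinate, with the others as parameters\<close>

definition put :: "3 \<Rightarrow> complex \<Rightarrow> complex^3 \<Rightarrow> complex^3" where
  "put c t z = (\<chi> i. if i = c then t else z $ i)"

lemma put_nth [simp]: "put c t z $ i = (if i = c then t else z $ i)" by (simp add: put_def)
lemma put_put [simp]: "put c t (put c t' z) = put c t z" by (simp add: vec_eq_iff)
lemma put_self [simp]: "put c (z $ c) z = z" by (simp add: vec_eq_iff)
lemma put_axis: "put c t z = z + axis c (t - z $ c)" by (simp add: vec_eq_iff axis_def)

lemma bounded_linear_axis: "bounded_linear (axis c :: complex \<Rightarrow> complex^3)"
  by (intro linear_conv_bounded_linear[THEN iffD1] linearI) (auto simp: axis_def vec_eq_iff)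

lemma smooth_nth: "smooth F \<Longrightarrow> smooth (\<lambda>x. F x $ (c::3) :: complex)"
  by (rule smooth_bounded_linear_compose[OF bounded_linear_vec_nth])

lemma smooth_axis: "smooth F \<Longrightarrow> smooth (\<lambda>x. axis (c::3) (F x :: complex))"
  by (rule smooth_bounded_linear_compose[OF bounded_linear_axis])

lemma smooth_put: "smooth F \<Longrightarrow> smooth G \<Longrightarrow> smooth (\<lambda>x. put c (F x) (G x))"
  unfolding put_axis by (intro smooth_add smooth_axis smooth_diff smooth_nth)

lemma smooth_fst: "smooth fst" and smooth_snd: "smooth snd"
  by (auto intro: smooth_bounded_linear bounded_linear_fst bounded_linear_snd)

text \<open>Polar coordinates are centred at the point of evaluation, which cancels the singularity of
  the Cauchy kernel.\<close>

definition cau :: "3 \<Rightarrow> real \<Rightarrow> (complex^3 \<Rightarrow> complex) \<Rightarrow> complex^3 \<Rightarrow> complex" where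
  "cau c R a z = integral (cbox (0, 0) (R, 2 * pi))
     (\<lambda>s. a (z - axis c (of_real (fst s) * cis (snd s))) * cis (- snd s)) / pi"

lemma smooth_cau_kernel:
  assumes "smooth a"
  shows "smooth (\<lambda>p :: (complex^3) \<times> (real \<times> real). a (fst p - axis c (of_real (fst (snd p)) * cis (snd (snd p)))) * cis (- snd (snd p)))"
  by (intro smooth_mult smooth_compose[OF assms] smooth_diff smooth_axis smooth_of_real smooth_fst
    smooth_compose[OF smooth_cis] smooth_minus smooth_compose[OF smooth_fst] smooth_compose[OF smooth_snd] smooth_snd)

lemma smooth_cau: "smooth a \<Longrightarrow> smooth (cau c R a)"
  unfolding cau_def[abs_def] divide_inverse
  using smooth_integral[OF smooth_cau_kernel, of a "(0,0)" "(R, 2 * pi)" c]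
  by (intro smooth_mult smooth_const) simp

text \<open>\<open>cau\<close> is a convolution, so every derivative with constant coefficients can
  be moved to \<open>a\<close>; this is differentiation under the integral sign.\<close>

lemma wdb_cau:
  assumes a: "smooth a"
  shows "wdb j (cau c R a) z = cau c R (wdb j a) z"
proof -
  define H where "H = (\<lambda>p :: (complex^3) \<times> (real \<times> real). a (fst p - axis c (of_real (fst (snd p)) * cis (snd (snd p)))) * cis (- snd (snd p)))"
  have H: "smooth H" unfolding H_def by (rule smooth_cau_kernel[OF a])
  have H1: "Ck (Suc 0) H" using H unfolding smooth_def by blast
  have dH: "dir_deriv H (z, s) (u, 0) = dir_deriv a (z - axis c (of_real (fst s) * cis (snd s))) u * cis (- snd s)" for u s
  proof -
    have "((\<lambda>z. (z, s)) has_derivative (\<lambda>u. (u, 0))) (at z)"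
      by (intro has_derivative_Pair has_derivative_ident has_derivative_const)
    from has_derivative_compose[OF this, of H] smooth_has_derivative[OF H, of "(z, s)"]
    have 1: "((\<lambda>z. H (z, s)) has_derivative (\<lambda>u. dir_deriv H (z, s) (u, 0))) (at z)" by blast
    have "((\<lambda>z. z - axis c (of_real (fst s) * cis (snd s))) has_derivative (\<lambda>u. u - 0)) (at z)"
      by (intro has_derivative_diff has_derivative_ident has_derivative_const)
    from has_derivative_compose[OF this, of a] smooth_has_derivative[OF a]
    have "((\<lambda>z. a (z - axis c (of_real (fst s) * cis (snd s)))) has_derivative (\<lambda>u. dir_deriv a (z - axis c (of_real (fst s) * cis (snd s))) u)) (at z)" by simp
    then have "((\<lambda>z. H (z, s)) has_derivative (\<lambda>u. dir_deriv a (z - axis c (of_real (fst s) * cis (snd s))) u * cis (- snd s))) (at z)"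
      unfolding H_def fst_conv snd_conv by (rule has_derivative_mult_left)
    from has_derivative_unique[OF 1 this] show ?thesis by meson
  qed
  have "dir_deriv (cau c R a) z u = integral (cbox (0, 0) (R, 2 * pi)) (\<lambda>s. dir_deriv a (z - axis c (of_real (fst s) * cis (snd s))) u * cis (- snd s)) / pi" for u
  proof -
    have "((\<lambda>z. integral (cbox (0, 0) (R, 2 * pi)) (\<lambda>s. H (z, s)) / pi) has_derivative
       (\<lambda>u. integral (cbox (0, 0) (R, 2 * pi)) (\<lambda>s. dir_deriv H (z, s) (u, 0)) / pi)) (at z)"
      by (intro bounded_linear.has_derivative[OF bounded_linear_divide] integral_param_derivative[OF H1])
    from frechet_derivative_at[OF this, symmetric] show ?thesis
      unfolding dH by (simp add: cau_def[abs_def] H_def)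
  qed
  moreover have "(\<lambda>s. dir_deriv a (z - axis c (of_real (fst s) * cis (snd s))) u * cis (- snd s)) integrable_on cbox (0, 0) (R, 2 * pi)" for u
    by (intro integrable_continuous continuous_on_mult continuous_on_compose2[OF smooth_continuous[OF smooth_dir_deriv[OF a], of UNIV]]
      continuous_on_diff continuous_on_const bounded_linear.continuous_on[OF bounded_linear_axis] continuous_intros) auto
  ultimately have *: "integral (cbox (0, 0) (R, 2 * pi)) (\<lambda>s. x * (dir_deriv a (z - axis c (of_real (fst s) * cis (snd s))) u * cis (- snd s))
      + y * (dir_deriv a (z - axis c (of_real (fst s) * cis (snd s))) v * cis (- snd s))) / pi = x * dir_deriv (cau c R a) z u + y * dir_deriv (cau c R a) z v" for x y u v
    by (subst integral_add) (auto intro!: integrable_on_mult_right simp: add_divide_distrib)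
  show ?thesis
    using *[of "1/2" "axis j 1" "\<i>/2" "axis j \<i>"]
    unfolding wdb_def cau_def[of c R "\<lambda>z. _ z"] by (simp add: field_simps)
qed

lemma wirtinger_chain:
  fixes \<tau> :: "complex^3 \<Rightarrow> complex^3"
  assumes \<tau>: "(\<tau> has_derivative (\<lambda>u. \<chi> l. \<Sum>j\<in>UNIV. T l j * u $ j)) (at z)" and G: "G differentiable at (\<tau> z)"
  shows "wd j (\<lambda>z. G (\<tau> z)) z = (\<Sum>l\<in>UNIV. wd l G (\<tau> z) * T l j)"
    "wdb j (\<lambda>z. G (\<tau> z)) z = (\<Sum>l\<in>UNIV. wdb l G (\<tau> z) * cnj (T l j))"
    "(\<lambda>z. G (\<tau> z)) differentiable at z"
proof -
  from has_derivative_compose[OF \<tau> has_derivative_wirtinger[OF G]]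
  have 1: "((\<lambda>z. G (\<tau> z)) has_derivative (\<lambda>u. \<Sum>l\<in>UNIV. (\<Sum>j\<in>UNIV. T l j * u $ j) * wd l G (\<tau> z) + cnj (\<Sum>j\<in>UNIV. T l j * u $ j) * wdb l G (\<tau> z))) (at z)"
    by simp
  then show "(\<lambda>z. G (\<tau> z)) differentiable at z" by (auto simp: differentiable_def)
  have "(\<Sum>l\<in>UNIV. (\<Sum>j\<in>UNIV. T l j * u $ j) * wd l G (\<tau> z) + cnj (\<Sum>j\<in>UNIV. T l j * u $ j) * wdb l G (\<tau> z))
    = (\<Sum>j\<in>UNIV. u $ j * (\<Sum>l\<in>UNIV. wd l G (\<tau> z) * T l j) + cnj (u $ j) * (\<Sum>l\<in>UNIV. wdb l G (\<tau> z) * cnj (T l j)))" for u :: "complex^3"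
    by (simp add: sum_distrib_left sum_distrib_right sum.distrib[symmetric] mult_ac) (rule sum.swap)
  with 1 have "((\<lambda>z. G (\<tau> z)) has_derivative (\<lambda>u. \<Sum>j\<in>UNIV. u $ j * (\<Sum>l\<in>UNIV. wd l G (\<tau> z) * T l j) + cnj (u $ j) * (\<Sum>l\<in>UNIV. wdb l G (\<tau> z) * cnj (T l j)))) (at z)"
    by simp
  from wirtinger_unique[OF this] show "wd j (\<lambda>z. G (\<tau> z)) z = (\<Sum>l\<in>UNIV. wd l G (\<tau> z) * T l j)"
    "wdb j (\<lambda>z. G (\<tau> z)) z = (\<Sum>l\<in>UNIV. wdb l G (\<tau> z) * cnj (T l j))" .
qed

lemma dir_deriv_axis:
  assumes "F differentiable at z"
  shows "dir_deriv F z (axis c t) = t * wd c F z + cnj t * wdb c F z"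
proof -
  have "dir_deriv F z (axis c t) = (\<Sum>j\<in>UNIV. if j = c then t * wd c F z + cnj t * wdb c F z else 0)"
    unfolding dir_deriv_wirtinger[OF assms] by (intro sum.cong) (auto simp: axis_def)
  then show ?thesis by simp
qed

lemma slice_derivative:
  assumes "smooth F" "wdb c F (put c t z) = 0"
  shows "((\<lambda>t. F (put c t z)) has_field_derivative wd c F (put c t z)) (at t)"
proof -
  have "((\<lambda>t. put c t z) has_derivative (\<lambda>s. axis c s)) (at t)"
  proof -
    have e: "(\<lambda>t. put c t z) = (\<lambda>t. (z - axis c (z $ c)) + axis c t)"
      by (auto simp: vec_eq_iff axis_def)
    show ?thesis unfolding e
      by (auto intro!: derivative_eq_intros bounded_linear_imp_has_derivative[OF bounded_linear_axis])
  qed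
  from has_derivative_compose[OF this, of F] smooth_has_derivative[OF assms(1)]
  have "((\<lambda>t. F (put c t z)) has_derivative (\<lambda>s. dir_deriv F (put c t z) (axis c s))) (at t)" by blast
  then show ?thesis
    unfolding has_field_derivative_def dir_deriv_axis[OF smooth_differentiable[OF assms(1)]]
    by (simp add: assms(2) mult_commute_abs)
qed

lemma put_diff_axis: "put c t z - axis c s = put c (t - s) z"
  by (auto simp: vec_eq_iff axis_def)

lemma continuous_cau_point: "continuous_on A (\<lambda>s::real \<times> real. (z :: complex^3) - axis c (of_real (fst s) * cis (snd s)))"
  by (intro smooth_continuous smooth_diff smooth_const smooth_axis smooth_mult smooth_of_real smooth_fst
    smooth_compose[OF smooth_cis smooth_snd])

lemma continuous_cau_integrand:
  fixes a :: "complex^3 \<Rightarrow> complex"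
  assumes "smooth a"
  shows "continuous_on A (\<lambda>s::real \<times> real. a (z - axis c (of_real (fst s) * cis (snd s))) * cis (- snd s))"
  by (intro continuous_on_mult continuous_on_compose2[OF smooth_continuous[OF assms, of UNIV] continuous_cau_point] continuous_intros) auto

text \<open>In polar coordinates at \<open>z\<close> the integrand is \<open>- 1/2\<close> times the
  sum of \<open>\<phi>r\<close>, the radial derivative of \<open>a\<close>, and
  \<open>\<psi>\<close>, a multiple of its angular derivative divided by the radius. The former
  integrates to \<open>- a z\<close> on each ray, as \<open>R\<close> reaches beyond the support;
  the latter integrates to 0 by periodicity.\<close>

lemma cauchy_pompeiu:
  assumes a: "smooth a" and supp: "\<And>w. cmod (w $ c) \<ge> 2 \<Longrightarrow> a w = 0" and R: "cmod (z $ c) + 2 \<le> R"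
  shows "cau c R (wdb c a) z = a z"
proof -
  define p where "p s = z - axis c (of_real (fst s) * cis (snd s))" for s :: "real \<times> real"
  define A where "A s = wd c a (p s)" for s
  define B where "B s = wdb c a (p s)" for s
  define \<phi>r where "\<phi>r s = - (cis (snd s) * A s + cis (- snd s) * B s)" for s
  define \<psi> where "\<psi> s = cis (snd s) * A s - cis (- snd s) * B s" for s
  have R0: "0 \<le> R" using R norm_ge_zero[of "z $ c"] by linarith
  have cp: "continuous_on S p" for S unfolding p_def by (rule continuous_cau_point)
  have cA: "continuous_on S A" and cB: "continuous_on S B" for S
    unfolding A_def B_def
    by (intro continuous_on_compose2[OF smooth_continuous[OF smooth_wd[OF a], of UNIV] cp]
       continuous_on_compose2[OF smooth_continuous[OF smooth_wdb[OF a], of UNIV] cp]; simp)+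
  have c\<phi>: "continuous_on S \<phi>r" and c\<psi>: "continuous_on S \<psi>" for S
    unfolding \<phi>r_def \<psi>_def by (intro continuous_intros cA cB)+
  have da: "a differentiable at w" for w by (rule smooth_differentiable[OF a])
  have I\<phi>: "integral (cbox 0 R) (\<lambda>r. \<phi>r (r, \<theta>)) = - a z" for \<theta>
  proof -
    have "((\<lambda>r. \<phi>r (r, \<theta>)) has_integral a (p (R, \<theta>)) - a (p (0, \<theta>))) {0..R}"
    proof (rule fundamental_theorem_of_calculus[OF R0])
      fix r
      have pe: "p (r, \<theta>) = z + r *\<^sub>R axis c (- cis \<theta>)" for r
        by (auto simp: p_def vec_eq_iff axis_def complex_eq_iff)
      have "\<phi>r (r, \<theta>) = dir_deriv a (z + r *\<^sub>R axis c (- cis \<theta>)) (axis c (- cis \<theta>))"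
        unfolding dir_deriv_axis[OF da] \<phi>r_def A_def B_def pe by (simp add: cis_cnj)
      then show "((\<lambda>r. a (p (r, \<theta>))) has_vector_derivative \<phi>r (r, \<theta>)) (at r within {0..R})"
        unfolding pe using has_vector_derivative_along[OF da] by simp
    qed
    moreover have "a (p (R, \<theta>)) = 0"
    proof (rule supp)
      have "cmod (of_real R * cis \<theta>) - cmod (z $ c) \<le> cmod (z $ c - of_real R * cis \<theta>)"
        by (metis norm_minus_commute norm_triangle_ineq2)
      then show "2 \<le> cmod (p (R, \<theta>) $ c)" using R R0 by (simp add: p_def norm_mult)
    qed
    moreover have "p (0, \<theta>) = z" by (simp add: p_def)
    ultimately show ?thesis by (simp add: integral_unique)
  qed
  have I\<psi>: "integral (cbox 0 (2 * pi)) (\<lambda>\<theta>. \<psi> (r, \<theta>)) = 0" if "r \<noteq> 0" for r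
  proof -
    have "((\<lambda>\<theta>. - (\<i> * of_real r) * \<psi> (r, \<theta>)) has_integral a (p (r, 2 * pi)) - a (p (r, 0))) {0..2 * pi}"
    proof (rule fundamental_theorem_of_calculus)
      fix \<theta>
      have "(cis has_vector_derivative \<i> * cis \<theta>) (at \<theta> within {0..2 * pi})"
        using exp_scaleR_has_vector_derivative_right[of \<i> \<theta> "{0..2 * pi}"]
        by (simp add: cis_conv_exp[abs_def] scaleR_conv_of_real mult.commute)
      then have "((\<lambda>\<theta>. - (of_real r * cis \<theta>)) has_vector_derivative - (of_real r * (\<i> * cis \<theta>))) (at \<theta> within {0..2 * pi})"
        by (intro has_vector_derivative_minus has_vector_derivative_mult_right)
      from bounded_linear.has_vector_derivative[OF bounded_linear_axis this]
      have "((\<lambda>\<theta>. z + axis c (- (of_real r * cis \<theta>))) has_vector_derivative 0 + axis c (- (of_real r * (\<i> * cis \<theta>)))) (at \<theta> within {0..2 * pi})"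
        by (intro has_vector_derivative_add has_vector_derivative_const)
      moreover have "z + axis c (- (of_real r * cis \<theta>)) = p (r, \<theta>)" for \<theta>
        by (auto simp: p_def vec_eq_iff axis_def)
      ultimately have "((\<lambda>\<theta>. p (r, \<theta>)) has_derivative (\<lambda>t. t *\<^sub>R axis c (- (of_real r * (\<i> * cis \<theta>))))) (at \<theta> within {0..2 * pi})"
        by (simp add: has_vector_derivative_def)
      from has_derivative_compose[OF this, of a] smooth_has_derivative[OF a, of "p (r, \<theta>)"]
      have "((\<lambda>\<theta>. a (p (r, \<theta>))) has_derivative (\<lambda>t. dir_deriv a (p (r, \<theta>)) (t *\<^sub>R axis c (- (of_real r * (\<i> * cis \<theta>)))))) (at \<theta> within {0..2 * pi})"
        by blast
      then have "((\<lambda>\<theta>. a (p (r, \<theta>))) has_vector_derivative dir_deriv a (p (r, \<theta>)) (axis c (- (of_real r * (\<i> * cis \<theta>))))) (at \<theta> within {0..2 * pi})"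
        unfolding has_vector_derivative_def linear_scale[OF has_derivative_linear[OF smooth_has_derivative[OF a]]] .
      moreover have "dir_deriv a (p (r, \<theta>)) (axis c (- (of_real r * (\<i> * cis \<theta>)))) = - (\<i> * of_real r) * \<psi> (r, \<theta>)"
        unfolding dir_deriv_axis[OF da] \<psi>_def A_def B_def by (simp add: cis_cnj algebra_simps)
      ultimately show "((\<lambda>\<theta>. a (p (r, \<theta>))) has_vector_derivative - (\<i> * of_real r) * \<psi> (r, \<theta>)) (at \<theta> within {0..2 * pi})"
        by simp
    qed simp
    moreover have "p (r, 2 * pi) = p (r, 0)" by (simp add: p_def)
    ultimately have "((\<lambda>\<theta>. - (\<i> * of_real r) * \<psi> (r, \<theta>)) has_integral 0) {0..2 * pi}"
      by (simp only: diff_self)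
    then have "integral (cbox 0 (2 * pi)) (\<lambda>\<theta>. - (\<i> * of_real r) * \<psi> (r, \<theta>)) = 0"
      by (simp only: cbox_interval integral_unique)
    then show ?thesis using that by (simp only: integral_mult_right mult_eq_0_iff) simp
  qed
  have 1: "integral (cbox (0, 0) (R, 2 * pi)) \<psi> = 0"
  proof -
    have "integral (cbox (0, 0) (R, 2 * pi)) \<psi> = integral (cbox 0 R) (\<lambda>r. integral (cbox 0 (2 * pi)) (\<lambda>\<theta>. \<psi> (r, \<theta>)))"
      by (rule integral_prod_continuous[OF c\<psi>])
    \<comment> \<open>The division by the radius in \<open>I\<psi>\<close> excludes only the
      negligible set where the radius is 0.\<close>
    also have "\<dots> = integral (cbox 0 R) (\<lambda>r. 0)"
      by (rule integral_spike[of "{0}"]) (use I\<psi> in auto)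
    finally show ?thesis by simp
  qed
  have 2: "integral (cbox (0, 0) (R, 2 * pi)) \<phi>r = - 2 * pi * a z"
  proof -
    have "integral (cbox (0, 0) (R, 2 * pi)) \<phi>r = integral (cbox 0 R) (\<lambda>r. integral (cbox 0 (2 * pi)) (\<lambda>\<theta>. \<phi>r (r, \<theta>)))"
      by (rule integral_prod_continuous[OF c\<phi>])
    also have "\<dots> = integral (cbox 0 (2 * pi)) (\<lambda>\<theta>. integral (cbox 0 R) (\<lambda>r. \<phi>r (r, \<theta>)))"
      by (rule integral_swap_continuous) (use c\<phi> in simp)
    finally show ?thesis by (simp add: I\<phi>[simplified] scaleR_conv_of_real)
  qed
  have "integral (cbox (0, 0) (R, 2 * pi)) (\<lambda>s. wdb c a (p s) * cis (- snd s)) = integral (cbox (0, 0) (R, 2 * pi)) (\<lambda>s. (- 1/2) * \<phi>r s + (- 1/2) * \<psi> s)"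
    by (rule integral_cong) (simp add: \<phi>r_def \<psi>_def B_def field_simps)
  also have "\<dots> = integral (cbox (0, 0) (R, 2 * pi)) (\<lambda>s. (- 1/2) * \<phi>r s) + integral (cbox (0, 0) (R, 2 * pi)) (\<lambda>s. (- 1/2) * \<psi> s)"
    by (intro integral_add integrable_continuous continuous_on_mult continuous_on_const c\<phi> c\<psi>)
  also have "\<dots> = pi * a z" unfolding integral_mult_right 1 2 by simp
  finally show ?thesis unfolding cau_def p_def by simp
qed

text \<open>By the reverse triangle inequality, only radii differing from
  \<open>cmod (z $ c)\<close> by less than 2 reach the support of \<open>a\<close>. The choice
  \<open>ra = 0\<close> serves to change \<open>R\<close>; the choice
  \<open>ra = cmod (z $ c) - 2\<close> isolates an annulus of bounded width.\<close>

lemma cau_box: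
  fixes a :: "complex^3 \<Rightarrow> complex"
  assumes a: "smooth a" and supp: "\<And>w. cmod (w $ c) \<ge> 2 \<Longrightarrow> a w = 0"
    and r: "0 \<le> ra" "ra = 0 \<or> ra \<le> cmod (z $ c) - 2" "cmod (z $ c) + 2 \<le> rb" "rb \<le> R"
  shows "integral (cbox (0, 0) (R, 2 * pi)) (\<lambda>s. a (z - axis c (of_real (fst s) * cis (snd s))) * cis (- snd s))
    = integral (cbox (ra, 0) (rb, 2 * pi)) (\<lambda>s. a (z - axis c (of_real (fst s) * cis (snd s))) * cis (- snd s))"
    (is "integral ?A ?f = integral ?B ?f")
proof -
  have "integral ?A ?f = integral ?A (\<lambda>s. if s \<in> ?B then ?f s else 0)"
  proof (rule integral_cong)
    fix s assume s: "s \<in> ?A"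
    obtain x \<theta> where sx: "s = (x, \<theta>)" by (cases s)
    have "?f s = 0" if "s \<notin> ?B"
    proof -
      have x: "0 \<le> x" "x < ra \<or> rb < x" using s that by (auto simp: sx)
      have "\<bar>cmod (z $ c) - cmod (of_real x * cis \<theta>)\<bar> \<le> cmod (z $ c - of_real x * cis \<theta>)"
        by (rule norm_triangle_ineq3)
      then have "2 \<le> cmod ((z - axis c (of_real x * cis \<theta>)) $ c)"
        using x r by (auto simp: norm_mult axis_def)
      from supp[OF this] show ?thesis by (simp add: sx)
    qed
    then show "?f s = (if s \<in> ?B then ?f s else 0)" by auto
  qed
  also have "\<dots> = integral (?B \<inter> ?A) ?f" by (rule integral_restrict_Int)
  also have "?B \<inter> ?A = ?B" using r by (auto simp: cbox_Pair_eq)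
  finally show ?thesis .
qed

text \<open>The radius depends on the point so as to cover the support of \<open>a\<close> from
  everywhere. By \<open>cauT_eq\<close> every larger radius gives the same value, so near each point
  a fixed one can be used.\<close>

definition cauT :: "3 \<Rightarrow> (complex^3 \<Rightarrow> complex) \<Rightarrow> complex^3 \<Rightarrow> complex" where
  "cauT c a z = cau c (cmod (z $ c) + 2) a z"

context
  fixes a :: "complex^3 \<Rightarrow> complex" and c :: 3
  assumes a: "smooth a" and supp: "\<And>w. cmod (w $ c) \<ge> 2 \<Longrightarrow> a w = 0"
begin

lemma cauT_eq: "cmod (z $ c) + 2 \<le> R \<Longrightarrow> cau c R a z = cauT c a z"
  unfolding cauT_def cau_def by (subst cau_box[OF a supp, where z=z and R=R and ra=0 and rb="cmod (z $ c) + 2"]) auto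

lemma cauT_local: "\<exists>U. open U \<and> z \<in> U \<and> (\<forall>w\<in>U. cauT c a w = cau c (cmod (z $ c) + 3) a w)"
proof (intro exI conjI ballI)
  have "continuous_on UNIV (\<lambda>w::complex^3. cmod (w $ c))" by (intro continuous_intros)
  then show "open {w::complex^3. cmod (w $ c) < cmod (z $ c) + 1}"
    by (intro open_Collect_less continuous_intros)
  fix w assume "w \<in> {w. cmod (w $ c) < cmod (z $ c) + 1}"
  then show "cauT c a w = cau c (cmod (z $ c) + 3) a w" by (intro cauT_eq[symmetric]) simp
qed simp

lemma smooth_cauT: "smooth (cauT c a)"
proof (rule smooth_local)
  fix z
  obtain U where "open U" "z \<in> U" "\<forall>w\<in>U. cauT c a w = cau c (cmod (z $ c) + 3) a w" using cauT_local[of z] by blast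
  then show "\<exists>G U. open U \<and> z \<in> U \<and> (\<forall>y\<in>U. cauT c a y = G y) \<and> smooth G"
    by (intro exI[of _ "cau c (cmod (z $ c) + 3) a"] exI[of _ U] conjI smooth_cau[OF a])
qed

lemma wdb_cauT: "wdb c (cauT c a) z = a z"
proof -
  obtain U where "open U" "z \<in> U" "\<forall>w\<in>U. cauT c a w = cau c (cmod (z $ c) + 3) a w" using cauT_local[of z] by blast
  then have "wdb c (cauT c a) z = wdb c (cau c (cmod (z $ c) + 3) a) z" by (intro wirtinger_cong) auto
  also have "\<dots> = cau c (cmod (z $ c) + 3) (wdb c a) z" by (rule wdb_cau[OF a])
  also have "\<dots> = a z"
  proof (rule cauchy_pompeiu[OF a])
    show "a w = 0" if "2 \<le> cmod (w $ c)" for w by (rule supp[OF that])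
  qed simp
  finally show ?thesis .
qed

text \<open>The effective range of radii has length 4 for every \<open>t\<close>, hence area
  \<open>8 * pi\<close> in the parameter rectangle. Boundedness at infinity is what removes the
  singularity in \<open>cauN_eq\<close>.\<close>

lemma cauT_bounded: "\<exists>B. \<forall>t. 2 \<le> cmod t \<longrightarrow> cmod (cauT c a (put c t z)) \<le> B"
proof -
  have "continuous_on (cball 0 2) (\<lambda>t. a (put c t z))"
  proof -
    have "(\<lambda>t. put c t z) = (\<lambda>t. (z - axis c (z $ c)) + axis c t)" by (auto simp: vec_eq_iff axis_def)
    then have "continuous_on (cball 0 2) (\<lambda>t. put c t z)"
      by (simp only:) (intro continuous_on_add continuous_on_const linear_continuous_on bounded_linear_axis)
    then show ?thesis by (rule continuous_on_compose2[OF smooth_continuous[OF a, of UNIV]]) simp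
  qed
  then have "bounded ((\<lambda>t. a (put c t z)) ` cball 0 2)"
    by (intro compact_imp_bounded compact_continuous_image compact_cball)
  then obtain M where M': "\<forall>x \<in> (\<lambda>t. a (put c t z)) ` cball 0 2. cmod x \<le> M"
    unfolding bounded_iff by blast
  have M: "cmod (a (put c t z)) \<le> M" if "cmod t \<le> 2" for t
    using M' that by (simp add: image_iff)
  have M0: "0 \<le> M" by (rule order_trans[OF norm_ge_zero M[of 0]]) simp
  have M: "cmod (a (put c t z)) \<le> M" for t
    using M[of t] supp[of "put c t z"] M0 by (cases "cmod t \<le> 2") auto
  have "cmod (cauT c a (put c t z)) \<le> M * (8 * pi) / pi" if t: "2 \<le> cmod t" for t
  proof -
    let ?f = "\<lambda>s. a (put c t z - axis c (of_real (fst s) * cis (snd s))) * cis (- snd s)"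
    let ?B = "cbox (cmod t - 2, 0) (cmod t + 2, 2 * pi)"
    have "cauT c a (put c t z) = integral ?B ?f / pi"
      unfolding cauT_def cau_def by (subst cau_box[OF a supp, where ra="cmod t - 2" and rb="cmod t + 2"]) (use t in auto)
    moreover have "cmod (integral ?B ?f) \<le> M * measure lborel ?B"
      by (rule integrable_bound[OF M0 integrable_continuous[OF continuous_cau_integrand[OF a]]])
        (simp add: put_diff_axis norm_mult M)
    moreover have "measure lborel ?B = 8 * pi" by (simp add: content_Pair)
    ultimately show ?thesis by (simp add: norm_divide pos_divide_le_eq mult.assoc)
  qed
  then show ?thesis by blast
qed

text \<open>The Cauchy transform in the coordinate at infinity; near infinity it is the Cauchy integral
  of its values on the circle of radius \<open>1/4\<close>.\<close>

definition cauN :: "complex^3 \<Rightarrow> complex" where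
  "cauN z = integral (cbox 0 1) (\<lambda>x. cau c 6 a (put c (4 * cis (- (2 * pi * x))) z) * (cis (2 * pi * x) / 4)
     * sinv (1/8) (cis (2 * pi * x) / 4 - z $ c))"

definition cauI :: "complex^3 \<Rightarrow> complex" where
  "cauI z = (if z $ c = 0 then cauN z else cauT c a (put c (inverse (z $ c)) z))"

lemma smooth_cauN: "smooth cauN"
proof -
  have x: "smooth (\<lambda>p :: (complex^3) \<times> real. 2 * pi * snd p)"
    by (intro smooth_mult smooth_const smooth_snd)
  have c1: "smooth (\<lambda>p :: (complex^3) \<times> real. cis (2 * pi * snd p) * (1/4))"
    by (intro smooth_mult smooth_const smooth_compose[OF smooth_cis x])
  have c2: "smooth (\<lambda>p :: (complex^3) \<times> real. 4 * cis (- (2 * pi * snd p)))"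
    by (intro smooth_mult smooth_const smooth_compose[OF smooth_cis smooth_minus[OF x]])
  have "smooth (\<lambda>p :: (complex^3) \<times> real. cau c 6 a (put c (4 * cis (- (2 * pi * snd p))) (fst p)) * (cis (2 * pi * snd p) * (1/4))
     * sinv (1/8) (cis (2 * pi * snd p) * (1/4) - fst p $ c))"
    by (intro smooth_mult smooth_compose[OF smooth_cau[OF a] smooth_put[OF c2 smooth_fst]] c1
       smooth_compose[OF smooth_sinv smooth_diff[OF c1 smooth_nth[OF smooth_fst]]]) simp
  from smooth_integral[OF this, of 0 1] show ?thesis by (simp add: cauN_def[abs_def])
qed

text \<open>In the coordinate \<open>u\<close> at infinity the transform is holomorphic for
  \<open>0 < cmod u < 1/2\<close>, as \<open>a\<close> vanishes at \<open>inverse u\<close>. It is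
  also bounded, so it extends over 0 and is represented by Cauchy's formula.\<close>

lemma cauN_eq:
  assumes z: "z $ c \<noteq> 0" "cmod (z $ c) < 1/8"
  shows "cauN z = cauT c a (put c (inverse (z $ c)) z)"
proof -
  define h where "h u = cauT c a (put c (inverse u) z)" for u
  have inv2: "2 \<le> cmod (inverse u)" if "u \<noteq> 0" "cmod u < 1/2" for u
    unfolding norm_inverse using that by (simp add: field_simps)
  have hol: "h holomorphic_on ball 0 (1/2) - {0}"
  proof -
    have "\<exists>d. (h has_field_derivative d) (at u)" if u: "u \<in> ball 0 (1/2) - {0}" for u
    proof -
      have n: "2 \<le> cmod (inverse u)" using u inv2 by auto
      have 1: "((\<lambda>t. cauT c a (put c t z)) has_field_derivative wd c (cauT c a) (put c (inverse u) z)) (at (inverse u))"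
        by (rule slice_derivative[OF smooth_cauT]) (use n in \<open>simp add: wdb_cauT supp\<close>)
      have 2: "(inverse has_field_derivative - (inverse u ^ Suc (Suc 0))) (at u)"
        using u by (intro DERIV_inverse) auto
      show ?thesis unfolding h_def using DERIV_chain2[OF 1 2] by blast
    qed
    then show ?thesis
      by (subst holomorphic_on_open) (auto intro: open_delete)
  qed
  obtain B where B: "\<And>t. 2 \<le> cmod t \<Longrightarrow> cmod (cauT c a (put c t z)) \<le> B" using cauT_bounded by blast
  have bd: "\<forall>\<^sub>F u in at 0. cmod (h u) \<le> B"
    unfolding eventually_at by (rule exI[of _ "1/2"]) (auto simp: h_def intro!: B inv2)
  obtain k where k: "k holomorphic_on ball 0 (1/2)" "\<And>u. u \<in> ball 0 (1/2) - {0} \<Longrightarrow> k u = h u"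
    using holomorphic_on_extend_bounded[OF hol] bd by auto
  have "((\<lambda>u. k u / (u - z $ c)) has_contour_integral (2 * of_real pi * \<i> * k (z $ c))) (circlepath 0 (1/4))"
    by (rule Cauchy_integral_circlepath_simple[OF holomorphic_on_subset[OF k(1)]]) (use z in auto)
  then have "((\<lambda>x. k (circlepath 0 (1/4) x) / (circlepath 0 (1/4) x - z $ c) * vector_derivative (circlepath 0 (1/4)) (at x))
     has_integral 2 * of_real pi * \<i> * k (z $ c)) {0..1}"
    unfolding has_contour_integral .
  moreover have "circlepath 0 (1/4) x = cis (2 * pi * x) / 4" for x
    by (simp add: circlepath cis_conv_exp mult_ac)
  moreover have "vector_derivative (circlepath 0 (1/4)) (at x) = 2 * pi * \<i> * (cis (2 * pi * x) / 4)" for x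
    by (simp add: vector_derivative_circlepath cis_conv_exp mult_ac)
  ultimately have "((\<lambda>x. k (cis (2 * pi * x) / 4) / (cis (2 * pi * x) / 4 - z $ c) * (2 * pi * \<i> * (cis (2 * pi * x) / 4)))
     has_integral 2 * of_real pi * \<i> * k (z $ c)) {0..1}" by simp
  from has_integral_mult_right[OF this, of "inverse (2 * of_real pi * \<i>)"]
  have I: "((\<lambda>x. k (cis (2 * pi * x) / 4) / (cis (2 * pi * x) / 4 - z $ c) * (cis (2 * pi * x) / 4)) has_integral k (z $ c)) {0..1}"
    by (simp add: field_simps)
  \<comment> \<open>The inverted points have modulus 4, so the radius \<open>6 = 4 + 2\<close>
    suffices in \<open>cau\<close>. The point \<open>z $ c\<close> has distance more than
    \<open>1/4 - 1/8\<close> from the circle, so \<open>sinv (1/8)\<close> is the true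
    reciprocal.\<close>
  have E: "k (cis (2 * pi * x) / 4) / (cis (2 * pi * x) / 4 - z $ c) * (cis (2 * pi * x) / 4) =
     cau c 6 a (put c (4 * cis (- (2 * pi * x))) z) * (cis (2 * pi * x) / 4) * sinv (1/8) (cis (2 * pi * x) / 4 - z $ c)" for x
  proof -
    have "cmod (cis (2 * pi * x) / 4) - cmod (z $ c) \<le> cmod (cis (2 * pi * x) / 4 - z $ c)" by (rule norm_triangle_ineq2)
    then have e1: "sinv (1/8) (cis (2 * pi * x) / 4 - z $ c) = inverse (cis (2 * pi * x) / 4 - z $ c)"
      by (intro sinv_eq) (use z in \<open>auto simp: norm_divide\<close>)
    have e2: "k (cis (2 * pi * x) / 4) = h (cis (2 * pi * x) / 4)" by (rule k(2)) (auto simp: norm_divide)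
    have e3: "inverse (cis (2 * pi * x) / 4) = 4 * cis (- (2 * pi * x))" by (simp add: cis_inverse[symmetric] inverse_eq_divide)
    have e4: "cau c 6 a (put c (4 * cis (- (2 * pi * x))) z) = cauT c a (put c (4 * cis (- (2 * pi * x))) z)"
      by (rule cauT_eq) (simp add: norm_mult)
    show ?thesis unfolding e4 e1 e2 h_def e3 divide_inverse[of _ "_ - _"] by (rule mult.assoc[THEN trans, OF arg_cong2[of _ _ _ _ "(*)", OF refl mult.commute], THEN trans, OF mult.assoc[symmetric]])
  qed
  have "cauN z = k (z $ c)"
    unfolding cauN_def cbox_interval using I unfolding E by (rule integral_unique)
  also have "\<dots> = h (z $ c)" by (rule k(2)) (use z in auto)
  finally show ?thesis by (simp add: h_def)
qed

lemma smooth_cauI: "smooth cauI"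
proof (rule smooth_local)
  fix z
  show "\<exists>G U. open U \<and> z \<in> U \<and> (\<forall>y\<in>U. cauI y = G y) \<and> smooth G"
  proof (cases "z $ c = 0")
    case True
    have "open {w::complex^3. cmod (w $ c) < 1/8}"
      by (intro open_Collect_less continuous_intros)
    then show ?thesis using True smooth_cauN
      by (intro exI[of _ cauN] exI[of _ "{w. cmod (w $ c) < 1/8}"]) (auto simp: cauI_def cauN_eq)
  next
    case False
    define e where "e = cmod (z $ c) / 2"
    have e: "e > 0" using False by (simp add: e_def)
    have "open {w::complex^3. e < cmod (w $ c)}"
      by (intro open_Collect_less continuous_intros)
    \<comment> \<open>Off the hyperplane the inversion is replaced by a globally smooth function
      that agrees with it near the point.\<close>
    moreover have "cauI w = cauT c a (put c (sinv e (w $ c)) w)" if "e < cmod (w $ c)" for w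
      using that e by (auto simp: cauI_def sinv_eq)
    moreover have "smooth (\<lambda>w. cauT c a (put c (sinv e (w $ c)) w))"
      by (rule smooth_compose[OF smooth_cauT smooth_put[OF smooth_compose[OF smooth_sinv[OF e] smooth_nth[OF smooth_ident]] smooth_ident]])
    ultimately show ?thesis using False
      by (intro exI[of _ "\<lambda>w. cauT c a (put c (sinv e (w $ c)) w)"] exI[of _ "{w. e < cmod (w $ c)}"]) (auto simp: e_def)
  qed
qed

end

section \<open>The equation for d-bar on the fibres of a projective line bundle\<close>

lemma has_derivative_put_inverse:
  assumes "z $ c \<noteq> 0"
  shows "((\<lambda>z. put c (inverse (z $ c)) z) has_derivative
    (\<lambda>u. \<chi> l. \<Sum>j\<in>UNIV. (if l = j then if l = c then - (inverse (z $ c))\<^sup>2 else 1 else 0) * u $ j)) (at z)"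
proof -
  have "((\<lambda>z. z + axis c (inverse (z $ c) - z $ c)) has_derivative
     (\<lambda>u. u + axis c (- (inverse (z $ c) * (u $ c) * inverse (z $ c)) - u $ c))) (at z)"
    by (intro has_derivative_add has_derivative_ident bounded_linear.has_derivative[OF bounded_linear_axis]
       has_derivative_diff Deriv.has_derivative_inverse assms bounded_linear_imp_has_derivative[OF bounded_linear_vec_nth])
  moreover have "u + axis c (- (inverse (z $ c) * (u $ c) * inverse (z $ c)) - u $ c) =
    (\<chi> l. \<Sum>j\<in>UNIV. (if l = j then if l = c then - (inverse (z $ c))\<^sup>2 else 1 else 0) * u $ j)" for u :: "complex^3"
  proof -
    have "(\<Sum>j\<in>UNIV. (if l = j then if l = c then - (inverse (z $ c))\<^sup>2 else 1 else 0) * u $ j)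
      = (\<Sum>j\<in>UNIV. if l = j then (if l = c then - (inverse (z $ c))\<^sup>2 else 1) * u $ l else 0)" for l
      by (intro sum.cong) auto
    then show ?thesis by (auto simp: vec_eq_iff axis_def power2_eq_square)
  qed
  ultimately show ?thesis by (simp add: put_axis)
qed

lemma wdb_put_inverse:
  assumes "z $ c \<noteq> 0" "smooth G"
  shows "wdb j (\<lambda>z. G (put c (inverse (z $ c)) z)) z =
    wdb j G (put c (inverse (z $ c)) z) * cnj (if j = c then - (inverse (z $ c))\<^sup>2 else 1)"
proof -
  have "wdb j (\<lambda>z. G (put c (inverse (z $ c)) z)) z = (\<Sum>l\<in>UNIV. wdb l G (put c (inverse (z $ c)) z) * cnj (if l = j then if l = c then - (inverse (z $ c))\<^sup>2 else 1 else 0))"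
    by (rule wirtinger_chain(2)[OF has_derivative_put_inverse[OF assms(1)] smooth_differentiable[OF assms(2)]])
  also have "\<dots> = (\<Sum>l\<in>UNIV. if l = j then wdb j G (put c (inverse (z $ c)) z) * cnj (if j = c then - (inverse (z $ c))\<^sup>2 else 1) else 0)"
    by (intro sum.cong) auto
  finally show ?thesis by simp
qed

lemma wdb_put0:
  assumes "smooth G"
  shows "wdb j (\<lambda>z. G (put c 0 z)) z = (if j = c then 0 else wdb j G (put c 0 z))"
proof -
  have "((\<lambda>z. put c 0 z) has_derivative (\<lambda>u. \<chi> l. \<Sum>j\<in>UNIV. (if l = j \<and> l \<noteq> c then 1 else 0) * u $ j)) (at z)"
  proof -
    have "((\<lambda>z. z + axis c (0 - z $ c)) has_derivative (\<lambda>u. u + axis c (0 - u $ c))) (at z)"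
      by (intro has_derivative_add has_derivative_ident bounded_linear.has_derivative[OF bounded_linear_axis]
         has_derivative_diff has_derivative_const bounded_linear_imp_has_derivative[OF bounded_linear_vec_nth])
    moreover have "u + axis c (0 - u $ c) = (\<chi> l. \<Sum>j\<in>UNIV. (if l = j \<and> l \<noteq> c then 1 else 0) * u $ j)" for u :: "complex^3"
    proof -
      have "(\<Sum>j\<in>UNIV. (if l = j \<and> l \<noteq> c then 1 else 0) * u $ j) = (\<Sum>j\<in>UNIV. if l = j then (if l \<noteq> c then 1 else 0) * u $ l else 0)" for l
        by (intro sum.cong) auto
      then show ?thesis by (auto simp: vec_eq_iff axis_def)
    qed
    ultimately show ?thesis by (simp add: put_axis)
  qed
  from wirtinger_chain(2)[OF this smooth_differentiable[OF assms]]
  have "wdb j (\<lambda>z. G (put c 0 z)) z = (\<Sum>l\<in>UNIV. wdb l G (put c 0 z) * cnj (if l = j \<and> l \<noteq> c then 1 else 0))" .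
  also have "\<dots> = (\<Sum>l\<in>UNIV. if l = j then (if j = c then 0 else wdb j G (put c 0 z)) else 0)"
    by (intro sum.cong) auto
  finally show ?thesis by simp
qed

lemma smooth_put0: "smooth G \<Longrightarrow> smooth (\<lambda>z. G (put c 0 z))"
  by (rule smooth_compose[OF _ smooth_put[OF smooth_const smooth_ident]])

lemma continuous_slice:
  fixes A :: "complex^3 \<Rightarrow> complex"
  assumes "continuous_on UNIV A"
  shows "continuous_on S (\<lambda>t. A (put c t z))"
proof -
  have "(\<lambda>t. put c t z) = (\<lambda>t. (z - axis c (z $ c)) + axis c t)" by (auto simp: vec_eq_iff axis_def)
  then have "continuous_on S (\<lambda>t. put c t z)"
    by (simp only:) (intro continuous_on_add continuous_on_const linear_continuous_on bounded_linear_axis)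
  then show ?thesis by (rule continuous_on_compose2[OF assms]) simp
qed

lemma agree_off_hyperplane:
  fixes A B :: "complex^3 \<Rightarrow> complex"
  assumes "continuous_on UNIV A" "continuous_on UNIV B" "\<And>z. z $ c \<noteq> 0 \<Longrightarrow> A z = B z"
  shows "A z = B z"
proof (cases "z $ c = 0")
  case True
  have "isCont (\<lambda>t. A (put c t z)) 0" "isCont (\<lambda>t. B (put c t z)) 0"
    using continuous_slice[OF assms(1), of UNIV c z] continuous_slice[OF assms(2), of UNIV c z]
    by (auto simp: continuous_on_eq_continuous_at)
  then have 1: "((\<lambda>t. A (put c t z)) \<longlongrightarrow> A (put c 0 z)) (at 0)" "((\<lambda>t. B (put c t z)) \<longlongrightarrow> B (put c 0 z)) (at 0)"
    by (simp_all add: isCont_def)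
  have "((\<lambda>t. A (put c t z)) \<longlongrightarrow> B (put c 0 z)) (at 0)"
    by (rule Lim_transform_eventually[OF 1(2)]) (auto simp: eventually_at_filter assms(3))
  from LIM_unique[OF 1(1) this] show ?thesis using True put_self[of c z] by simp
qed (use assms in auto)

text \<open>Vanishing of the first cohomology of the projective line, with smooth dependence on
  parameters. \<open>b0\<close> and \<open>b1\<close> express one form of type (0,1) in the two
  affine coordinates; the partition \<open>chi\<close> splits it into two compactly supported
  pieces, whose Cauchy transforms are added. Subtracting the value at the origin of the first
  coordinate gives the normalization.\<close>

lemma fibre_solution:
  assumes b: "smooth b0" "smooth b1"
    and tr: "\<And>z. z $ c \<noteq> 0 \<Longrightarrow> b0 z = b1 (put c (inverse (z $ c)) z) * cnj (- (inverse (z $ c))\<^sup>2)"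
  shows "\<exists>G0 G1. smooth G0 \<and> smooth G1 \<and> (\<forall>z. z $ c \<noteq> 0 \<longrightarrow> G0 z = G1 (put c (inverse (z $ c)) z)) \<and>
    (\<forall>z. wdb c G0 z = b0 z) \<and> (\<forall>z. wdb c G1 z = b1 z) \<and> (\<forall>z. G0 (put c 0 z) = 0)"
proof -
  have tr': "b1 z = b0 (put c (inverse (z $ c)) z) * cnj (- (inverse (z $ c))\<^sup>2)" if "z $ c \<noteq> 0" for z
    using tr[of "put c (inverse (z $ c)) z"] that by (simp add: field_simps)
  define a0 where "a0 z = of_real (chi (z $ c)) * b0 z" for z
  define a1 where "a1 z = of_real (chi (z $ c)) * b1 z" for z
  have ch: "smooth (\<lambda>z. complex_of_real (chi (z $ c)))"
    by (rule smooth_of_real[OF smooth_compose[OF smooth_chi smooth_nth[OF smooth_ident]]])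
  have sa: "smooth a0" "smooth a1" unfolding a0_def a1_def by (rule smooth_mult[OF ch b(1)] smooth_mult[OF ch b(2)])+
  have supp: "2 \<le> cmod (w $ c) \<Longrightarrow> a0 w = 0" "2 \<le> cmod (w $ c) \<Longrightarrow> a1 w = 0" for w
    by (simp_all add: a0_def a1_def chi_0)
  \<comment> \<open>Off the hyperplane the second summand is a Cauchy transform in the inverted
    coordinate, and the chain rule adds up the two pieces. On the hyperplane the equation holds by
    continuity.\<close>
  have key: "wdb c (\<lambda>z. cauT c a z + cauI a' c z) z = b z"
    if s: "smooth a" "smooth a'" "smooth b" and sp: "\<And>w. 2 \<le> cmod (w $ c) \<Longrightarrow> a w = 0" "\<And>w. 2 \<le> cmod (w $ c) \<Longrightarrow> a' w = 0"
      and ab: "\<And>z. z $ c \<noteq> 0 \<Longrightarrow> a z + a' (put c (inverse (z $ c)) z) * cnj (- (inverse (z $ c))\<^sup>2) = b z" for a a' b z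
  proof -
    have sT: "smooth (cauT c a)" "smooth (cauT c a')" "smooth (cauI a' c)"
      by (rule smooth_cauT[OF s(1) sp(1)], assumption, rule smooth_cauT[OF s(2) sp(2)], assumption, rule smooth_cauI[OF s(2) sp(2)])
    show ?thesis
    proof (rule agree_off_hyperplane[where c=c])
      show "continuous_on UNIV (wdb c (\<lambda>z. cauT c a z + cauI a' c z))"
        by (rule smooth_continuous[OF smooth_wdb[OF smooth_add[OF sT(1,3)]]])
      show "continuous_on UNIV b" by (rule smooth_continuous[OF s(3)])
      fix z :: "complex^3" assume z: "z $ c \<noteq> 0"
      have "open {w::complex^3. w $ c \<noteq> 0}" by (intro open_Collect_neq continuous_intros)
      then have "wdb c (cauI a' c) z = wdb c (\<lambda>z. cauT c a' (put c (inverse (z $ c)) z)) z"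
        by (rule wirtinger_cong) (use z in \<open>auto simp: cauI_def[OF s(2) sp(2)]\<close>)
      also have "\<dots> = a' (put c (inverse (z $ c)) z) * cnj (- (inverse (z $ c))\<^sup>2)"
        by (simp add: wdb_put_inverse[OF z sT(2)] wdb_cauT[OF s(2) sp(2)])
      finally show "wdb c (\<lambda>z. cauT c a z + cauI a' c z) z = b z"
        using ab[OF z] by (simp add: wirtinger_add smooth_differentiable sT wdb_cauT[OF s(1) sp(1)])
    qed
  qed
  define H0 where "H0 z = cauT c a0 z + cauI a1 c z" for z
  define H1 where "H1 z = cauT c a1 z + cauI a0 c z" for z
  have sH: "smooth H0" "smooth H1" unfolding H0_def H1_def
    by (intro smooth_add smooth_cauT[OF sa(1) supp(1)] smooth_cauI[OF sa(2) supp(2)]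
      smooth_cauT[OF sa(2) supp(2)] smooth_cauI[OF sa(1) supp(1)]; assumption)+
  have d0: "wdb c H0 z = b0 z" for z
    unfolding H0_def
  proof (rule key[OF sa b(1) supp])
    fix z :: "complex^3" assume z: "z $ c \<noteq> 0"
    have "a0 z + a1 (put c (inverse (z $ c)) z) * cnj (- (inverse (z $ c))\<^sup>2) = of_real (chi (z $ c) + chi (inverse (z $ c))) * b0 z"
      unfolding a0_def a1_def tr[OF z] by (simp add: algebra_simps)
    then show "a0 z + a1 (put c (inverse (z $ c)) z) * cnj (- (inverse (z $ c))\<^sup>2) = b0 z" by (simp add: chi_inverse[OF z])
  qed
  have d1: "wdb c H1 z = b1 z" for z
    unfolding H1_def
  proof (rule key[OF sa(2,1) b(2) supp(2,1)])
    fix z :: "complex^3" assume z: "z $ c \<noteq> 0"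
    have "a1 z + a0 (put c (inverse (z $ c)) z) * cnj (- (inverse (z $ c))\<^sup>2) = of_real (chi (z $ c) + chi (inverse (z $ c))) * b1 z"
      unfolding a0_def a1_def tr'[OF z] by (simp add: algebra_simps)
    then show "a1 z + a0 (put c (inverse (z $ c)) z) * cnj (- (inverse (z $ c))\<^sup>2) = b1 z" by (simp add: chi_inverse[OF z])
  qed
  have H01: "H0 z = H1 (put c (inverse (z $ c)) z)" if "z $ c \<noteq> 0" for z
    using that by (simp add: H0_def H1_def cauI_def[OF sa(2) supp(2)] cauI_def[OF sa(1) supp(1)])
  have s0: "smooth (\<lambda>z. H0 (put c 0 z))" by (rule smooth_put0[OF sH(1)])
  have z0: "wdb c (\<lambda>z. - H0 (put c 0 z)) z = 0" for z
  proof -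
    have "wdb c (\<lambda>z. - 1 * H0 (put c 0 z)) z = 0"
      using wirtinger_mult(2)[of "\<lambda>z. - 1" z "\<lambda>z. H0 (put c 0 z)" c] wdb_put0[OF sH(1), of c c z] smooth_differentiable[OF s0] smooth_differentiable[OF smooth_const, of "- 1 :: complex"]
      by (simp add: wirtinger_const)
    then show ?thesis by simp
  qed
  have w: "wdb c (\<lambda>z. H z - H0 (put c 0 z)) z = wdb c H z" if "smooth H" for H z
    using wirtinger_add(2)[OF smooth_differentiable[OF that] smooth_differentiable[OF smooth_minus[OF s0]], of c z] z0 by simp
  show ?thesis
    by (rule exI[of _ "\<lambda>z. H0 z - H0 (put c 0 z)"], rule exI[of _ "\<lambda>z. H1 z - H0 (put c 0 z)"])
      (use sH d0 d1 H01 w s0 smooth_diff in auto)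
qed

text \<open>\<open>B\<close> is the expression of \<open>u\<close> in the coordinate at infinity.
  Its continuity gives the entire function a limit there, and Liouville's theorem applies.\<close>

lemma fibre_const:
  assumes u: "smooth u" "\<And>t. wdb c u (put c t z) = 0" and B: "isCont B 0"
    and uB: "\<And>t. t \<noteq> 0 \<Longrightarrow> u (put c t z) = B (inverse t)"
  shows "u (put c t z) = B 0"
proof (rule Liouville_weak[where f="\<lambda>t. u (put c t z)"])
  show "(\<lambda>t. u (put c t z)) holomorphic_on UNIV"
    by (subst holomorphic_on_open) (auto intro: slice_derivative[OF u])
  have "((\<lambda>t. B (inverse t)) \<longlongrightarrow> B 0) at_infinity"
    by (rule isCont_tendsto_compose[OF B tendsto_inverse_0])
  then show "((\<lambda>t. u (put c t z)) \<longlongrightarrow> B 0) at_infinity"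
  proof (rule Lim_transform_eventually)
    have "B (inverse t) = u (put c t z)" if "1 \<le> cmod t" for t
      using that by (intro uB[symmetric]) auto
    then show "\<forall>\<^sub>F t in at_infinity. B (inverse t) = u (put c t z)"
      unfolding eventually_at_infinity by blast
  qed
qed

section \<open>Covariance under holomorphic changes of charts\<close>

text \<open>\<open>T\<close> is the holomorphic Jacobian matrix of \<open>\<tau>\<close>. The
  densities differ by \<open>P * cnj P\<close> with \<open>P\<close> holomorphic and without zeros,
  and \<open>\<Lambda>\<close> is the logarithmic derivative of \<open>P\<close>.\<close>

locale chart_change =
  A: weighted_chart g gi D Di f fi v q Y Z F c +
  B: weighted_chart g' gi' D' Di' f' fi' v' q Y' Z' F' c'
  for g gi D Di f fi v q Y Z F c g' gi' D' Di' f' fi' v' Y' Z' F' c' +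
  fixes \<tau> :: "complex^3 \<Rightarrow> complex^3" and T :: "3 \<Rightarrow> 3 \<Rightarrow> complex^3 \<Rightarrow> complex" and U :: "(complex^3) set"
    and P :: "complex^3 \<Rightarrow> complex" and \<Lambda> :: "3 \<Rightarrow> complex^3 \<Rightarrow> complex"
  assumes U: "open U"
    and \<tau>: "z \<in> U \<Longrightarrow> (\<tau> has_derivative (\<lambda>u. \<chi> l. \<Sum>j\<in>UNIV. T l j z * u $ j)) (at z)"
    and T: "z \<in> U \<Longrightarrow> T l j differentiable at z" "z \<in> U \<Longrightarrow> wdb k (T l j) z = 0"
    and Tdet: "z \<in> U \<Longrightarrow> det3 (\<lambda>l j. T l j z) \<noteq> 0"
    and gt: "z \<in> U \<Longrightarrow> val (g j k) z = (\<Sum>a\<in>UNIV. \<Sum>b\<in>UNIV. T a j z * cnj (T b k z) * val (g' a b) (\<tau> z))"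
    and ft: "z \<in> U \<Longrightarrow> val f z = val f' (\<tau> z)" and fit: "z \<in> U \<Longrightarrow> val fi z = val fi' (\<tau> z)"
    and vt: "z \<in> U \<Longrightarrow> val v z = val v' (\<tau> z)"
    and Ft: "z \<in> U \<Longrightarrow> val F z = val F' (\<tau> z)"
    and Dt: "z \<in> U \<Longrightarrow> val D z = P z * cnj (P z) * val D' (\<tau> z)"
    and P: "z \<in> U \<Longrightarrow> P differentiable at z" "z \<in> U \<Longrightarrow> wdb k P z = 0" "z \<in> U \<Longrightarrow> wd k P z = \<Lambda> k z * P z" "z \<in> U \<Longrightarrow> P z \<noteq> 0"
    and \<Lambda>: "z \<in> U \<Longrightarrow> \<Lambda> k differentiable at z" "z \<in> U \<Longrightarrow> wdb m (\<Lambda> k) z = 0"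
begin

lemma chain:
  assumes "z \<in> U"
  shows "wd j (\<lambda>z. val G (\<tau> z)) z = (\<Sum>a\<in>UNIV. val (dd a G) (\<tau> z) * T a j z)"
    "wdb j (\<lambda>z. val G (\<tau> z)) z = (\<Sum>a\<in>UNIV. val (db a G) (\<tau> z) * cnj (T a j z))"
    "(\<lambda>z. val G (\<tau> z)) differentiable at z"
  using wirtinger_chain[OF \<tau>[OF assms] val_diff] by simp_all

lemma wd_eq:
  assumes "z \<in> U" "\<And>z. z \<in> U \<Longrightarrow> X z = X' z"
  shows "wd j X z = wd j X' z" "wdb j X z = wdb j X' z"
  using wirtinger_cong[OF U assms] by auto

lemma d_scalar:
  assumes "\<And>z. z \<in> U \<Longrightarrow> val s z = val s' (\<tau> z)" "z \<in> U"
  shows "val (dd j s) z = (\<Sum>a\<in>UNIV. val (dd a s') (\<tau> z) * T a j z)"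
    "val (db j s) z = (\<Sum>a\<in>UNIV. val (db a s') (\<tau> z) * cnj (T a j z))"
  using wd_eq[OF assms(2), of "val s" "\<lambda>z. val s' (\<tau> z)" j] chain(1,2)[OF assms(2), where G=s' and j=j] assms(1) by simp_all

lemma wd_sum:
  assumes "\<And>a. X a differentiable at z"
  shows "wd j (\<lambda>z. \<Sum>a\<in>(UNIV::3 set). X a z) z = (\<Sum>a\<in>UNIV. wd j (X a) z)"
    "wdb j (\<lambda>z. \<Sum>a\<in>(UNIV::3 set). X a z) z = (\<Sum>a\<in>UNIV. wdb j (X a) z)"
    "(\<lambda>z. \<Sum>a\<in>(UNIV::3 set). X a z) differentiable at z"
proof -
  show "(\<lambda>z. \<Sum>a\<in>(UNIV::3 set). X a z) differentiable at z" by (simp add: sum_3 assms)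
  show "wd j (\<lambda>z. \<Sum>a\<in>(UNIV::3 set). X a z) z = (\<Sum>a\<in>UNIV. wd j (X a) z)"
    "wdb j (\<lambda>z. \<Sum>a\<in>(UNIV::3 set). X a z) z = (\<Sum>a\<in>UNIV. wdb j (X a) z)"
    by (simp_all add: sum_3 assms wirtinger_add)
qed

lemma cnj_diff: "X differentiable at z \<Longrightarrow> (\<lambda>z. cnj (X z)) differentiable at z"
  unfolding differentiable_def by (blast intro: has_derivative_cnj)

lemma cT: assumes "z \<in> U"
  shows "(\<lambda>z. cnj (T l j z)) differentiable at z" "wd k (\<lambda>z. cnj (T l j z)) z = 0"
  using cnj_diff[OF T(1)[OF assms]] wirtinger_cnj[OF T(1)[OF assms]] T(2)[OF assms] by auto

text \<open>An inverse matrix is unique, so it suffices that the transported matrix \<open>M\<close>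
  inverts \<open>G\<close>. The transformation rule of the metric gives this only after
  multiplication by the Jacobian, which is cancelled with its cofactors.\<close>

lemma gi_t:
  assumes z: "z \<in> U"
  shows "val (gi' a b) (\<tau> z) = (\<Sum>j\<in>UNIV. \<Sum>k\<in>UNIV. T a j z * cnj (T b k z) * val (gi j k) z)"
proof -
  define t where "t = (\<lambda>l j. T l j z)"
  define M where "M a b = (\<Sum>j\<in>UNIV. \<Sum>k\<in>UNIV. t a j * cnj (t b k) * val (gi j k) z)" for a b
  define G where "G a b = val (g' a b) (\<tau> z)" for a b
  have A1: "(\<Sum>k\<in>UNIV. val (gi j k) z * val (g l k) z) = (if j = l then 1 else 0)" for j l
    using arg_cong[OF A.inv1[of j l], of "\<lambda>F. val F z"] by simp
  have B2: "(\<Sum>c\<in>UNIV. val (gi' c b) (\<tau> z) * G c d) = (if b = d then 1 else 0)" for b d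
    using arg_cong[OF B.inv2[of b d], of "\<lambda>F. val F (\<tau> z)"] by (simp add: G_def)
  have B1: "(\<Sum>b\<in>UNIV. val (gi' a b) (\<tau> z) * G c b) = (if a = c then 1 else 0)" for a c
    using arg_cong[OF B.inv1[of a c], of "\<lambda>F. val F (\<tau> z)"] by (simp add: G_def)
  have X: "(\<Sum>c\<in>UNIV. (\<Sum>b\<in>UNIV. M a b * G c b) * t c l) = t a l" for a l
  proof -
    have "(\<Sum>c\<in>UNIV. (\<Sum>b\<in>UNIV. M a b * G c b) * t c l) = (\<Sum>c\<in>UNIV. \<Sum>b\<in>UNIV. \<Sum>j\<in>UNIV. \<Sum>k\<in>UNIV. t a j * val (gi j k) z * (t c l * cnj (t b k) * G c b))"
      by (simp add: M_def sum_distrib_left sum_distrib_right mult_ac)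
    also have "\<dots> = (\<Sum>j\<in>UNIV. \<Sum>k\<in>UNIV. \<Sum>c\<in>UNIV. \<Sum>b\<in>UNIV. t a j * val (gi j k) z * (t c l * cnj (t b k) * G c b))"
    proof -
      have "(\<Sum>c\<in>UNIV. \<Sum>b\<in>UNIV. \<Sum>j\<in>UNIV. \<Sum>k\<in>UNIV. t a j * val (gi j k) z * (t c l * cnj (t b k) * G c b))
        = (\<Sum>c\<in>UNIV. \<Sum>j\<in>UNIV. \<Sum>k\<in>UNIV. \<Sum>b\<in>UNIV. t a j * val (gi j k) z * (t c l * cnj (t b k) * G c b))"
        by (intro sum.cong refl sum3_rot)
      also have "\<dots> = (\<Sum>j\<in>UNIV. \<Sum>k\<in>UNIV. \<Sum>c\<in>UNIV. \<Sum>b\<in>UNIV. t a j * val (gi j k) z * (t c l * cnj (t b k) * G c b))"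
        by (rule sum3_rot)
      finally show ?thesis .
    qed
    also have "\<dots> = (\<Sum>j\<in>UNIV. t a j * (\<Sum>k\<in>UNIV. val (gi j k) z * val (g l k) z))"
      unfolding gt[OF z] by (simp add: sum_distrib_left t_def G_def mult_ac)
    also have "\<dots> = (\<Sum>j\<in>UNIV. if j = l then t a l else 0)" unfolding A1 by (intro sum.cong) auto
    finally show ?thesis by simp
  qed
  have Ti: "(\<Sum>l\<in>UNIV. t c l * cof t d l) = (if c = d then det3 t else 0)" for c d
    using cof_row[of t d c] by (auto simp: mult.commute)
  have dt: "det3 t \<noteq> 0" using Tdet[OF z] by (simp add: t_def)
  have MG: "(\<Sum>b\<in>UNIV. M a b * G d b) = (if a = d then 1 else 0)" for a d
  proof -
    have "(\<Sum>l\<in>UNIV. (\<Sum>c\<in>UNIV. (\<Sum>b\<in>UNIV. M a b * G c b) * t c l) * cof t d l) = (\<Sum>c\<in>UNIV. (\<Sum>b\<in>UNIV. M a b * G c b) * (\<Sum>l\<in>UNIV. t c l * cof t d l))"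
      unfolding sum_distrib_left[of _ "\<lambda>l. t _ l * cof t d l"] sum_distrib_right[of _ UNIV "cof t d _"]
      by (subst sum.swap) (simp only: mult.assoc)
    also have "\<dots> = (\<Sum>c\<in>UNIV. if c = d then (\<Sum>b\<in>UNIV. M a b * G d b) * det3 t else 0)"
      unfolding Ti by (intro sum.cong) auto
    finally have "(if a = d then det3 t else 0) = (\<Sum>b\<in>UNIV. M a b * G d b) * det3 t" unfolding X Ti by simp
    then show ?thesis using dt by (auto split: if_splits)
  qed
  have "val (gi' a b) (\<tau> z) = (\<Sum>d\<in>UNIV. (\<Sum>e\<in>UNIV. M a e * G d e) * val (gi' d b) (\<tau> z))"
    unfolding MG by (simp add: if_distrib[of "\<lambda>x. x * _"] cong: if_cong)
  also have "\<dots> = (\<Sum>e\<in>UNIV. M a e * (\<Sum>d\<in>UNIV. val (gi' d b) (\<tau> z) * G d e))"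
    by (simp add: sum_distrib_left sum_distrib_right mult_ac) (rule sum.swap)
  also have "\<dots> = M a b" unfolding B2 by (simp add: if_distrib[of "\<lambda>x. _ * x"] cong: if_cong)
  finally show ?thesis by (simp add: M_def t_def)
qed

lemma trace_t:
  assumes z: "z \<in> U" and S: "\<And>j k. S j k = (\<Sum>a\<in>UNIV. \<Sum>b\<in>UNIV. T a j z * cnj (T b k z) * S' a b)"
  shows "(\<Sum>j\<in>UNIV. \<Sum>k\<in>UNIV. val (gi j k) z * S j k) = (\<Sum>a\<in>UNIV. \<Sum>b\<in>UNIV. val (gi' a b) (\<tau> z) * S' a b)"
proof -
  have "(\<Sum>j\<in>UNIV. \<Sum>k\<in>UNIV. val (gi j k) z * S j k) = (\<Sum>j\<in>UNIV. \<Sum>k\<in>UNIV. \<Sum>a\<in>UNIV. \<Sum>b\<in>UNIV. T a j z * cnj (T b k z) * val (gi j k) z * S' a b)"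
    unfolding S by (simp add: sum_distrib_left mult_ac)
  also have "\<dots> = (\<Sum>a\<in>UNIV. \<Sum>b\<in>UNIV. \<Sum>j\<in>UNIV. \<Sum>k\<in>UNIV. T a j z * cnj (T b k z) * val (gi j k) z * S' a b)"
  proof -
    have "(\<Sum>j\<in>UNIV. \<Sum>k\<in>UNIV. \<Sum>a\<in>UNIV. \<Sum>b\<in>UNIV. T a j z * cnj (T b k z) * val (gi j k) z * S' a b)
      = (\<Sum>j\<in>UNIV. \<Sum>a\<in>UNIV. \<Sum>b\<in>UNIV. \<Sum>k\<in>UNIV. T a j z * cnj (T b k z) * val (gi j k) z * S' a b)"
      by (intro sum.cong refl sum3_rot)
    then show ?thesis using sum3_rot[of "\<lambda>j a b. \<Sum>k\<in>UNIV. T a j z * cnj (T b k z) * val (gi j k) z * S' a b"] by simp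
  qed
  also have "\<dots> = (\<Sum>a\<in>UNIV. \<Sum>b\<in>UNIV. val (gi' a b) (\<tau> z) * S' a b)"
    unfolding gi_t[OF z] by (simp add: sum_distrib_right)
  finally show ?thesis .
qed

lemma raise_t:
  assumes z: "z \<in> U" and S: "\<And>j. S j = (\<Sum>a\<in>UNIV. T a j z * S' a)"
  shows "(\<Sum>a\<in>UNIV. val (gi' a b) (\<tau> z) * S' a) = (\<Sum>k\<in>UNIV. cnj (T b k z) * (\<Sum>j\<in>UNIV. val (gi j k) z * S j))"
proof -
  have "(\<Sum>a\<in>UNIV. val (gi' a b) (\<tau> z) * S' a) = (\<Sum>a\<in>UNIV. \<Sum>j\<in>UNIV. \<Sum>k\<in>UNIV. cnj (T b k z) * (val (gi j k) z * (T a j z * S' a)))"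
    unfolding gi_t[OF z] by (simp add: sum_distrib_left sum_distrib_right mult_ac)
  also have "\<dots> = (\<Sum>k\<in>UNIV. \<Sum>j\<in>UNIV. \<Sum>a\<in>UNIV. cnj (T b k z) * (val (gi j k) z * (T a j z * S' a)))" by (rule sum3_swap13)
  finally show ?thesis unfolding S by (simp add: sum_distrib_left)
qed

lemma Wb_t:
  assumes z: "z \<in> U"
  shows "val (B.Wb b) (\<tau> z) = (\<Sum>k\<in>UNIV. cnj (T b k z) * val (A.Wb k) z)"
proof -
  have "val (dd j F) z = (\<Sum>a\<in>UNIV. T a j z * val (dd a F') (\<tau> z))" for j
    using d_scalar(1)[OF Ft z] by (simp add: mult.commute)
  from raise_t[OF z this, of b] show ?thesis unfolding A.upb_def B.upb_def by simp
qed

lemma W_t: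
  assumes z: "z \<in> U"
  shows "val (B.W b) (\<tau> z) = (\<Sum>k\<in>UNIV. T b k z * val (A.W k) z)"
  using arg_cong[OF Wb_t[OF z, of b], of cnj] by (simp add: A.W_def B.W_def)

lemma dWb_t:
  assumes z: "z \<in> U"
  shows "(\<Sum>a\<in>UNIV. T a j z * val (dd a (B.Wb b)) (\<tau> z)) = (\<Sum>k\<in>UNIV. cnj (T b k z) * val (dd j (A.Wb k)) z)"
proof -
  have "wd j (\<lambda>z. val (B.Wb b) (\<tau> z)) z = wd j (\<lambda>z. \<Sum>k\<in>UNIV. cnj (T b k z) * val (A.Wb k) z) z"
    by (rule wd_eq[OF z Wb_t])
  also have "\<dots> = (\<Sum>k\<in>UNIV. wd j (\<lambda>z. cnj (T b k z) * val (A.Wb k) z) z)"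
    by (rule wd_sum) (intro differentiable_mult cT[OF z] val_diff)
  also have "\<dots> = (\<Sum>k\<in>UNIV. cnj (T b k z) * val (dd j (A.Wb k)) z)"
    by (simp add: wirtinger_mult cT[OF z] val_diff)
  finally show ?thesis unfolding chain[OF z] by (simp add: mult.commute)
qed

text \<open>The factors \<open>T\<close> and the error term \<open>\<Lambda>0\<close> are
  holomorphic, hence invisible to \<open>db\<close>. This covers mixed Hessians, with error 0, as
  well as \<open>R\<close>.\<close>

lemma d2_t:
  assumes s: "\<And>z. z \<in> U \<Longrightarrow> X j z = \<Lambda>0 j z + (\<Sum>a\<in>UNIV. T a j z * val (X' a) (\<tau> z))"
    and L: "\<And>z. z \<in> U \<Longrightarrow> \<Lambda>0 j differentiable at z" "\<And>z. z \<in> U \<Longrightarrow> wdb k (\<Lambda>0 j) z = 0" and z: "z \<in> U"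
  shows "wdb k (X j) z = (\<Sum>a\<in>UNIV. \<Sum>b\<in>UNIV. T a j z * cnj (T b k z) * val (db b (X' a)) (\<tau> z))"
proof -
  have d: "(\<lambda>z. T a j z * val (X' a) (\<tau> z)) differentiable at z" for a
    by (intro differentiable_mult T(1)[OF z] chain[OF z])
  have "wdb k (X j) z = wdb k (\<lambda>z. \<Lambda>0 j z + (\<Sum>a\<in>UNIV. T a j z * val (X' a) (\<tau> z))) z"
    by (rule wd_eq(2)[OF z s])
  also have "\<dots> = (\<Sum>a\<in>UNIV. wdb k (\<lambda>z. T a j z * val (X' a) (\<tau> z)) z)"
    using wirtinger_add(2)[OF L(1)[OF z] wd_sum(3)[OF d], of k] wd_sum(2)[OF d, of k] L(2)[OF z] by simp
  also have "\<dots> = (\<Sum>a\<in>UNIV. T a j z * (\<Sum>b\<in>UNIV. val (db b (X' a)) (\<tau> z) * cnj (T b k z)))"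
    unfolding wirtinger_mult(2)[OF T(1)[OF z] chain(3)[OF z]] T(2)[OF z] chain(2)[OF z] by simp
  finally show ?thesis by (simp add: sum_distrib_left mult_ac)
qed

lemma box_t:
  assumes s: "\<And>z. z \<in> U \<Longrightarrow> val s z = val s' (\<tau> z)" and z: "z \<in> U"
  shows "val (A.box s) z = val (B.box s') (\<tau> z)"
proof -
  have "val (dd j (db k s)) z = (\<Sum>a\<in>UNIV. \<Sum>b\<in>UNIV. T a j z * cnj (T b k z) * val (dd a (db b s')) (\<tau> z))" for j k
    using d2_t[of "\<lambda>j. val (dd j s)" j "\<lambda>j z. 0" "\<lambda>a. dd a s'" k z, OF _ _ _ z] d_scalar(1)[OF s]
    by (simp add: dd_db mult.commute[of "T _ _ _"] differentiable_const wirtinger_const)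
  from trace_t[OF z this] show ?thesis by (simp add: A.box_def B.box_def)
qed

lemma Q_t: "z \<in> U \<Longrightarrow> val A.Q z = val B.Q (\<tau> z)"
  by (simp add: A.Q_def B.Q_def fit)

lemma phi_t:
  assumes z: "z \<in> U"
  shows "val A.phi z = val B.phi (\<tau> z)"
proof -
  have df: "val (db k f) z = (\<Sum>b\<in>UNIV. val (db b f') (\<tau> z) * cnj (T b k z))" for k
    by (rule d_scalar(2)[OF _ z]) (rule ft)
  have "(\<Sum>k\<in>UNIV. val (A.Wb k) z * val (db k f) z) = (\<Sum>k\<in>UNIV. \<Sum>b\<in>UNIV. (cnj (T b k z) * val (A.Wb k) z) * val (db b f') (\<tau> z))"
    unfolding df by (simp add: sum_distrib_left mult_ac)
  also have "\<dots> = (\<Sum>b\<in>UNIV. \<Sum>k\<in>UNIV. (cnj (T b k z) * val (A.Wb k) z) * val (db b f') (\<tau> z))"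
    by (rule sum.swap)
  also have "\<dots> = (\<Sum>b\<in>UNIV. val (B.Wb b) (\<tau> z) * val (db b f') (\<tau> z))"
    unfolding Wb_t[OF z] by (simp only: sum_distrib_right)
  finally have "val (A.appb A.Wb f) z = val (B.appb B.Wb f') (\<tau> z)" by (simp add: A.appb_def B.appb_def)
  then show ?thesis
    unfolding A.phi_def B.phi_def A.dvb_upb B.dvb_upb A.appY_swap B.appY_swap
    by (simp add: box_t[OF Ft z] Q_t[OF z])
qed

lemma psi_t:
  assumes z: "z \<in> U"
  shows "val (A.psi j) z = \<Lambda> j z + (\<Sum>a\<in>UNIV. T a j z * val (B.psi a) (\<tau> z))"
proof -
  have cP: "(\<lambda>z. cnj (P z)) differentiable at z" "wd k (\<lambda>z. cnj (P z)) z = 0" for k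
    using cnj_diff[OF P(1)[OF z]] wirtinger_cnj[OF P(1)[OF z]] P(2)[OF z] by auto
  have "wd j (val D) z = wd j (\<lambda>z. P z * cnj (P z) * val D' (\<tau> z)) z" by (rule wd_eq(1)[OF z Dt])
  also have "\<dots> = \<Lambda> j z * (P z * cnj (P z) * val D' (\<tau> z)) + P z * cnj (P z) * (\<Sum>a\<in>UNIV. val (dd a D') (\<tau> z) * T a j z)"
    by (simp add: wirtinger_mult differentiable_mult P(1,3)[OF z] cP chain[OF z] algebra_simps)
  also have "\<dots> = val D z * (\<Lambda> j z + (\<Sum>a\<in>UNIV. T a j z * val (B.psi a) (\<tau> z)))"
    unfolding Dt[OF z] B.dD B.psi_def[symmetric] by (simp add: sum_distrib_left algebra_simps)
  finally have "val (Di * dd j D) z = val (D * Di) z * (\<Lambda> j z + (\<Sum>a\<in>UNIV. T a j z * val (B.psi a) (\<tau> z)))"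
    by (simp add: mult_ac)
  then show ?thesis unfolding A.psi_D A.DDi by simp
qed

text \<open>\<open>Psi\<close> is not a tensor: passing to another chart adds
  \<open>\<Lambda>\<close>. That term is holomorphic, so it is gone after one application of
  \<open>db\<close>.\<close>

lemma R_t:
  assumes z: "z \<in> U"
  shows "val (A.R j k) z = (\<Sum>a\<in>UNIV. \<Sum>b\<in>UNIV. T a j z * cnj (T b k z) * val (B.R a b) (\<tau> z))"
proof -
  have "val (A.Psi j) z = \<Lambda> j z + (\<Sum>a\<in>UNIV. T a j z * val (B.Psi a) (\<tau> z))" if z: "z \<in> U" for z
    unfolding A.Psi_def B.Psi_def using d_scalar(1)[OF ft z, of j]
    by (simp add: psi_t[OF z] Q_t[OF z] sum.distrib sum_distrib_left algebra_simps)
  from d2_t[of "\<lambda>j. val (A.Psi j)" j \<Lambda>, OF this \<Lambda> z, of k] show ?thesis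
    by (simp add: A.R_def B.R_def)
qed

lemma cc_t:
  assumes z: "z \<in> U"
  shows "val (A.cc j) z = (\<Sum>a\<in>UNIV. T a j z * val (B.cc a) (\<tau> z))"
proof -
  have "(\<Sum>m\<in>UNIV. val (A.R j m) z * val (A.Wb m) z) = (\<Sum>m\<in>UNIV. \<Sum>a\<in>UNIV. \<Sum>b\<in>UNIV. T a j z * val (B.R a b) (\<tau> z) * (cnj (T b m z) * val (A.Wb m) z))"
    unfolding R_t[OF z] by (simp add: sum_distrib_left sum_distrib_right mult_ac)
  also have "\<dots> = (\<Sum>a\<in>UNIV. \<Sum>b\<in>UNIV. \<Sum>m\<in>UNIV. T a j z * val (B.R a b) (\<tau> z) * (cnj (T b m z) * val (A.Wb m) z))"
    by (rule sum3_rot)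
  also have "\<dots> = (\<Sum>a\<in>UNIV. T a j z * (\<Sum>b\<in>UNIV. val (B.R a b) (\<tau> z) * val (B.Wb b) (\<tau> z)))"
    unfolding Wb_t[OF z] by (simp add: sum_distrib_left mult_ac)
  finally show ?thesis
    unfolding A.cc_def B.cc_def using d_scalar(1)[OF phi_t z, of j]
    by (simp add: sum_subtractf right_diff_distrib mult.commute[of _ "T _ _ _"])
qed

text \<open>Every ingredient of \<open>V\<close> has now been seen to be a tensor. So
  \<open>V\<close> is a global field of type (0,1), and the boundary terms of adjacent charts become
  comparable.\<close>

theorem V_t:
  assumes z: "z \<in> U"
  shows "val (B.V b) (\<tau> z) = (\<Sum>m\<in>UNIV. cnj (T b m z) * val (A.V m) z)"
proof -
  have 1: "(\<Sum>a\<in>UNIV. val (B.W a) (\<tau> z) * val (dd a (B.Wb b)) (\<tau> z)) = (\<Sum>m\<in>UNIV. cnj (T b m z) * (\<Sum>j\<in>UNIV. val (A.W j) z * val (dd j (A.Wb m)) z))"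
  proof -
    have "(\<Sum>a\<in>UNIV. val (B.W a) (\<tau> z) * val (dd a (B.Wb b)) (\<tau> z)) = (\<Sum>a\<in>UNIV. \<Sum>j\<in>UNIV. val (A.W j) z * (T a j z * val (dd a (B.Wb b)) (\<tau> z)))"
      unfolding W_t[OF z] by (simp add: sum_distrib_left sum_distrib_right mult_ac)
    also have "\<dots> = (\<Sum>j\<in>UNIV. val (A.W j) z * (\<Sum>a\<in>UNIV. T a j z * val (dd a (B.Wb b)) (\<tau> z)))"
      by (subst sum.swap) (simp only: sum_distrib_left)
    also have "\<dots> = (\<Sum>j\<in>UNIV. \<Sum>m\<in>UNIV. cnj (T b m z) * (val (A.W j) z * val (dd j (A.Wb m)) z))"
      unfolding dWb_t[OF z] by (simp add: sum_distrib_left mult_ac)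
    also have "\<dots> = (\<Sum>m\<in>UNIV. \<Sum>j\<in>UNIV. cnj (T b m z) * (val (A.W j) z * val (dd j (A.Wb m)) z))" by (rule sum.swap)
    finally show ?thesis by (simp only: sum_distrib_left)
  qed
  have 2: "(\<Sum>a\<in>UNIV. val (gi' a b) (\<tau> z) * val (B.cc a) (\<tau> z)) = (\<Sum>m\<in>UNIV. cnj (T b m z) * (\<Sum>j\<in>UNIV. val (gi j m) z * val (A.cc j) z))"
    by (rule raise_t[OF z cc_t[OF z]])
  have "val (B.V b) (\<tau> z) = val v z * ((\<Sum>a\<in>UNIV. val (B.W a) (\<tau> z) * val (dd a (B.Wb b)) (\<tau> z)) - cnj (val F z) * (\<Sum>a\<in>UNIV. val (gi' a b) (\<tau> z) * val (B.cc a) (\<tau> z)))"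
    by (simp add: B.V_def vt[OF z] Ft[OF z])
  also have "\<dots> = (\<Sum>m\<in>UNIV. cnj (T b m z) * val (A.V m) z)"
    unfolding 1 2 A.V_def by (simp add: sum_subtractf sum_distrib_left algebra_simps)
  finally show ?thesis .
qed

end

section \<open>Integration over polydiscs\<close>

definition circ :: "(complex \<Rightarrow> 'b::euclidean_space) \<Rightarrow> 'b" where
  "circ \<phi> = integral (cbox 0 (2 * pi)) (\<lambda>\<theta>. \<phi> (cis \<theta>))"

text \<open>The integral over the unit disc in polar coordinates. On a rectangle, exchanging
  integrals only requires continuity of the integrand.\<close>

definition dint :: "(complex \<Rightarrow> 'b::euclidean_space) \<Rightarrow> 'b" where
  "dint \<phi> = integral (cbox (0, 0) (1, 2 * pi)) (\<lambda>s. fst s *\<^sub>R \<phi> (of_real (fst s) * cis (snd s)))"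

lemma integral_periodic_shift:
  fixes g :: "real \<Rightarrow> 'b::euclidean_space"
  assumes g: "continuous_on UNIV g" and per: "\<And>x. g (x + 2 * pi) = g x" and a: "0 \<le> a" "a \<le> 2 * pi"
  shows "integral {0..2 * pi} (\<lambda>x. g (x + a)) = integral {0..2 * pi} g"
proof -
  have i: "g integrable_on {x..y}" for x y
    by (rule integrable_continuous_real[OF continuous_on_subset[OF g]]) simp
  have s: "integral {x..y} (\<lambda>x. g (x + c)) = integral {x + c..y + c} g" for x y c
    using integral_shift_Icc_real[of x y g c] by (simp add: comp_def add.commute)
  have "integral {0..2 * pi} (\<lambda>x. g (x + a)) = integral {a..2 * pi + a} g" using s[of 0 "2 * pi" a] by simp
  also have "\<dots> = integral {a..2 * pi} g + integral {2 * pi..2 * pi + a} g"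
    using a by (intro Henstock_Kurzweil_Integration.integral_combine[symmetric] i) auto
  also have "integral {2 * pi..2 * pi + a} g = integral {0..a} g"
    using s[of 0 a "2 * pi"] by (simp add: per add.commute)
  also have "integral {a..2 * pi} g + integral {0..a} g = integral {0..2 * pi} g"
    using Henstock_Kurzweil_Integration.integral_combine[OF a i] by (simp add: add.commute)
  finally show ?thesis .
qed

lemma circ_rot:
  assumes "continuous_on UNIV \<phi>"
  shows "circ (\<lambda>t. \<phi> (t * cis a)) = circ \<phi>"
proof -
  define a' where "a' = Arg2pi (cis a)"
  have a': "0 \<le> a'" "a' \<le> 2 * pi" "cis a = cis a'"
    using Arg2pi[of "cis a"] by (auto simp: a'_def is_Arg_def cis_conv_exp)
  have c: "continuous_on UNIV (\<lambda>x. \<phi> (cis x))"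
    by (intro continuous_on_compose2[OF assms] continuous_intros) auto
  have p: "\<phi> (cis (x + 2 * pi)) = \<phi> (cis x)" for x by (simp add: cis_mult[symmetric])
  show ?thesis
    using integral_periodic_shift[OF c p a'(1,2)] by (simp add: circ_def a'(3) cis_mult)
qed

lemma circ_cnj:
  assumes "continuous_on UNIV \<phi>"
  shows "circ (\<lambda>t. \<phi> (cnj t)) = circ \<phi>"
proof -
  have c: "continuous_on UNIV (\<lambda>x. \<phi> (cis x))"
    by (intro continuous_on_compose2[OF assms] continuous_intros) auto
  have p: "\<phi> (cis (x + 2 * pi)) = \<phi> (cis x)" for x by (simp add: cis_mult[symmetric])
  have "integral {0..2 * pi} (\<lambda>x. \<phi> (cis (- x))) = integral {- (2 * pi)..- 0} (\<lambda>x. \<phi> (cis (- (- x))))"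
    by (rule Henstock_Kurzweil_Integration.integral_reflect_real[symmetric])
  also have "\<dots> = integral {0..2 * pi} (\<lambda>x. \<phi> (cis (x + - (2 * pi))))"
    using integral_shift_Icc_real[of 0 "2 * pi" "\<lambda>x. \<phi> (cis x)" "- (2 * pi)"] by (simp add: comp_def add.commute)
  also have "\<dots> = integral {0..2 * pi} (\<lambda>x. \<phi> (cis x))"
    using p[of "_ + - (2 * pi)"] by (intro integral_cong) simp
  finally show ?thesis by (simp add: circ_def cis_cnj)
qed

lemma continuous_polar: "continuous_on S (\<lambda>s::real \<times> real. complex_of_real (fst s) * cis (snd s))"
  by (intro continuous_intros)

lemma continuous_dint:
  fixes h :: "'a::topological_space \<Rightarrow> complex \<Rightarrow> 'b::euclidean_space"
  assumes "continuous_on UNIV (\<lambda>(x, t). h x t)"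
  shows "continuous_on UNIV (\<lambda>x. dint (h x))"
  unfolding dint_def
proof (rule integral_continuous_on_param)
  have "continuous_on (UNIV \<times> cbox (0, 0) (1, 2 * pi)) (\<lambda>p. (\<lambda>(x, t). h x t) (fst p, of_real (fst (snd p)) * cis (snd (snd p))))"
    by (intro continuous_on_compose2[OF assms] continuous_intros) auto
  then show "continuous_on (UNIV \<times> cbox (0, 0) (1, 2 * pi)) (\<lambda>(x, s). fst s *\<^sub>R h x (of_real (fst s) * cis (snd s)))"
    unfolding case_prod_unfold by (intro continuous_on_scaleR continuous_intros) simp
qed

lemma continuous_circ:
  fixes h :: "'a::topological_space \<Rightarrow> complex \<Rightarrow> 'b::euclidean_space"
  assumes "continuous_on UNIV (\<lambda>(x, t). h x t)"
  shows "continuous_on UNIV (\<lambda>x. circ (h x))"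
  unfolding circ_def
proof (rule integral_continuous_on_param)
  have "continuous_on (UNIV \<times> cbox 0 (2 * pi)) (\<lambda>p. (\<lambda>(x, t). h x t) (fst p, cis (snd p)))"
    by (intro continuous_on_compose2[OF assms] continuous_intros) auto
  then show "continuous_on (UNIV \<times> cbox 0 (2 * pi)) (\<lambda>(x, s). h x (cis s))"
    unfolding case_prod_unfold by simp
qed

lemma dint_integrable:
  fixes \<phi> :: "complex \<Rightarrow> 'b::euclidean_space"
  assumes "continuous_on UNIV \<phi>"
  shows "(\<lambda>s. fst s *\<^sub>R \<phi> (of_real (fst s) * cis (snd s))) integrable_on cbox (0, 0) (1, 2 * pi)"
  by (intro integrable_continuous continuous_on_scaleR continuous_on_compose2[OF assms continuous_polar] continuous_intros) auto

lemma dint_add: "continuous_on UNIV \<phi> \<Longrightarrow> continuous_on UNIV \<psi> \<Longrightarrow> dint (\<lambda>t. \<phi> t + \<psi> t) = dint \<phi> + dint \<psi>"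
  unfolding dint_def by (simp add: scaleR_right_distrib integral_add dint_integrable)

lemma dint_neg: "dint (\<lambda>t. - \<phi> t) = - dint \<phi>"
  unfolding dint_def by simp

lemma dint_linear:
  fixes L :: "'b::euclidean_space \<Rightarrow> 'c::euclidean_space"
  shows "bounded_linear L \<Longrightarrow> continuous_on UNIV \<phi> \<Longrightarrow> dint (\<lambda>t. L (\<phi> t)) = L (dint \<phi>)"
  unfolding dint_def using integral_linear[OF dint_integrable, of \<phi> L]
  by (simp add: comp_def linear_scale[OF bounded_linear.linear])

lemma dint_circ:
  assumes "continuous_on UNIV \<phi>"
  shows "dint \<phi> = integral (cbox 0 1) (\<lambda>r. r *\<^sub>R circ (\<lambda>t. \<phi> (of_real r * t)))"
proof -
  have "continuous_on (cbox (0, 0) (1, 2 * pi)) (\<lambda>s. fst s *\<^sub>R \<phi> (of_real (fst s) * cis (snd s)))"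
    by (intro continuous_on_scaleR continuous_on_compose2[OF assms continuous_polar] continuous_intros) auto
  from integral_prod_continuous[OF this] show ?thesis by (simp add: dint_def circ_def)
qed

lemma dint_rot:
  assumes "continuous_on UNIV \<phi>"
  shows "dint (\<lambda>t. \<phi> (t * cis a)) = dint \<phi>"
proof -
  have "continuous_on UNIV (\<lambda>t. \<phi> (t * cis a))" "continuous_on UNIV (\<lambda>t. \<phi> (of_real r * t))" for r
    by (intro continuous_on_compose2[OF assms] continuous_intros; simp)+
  then show ?thesis using circ_rot[of "\<lambda>t. \<phi> (of_real _ * t)" a]
    by (simp add: dint_circ assms mult.assoc)
qed

lemma dint_swap:
  fixes h :: "complex \<Rightarrow> complex \<Rightarrow> 'b::euclidean_space"
  assumes "continuous_on UNIV (\<lambda>(s, t). h s t)"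
  shows "dint (\<lambda>s. dint (\<lambda>t. h s t)) = dint (\<lambda>t. dint (\<lambda>s. h s t))"
proof -
  define H where "H p r = fst p *\<^sub>R fst r *\<^sub>R h (of_real (fst p) * cis (snd p)) (of_real (fst r) * cis (snd r))" for p r :: "real \<times> real"
  have "continuous_on UNIV (\<lambda>x::(real \<times> real) \<times> (real \<times> real). (\<lambda>(s, t). h s t) (of_real (fst (fst x)) * cis (snd (fst x)), of_real (fst (snd x)) * cis (snd (snd x))))"
    by (intro continuous_on_compose2[OF assms] continuous_intros) auto
  then have "continuous_on UNIV (\<lambda>(p, r). H p r)"
    unfolding H_def case_prod_unfold by (intro continuous_on_scaleR continuous_intros) simp
  then have c: "continuous_on S (\<lambda>(p, r). H p r)" for S by (rule continuous_on_subset) simp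
  have "dint (\<lambda>s. dint (\<lambda>t. h s t)) = integral (cbox (0, 0) (1, 2 * pi)) (\<lambda>p. integral (cbox (0, 0) (1, 2 * pi)) (\<lambda>r. H p r))"
    by (simp only: dint_def H_def integral_cmul)
  also have "\<dots> = integral (cbox (0, 0) (1, 2 * pi)) (\<lambda>r. integral (cbox (0, 0) (1, 2 * pi)) (\<lambda>p. H p r))"
    by (rule integral_swap_continuous[OF c])
  also have "\<dots> = dint (\<lambda>t. dint (\<lambda>s. h s t))"
  proof -
    have "H p r = fst r *\<^sub>R fst p *\<^sub>R h (of_real (fst p) * cis (snd p)) (of_real (fst r) * cis (snd r))" for p r
      unfolding H_def by (rule scaleR_left_commute)
    then show ?thesis by (simp only: dint_def integral_cmul)
  qed
  finally show ?thesis .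
qed

lemma circ_dint_swap:
  fixes h :: "complex \<Rightarrow> complex \<Rightarrow> 'b::euclidean_space"
  assumes "continuous_on UNIV (\<lambda>(s, t). h s t)"
  shows "dint (\<lambda>s. circ (\<lambda>t. h s t)) = circ (\<lambda>t. dint (\<lambda>s. h s t))"
proof -
  define H where "H p r = fst p *\<^sub>R h (of_real (fst p) * cis (snd p)) (cis r)" for p :: "real \<times> real" and r
  have "continuous_on UNIV (\<lambda>x::(real \<times> real) \<times> real. (\<lambda>(s, t). h s t) (of_real (fst (fst x)) * cis (snd (fst x)), cis (snd x)))"
    by (intro continuous_on_compose2[OF assms] continuous_intros) auto
  then have "continuous_on UNIV (\<lambda>(p, r). H p r)"
    unfolding H_def case_prod_unfold by (intro continuous_on_scaleR continuous_intros) simp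
  then have c: "continuous_on S (\<lambda>(p, r). H p r)" for S by (rule continuous_on_subset) simp
  have "dint (\<lambda>s. circ (\<lambda>t. h s t)) = integral (cbox (0, 0) (1, 2 * pi)) (\<lambda>p. integral (cbox 0 (2 * pi)) (\<lambda>r. H p r))"
    unfolding dint_def circ_def H_def by simp
  also have "\<dots> = integral (cbox 0 (2 * pi)) (\<lambda>r. integral (cbox (0, 0) (1, 2 * pi)) (\<lambda>p. H p r))"
    by (rule integral_swap_continuous[OF c])
  finally show ?thesis unfolding dint_def circ_def H_def by simp
qed

lemma dint_nonneg: "continuous_on UNIV \<phi> \<Longrightarrow> (\<And>t. 0 \<le> \<phi> t) \<Longrightarrow> 0 \<le> (dint \<phi> :: real)"
  unfolding dint_def by (rule integral_nonneg[OF dint_integrable]) (auto simp: cbox_Pair_eq)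

lemma dint_eq_0:
  fixes \<phi> :: "complex \<Rightarrow> real"
  assumes c: "continuous_on UNIV \<phi>" and nn: "\<And>t. 0 \<le> \<phi> t" and z: "dint \<phi> = 0" and t: "cmod t \<le> 1"
  shows "\<phi> t = 0"
proof -
  have cc: "continuous_on (cbox (0, 0) (1, 2 * pi)) (\<lambda>s. fst s *\<^sub>R \<phi> (of_real (fst s) * cis (snd s)))"
    by (intro continuous_on_scaleR continuous_on_compose2[OF c continuous_polar] continuous_intros) auto
  have *: "\<forall>s \<in> cbox (0, 0) (1, 2 * pi). fst s *\<^sub>R \<phi> (of_real (fst s) * cis (snd s)) = 0"
  proof -
    have "box (0::real, 0::real) (1, 2 * pi) \<noteq> {}" by (auto simp: box_ne_empty Basis_prod_def)
    moreover have "0 \<le> fst s *\<^sub>R \<phi> (of_real (fst s) * cis (snd s))" if "s \<in> cbox (0, 0) (1, 2 * pi)" for s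
      using that nn by (auto simp: cbox_Pair_eq)
    ultimately show ?thesis using integral_cbox_eq_0_iff[OF cc] z unfolding dint_def by blast
  qed
  have nz: "\<phi> t = 0" if "t \<noteq> 0" "cmod t \<le> 1" for t
  proof -
    have "t = of_real (cmod t) * cis (Arg2pi t)" using Arg2pi[of t] by (simp add: is_Arg_def cis_conv_exp)
    moreover have "(cmod t, Arg2pi t) \<in> cbox (0, 0) (1, 2 * pi)" using Arg2pi[of t] that by (auto simp: cbox_Pair_eq)
    ultimately show ?thesis using *[rule_format, of "(cmod t, Arg2pi t)"] that by simp
  qed
  show ?thesis
  proof (cases "t = 0")
    \<comment> \<open>The factor \<open>fst s\<close> vanishes at the centre, so the value there is
      recovered by continuity.\<close>
    case True
    have "(\<phi> \<longlongrightarrow> \<phi> 0) (at 0)" using c by (simp add: continuous_on_eq_continuous_at isCont_def)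
    moreover have "(\<phi> \<longlongrightarrow> 0) (at 0)"
      by (rule tendsto_eventually) (auto simp: eventually_at intro!: exI[of _ 1] nz)
    ultimately show ?thesis using LIM_unique True by blast
  qed (use nz t in auto)
qed

text \<open>Green's theorem in polar form: the radius times \<open>wdb c X\<close> is half the sum
  of \<open>Xr\<close>, the radial derivative of r exp(i \<theta>) X, and \<open>Xt\<close>, the
  angular derivative of i exp(i \<theta>) X. The second integrates to 0 by periodicity.\<close>

lemma disc_stokes:
  assumes X: "smooth X"
  shows "dint (\<lambda>t. wdb c X (put c t z)) = circ (\<lambda>t. X (put c t z) * t) / 2"
proof -
  define p where "p s = put c (of_real (fst s) * cis (snd s)) z" for s :: "real \<times> real"
  define A where "A s = wd c X (p s)" for s
  define B where "B s = wdb c X (p s)" for s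
  define Xr where "Xr s = X (p s) * cis (snd s) + of_real (fst s) * ((cis (snd s) * A s + cis (- snd s) * B s) * cis (snd s))" for s
  define Xt where "Xt s = - X (p s) * cis (snd s) + \<i> * cis (snd s) * (\<i> * of_real (fst s) * cis (snd s) * A s - \<i> * of_real (fst s) * cis (- snd s) * B s)" for s
  have pe: "p s = z + axis c (of_real (fst s) * cis (snd s) - z $ c)" for s by (simp add: p_def put_axis)
  have cp: "continuous_on S p" for S
    unfolding pe by (intro continuous_on_add continuous_on_const bounded_linear.continuous_on[OF bounded_linear_axis] continuous_intros)
  have cX: "continuous_on S (\<lambda>s. X (p s))" "continuous_on S A" "continuous_on S B" for S
    unfolding A_def B_def
    by (intro continuous_on_compose2[OF smooth_continuous[OF X, of UNIV] cp] continuous_on_compose2[OF smooth_continuous[OF smooth_wd[OF X], of UNIV] cp]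
       continuous_on_compose2[OF smooth_continuous[OF smooth_wdb[OF X], of UNIV] cp]; simp)+
  have cr: "continuous_on S Xr" and ct: "continuous_on S Xt" for S
    unfolding Xr_def Xt_def by (intro continuous_intros cX)+
  have dX: "X differentiable at w" for w by (rule smooth_differentiable[OF X])
  have hd: "((\<lambda>x. X (put c (\<gamma> x) z)) has_vector_derivative \<gamma>' * wd c X (put c (\<gamma> x) z) + cnj \<gamma>' * wdb c X (put c (\<gamma> x) z)) (at x within S)"
    if g: "(\<gamma> has_vector_derivative \<gamma>') (at x within S)" for \<gamma> \<gamma>' and x :: real and S
  proof -
    have "((\<lambda>x. (z - axis c (z $ c)) + axis c (\<gamma> x)) has_vector_derivative 0 + axis c \<gamma>') (at x within S)"
      by (intro has_vector_derivative_add has_vector_derivative_const bounded_linear.has_vector_derivative[OF bounded_linear_axis g])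
    moreover have "(z - axis c (z $ c)) + axis c (\<gamma> x) = put c (\<gamma> x) z" for x by (auto simp: vec_eq_iff axis_def)
    ultimately have "((\<lambda>x. put c (\<gamma> x) z) has_derivative (\<lambda>t. t *\<^sub>R axis c \<gamma>')) (at x within S)"
      by (simp add: has_vector_derivative_def)
    from has_derivative_compose[OF this, of X] smooth_has_derivative[OF X, of "put c (\<gamma> x) z"]
    have "((\<lambda>x. X (put c (\<gamma> x) z)) has_derivative (\<lambda>t. dir_deriv X (put c (\<gamma> x) z) (t *\<^sub>R axis c \<gamma>'))) (at x within S)"
      by blast
    then show ?thesis
      unfolding has_vector_derivative_def linear_scale[OF has_derivative_linear[OF smooth_has_derivative[OF X]]] dir_deriv_axis[OF dX] .
  qed
  have dcis: "(cis has_vector_derivative \<i> * cis \<theta>) (at \<theta> within S)" for \<theta> S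
    using exp_scaleR_has_vector_derivative_right[of \<i> \<theta> S]
    by (simp add: cis_conv_exp[abs_def] scaleR_conv_of_real mult.commute)
  have Ir: "integral (cbox 0 1) (\<lambda>r. Xr (r, \<theta>)) = X (put c (cis \<theta>) z) * cis \<theta>" for \<theta>
  proof -
    have "((\<lambda>r. Xr (r, \<theta>)) has_integral (of_real 1 * (X (p (1, \<theta>)) * cis \<theta>)) - (of_real 0 * (X (p (0, \<theta>)) * cis \<theta>))) {0..1}"
    proof (rule fundamental_theorem_of_calculus)
      fix r :: real
      have o: "(complex_of_real has_vector_derivative 1) (at r within {0..1})"
        by (auto intro!: derivative_eq_intros)
      have "((\<lambda>r. of_real r * cis \<theta>) has_vector_derivative 1 * cis \<theta>) (at r within {0..1})"
        by (rule has_vector_derivative_mult_left[OF o])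
      then have "((\<lambda>r. X (p (r, \<theta>))) has_vector_derivative cis \<theta> * A (r, \<theta>) + cis (- \<theta>) * B (r, \<theta>)) (at r within {0..1})"
        using hd[of "\<lambda>r. of_real r * cis \<theta>" "cis \<theta>" r "{0..1}"] by (simp add: p_def A_def B_def cis_cnj)
      from has_vector_derivative_mult[OF o has_vector_derivative_mult_left[OF this, of "cis \<theta>"]]
      show "((\<lambda>r. of_real r * (X (p (r, \<theta>)) * cis \<theta>)) has_vector_derivative Xr (r, \<theta>)) (at r within {0..1})"
        by (simp add: Xr_def add.commute)
    qed simp
    then show ?thesis by (simp add: integral_unique p_def)
  qed
  have It: "integral (cbox 0 (2 * pi)) (\<lambda>\<theta>. Xt (r, \<theta>)) = 0" for r
  proof -
    have "((\<lambda>\<theta>. Xt (r, \<theta>)) has_integral (\<i> * cis (2 * pi) * X (p (r, 2 * pi))) - (\<i> * cis 0 * X (p (r, 0)))) {0..2 * pi}"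
    proof (rule fundamental_theorem_of_calculus)
      fix \<theta> :: real
      have d1: "((\<lambda>\<theta>. \<i> * cis \<theta>) has_vector_derivative \<i> * (\<i> * cis \<theta>)) (at \<theta> within {0..2 * pi})"
        by (rule has_vector_derivative_mult_right[OF dcis])
      have "((\<lambda>\<theta>. of_real r * cis \<theta>) has_vector_derivative of_real r * (\<i> * cis \<theta>)) (at \<theta> within {0..2 * pi})"
        by (rule has_vector_derivative_mult_right[OF dcis])
      from hd[OF this]
      have "((\<lambda>\<theta>. X (p (r, \<theta>))) has_vector_derivative \<i> * of_real r * cis \<theta> * A (r, \<theta>) - \<i> * of_real r * cis (- \<theta>) * B (r, \<theta>)) (at \<theta> within {0..2 * pi})"
        by (simp add: p_def A_def B_def cis_cnj mult_ac)
      from has_vector_derivative_mult[OF d1 this]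
      show "((\<lambda>\<theta>. \<i> * cis \<theta> * X (p (r, \<theta>))) has_vector_derivative Xt (r, \<theta>)) (at \<theta> within {0..2 * pi})"
        by (simp add: Xt_def algebra_simps)
    qed simp
    then show ?thesis by (simp add: integral_unique p_def)
  qed
  have "dint (\<lambda>t. wdb c X (put c t z)) = integral (cbox (0, 0) (1, 2 * pi)) (\<lambda>s. (1/2) * Xr s + (1/2) * Xt s)"
    unfolding dint_def
  proof (rule integral_cong)
    fix s :: "real \<times> real"
    have c1: "cis (snd s) * cis (- snd s) = 1" by (simp add: cis_mult)
    have "Xr s + Xt s = 2 * of_real (fst s) * ((cis (snd s) * cis (- snd s)) * B s)"
      unfolding Xr_def Xt_def by (simp add: algebra_simps)
    then show "fst s *\<^sub>R wdb c X (put c (of_real (fst s) * cis (snd s)) z) = (1/2) * Xr s + (1/2) * Xt s"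
      unfolding c1 distrib_left[symmetric] by (simp add: B_def p_def scaleR_conv_of_real)
  qed
  also have "\<dots> = (1/2) * integral (cbox (0, 0) (1, 2 * pi)) Xr + (1/2) * integral (cbox (0, 0) (1, 2 * pi)) Xt"
    unfolding integral_mult_right[symmetric]
    by (intro integral_add integrable_continuous continuous_on_mult continuous_on_const cr ct)
  also have "integral (cbox (0, 0) (1, 2 * pi)) Xt = 0"
    unfolding integral_prod_continuous[OF ct] It by simp
  also have "integral (cbox (0, 0) (1, 2 * pi)) Xr = circ (\<lambda>t. X (put c t z) * t)"
  proof -
    have "integral (cbox (0, 0) (1, 2 * pi)) Xr = integral (cbox 0 (2 * pi)) (\<lambda>\<theta>. integral (cbox 0 1) (\<lambda>r. Xr (r, \<theta>)))"
      unfolding integral_prod_continuous[OF cr] by (rule integral_swap_continuous) (use cr in simp)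
    then show ?thesis unfolding Ir circ_def .
  qed
  finally show ?thesis by simp
qed

section \<open>Stokes' theorem on the unit polydisc\<close>

text \<open>The last argument is the coordinate \<open>c\<close>, so that the innermost integral of
  \<open>pint c\<close> runs along \<open>c\<close>; the others follow in cyclic order.\<close>

definition pt :: "3 \<Rightarrow> complex \<Rightarrow> complex \<Rightarrow> complex \<Rightarrow> complex^3" where
  "pt c s t r = put c r (put (nx (nx c)) t (put (nx c) s 0))"

definition pint :: "3 \<Rightarrow> (complex^3 \<Rightarrow> 'b::euclidean_space) \<Rightarrow> 'b" where
  "pint c h = dint (\<lambda>s. dint (\<lambda>t. dint (\<lambda>r. h (pt c s t r))))"

lemma nx_distinct: "nx c \<noteq> c" "nx (nx c) \<noteq> c" "nx (nx c) \<noteq> nx c" "nx (nx (nx c)) = c" "c \<noteq> nx c" "c \<noteq> nx (nx c)" "nx c \<noteq> nx (nx c)"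
  using exhaust_3[of c] by auto

lemma pt_rot: "pt c s t r = pt (nx c) t r s"
  unfolding pt_def nx_distinct using nx_distinct[of c] by (simp add: vec_eq_iff)

lemma continuous_pt: "continuous_on UNIV (\<lambda>p::complex \<times> complex \<times> complex. pt c (fst p) (fst (snd p)) (snd (snd p)))"
  unfolding pt_def put_axis
  by (intro continuous_on_add continuous_on_const bounded_linear.continuous_on[OF bounded_linear_axis] continuous_on_diff
     bounded_linear.continuous_on[OF bounded_linear_vec_nth] continuous_intros)

lemma continuous_pt_compose:
  assumes h: "continuous_on UNIV h" and "continuous_on S a" "continuous_on S b" "continuous_on S d"
  shows "continuous_on S (\<lambda>x. h (pt c (a x) (b x) (d x)))"
proof -
  have "continuous_on S (\<lambda>x. pt c (fst (a x, b x, d x)) (fst (snd (a x, b x, d x))) (snd (snd (a x, b x, d x))))"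
    by (rule continuous_on_compose2[OF continuous_pt]) (use assms in \<open>auto intro: continuous_intros\<close>)
  then show ?thesis by (intro continuous_on_compose2[OF h]) auto
qed

lemma pint_rot:
  assumes h: "continuous_on UNIV h"
  shows "pint c h = pint (nx c) h"
proof -
  note ch = continuous_pt_compose[OF h]
  have 1: "continuous_on UNIV (\<lambda>x. dint (\<lambda>r. h (pt c (fst x) (snd x) r)))"
    by (rule continuous_dint) (simp add: case_prod_unfold, intro ch continuous_intros)
  have "pint c h = dint (\<lambda>t. dint (\<lambda>s. dint (\<lambda>r. h (pt c s t r))))"
    unfolding pint_def by (rule dint_swap) (use 1 in \<open>simp add: case_prod_unfold\<close>)
  also have "\<dots> = dint (\<lambda>t. dint (\<lambda>r. dint (\<lambda>s. h (pt c s t r))))"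
  proof -
    have "dint (\<lambda>s. dint (\<lambda>r. h (pt c s t r))) = dint (\<lambda>r. dint (\<lambda>s. h (pt c s t r)))" for t
      by (rule dint_swap) (simp add: case_prod_unfold, intro ch continuous_intros)
    then show ?thesis by simp
  qed
  finally show ?thesis unfolding pint_def pt_rot[of c] .
qed

text \<open>Each term of a divergence can thus be integrated with its own coordinate innermost, as
  \<open>pint_stokes\<close> requires.\<close>

lemma pint_indep: "continuous_on UNIV h \<Longrightarrow> pint c h = pint d h"
  using pint_rot[of h 1] pint_rot[of h 2] pint_rot[of h 3] exhaust_3[of c] exhaust_3[of d] by auto

lemma pint_add:
  assumes h: "continuous_on UNIV h" "continuous_on UNIV k"
  shows "pint c (\<lambda>z. h z + k z) = pint c h + pint c k"
proof -
  note ch = continuous_pt_compose[OF h(1)] continuous_pt_compose[OF h(2)]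
  have 1: "continuous_on UNIV (\<lambda>r. h (pt c s t r))" "continuous_on UNIV (\<lambda>r. k (pt c s t r))" for s t
    by (intro ch continuous_intros)+
  have 2: "continuous_on UNIV (\<lambda>t. dint (\<lambda>r. h (pt c s t r)))" "continuous_on UNIV (\<lambda>t. dint (\<lambda>r. k (pt c s t r)))" for s
    by (rule continuous_dint, simp add: case_prod_unfold, intro ch continuous_intros)+
  have 3: "continuous_on UNIV (\<lambda>x. dint (\<lambda>r. h (pt c (fst x) (snd x) r)))" "continuous_on UNIV (\<lambda>x. dint (\<lambda>r. k (pt c (fst x) (snd x) r)))"
    by (rule continuous_dint, simp add: case_prod_unfold, intro ch continuous_intros)+
  have 4: "continuous_on UNIV (\<lambda>s. dint (\<lambda>t. dint (\<lambda>r. h (pt c s t r))))" "continuous_on UNIV (\<lambda>s. dint (\<lambda>t. dint (\<lambda>r. k (pt c s t r))))"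
    by (rule continuous_dint, use 3 in \<open>simp add: case_prod_unfold\<close>)+
  show ?thesis unfolding pint_def by (simp add: dint_add 1 2 4)
qed

lemma pint_linear:
  fixes L :: "'b::euclidean_space \<Rightarrow> 'c::euclidean_space"
  assumes L: "bounded_linear L" and h: "continuous_on UNIV h"
  shows "pint c (\<lambda>z. L (h z)) = L (pint c h)"
proof -
  note ch = continuous_pt_compose[OF h]
  have 1: "continuous_on UNIV (\<lambda>r. h (pt c s t r))" for s t
    by (intro ch continuous_intros)
  have 2: "continuous_on UNIV (\<lambda>t. dint (\<lambda>r. h (pt c s t r)))" for s
    by (rule continuous_dint, simp add: case_prod_unfold, intro ch continuous_intros)
  have 3: "continuous_on UNIV (\<lambda>x. dint (\<lambda>r. h (pt c (fst x) (snd x) r)))"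
    by (rule continuous_dint, simp add: case_prod_unfold, intro ch continuous_intros)
  have 4: "continuous_on UNIV (\<lambda>s. dint (\<lambda>t. dint (\<lambda>r. h (pt c s t r))))"
    by (rule continuous_dint, use 3 in \<open>simp add: case_prod_unfold\<close>)
  show ?thesis unfolding pint_def by (simp add: dint_linear[OF L] 1 2 4)
qed

lemma pint_nonneg_zero:
  fixes h :: "complex^3 \<Rightarrow> real"
  assumes h: "continuous_on UNIV h" and nn: "\<And>z. 0 \<le> h z"
  shows "0 \<le> pint c h" "pint c h = 0 \<Longrightarrow> (\<And>i. cmod (z $ i) \<le> 1) \<Longrightarrow> h z = 0"
proof -
  note ch = continuous_pt_compose[OF h]
  have 1: "continuous_on UNIV (\<lambda>r. h (pt c s t r))" for s t
    by (intro ch continuous_intros)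
  have 2: "continuous_on UNIV (\<lambda>t. dint (\<lambda>r. h (pt c s t r)))" for s
    by (rule continuous_dint, simp add: case_prod_unfold, intro ch continuous_intros)
  have 3: "continuous_on UNIV (\<lambda>x. dint (\<lambda>r. h (pt c (fst x) (snd x) r)))"
    by (rule continuous_dint, simp add: case_prod_unfold, intro ch continuous_intros)
  have 4: "continuous_on UNIV (\<lambda>s. dint (\<lambda>t. dint (\<lambda>r. h (pt c s t r))))"
    by (rule continuous_dint, use 3 in \<open>simp add: case_prod_unfold\<close>)
  have n1: "0 \<le> dint (\<lambda>r. h (pt c s t r))" for s t by (rule dint_nonneg[OF 1 nn])
  have n2: "0 \<le> dint (\<lambda>t. dint (\<lambda>r. h (pt c s t r)))" for s by (rule dint_nonneg[OF 2 n1])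
  show "0 \<le> pint c h" unfolding pint_def by (rule dint_nonneg[OF 4 n2])
  assume p: "pint c h = 0" and z: "\<And>i. cmod (z $ i) \<le> 1"
  have "h (pt c (z $ nx c) (z $ nx (nx c)) (z $ c)) = 0"
    by (rule dint_eq_0[OF 1 nn dint_eq_0[OF 2 n1 dint_eq_0[OF 4 n2 p[unfolded pint_def] z] z] z])
  moreover have "pt c (z $ nx c) (z $ nx (nx c)) (z $ c) = z"
  proof -
    have "i = c \<or> i = nx c \<or> i = nx (nx c)" for i
      using exhaust_3[of i] exhaust_3[of c] by auto
    then show ?thesis using nx_distinct[of c] by (auto simp: pt_def vec_eq_iff)
  qed
  ultimately show "h z = 0" by simp
qed

definition flux :: "3 \<Rightarrow> (complex^3 \<Rightarrow> complex) \<Rightarrow> complex" where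
  "flux c X = circ (\<lambda>t. dint (\<lambda>s. dint (\<lambda>r. X (pt c s r t) * t)))"

lemma pint_stokes:
  assumes X: "smooth X"
  shows "pint c (wdb c X) = flux c X / 2"
proof -
  have cX: "continuous_on UNIV X" by (rule smooth_continuous[OF X])
  note ch = continuous_pt_compose[OF cX]
  have s: "dint (\<lambda>r. wdb c X (pt c s t r)) = circ (\<lambda>r. X (pt c s t r) * r) / 2" for s t
    unfolding pt_def by (rule disc_stokes[OF X])
  have 1: "continuous_on UNIV (\<lambda>t. circ (\<lambda>r. X (pt c s t r) * r))" for s
    by (rule continuous_circ, simp add: case_prod_unfold, intro continuous_on_mult ch continuous_intros)
  have 2: "continuous_on UNIV (\<lambda>x. circ (\<lambda>r. X (pt c (fst x) (snd x) r) * r))"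
    by (rule continuous_circ, simp add: case_prod_unfold, intro continuous_on_mult ch continuous_intros)
  have 3: "continuous_on UNIV (\<lambda>s. dint (\<lambda>t. circ (\<lambda>r. X (pt c s t r) * r)))"
    by (rule continuous_dint, use 2 in \<open>simp add: case_prod_unfold\<close>)
  have "pint c (wdb c X) = dint (\<lambda>s. dint (\<lambda>t. circ (\<lambda>r. X (pt c s t r) * r))) / 2"
    unfolding pint_def s
    by (simp add: dint_linear[OF bounded_linear_divide] 1 3)
  also have "dint (\<lambda>s. dint (\<lambda>t. circ (\<lambda>r. X (pt c s t r) * r))) = dint (\<lambda>s. circ (\<lambda>r. dint (\<lambda>t. X (pt c s t r) * r)))"
  proof -
    have "dint (\<lambda>t. circ (\<lambda>r. X (pt c s t r) * r)) = circ (\<lambda>r. dint (\<lambda>t. X (pt c s t r) * r))" for s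
      by (rule circ_dint_swap) (simp add: case_prod_unfold, intro continuous_on_mult ch continuous_intros)
    then show ?thesis by simp
  qed
  also have "\<dots> = circ (\<lambda>r. dint (\<lambda>s. dint (\<lambda>t. X (pt c s t r) * r)))"
  proof (rule circ_dint_swap)
    have "continuous_on UNIV (\<lambda>x. dint (\<lambda>t. X (pt c (fst x) t (snd x)) * snd x))"
      by (rule continuous_dint, simp add: case_prod_unfold, intro continuous_on_mult ch continuous_intros)
    then show "continuous_on UNIV (\<lambda>(s, r). dint (\<lambda>t. X (pt c s t r) * r))" by (simp add: case_prod_unfold)
  qed
  finally show ?thesis by (simp add: flux_def)
qed

text \<open>Across the face \<open>\<bar>z\<^sub>c\<bar> = 1\<close> the transition map reverses the angle of \<open>z\<^sub>c\<close> and rotates the other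
  coordinates by multiples of it.\<close>

lemma flux_cancel:
  assumes X: "continuous_on UNIV X" "continuous_on UNIV X'"
    and rel: "\<And>\<theta> s r. X' (pt c (s * cis (a * \<theta>)) (r * cis (b * \<theta>)) (cis (- \<theta>))) * cis (- \<theta>) = - X (pt c s r (cis \<theta>)) * cis \<theta>"
  shows "flux c X' = - flux c X"
proof -
  note ch = continuous_pt_compose[OF X(2)]
  define K where "K t = dint (\<lambda>s. dint (\<lambda>r. X' (pt c s r t) * t))" for t
  have K3: "continuous_on UNIV (\<lambda>x. dint (\<lambda>r. X' (pt c (snd x) r (fst x)) * fst x))"
    by (rule continuous_dint, simp add: case_prod_unfold, intro continuous_on_mult ch continuous_intros)
  have K: "continuous_on UNIV K" unfolding K_def
    by (rule continuous_dint) (use K3 in \<open>simp add: case_prod_unfold\<close>)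
  have K': "K (cnj (cis \<theta>)) = - dint (\<lambda>s. dint (\<lambda>r. X (pt c s r (cis \<theta>)) * cis \<theta>))" for \<theta>
  proof -
    have c1: "continuous_on UNIV (\<lambda>s. dint (\<lambda>r. X' (pt c s r (cis (- \<theta>))) * cis (- \<theta>)))"
      by (rule continuous_dint, simp add: case_prod_unfold, intro continuous_on_mult ch continuous_intros)
    have c2: "continuous_on UNIV (\<lambda>r. X' (pt c s r (cis (- \<theta>))) * cis (- \<theta>))" for s
      by (intro continuous_on_mult ch continuous_intros)
    have "K (cnj (cis \<theta>)) = dint (\<lambda>s. dint (\<lambda>r. X' (pt c (s * cis (a * \<theta>)) r (cis (- \<theta>))) * cis (- \<theta>)))"
      unfolding K_def cis_cnj by (rule dint_rot[OF c1, symmetric])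
    also have "\<dots> = dint (\<lambda>s. dint (\<lambda>r. X' (pt c (s * cis (a * \<theta>)) (r * cis (b * \<theta>)) (cis (- \<theta>))) * cis (- \<theta>)))"
      using dint_rot[OF c2, of _ "b * \<theta>"] by simp
    finally show ?thesis unfolding rel by (simp add: dint_neg)
  qed
  have "flux c X' = circ K" by (simp add: flux_def K_def[abs_def])
  also have "\<dots> = circ (\<lambda>t. K (cnj t))" by (rule circ_cnj[OF K, symmetric])
  also have "\<dots> = - flux c X"
    unfolding circ_def[of "\<lambda>t. K (cnj t)"] K' flux_def circ_def by simp
  finally show ?thesis .
qed

section \<open>The flips between adjacent charts\<close>

fun flip :: "3 \<Rightarrow> chart_index \<Rightarrow> chart_index" where
  "flip m (i, j, k) = (if m = 1 then \<not> i else i, if m = 2 then \<not> j else j, if m = 3 then \<not> k else k)"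

lemma flip_flip [simp]: "flip m (flip m \<alpha>) = \<alpha>" by (cases \<alpha>) auto

text \<open>Adjacent charts differ by a monomial map multiplying the \<open>l\<close>-th coordinate
  by this power of the \<open>m\<close>-th. The entry \<open>- 2\<close> for \<open>l = m\<close>
  encodes inversion in the same form as the rest; the other entries are read off from
  \<open>tower_transition\<close>.\<close>

fun fexp :: "nat \<Rightarrow> chart_index \<Rightarrow> 3 \<Rightarrow> 3 \<Rightarrow> int" where
  "fexp n (i, j, k) m l = (if l = m then - 2
     else if m = 2 \<and> l = 3 then (if k then 1 else - 1)
     else if m = 1 \<and> l = 2 then (if j then int n else - int n)
     else if m = 1 \<and> l = 3 then (if j then if k then - int n else int n else 0) else 0)"

definition ftau :: "nat \<Rightarrow> chart_index \<Rightarrow> 3 \<Rightarrow> complex^3 \<Rightarrow> complex^3" where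
  "ftau n \<alpha> m z = (\<chi> l. z $ l * (z $ m) powi fexp n \<alpha> m l)"

definition fjac :: "nat \<Rightarrow> chart_index \<Rightarrow> 3 \<Rightarrow> 3 \<Rightarrow> 3 \<Rightarrow> complex^3 \<Rightarrow> complex" where
  "fjac n \<alpha> m a j z = (if a = j then (if a = m then - 1 else 1) * (z $ m) powi fexp n \<alpha> m a
     else if j = m then z $ a * of_int (fexp n \<alpha> m a) * (z $ m) powi (fexp n \<alpha> m a - 1) else 0)"

lemma fexp_self [simp]: "fexp n \<alpha> m m = - 2" by (cases \<alpha>) simp

lemma powi_m2: "(x::complex) powi (- 2) = inverse x ^ 2"
  by (simp add: power_int_def)

lemma ftau_nth: "ftau n \<alpha> m z $ l = (if l = m then inverse (z $ m) else z $ l * (z $ m) powi fexp n \<alpha> m l)"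
  by (cases "z $ m = 0") (simp_all add: ftau_def powi_m2 power2_eq_square)

lemma overlap_flip: "tower_overlap \<alpha> (flip m \<alpha>) z \<longleftrightarrow> z $ m \<noteq> 0"
  using exhaust_3[of m] by (cases \<alpha>) (auto simp: tower_overlap_def)

lemma transition_flip:
  assumes "z $ m \<noteq> 0"
  shows "transition (tower_chart n) \<alpha> (flip m \<alpha>) z = ftau n \<alpha> m z"
proof -
  obtain i j k where \<alpha>: "\<alpha> = (i, j, k)" by (cases \<alpha>)
  have "tower_transition n \<alpha> (flip m \<alpha>) z = ftau n \<alpha> m z"
    using exhaust_3[of m] assms
    by (elim disjE; cases i; cases j; cases k)
      (simp_all add: \<alpha> tower_transition_def Let_def vec_eq_iff forall_3 ftau_nth swap_factor_def swap_coord_def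
        twist_def twist_factor_def power_int_minus)
  then show ?thesis using transition_tower_chart[of \<alpha> "flip m \<alpha>" z] assms by (simp add: overlap_flip)
qed

lemma open_coord_nz: "open {z::complex^3. z $ m \<noteq> 0}"
  by (intro open_Collect_neq continuous_intros)

lemma wirtinger_of_coord:
  assumes "(\<phi> has_field_derivative d) (at (z $ m))"
  shows "((\<lambda>z. \<phi> (z $ m)) has_derivative (\<lambda>u. d * u $ m)) (at z)"
    "(\<lambda>z. \<phi> (z $ m)) differentiable at z"
    "wd j (\<lambda>z. \<phi> (z $ m)) z = (if j = m then d else 0)" "wdb j (\<lambda>z. \<phi> (z $ m)) z = 0"
proof -
  have nth: "((\<lambda>z::complex^3. z $ m) has_derivative (\<lambda>u. u $ m)) (at z)"
    by (simp add: bounded_linear_imp_has_derivative bounded_linear_vec_nth)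
  from has_derivative_compose[OF this, of \<phi> "(*) d"] assms
  show 1: "((\<lambda>z. \<phi> (z $ m)) has_derivative (\<lambda>u. d * u $ m)) (at z)"
    by (simp add: has_field_derivative_def)
  then show "(\<lambda>z. \<phi> (z $ m)) differentiable at z" by (auto simp: differentiable_def)
  have "(\<lambda>u. d * u $ m) = (\<lambda>u. \<Sum>j\<in>UNIV. u $ j * (if j = m then d else 0) + cnj (u $ j) * 0)"
  proof
    fix u :: "complex^3"
    have "(\<Sum>j\<in>UNIV. u $ j * (if j = m then d else 0) + cnj (u $ j) * 0) = (\<Sum>j\<in>UNIV. if j = m then d * u $ m else 0)"
      by (intro sum.cong) auto
    then show "d * u $ m = (\<Sum>j\<in>UNIV. u $ j * (if j = m then d else 0) + cnj (u $ j) * 0)" by simp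
  qed
  with 1 have "((\<lambda>z. \<phi> (z $ m)) has_derivative (\<lambda>u. \<Sum>j\<in>UNIV. u $ j * (if j = m then d else 0) + cnj (u $ j) * 0)) (at z)" by simp
  from wirtinger_unique[OF this] show "wd j (\<lambda>z. \<phi> (z $ m)) z = (if j = m then d else 0)" "wdb j (\<lambda>z. \<phi> (z $ m)) z = 0" .
qed

lemma powi_deriv: "(x::complex) \<noteq> 0 \<Longrightarrow> ((\<lambda>x. x powi e) has_field_derivative of_int e * x powi (e - 1)) (at x)"
  using DERIV_power_int[of "\<lambda>x. x" 1 x UNIV e] by simp

lemma vec_nth_differentiable: "(\<lambda>z::complex^3. z $ a) differentiable at z"
  by (rule linear_imp_differentiable[OF bounded_linear.linear[OF bounded_linear_vec_nth]])

lemma holo_coord_powi: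
  assumes "z $ m \<noteq> 0"
  shows "(\<lambda>z::complex^3. c * (z $ m) powi e) differentiable at z" "wdb j (\<lambda>z. c * (z $ m) powi e) z = 0"
    "wd j (\<lambda>z. c * (z $ m) powi e) z = (if j = m then c * (of_int e * (z $ m) powi (e - 1)) else 0)"
proof -
  have "((\<lambda>x. c * x powi e) has_field_derivative c * (of_int e * (z $ m) powi (e - 1))) (at (z $ m))"
    by (rule DERIV_cmult[OF powi_deriv[OF assms]])
  from wirtinger_of_coord[OF this] show "(\<lambda>z::complex^3. c * (z $ m) powi e) differentiable at z" "wdb j (\<lambda>z. c * (z $ m) powi e) z = 0"
    "wd j (\<lambda>z. c * (z $ m) powi e) z = (if j = m then c * (of_int e * (z $ m) powi (e - 1)) else 0)" by auto
qed

lemma ftau_deriv: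
  assumes z: "z $ m \<noteq> 0"
  shows "(ftau n \<alpha> m has_derivative (\<lambda>u. \<chi> l. \<Sum>j\<in>UNIV. fjac n \<alpha> m l j z * u $ j)) (at z)"
proof -
  have nth: "((\<lambda>z::complex^3. z $ l) has_derivative (\<lambda>u. u $ l)) (at z)" for l
    by (simp add: bounded_linear_imp_has_derivative bounded_linear_vec_nth)
  have c: "((\<lambda>z. ftau n \<alpha> m z $ l) has_derivative (\<lambda>u. \<Sum>j\<in>UNIV. fjac n \<alpha> m l j z * u $ j)) (at z)" for l
  proof -
    let ?e = "fexp n \<alpha> m l"
    have "((\<lambda>z. z $ l * (z $ m) powi ?e) has_derivative (\<lambda>u. z $ l * ((of_int ?e * (z $ m) powi (?e - 1)) * u $ m) + u $ l * (z $ m) powi ?e)) (at z)"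
      by (rule has_derivative_mult[OF nth wirtinger_of_coord(1)[OF powi_deriv[OF z]]])
    moreover have "z $ l * ((of_int ?e * (z $ m) powi (?e - 1)) * u $ m) + u $ l * (z $ m) powi ?e = (\<Sum>j\<in>UNIV. fjac n \<alpha> m l j z * u $ j)" for u :: "complex^3"
    proof (cases "l = m")
      case True
      have "z $ m * (z $ m) powi (- 3) = (z $ m) powi (- 2)"
        using power_int_add[of "z $ m" 1 "- 3"] z by simp
      then have "z $ m * ((of_int (- 2) * (z $ m) powi (- 2 - 1)) * u $ m) + u $ m * (z $ m) powi (- 2) = - ((z $ m) powi (- 2) * u $ m)"
        by (simp add: algebra_simps)
      moreover have "(\<Sum>j\<in>UNIV. fjac n \<alpha> m m j z * u $ j) = (\<Sum>j\<in>UNIV. if j = m then - ((z $ m) powi (- 2) * u $ m) else 0)"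
        by (intro sum.cong) (auto simp: fjac_def)
      ultimately show ?thesis using True by simp
    next
      case False
      have "(\<Sum>j\<in>UNIV. fjac n \<alpha> m l j z * u $ j) = (\<Sum>j\<in>UNIV. (if j = l then (z $ m) powi ?e * u $ l else 0) + (if j = m then z $ l * of_int ?e * (z $ m) powi (?e - 1) * u $ m else 0))"
        using False by (intro sum.cong) (auto simp: fjac_def)
      then show ?thesis by (simp add: sum.distrib algebra_simps)
    qed
    ultimately show ?thesis by (simp add: ftau_def)
  qed
  have "((\<lambda>z. \<Sum>l\<in>UNIV. axis l (ftau n \<alpha> m z $ l)) has_derivative (\<lambda>u. \<Sum>l\<in>UNIV. axis l (\<Sum>j\<in>UNIV. fjac n \<alpha> m l j z * u $ j))) (at z)"
    by (intro has_derivative_sum bounded_linear.has_derivative[OF bounded_linear_axis] c)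
  moreover have "(\<Sum>l\<in>UNIV. axis l (w l)) = (\<chi> l. w l)" for w :: "3 \<Rightarrow> complex"
    using vec_sum_axis[of "\<chi> l. w l"] by simp
  ultimately show ?thesis by simp
qed

lemma fjac_holo:
  assumes z: "z $ m \<noteq> 0"
  shows "fjac n \<alpha> m a j differentiable at z" "wdb k (fjac n \<alpha> m a j) z = 0"
proof -
  have e: "fjac n \<alpha> m a j = (\<lambda>z. (if a = j then if a = m then - 1 else 1 else 0) * (z $ m) powi fexp n \<alpha> m a) \<or>
    fjac n \<alpha> m a j = (\<lambda>z. z $ a * (of_int (fexp n \<alpha> m a) * (z $ m) powi (fexp n \<alpha> m a - 1)))"
    by (auto simp: fjac_def fun_eq_iff)
  have d: "(\<lambda>z. z $ a * (of_int (fexp n \<alpha> m a) * (z $ m) powi (fexp n \<alpha> m a - 1))) differentiable at z"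
    by (rule differentiable_mult[OF vec_nth_differentiable holo_coord_powi(1)[OF z]])
  have w: "wdb k (\<lambda>z. z $ a * (of_int (fexp n \<alpha> m a) * (z $ m) powi (fexp n \<alpha> m a - 1))) z = 0"
    by (simp add: wirtinger_mult(2)[OF vec_nth_differentiable holo_coord_powi(1)[OF z]] wirtinger_nth holo_coord_powi(2)[OF z])
  show "fjac n \<alpha> m a j differentiable at z" "wdb k (fjac n \<alpha> m a j) z = 0"
    using e d w holo_coord_powi(1,2)[OF z] by (elim disjE; simp)+
qed

text \<open>Off the diagonal the Jacobian has entries in column \<open>m\<close> only, so its
  determinant is the product of the diagonal monomials. The sign comes from differentiating the
  inversion.\<close>

definition fdet :: "nat \<Rightarrow> chart_index \<Rightarrow> 3 \<Rightarrow> complex^3 \<Rightarrow> complex" where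
  "fdet n \<alpha> m z = - 1 * (z $ m) powi (\<Sum>l\<in>UNIV. fexp n \<alpha> m l)"

lemma det3_fjac: "z $ m \<noteq> 0 \<Longrightarrow> det3 (\<lambda>a j. fjac n \<alpha> m a j z) = fdet n \<alpha> m z"
  using exhaust_3[of m]
  by (elim disjE) (simp_all add: det3_def cof_def sum_3 fjac_def fdet_def power_int_add power_int_diff powi_m2 field_simps)

lemma fdet_nz: "z $ m \<noteq> 0 \<Longrightarrow> fdet n \<alpha> m z \<noteq> 0" by (simp add: fdet_def)

lemma fdet_unit: "cmod (z $ m) = 1 \<Longrightarrow> fdet n \<alpha> m z * cnj (fdet n \<alpha> m z) = 1"
proof -
  assume "cmod (z $ m) = 1"
  then have "cmod (fdet n \<alpha> m z) = 1" by (simp add: fdet_def norm_mult norm_power_int)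
  then show ?thesis by (metis complex_norm_square of_real_1 power_one)
qed

lemma det3_mult: "det3 (\<lambda>j k. \<Sum>a\<in>UNIV. \<Sum>b\<in>UNIV. T a j * S b k * g a b) = det3 T * det3 S * det3 (g :: 3 \<Rightarrow> 3 \<Rightarrow> complex)"
proof -
  have d: "det3 h = det (\<chi> i j. h i j)" for h :: "3 \<Rightarrow> 3 \<Rightarrow> complex"
    by (simp add: det3_def cof_def sum_3 det_3 algebra_simps)
  have "(\<chi> j k. \<Sum>a\<in>UNIV. \<Sum>b\<in>UNIV. T a j * S b k * g a b) = transpose (\<chi> i j. T i j) ** (\<chi> i j. g i j) ** (\<chi> i j. S i j)"
    by (simp add: matrix_matrix_mult_def transpose_def vec_eq_iff sum_distrib_left sum_distrib_right mult_ac)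
      (intro allI sum.swap)
  then show ?thesis unfolding d by (simp add: det_mul)
qed

section \<open>The unipotent vector field\<close>

text \<open>The fibre coordinate of \<open>E\<close> is translated by the section of \<open>\<O>(n)\<close> that reads \<open>1\<close> or
  \<open>z\<^sub>1\<^sup>n\<close> in the two charts of the base.\<close>

fun zvf :: "nat \<Rightarrow> chart_index \<Rightarrow> 3 \<Rightarrow> sfun" where
  "zvf n (i, j, k) l = (if l = 2 then (if j then - (coord 2 * coord 2) else 1) * (if i then coord 1 ^ n else 1)
     else if l = 3 \<and> j then (if k then 1 else - 1) * (coord 2 * coord 3) * (if i then coord 1 ^ n else 1) else 0)"

text \<open>Read in the real tangent space, the field \<open>bK\<close> is \<open>2\<i>\<close> times this field.\<close>

fun yvf :: "real \<Rightarrow> chart_index \<Rightarrow> 3 \<Rightarrow> sfun" where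
  "yvf b (i, j, k) l = (if l = 3 then cst (of_real ((if k then - b else b) / 2)) * coord 3 else 0)"

lemma val_power [simp]: "val (F ^ n) z = val F z ^ n" by (induction n) auto

lemma d_power: "db m (F ^ n) = of_nat n * F ^ (n - 1) * db m F" "dd m (F ^ n) = of_nat n * F ^ (n - 1) * dd m F"
proof -
  have "db m (F ^ Suc k) = of_nat (Suc k) * F ^ k * db m F" "dd m (F ^ Suc k) = of_nat (Suc k) * F ^ k * dd m F" for k
    by (induction k) (simp_all add: algebra_simps)
  then show "db m (F ^ n) = of_nat n * F ^ (n - 1) * db m F" "dd m (F ^ n) = of_nat n * F ^ (n - 1) * dd m F"
    by (cases n; simp)+
qed

lemma db_zvf: "db m (zvf n \<alpha> l) = 0"
  by (cases \<alpha>) (simp add: d_power)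

lemma db_yvf: "db m (yvf b \<alpha> l) = 0"
  by (cases \<alpha>) simp

lemma yz_commute: "(\<Sum>l\<in>UNIV. yvf b \<alpha> l * dd l (zvf n \<alpha> j)) = (\<Sum>l\<in>UNIV. zvf n \<alpha> l * dd l (yvf b \<alpha> j))"
  using exhaust_3[of j] by (cases \<alpha>; elim disjE) (auto simp: sum_3 d_power algebra_simps)

lemma zvf_flip:
  assumes z: "z $ m \<noteq> 0"
  shows "val (zvf n (flip m \<alpha>) a) (ftau n \<alpha> m z) = (\<Sum>j\<in>UNIV. fjac n \<alpha> m a j z * val (zvf n \<alpha> j) z)"
proof -
  obtain i j k where \<alpha>: "\<alpha> = (i, j, k)" by (cases \<alpha>)
  have p: "(z $ 1) powi int n * (z $ 1) powi - int n = 1" if "m = 1"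
    using z that by (simp add: power_int_minus)
  consider "m = 1" | "m = 2" | "m = 3" using exhaust_3[of m] by blast
  then show ?thesis
  proof cases
    case 1
    then show ?thesis using exhaust_3[of a] z
      by (elim disjE; cases i; cases j; cases k)
        (simp_all add: \<alpha> sum_3 fjac_def ftau_nth power_int_minus field_simps power_mult_distrib power_inverse)
  next
    case 2
    then show ?thesis using exhaust_3[of a] z
      by (elim disjE; cases j; cases k)
        (simp_all add: \<alpha> sum_3 fjac_def ftau_nth power_int_minus field_simps power2_eq_square powi_m2)
  next
    case 3
    then show ?thesis using exhaust_3[of a] z
      by (elim disjE; cases j; cases k)
        (simp_all add: \<alpha> sum_3 fjac_def ftau_nth power_int_minus field_simps power2_eq_square powi_m2)
  qed
qed

lemma yvf_flip:
  assumes z: "z $ m \<noteq> 0"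
  shows "val (yvf b (flip m \<alpha>) a) (ftau n \<alpha> m z) = (\<Sum>j\<in>UNIV. fjac n \<alpha> m a j z * val (yvf b \<alpha> j) z)"
proof -
  obtain i j k where \<alpha>: "\<alpha> = (i, j, k)" by (cases \<alpha>)
  show ?thesis using exhaust_3[of a] exhaust_3[of m] z
    by (elim disjE; cases j; cases k)
      (simp_all add: \<alpha> sum_3 fjac_def ftau_nth power_int_minus field_simps power2_eq_square powi_m2)
qed

lemma ftau_put_above:
  assumes "m \<noteq> c" "fexp n \<alpha> m m = - 2"
  shows "ftau n \<alpha> m (put c t z) = put c ((z $ m) powi fexp n \<alpha> m c * t) (ftau n \<alpha> m z)"
  using assms by (auto simp: vec_eq_iff ftau_nth)

lemma ftau_3: "ftau n \<alpha> 3 z = put 3 (inverse (z $ 3)) z"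
  by (cases \<alpha>) (simp add: vec_eq_iff ftau_nth forall_3)

lemma ftau_2: "z $ 3 = 0 \<Longrightarrow> ftau n \<alpha> 2 z = put 2 (inverse (z $ 2)) z"
  by (cases \<alpha>) (simp add: vec_eq_iff ftau_nth forall_3)

section \<open>The potential of the unipotent vector field\<close>

definition fibre_sol :: "3 \<Rightarrow> (complex^3 \<Rightarrow> complex) \<Rightarrow> (complex^3 \<Rightarrow> complex) \<Rightarrow> (complex^3 \<Rightarrow> complex) \<times> (complex^3 \<Rightarrow> complex) \<Rightarrow> bool" where
  "fibre_sol c b0 b1 G \<longleftrightarrow> smooth (fst G) \<and> smooth (snd G) \<and>
    (\<forall>z. z $ c \<noteq> 0 \<longrightarrow> fst G z = snd G (put c (inverse (z $ c)) z)) \<and>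
    (\<forall>z. wdb c (fst G) z = b0 z) \<and> (\<forall>z. wdb c (snd G) z = b1 z) \<and> (\<forall>z. fst G (put c 0 z) = 0)"

lemma wdb_diff:
  "smooth F \<Longrightarrow> smooth G \<Longrightarrow> wdb m (\<lambda>z. F z - G z) z = wdb m F z - wdb m G z"
proof -
  assume s: "smooth F" "smooth G"
  have "val (db m (mk_sfun F - mk_sfun G)) z = val (db m (mk_sfun F)) z - val (db m (mk_sfun G)) z" by simp
  moreover have "val (mk_sfun F - mk_sfun G) = (\<lambda>z. F z - G z)" by (rule ext) (simp add: val_mk s)
  ultimately show ?thesis by (simp only: val_simps(8) val_mk s)
qed

lemma wdb_commute: "smooth F \<Longrightarrow> wdb j (wdb k F) z = wdb k (wdb j F) z"
  by (rule wirtinger_commute(2))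

lemma wdb_put_scaled:
  assumes "smooth G"
  shows "wdb c (\<lambda>z. G (put c (\<kappa> * z $ c) w)) z = cnj \<kappa> * wdb c G (put c (\<kappa> * z $ c) w)"
proof -
  have "((\<lambda>z. put c (\<kappa> * z $ c) w) has_derivative (\<lambda>u. \<chi> l. \<Sum>j\<in>UNIV. (if l = c \<and> j = c then \<kappa> else 0) * u $ j)) (at z)"
  proof -
    have "((\<lambda>z. w + axis c (\<kappa> * z $ c - w $ c)) has_derivative (\<lambda>u. 0 + axis c (\<kappa> * u $ c - 0))) (at z)"
      by (intro has_derivative_add has_derivative_const bounded_linear.has_derivative[OF bounded_linear_axis]
         has_derivative_diff has_derivative_mult_right bounded_linear_imp_has_derivative[OF bounded_linear_vec_nth])
    moreover have "0 + axis c (\<kappa> * u $ c - 0) = (\<chi> l. \<Sum>j\<in>UNIV. (if l = c \<and> j = c then \<kappa> else 0) * u $ j)" for u :: "complex^3"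
    proof -
      have "(\<Sum>j\<in>UNIV. (if l = c \<and> j = c then \<kappa> else 0) * u $ j) = (\<Sum>j\<in>UNIV. if j = c then (if l = c then \<kappa> else 0) * u $ c else 0)" for l
        by (intro sum.cong) auto
      then show ?thesis by (auto simp: vec_eq_iff axis_def)
    qed
    ultimately show ?thesis by (simp add: put_axis)
  qed
  from wirtinger_chain(2)[OF this smooth_differentiable[OF assms]]
  have "wdb c (\<lambda>z. G (put c (\<kappa> * z $ c) w)) z = (\<Sum>l\<in>UNIV. wdb l G (put c (\<kappa> * z $ c) w) * cnj (if l = c \<and> c = c then \<kappa> else 0))" .
  also have "\<dots> = (\<Sum>l\<in>UNIV. if l = c then cnj \<kappa> * wdb c G (put c (\<kappa> * z $ c) w) else 0)"
    by (intro sum.cong) auto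
  finally show ?thesis by simp
qed

lemma isCont_slice: "smooth (F :: complex^3 \<Rightarrow> complex) \<Longrightarrow> isCont (\<lambda>t. F (put c (\<kappa> * t) z)) x"
proof -
  assume F: "smooth F"
  have "isCont (\<lambda>t. F (put c t z)) (\<kappa> * x)"
    using continuous_slice[OF smooth_continuous[OF F, of UNIV], of UNIV c z] by (auto simp: continuous_on_eq_continuous_at)
  then show ?thesis by (rule isCont_o2[rotated]) (intro continuous_intros)
qed

text \<open>The difference of \<open>F\<close> and the rescaled \<open>F'\<close> is holomorphic on
  a projective line, hence constant, and it vanishes at \<open>t = 0\<close>. \<open>K\<close> and
  \<open>K'\<close> are the expressions at infinity, where multiplication by \<open>\<kappa>\<close>
  becomes multiplication by its inverse.\<close>

lemma fibre_glue:
  assumes s: "smooth F" "smooth F'" "smooth K" "smooth K'" and \<kappa>: "\<kappa> \<noteq> 0"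
    and d: "\<And>t. wdb c F (put c t z) = cnj \<kappa> * wdb c F' (put c (\<kappa> * t) z')"
    and FK: "\<And>t. t \<noteq> 0 \<Longrightarrow> F (put c t z) = K (put c (inverse t) z)"
    and FK': "\<And>t. t \<noteq> 0 \<Longrightarrow> F' (put c t z') = K' (put c (inverse t) z')"
    and 0: "F (put c 0 z) = F' (put c 0 z')"
  shows "F (put c t z) = F' (put c (\<kappa> * t) z')" "K (put c t z) = K' (put c (inverse \<kappa> * t) z')"
proof -
  define u where "u w = F w - F' (put c (\<kappa> * w $ c) z')" for w
  define B where "B t = K (put c t z) - K' (put c (inverse \<kappa> * t) z')" for t
  have s': "smooth (\<lambda>w. F' (put c (\<kappa> * w $ c) z'))"
    by (rule smooth_compose[OF s(2) smooth_put[OF smooth_mult[OF smooth_const smooth_nth[OF smooth_ident]] smooth_const]])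
  have u: "smooth u" unfolding u_def by (rule smooth_diff[OF s(1) s'])
  have du: "wdb c u (put c t z) = 0" for t
    unfolding u_def using d[of t] by (simp add: wdb_diff[OF s(1) s'] wdb_put_scaled[OF s(2)])
  have cB: "isCont B 0" unfolding B_def
    using isCont_slice[OF s(3), where c=c and \<kappa>=1 and z=z and x=0] isCont_slice[OF s(4), where c=c and \<kappa>="inverse \<kappa>" and z=z' and x=0] by (intro continuous_intros) simp_all
  have uB: "u (put c t z) = B (inverse t)" if "t \<noteq> 0" for t
    unfolding u_def B_def using FK[OF that] FK'[of "\<kappa> * t"] that \<kappa> by (simp add: field_simps)
  have c: "u (put c t z) = B 0" for t by (rule fibre_const[OF u du cB uB])
  have B0: "B 0 = 0" using c[of 0] 0 by (simp add: u_def)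
  show "F (put c t z) = F' (put c (\<kappa> * t) z')" using c[of t] B0 by (simp add: u_def)
  show "K (put c t z) = K' (put c (inverse \<kappa> * t) z')"
  proof (cases "t = 0")
    case True
    then show ?thesis using B0 by (simp add: B_def)
  next
    case False
    then show ?thesis using uB[of "inverse t"] c[of "inverse t"] B0 by (simp add: B_def)
  qed
qed

locale tower_kaehler =
  fixes n :: nat and h :: "chart_index \<Rightarrow> (complex^3) metric"
  assumes n: "n \<ge> 1" and km: "kaehler_metric (tower_chart n) h"
begin

sublocale K: kaehler_local "h \<alpha>" for \<alpha>
proof
  show "smooth (\<lambda>z. h \<alpha> z u v)" for u v
    using conjunct1[OF km[unfolded kaehler_metric_def]] by (elim allE)
  show "bilinear (h \<alpha> z)" "h \<alpha> z u v = h \<alpha> z v u" "u \<noteq> 0 \<Longrightarrow> h \<alpha> z u u > 0" for z u v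
    using km unfolding kaehler_metric_def by blast+
  show "h \<alpha> z (\<i> *s u) (\<i> *s v) = h \<alpha> z u v" for z u v
    using km unfolding kaehler_metric_def by blast
  show "dir_deriv (\<lambda>x. kaehler_form (h \<alpha>) x v w) z u + dir_deriv (\<lambda>x. kaehler_form (h \<alpha>) x w u) z v +
        dir_deriv (\<lambda>x. kaehler_form (h \<alpha>) x u v) z w = 0" for u v w z
    using km unfolding kaehler_metric_def by blast
qed

lemma g_flip:
  assumes z: "z $ m \<noteq> 0"
  shows "val (K.g \<alpha> j k) z = (\<Sum>a\<in>UNIV. \<Sum>b\<in>UNIV. fjac n \<alpha> m a j z * cnj (fjac n \<alpha> m b k z) * val (K.g (flip m \<alpha>) a b) (ftau n \<alpha> m z))"
proof -
  let ?\<tau> = "transition (tower_chart n) \<alpha> (flip m \<alpha>)"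
  let ?J = "\<lambda>u. \<chi> l. \<Sum>j\<in>UNIV. fjac n \<alpha> m l j z * u $ j"
  have "tower_chart n \<alpha> z \<in> range (tower_chart n (flip m \<alpha>))"
    using z by (simp add: tower_chart_in_range overlap_flip)
  then have "h \<alpha> z u v = h (flip m \<alpha>) (?\<tau> z) (dir_deriv ?\<tau> z u) (dir_deriv ?\<tau> z v)" for u v
    using km unfolding kaehler_metric_def by blast
  moreover have "(?\<tau> has_derivative ?J) (at z)"
    by (rule has_derivative_transform_within_open[OF ftau_deriv[OF z] open_coord_nz[of m]])
      (use z in \<open>simp_all add: transition_flip\<close>)
  then have "frechet_derivative ?\<tau> (at z) = ?J" by (rule frechet_derivative_at[symmetric])
  ultimately have H: "h \<alpha> z u v = h (flip m \<alpha>) (ftau n \<alpha> m z) (?J u) (?J v)" for u v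
    by (simp add: transition_flip[OF z])
  have J: "?J (axis j c) = (\<chi> l. fjac n \<alpha> m l j z * c)" for j c
  proof -
    have "(\<Sum>i\<in>UNIV. fjac n \<alpha> m l i z * axis j c $ i) = (\<Sum>i\<in>UNIV. if i = j then fjac n \<alpha> m l j z * c else 0)" for l
      by (intro sum.cong) (auto simp: axis_def)
    then show ?thesis by simp
  qed
  define S where "S = (\<Sum>a\<in>UNIV. \<Sum>b\<in>UNIV. fjac n \<alpha> m a j z * cnj (fjac n \<alpha> m b k z) * val (K.g (flip m \<alpha>) a b) (ftau n \<alpha> m z))"
  have "h \<alpha> z (axis j 1) (axis k c) = Re (S * cnj c)" for c
  proof -
    have "h \<alpha> z (axis j 1) (axis k c) = Re (\<Sum>a\<in>UNIV. \<Sum>b\<in>UNIV. val (K.g (flip m \<alpha>) a b) (ftau n \<alpha> m z) * fjac n \<alpha> m a j z * cnj (fjac n \<alpha> m b k z * c))"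
      unfolding H J by (subst K.h_eq) simp
    then show ?thesis by (simp add: S_def sum_distrib_left sum_distrib_right mult_ac)
  qed
  from this[of 1] this[of \<i>] have "val (K.g \<alpha> j k) z = S" by (subst K.val_g) (simp add: complex_eq_iff)
  then show ?thesis unfolding S_def .
qed

text \<open>The form of type (0,1) that the metric pairs with \<open>Z\<close>; the potential of
  \<open>Z\<close> is its primitive for d-bar.\<close>

definition al :: "chart_index \<Rightarrow> 3 \<Rightarrow> sfun" where
  "al \<alpha> k = (\<Sum>j\<in>UNIV. K.g \<alpha> j k * zvf n \<alpha> j)"

lemma al_closed: "db l (al \<alpha> k) = db k (al \<alpha> l)"
  unfolding al_def by (simp add: db_zvf K.kahb[of l \<alpha> _ k])

lemma al_flip:
  assumes z: "z $ m \<noteq> 0"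
  shows "val (al \<alpha> k) z = (\<Sum>b\<in>UNIV. cnj (fjac n \<alpha> m b k z) * val (al (flip m \<alpha>) b) (ftau n \<alpha> m z))"
proof -
  have "val (al \<alpha> k) z = (\<Sum>j\<in>UNIV. \<Sum>a\<in>UNIV. \<Sum>b\<in>UNIV. cnj (fjac n \<alpha> m b k z) * (val (K.g (flip m \<alpha>) a b) (ftau n \<alpha> m z) * (fjac n \<alpha> m a j z * val (zvf n \<alpha> j) z)))"
    unfolding al_def by (simp add: g_flip[OF z] sum_distrib_left sum_distrib_right mult_ac)
  also have "\<dots> = (\<Sum>b\<in>UNIV. \<Sum>a\<in>UNIV. \<Sum>j\<in>UNIV. cnj (fjac n \<alpha> m b k z) * (val (K.g (flip m \<alpha>) a b) (ftau n \<alpha> m z) * (fjac n \<alpha> m a j z * val (zvf n \<alpha> j) z)))"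
    by (rule sum3_swap13)
  also have "\<dots> = (\<Sum>b\<in>UNIV. cnj (fjac n \<alpha> m b k z) * val (al (flip m \<alpha>) b) (ftau n \<alpha> m z))"
    unfolding al_def by (simp add: zvf_flip[OF z] sum_distrib_left)
  finally show ?thesis .
qed

lemma fjac_below: "c \<noteq> m \<Longrightarrow> (\<Sum>b\<in>UNIV. cnj (fjac n \<alpha> m b c z) * X b) = cnj ((z $ m) powi fexp n \<alpha> m c) * X c"
proof -
  assume c: "c \<noteq> m"
  have "(\<Sum>b\<in>UNIV. cnj (fjac n \<alpha> m b c z) * X b) = (\<Sum>b\<in>UNIV. if b = c then cnj ((z $ m) powi fexp n \<alpha> m c) * X c else 0)"
    using c by (intro sum.cong) (auto simp: fjac_def)
  then show ?thesis by simp
qed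

lemma al_flip3: "z $ 3 \<noteq> 0 \<Longrightarrow> val (al \<alpha> 3) z = val (al (flip 3 \<alpha>) 3) (put 3 (inverse (z $ 3)) z) * cnj (- (inverse (z $ 3))\<^sup>2)"
proof -
  assume z: "z $ 3 \<noteq> 0"
  have "fjac n \<alpha> 3 b 3 z = (if b = (3::3) then - (inverse (z $ 3))\<^sup>2 else 0)" for b
    using exhaust_3[of b] by (cases \<alpha>) (auto simp: fjac_def powi_m2)
  then have "val (al \<alpha> 3) z = (\<Sum>b\<in>UNIV. if b = (3::3) then val (al (flip 3 \<alpha>) 3) (put 3 (inverse (z $ 3)) z) * cnj (- (inverse (z $ 3))\<^sup>2) else 0)"
    unfolding al_flip[OF z] ftau_3 by (intro sum.cong) auto
  then show ?thesis by simp
qed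

text \<open>On \<open>z $ 3 = 0\<close>, a copy of the Hirzebruch surface, the Jacobian entry that
  mixes in the third component vanishes. There the form changes like a form on the surface.\<close>

lemma al_flip2: "z $ 2 \<noteq> 0 \<Longrightarrow> z $ 3 = 0 \<Longrightarrow> val (al \<alpha> 2) z = val (al (flip 2 \<alpha>) 2) (put 2 (inverse (z $ 2)) z) * cnj (- (inverse (z $ 2))\<^sup>2)"
proof -
  assume z: "z $ 2 \<noteq> 0" and z3: "z $ 3 = 0"
  have "fjac n \<alpha> 2 b 2 z = (if b = (2::3) then - (inverse (z $ 2))\<^sup>2 else 0)" for b
    using exhaust_3[of b] z3 by (cases \<alpha>) (auto simp: fjac_def powi_m2)
  then have "val (al \<alpha> 2) z = (\<Sum>b\<in>UNIV. if b = (2::3) then val (al (flip 2 \<alpha>) 2) (put 2 (inverse (z $ 2)) z) * cnj (- (inverse (z $ 2))\<^sup>2) else 0)"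
    unfolding al_flip[OF z] ftau_2[OF z3] by (intro sum.cong) auto
  then show ?thesis by simp
qed

lemma al_flip_other: "z $ m \<noteq> 0 \<Longrightarrow> c \<noteq> m \<Longrightarrow> val (al \<alpha> c) z = cnj ((z $ m) powi fexp n \<alpha> m c) * val (al (flip m \<alpha>) c) (ftau n \<alpha> m z)"
  by (simp add: al_flip fjac_below)

text \<open>For \<open>j = True\<close> all components of \<open>Z\<close> contain the factor
  \<open>coord 2\<close>. Thus 0 is a consistent initial value on \<open>C\<close>, and nothing has
  to be solved along \<open>C\<close>.\<close>

lemma al_C: "z $ 2 = 0 \<Longrightarrow> z $ 3 = 0 \<Longrightarrow> val (al (i, True, k) m) z = 0"
  by (simp add: al_def sum_3)

text \<open>A closed form is integrated along fibres of the tower: \<open>G1\<close> along the third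
  coordinate, starting from the surface \<open>z $ 3 = 0\<close>, and \<open>G2\<close> on that
  surface along the second coordinate, starting from \<open>C\<close>. Closedness makes the errors
  in the other directions holomorphic on the fibres, so they are decided by the initial values.
  Gluing over the base rests on the same rigidity.\<close>

theorem potential_exists:
  "\<exists>F. (\<forall>\<alpha>. smooth (F \<alpha>)) \<and> (\<forall>\<alpha> m z. wdb m (F \<alpha>) z = val (al \<alpha> m) z) \<and>
    (\<forall>\<alpha> m z. z $ m \<noteq> 0 \<longrightarrow> F \<alpha> z = F (flip m \<alpha>) (ftau n \<alpha> m z)) \<and>
    (\<forall>i z. z $ 2 = 0 \<longrightarrow> z $ 3 = 0 \<longrightarrow> F (i, True, False) z = 0)"
proof -
  have "\<exists>G. fibre_sol 3 (val (al (fst p, snd p, False) 3)) (val (al (fst p, snd p, True) 3)) G" for p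
    using fibre_solution[OF val_smooth[of "al (fst p, snd p, False) 3"] val_smooth[of "al (fst p, snd p, True) 3"], of 3]
      al_flip3[of _ "(fst p, snd p, False)"] by (simp add: fibre_sol_def)
  then obtain G where G: "fibre_sol 3 (val (al (fst p, snd p, False) 3)) (val (al (fst p, snd p, True) 3)) (G p)" for p
    by metis
  \<comment> \<open>The chart with \<open>j = True\<close> comes first in the pair because
    \<open>fibre_sol\<close> normalizes at the origin of the first coordinate, which here is the
    curve \<open>C\<close>.\<close>
  have "\<exists>G. fibre_sol 2 (\<lambda>z. val (al (i, True, False) 2) (put 3 0 z)) (\<lambda>z. val (al (i, False, False) 2) (put 3 0 z)) G" for i
  proof -
    have c: "put 3 0 (put 2 t z) = put 2 t (put 3 0 z)" for t z by (simp add: vec_eq_iff)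
    show ?thesis
      using fibre_solution[OF smooth_put0[OF val_smooth[of "al (i, True, False) 2"], of 3] smooth_put0[OF val_smooth[of "al (i, False, False) 2"], of 3], of 2]
       al_flip2[of "put 3 0 _" "(i, True, False)"] by (simp add: fibre_sol_def c)
  qed
  then obtain H where H: "fibre_sol 2 (\<lambda>z. val (al (i, True, False) 2) (put 3 0 z)) (\<lambda>z. val (al (i, False, False) 2) (put 3 0 z)) (H i)" for i
    by metis
  define G1 where "G1 \<alpha> = (case \<alpha> of (i, j, k) \<Rightarrow> if k then snd (G (i, j)) else fst (G (i, j)))" for \<alpha>
  define G2 where "G2 \<alpha> = (case \<alpha> of (i, j, k) \<Rightarrow> if j then fst (H i) else snd (H i))" for \<alpha> :: chart_index
  define F where "F \<alpha> z = G1 \<alpha> z + G2 \<alpha> (put 3 0 z)" for \<alpha> z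
  have p00: "put 3 0 (put 3 t z) = put 3 0 z" for t z by simp
  have s1: "smooth (G1 \<alpha>)" and s2: "smooth (G2 \<alpha>)" for \<alpha>
    using G H by (cases \<alpha>; auto simp: G1_def G2_def fibre_sol_def)+
  have s2': "smooth (\<lambda>z. G2 \<alpha> (put 3 0 z))" for \<alpha> by (rule smooth_put0[OF s2])
  have sF: "smooth (F \<alpha>)" for \<alpha> unfolding F_def by (rule smooth_add[OF s1 s2'])
  have G1d: "wdb 3 (G1 \<alpha>) z = val (al \<alpha> 3) z" for \<alpha> z
    using G[of "(fst \<alpha>, fst (snd \<alpha>))"] by (cases \<alpha>) (auto simp: G1_def fibre_sol_def)
  have G10: "G1 (i, j, False) (put 3 0 z) = 0" for i j z
    using G[of "(i, j)"] by (auto simp: G1_def fibre_sol_def)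
  have G1f: "G1 (i, j, False) z = G1 (i, j, True) (put 3 (inverse (z $ 3)) z)" if "z $ 3 \<noteq> 0" for i j z
    using G[of "(i, j)"] that by (auto simp: G1_def fibre_sol_def)
  have G1f': "G1 \<alpha> z = G1 (flip 3 \<alpha>) (put 3 (inverse (z $ 3)) z)" if z: "z $ 3 \<noteq> 0" for \<alpha> z
  proof -
    obtain i j k where \<alpha>: "\<alpha> = (i, j, k)" by (cases \<alpha>)
    show ?thesis using G1f[OF z, of i j] G1f[of "put 3 (inverse (z $ 3)) z" i j] z by (cases k) (simp_all add: \<alpha>)
  qed
  have G2k: "G2 (i, j, k) = G2 (i, j, k')" for i j k k' by (simp add: G2_def)
  have G2d: "wdb 2 (G2 (i, j, k)) z = val (al (i, j, False) 2) (put 3 0 z)" for i j k z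
    using H[of i] by (auto simp: G2_def fibre_sol_def)
  have G20: "G2 (i, True, k) (put 2 0 z) = 0" for i k z
    using H[of i] by (auto simp: G2_def fibre_sol_def)
  have G2f: "G2 (i, True, k) z = G2 (i, False, k) (put 2 (inverse (z $ 2)) z)" if "z $ 2 \<noteq> 0" for i k z
    using H[of i] that by (auto simp: G2_def fibre_sol_def)
  have wF: "wdb m (F \<alpha>) z = wdb m (G1 \<alpha>) z + (if m = 3 then 0 else wdb m (G2 \<alpha>) (put 3 0 z))" for m \<alpha> z
    unfolding F_def using wirtinger_add(2)[OF smooth_differentiable[OF s1] smooth_differentiable[OF s2']]
    by (simp add: wdb_put0[OF s2])
  \<comment> \<open>The defect in the base directions is holomorphic along the fibre, hence constant there.\<close>
  have D1: "wdb m (G1 (i, j, k)) z = val (al (i, j, k) m) z - val (al (i, j, False) m) (put 3 0 z)" if m: "m \<noteq> 3" for m i j k z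
  proof -
    define \<delta> where "\<delta> k w = wdb m (G1 (i, j, k)) w - val (al (i, j, k) m) w" for k w
    have s\<delta>: "smooth (\<delta> k)" for k unfolding \<delta>_def by (intro smooth_diff smooth_wdb s1 val_smooth)
    have h\<delta>: "wdb 3 (\<delta> k) w = 0" for k w
    proof -
      have "wdb 3 (\<delta> k) w = wdb 3 (wdb m (G1 (i, j, k))) w - wdb 3 (val (al (i, j, k) m)) w"
        unfolding \<delta>_def by (rule wdb_diff[OF smooth_wdb[OF s1] val_smooth])
      also have "wdb 3 (wdb m (G1 (i, j, k))) w = wdb m (wdb 3 (G1 (i, j, k))) w" by (rule wdb_commute[OF s1])
      also have "wdb 3 (G1 (i, j, k)) = val (al (i, j, k) 3)" by (rule ext) (rule G1d)
      also have "wdb m (val (al (i, j, k) 3)) w = wdb 3 (val (al (i, j, k) m)) w"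
        using arg_cong[OF al_closed[of m "(i, j, k)" 3], of "\<lambda>F. val F w"] by simp
      finally show ?thesis by simp
    qed
    have fl: "\<delta> False w = \<delta> True (put 3 (inverse (w $ 3)) w)" if w: "w $ 3 \<noteq> 0" for w
    proof -
      have "wdb m (G1 (i, j, False)) w = wdb m (\<lambda>w. G1 (i, j, True) (put 3 (inverse (w $ 3)) w)) w"
        by (rule wirtinger_cong(2)[OF open_coord_nz[of 3]]) (use w G1f in auto)
      also have "\<dots> = wdb m (G1 (i, j, True)) (put 3 (inverse (w $ 3)) w)"
        using m by (simp add: wdb_put_inverse[OF w s1])
      finally have 1: "wdb m (G1 (i, j, False)) w = wdb m (G1 (i, j, True)) (put 3 (inverse (w $ 3)) w)" .
      have "fexp n (i, j, False) 3 m = 0" using m by simp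
      then have "val (al (i, j, False) m) w = val (al (i, j, True) m) (put 3 (inverse (w $ 3)) w)"
        using al_flip_other[OF w m, of "(i, j, False)"] by (simp add: ftau_3)
      with 1 show ?thesis by (simp add: \<delta>_def)
    qed
    have 0: "\<delta> False (put 3 0 z) = - val (al (i, j, False) m) (put 3 0 z)"
    proof -
      have "wdb m (\<lambda>z. G1 (i, j, False) (put 3 0 z)) z = 0" unfolding G10 by (rule wirtinger_const)
      then have "wdb m (G1 (i, j, False)) (put 3 0 z) = 0" using m by (simp add: wdb_put0[OF s1])
      then show ?thesis by (simp add: \<delta>_def)
    qed
    have gl: "\<delta> False (put 3 t z) = 0 * t + \<delta> False (put 3 0 z)" "\<delta> True (put 3 t z) = \<delta> False (put 3 0 z)" for t
    proof -
      have k: "smooth (\<lambda>w::complex^3. \<delta> False (put 3 0 z))" by (rule smooth_const)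
      note g = fibre_glue[OF s\<delta>[of False] k s\<delta>[of True] k, of 1 3 z z]
      show "\<delta> False (put 3 t z) = 0 * t + \<delta> False (put 3 0 z)" "\<delta> True (put 3 t z) = \<delta> False (put 3 0 z)"
        using g[of t] fl[of "put 3 _ z"] by (simp_all add: h\<delta> wirtinger_const)
    qed
    have "\<delta> k z = - val (al (i, j, False) m) (put 3 0 z)"
      using gl[of "z $ 3"] 0 by (cases k) simp_all
    then show ?thesis by (simp add: \<delta>_def algebra_simps)
  qed
  \<comment> \<open>The defect argument of \<open>D1\<close>, one level down on the surface
    \<open>z $ 3 = 0\<close>. The defect vanishes on \<open>C\<close>, where \<open>G2\<close> is 0
    by normalization and the form is 0 by \<open>al_C\<close>.\<close>
  have D2: "wdb 1 (G2 (i, j, k)) (put 3 0 z) = val (al (i, j, False) 1) (put 3 0 z)" for i j k z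
  proof -
    define u where "u j w = wdb 1 (\<lambda>z. G2 (i, j, False) (put 3 0 z)) w - val (al (i, j, False) 1) (put 3 0 w)" for j w
    have su: "smooth (u j)" for j unfolding u_def by (intro smooth_diff smooth_wdb s2' smooth_put0[OF val_smooth])
    have hu: "wdb 2 (u j) w = 0" for j w
    proof -
      have "wdb 2 (u j) w = wdb 2 (wdb 1 (\<lambda>z. G2 (i, j, False) (put 3 0 z))) w - wdb 2 (\<lambda>w. val (al (i, j, False) 1) (put 3 0 w)) w"
        unfolding u_def by (rule wdb_diff[OF smooth_wdb[OF s2'] smooth_put0[OF val_smooth]])
      also have "wdb 2 (wdb 1 (\<lambda>z. G2 (i, j, False) (put 3 0 z))) w = wdb 1 (wdb 2 (\<lambda>z. G2 (i, j, False) (put 3 0 z))) w"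
        by (rule wdb_commute[OF s2'])
      also have "wdb 2 (\<lambda>z. G2 (i, j, False) (put 3 0 z)) = (\<lambda>z. val (al (i, j, False) 2) (put 3 0 z))"
        by (rule ext) (simp add: wdb_put0[OF s2] G2d)
      also have "wdb 1 (\<lambda>z. val (al (i, j, False) 2) (put 3 0 z)) w = wdb 2 (\<lambda>w. val (al (i, j, False) 1) (put 3 0 w)) w"
        using arg_cong[OF al_closed[of 1 "(i, j, False)" 2], of "\<lambda>F. val F (put 3 0 w)"] by (simp add: wdb_put0[OF val_smooth])
      finally show ?thesis by simp
    qed
    have cm: "put 3 0 (put 2 t w) = put 2 t (put 3 0 w)" for t and w :: "complex^3" by (simp add: vec_eq_iff)
    have fl: "u True w = u False (put 2 (inverse (w $ 2)) w)" if w: "w $ 2 \<noteq> 0" for w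
    proof -
      have "wdb 1 (\<lambda>z. G2 (i, True, False) (put 3 0 z)) w = wdb 1 (\<lambda>w. G2 (i, False, False) (put 3 0 (put 2 (inverse (w $ 2)) w))) w"
        by (rule wirtinger_cong(2)[OF open_coord_nz[of 2]]) (use w G2f[of "put 3 0 _"] in \<open>auto simp: cm\<close>)
      also have "\<dots> = wdb 1 (\<lambda>w. G2 (i, False, False) (put 3 0 w)) (put 2 (inverse (w $ 2)) w)"
        using wdb_put_inverse[OF w s2', of 1] by simp
      finally have 1: "wdb 1 (\<lambda>z. G2 (i, True, False) (put 3 0 z)) w = wdb 1 (\<lambda>w. G2 (i, False, False) (put 3 0 w)) (put 2 (inverse (w $ 2)) w)" .
      have "val (al (i, True, False) 1) (put 3 0 w) = val (al (i, False, False) 1) (put 3 0 (put 2 (inverse (w $ 2)) w))"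
        using al_flip_other[of "put 3 0 w" 2 1 "(i, True, False)"] w by (simp add: ftau_2 cm)
      with 1 show ?thesis by (simp add: u_def)
    qed
    have 0: "u True (put 2 0 z) = 0"
    proof -
      have "wdb 1 (\<lambda>z. G2 (i, True, False) (put 3 0 (put 2 0 z))) z = 0"
        unfolding cm G20 by (rule wirtinger_const)
      then have "wdb 1 (\<lambda>z. G2 (i, True, False) (put 3 0 z)) (put 2 0 z) = 0"
        using wdb_put0[OF s2', of 1 _ 2 z] by simp
      then show ?thesis by (simp add: u_def al_C)
    qed
    have gl: "u True (put 2 t z) = 0" "u False (put 2 t z) = 0" for t
    proof -
      have k: "smooth (\<lambda>w::complex^3. 0 :: complex)" by (rule smooth_const)
      note g = fibre_glue[OF su[of True] k su[of False] k, of 1 2 z z]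
      show "u True (put 2 t z) = 0" "u False (put 2 t z) = 0"
        using g[of t] fl[of "put 2 _ z"] 0 by (simp_all add: hu wirtinger_const)
    qed
    have "u j z = 0" using gl[of "z $ 2"] by (cases j) simp_all
    then show ?thesis using G2k[of i j k False] by (simp add: u_def wdb_put0[OF s2])
  qed
  have dF: "wdb m (F \<alpha>) z = val (al \<alpha> m) z" for \<alpha> m z
  proof -
    obtain i j k where \<alpha>: "\<alpha> = (i, j, k)" by (cases \<alpha>)
    show ?thesis using exhaust_3[of m] G1d[of \<alpha> z] D1[of m i j k z] D2[of i j k z] G2d[of i j k "put 3 0 z"]
      by (auto simp: wF \<alpha>)
  qed
  have FC: "F (i, True, False) z = 0" if "z $ 2 = 0" "z $ 3 = 0" for i z
  proof -
    have "put 3 0 z = z" "put 2 0 (put 3 0 z) = z" using that by (auto simp: vec_eq_iff)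
    then show ?thesis using G10[of i True z] G20[of i False "put 3 0 z"] by (simp add: F_def)
  qed
  have g3: "F \<alpha> z = F (flip 3 \<alpha>) (ftau n \<alpha> 3 z)" if "z $ 3 \<noteq> 0" for \<alpha> z
  proof -
    have "G2 (flip 3 \<alpha>) = G2 \<alpha>" by (cases \<alpha>) (simp add: G2_def)
    then show ?thesis using G1f'[OF that, of \<alpha>] by (simp add: F_def ftau_3)
  qed
  have g3': "F \<alpha> (put 3 t w) = F (flip 3 \<alpha>) (put 3 (inverse t) w)" if "t \<noteq> 0" for \<alpha> t w
    using g3[of "put 3 t w" \<alpha>] that by (simp add: ftau_3)
  \<comment> \<open>Two solutions over the same base point agree if they agree at one point of the fibre.\<close>
  have lift: "F (i, j, k) z = F (flip m (i, j, k)) (ftau n (i, j, k) m z)"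
    if z: "z $ m \<noteq> 0" and m: "m \<noteq> 3" and base: "F (i, j, False) (put 3 0 z) = F (flip m (i, j, False)) (put 3 0 (ftau n (i, j, False) m z))" for i j k m z
  proof -
    let ?\<alpha> = "(i, j, False)" and ?\<beta> = "(i, j, True)"
    let ?\<kappa> = "(z $ m) powi fexp n ?\<alpha> m 3"
    have \<kappa>: "?\<kappa> \<noteq> 0" using z by simp
    have f3: "flip 3 ?\<alpha> = ?\<beta>" "flip 3 (flip m ?\<alpha>) = flip m ?\<beta>" using m by auto
    have d: "wdb 3 (F ?\<alpha>) (put 3 t z) = cnj ?\<kappa> * wdb 3 (F (flip m ?\<alpha>)) (put 3 (?\<kappa> * t) (ftau n ?\<alpha> m z))" for t
      using al_flip_other[of "put 3 t z" m 3 ?\<alpha>] z m ftau_put_above[of m 3 n ?\<alpha> t z] by (simp add: dF del: flip.simps)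
    note g = fibre_glue[OF sF[of ?\<alpha>] sF[of "flip m ?\<alpha>"] sF[of ?\<beta>] sF[of "flip m ?\<beta>"] \<kappa> d
        g3'[of _ ?\<alpha> z, unfolded f3] g3'[of _ "flip m ?\<alpha>" "ftau n ?\<alpha> m z", unfolded f3] base, of "z $ 3"]
    show ?thesis
    proof (cases k)
      case False
      have "put 3 (?\<kappa> * z $ 3) (ftau n ?\<alpha> m z) = ftau n ?\<alpha> m z"
        using ftau_put_above[of m 3 n ?\<alpha> "z $ 3" z] m by simp
      with g(1) False show ?thesis by (simp del: flip.simps fexp.simps)
    next
      case True
      \<comment> \<open>In the chart at infinity of the third coordinate the fibres are identified
        by the inverse factor.\<close>
      have e: "fexp n ?\<beta> m 3 = - fexp n ?\<alpha> m 3" "fexp n ?\<beta> m 1 = fexp n ?\<alpha> m 1" "fexp n ?\<beta> m 2 = fexp n ?\<alpha> m 2"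
        using m by auto
      have "put 3 (inverse ?\<kappa> * z $ 3) (ftau n ?\<alpha> m z) = ftau n ?\<beta> m z"
        using m exhaust_3[of m] by (auto simp: vec_eq_iff forall_3 ftau_nth power_int_minus)
      with g(2) True show ?thesis by (simp del: flip.simps fexp.simps)
    qed
  qed
  have g2: "F \<alpha> z = F (flip 2 \<alpha>) (ftau n \<alpha> 2 z)" if z: "z $ 2 \<noteq> 0" for \<alpha> z
  proof -
    obtain i j k where \<alpha>: "\<alpha> = (i, j, k)" by (cases \<alpha>)
    have cm: "put 2 t (put 3 0 w) = put 3 0 (put 2 t w)" for t and w :: "complex^3" by (simp add: vec_eq_iff)
    have p: "put 3 0 (ftau n (i, j, False) 2 z) = put 2 (inverse (z $ 2)) (put 3 0 z)"
      by (simp add: vec_eq_iff forall_3 ftau_nth)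
    have e: "put 2 (z $ 2) (put 3 0 z) = put 3 0 z" by (simp add: vec_eq_iff)
    have "G2 (i, j, False) (put 3 0 z) = G2 (i, \<not> j, False) (put 2 (inverse (z $ 2)) (put 3 0 z))"
      using G2f[of "put 3 0 z" i False] G2f[of "put 2 (inverse (z $ 2)) (put 3 0 z)" i False] z e by (cases j) simp_all
    then have "F (i, j, False) (put 3 0 z) = F (flip 2 (i, j, False)) (put 3 0 (ftau n (i, j, False) 2 z))"
      unfolding F_def p00 p by (simp add: G10 p cm)
    then show ?thesis unfolding \<alpha> by (intro lift z) simp_all
  qed
  \<comment> \<open>The base flip is first compared on the surface \<open>z $ 3 = 0\<close>, along
    the second coordinate: on \<open>C\<close> both sides are 0 by \<open>FC\<close>, and
    \<open>fibre_glue\<close> spreads the equality. Then \<open>lift\<close> reaches the whole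
    chart.\<close>
  have g1: "F \<alpha> z = F (flip 1 \<alpha>) (ftau n \<alpha> 1 z)" if z: "z $ 1 \<noteq> 0" for \<alpha> z
  proof -
    obtain i j k where \<alpha>: "\<alpha> = (i, j, k)" by (cases \<alpha>)
    let ?z = "put 3 0 z"
    let ?\<alpha> = "(i, True, False)" and ?\<beta> = "(i, False, False)"
    let ?\<kappa> = "(z $ 1) powi fexp n ?\<alpha> 1 2"
    let ?z' = "ftau n ?\<alpha> 1 ?z"
    have \<kappa>: "?\<kappa> \<noteq> 0" using z by simp
    have z'3: "put 2 t ?z' $ 3 = 0" for t by (simp add: ftau_nth)
    have d: "wdb 2 (F ?\<alpha>) (put 2 t ?z) = cnj ?\<kappa> * wdb 2 (F (flip 1 ?\<alpha>)) (put 2 (?\<kappa> * t) ?z')" for t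
      using al_flip_other[of "put 2 t ?z" 1 2 ?\<alpha>] z ftau_put_above[of 1 2 n ?\<alpha> t ?z] by (simp add: dF del: flip.simps fexp.simps)
    have k1: "F ?\<alpha> (put 2 t ?z) = F ?\<beta> (put 2 (inverse t) ?z)" if "t \<noteq> 0" for t
      using g2[of "put 2 t ?z" ?\<alpha>] that by (simp add: ftau_2)
    have k2: "F (flip 1 ?\<alpha>) (put 2 t ?z') = F (flip 1 ?\<beta>) (put 2 (inverse t) ?z')" if "t \<noteq> 0" for t
      using g2[of "put 2 t ?z'" "flip 1 ?\<alpha>"] that ftau_2[OF z'3, of n "flip 1 ?\<alpha>"] by simp
    have 0: "F ?\<alpha> (put 2 0 ?z) = F (flip 1 ?\<alpha>) (put 2 0 ?z')"
      using FC[of "put 2 0 ?z" i] FC[of "put 2 0 ?z'" "\<not> i"] by (simp add: ftau_nth)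
    note g = fibre_glue[OF sF[of ?\<alpha>] sF[of "flip 1 ?\<alpha>"] sF[of ?\<beta>] sF[of "flip 1 ?\<beta>"] \<kappa> d k1 k2 0, of "z $ 2"]
    have "F (i, j, False) (put 3 0 z) = F (flip 1 (i, j, False)) (put 3 0 (ftau n (i, j, False) 1 z))"
    proof (cases j)
      case True
      have "put 2 (z $ 2) ?z = ?z" "put 2 (?\<kappa> * z $ 2) ?z' = put 3 0 (ftau n ?\<alpha> 1 z)"
        by (simp_all add: vec_eq_iff forall_3 ftau_nth)
      with g(1) True show ?thesis by (simp del: flip.simps fexp.simps)
    next
      case False
      have "put 2 (z $ 2) ?z = ?z" "put 2 (inverse ?\<kappa> * z $ 2) ?z' = put 3 0 (ftau n ?\<beta> 1 z)"
        by (simp_all add: vec_eq_iff forall_3 ftau_nth power_int_minus)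
      with g(2) False show ?thesis by (simp del: flip.simps fexp.simps)
    qed
    then show ?thesis unfolding \<alpha> by (intro lift z) simp_all
  qed
  have "F \<alpha> z = F (flip m \<alpha>) (ftau n \<alpha> m z)" if "z $ m \<noteq> 0" for \<alpha> m z
    using exhaust_3[of m] g1 g2 g3 that by blast
  then show ?thesis using sF dF FC by blast
qed

end

section \<open>Metrics of constant weighted scalar curvature\<close>

text \<open>Applying d-bar to the Poisson bracket of two potentials gives the lowered commutator of
  their fields, plus terms with derivatives of \<open>g\<close> that cancel by the symmetry
  \<open>kah\<close>.\<close>

lemma (in kaehler_chart) db_bracket_zero:
  assumes f: "\<And>k. db k f = (\<Sum>j\<in>UNIV. g j k * Y j)" and F: "\<And>k. db k F = (\<Sum>j\<in>UNIV. g j k * Z j)"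
    and Y: "\<And>m j. db m (Y j) = 0" and Z: "\<And>m j. db m (Z j) = 0"
    and YZ: "\<And>j. (\<Sum>l\<in>UNIV. Y l * dd l (Z j)) = (\<Sum>l\<in>UNIV. Z l * dd l (Y j))"
  shows "db m ((\<Sum>j\<in>UNIV. Y j * dd j F) - (\<Sum>j\<in>UNIV. Z j * dd j f)) = 0"
proof -
  have 1: "(\<Sum>j\<in>UNIV. A j * dd j (\<Sum>l\<in>UNIV. g l m * B l)) =
      (\<Sum>j\<in>UNIV. \<Sum>l\<in>UNIV. dd j (g l m) * (A j * B l)) + (\<Sum>l\<in>UNIV. g l m * (\<Sum>j\<in>UNIV. A j * dd j (B l)))" for A B :: "3 \<Rightarrow> sfun"
  proof -
    have "(\<Sum>j\<in>UNIV. A j * dd j (\<Sum>l\<in>UNIV. g l m * B l)) =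
      (\<Sum>j\<in>UNIV. \<Sum>l\<in>UNIV. dd j (g l m) * (A j * B l)) + (\<Sum>j\<in>UNIV. \<Sum>l\<in>UNIV. g l m * (A j * dd j (B l)))"
      by (simp add: sum_distrib_left sum.distrib algebra_simps)
    also have "(\<Sum>j\<in>UNIV. \<Sum>l\<in>UNIV. g l m * (A j * dd j (B l))) = (\<Sum>l\<in>UNIV. g l m * (\<Sum>j\<in>UNIV. A j * dd j (B l)))"
      by (subst sum.swap) (simp add: sum_distrib_left)
    finally show ?thesis .
  qed
  have "db m ((\<Sum>j\<in>UNIV. Y j * dd j F) - (\<Sum>j\<in>UNIV. Z j * dd j f)) =
      (\<Sum>j\<in>UNIV. Y j * dd j (\<Sum>l\<in>UNIV. g l m * Z l)) - (\<Sum>j\<in>UNIV. Z j * dd j (\<Sum>l\<in>UNIV. g l m * Y l))"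
    unfolding F[symmetric] f[symmetric] by (simp add: Y Z dd_db)
  also have "\<dots> = (\<Sum>j\<in>UNIV. \<Sum>l\<in>UNIV. dd j (g l m) * (Y j * Z l)) - (\<Sum>j\<in>UNIV. \<Sum>l\<in>UNIV. dd j (g l m) * (Z j * Y l))"
    unfolding 1 YZ by simp
  also have "(\<Sum>j\<in>UNIV. \<Sum>l\<in>UNIV. dd j (g l m) * (Z j * Y l)) = (\<Sum>j\<in>UNIV. \<Sum>l\<in>UNIV. dd j (g l m) * (Y j * Z l))"
    by (subst sum.swap) (simp add: kah[of _ _ m] mult_ac)
  finally show ?thesis by simp
qed

locale tower_weighted = tower_kaehler n h for n h +
  fixes b q c0 :: real and f :: "tower_point \<Rightarrow> real" and F :: "chart_index \<Rightarrow> sfun"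
  assumes f_smooth: "smooth (f \<circ> tower_chart n \<alpha>)"
    and f_pot: "kaehler_form (h \<alpha>) z (b *\<^sub>R tower_K n \<alpha> z) u = - dir_deriv (f \<circ> tower_chart n \<alpha>) z u"
    and f_pos: "f (tower_chart n \<alpha> z) > 0"
    and f_const: "weighted_scal (h \<alpha>) (\<lambda>z. b *\<^sub>R tower_K n \<alpha> z) (f \<circ> tower_chart n \<alpha>) q z = c0"
    and F_al: "db m (F \<alpha>) = al \<alpha> m"
    and F_flip: "z $ m \<noteq> 0 \<Longrightarrow> val (F \<alpha>) z = val (F (flip m \<alpha>)) (ftau n \<alpha> m z)"
    and F_C: "z $ 2 = 0 \<Longrightarrow> z $ 3 = 0 \<Longrightarrow> val (F (i, True, False)) z = 0"
begin

abbreviation fc where "fc \<alpha> \<equiv> f \<circ> tower_chart n \<alpha>"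

definition fs where "fs \<alpha> = mk_sfun (\<lambda>z. of_real (fc \<alpha> z))"
definition fsi where "fsi \<alpha> = mk_sfun (\<lambda>z. of_real (inverse (fc \<alpha> z)))"
definition fv where "fv \<alpha> = mk_sfun (\<lambda>z. of_real (fc \<alpha> z powr q))"

lemma fc_pos: "fc \<alpha> z > 0" by (simp add: f_pos)

lemma fc_nz: "fc \<alpha> z \<noteq> 0" using fc_pos[of \<alpha> z] by linarith

lemma val_fs: "val (fs \<alpha>) z = of_real (fc \<alpha> z)"
  unfolding fs_def by (subst val_mk[OF smooth_of_real[OF f_smooth]]) (rule refl)

lemma val_fsi: "val (fsi \<alpha>) z = of_real (inverse (fc \<alpha> z))"
  unfolding fsi_def by (subst val_mk[OF smooth_of_real[OF smooth_inverse[OF f_smooth fc_nz]]]) (rule refl)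

lemma val_fv: "val (fv \<alpha>) z = of_real (fc \<alpha> z powr q)"
  unfolding fv_def by (subst val_mk[OF smooth_of_real[OF smooth_powr[OF f_smooth fc_pos]]]) (rule refl)

lemma d_fs: "dir_deriv (val (fs \<alpha>)) z u = of_real (dir_deriv (fc \<alpha>) z u)"
proof -
  have "val (fs \<alpha>) = (\<lambda>z. of_real (fc \<alpha> z))" by (rule ext) (rule val_fs)
  then show ?thesis
    by (simp only: dir_deriv_compose_linear[OF bounded_linear_of_real smooth_differentiable[OF f_smooth]])
qed

lemma d_fv: "dir_deriv (val (fv \<alpha>)) z u = of_real q * val (fsi \<alpha>) z * dir_deriv (val (fs \<alpha>)) z u * val (fv \<alpha>) z"
proof -
  have e: "val (fv \<alpha>) = (\<lambda>z. of_real (fc \<alpha> z powr q))" by (rule ext) (rule val_fv)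
  have "((\<lambda>x. x powr q) has_field_derivative q * fc \<alpha> z powr (q - 1)) (at (fc \<alpha> z))"
    using fc_pos[of \<alpha> z] by (auto intro!: derivative_eq_intros)
  then have "((\<lambda>z. fc \<alpha> z powr q) has_derivative (\<lambda>u. q * fc \<alpha> z powr (q - 1) * dir_deriv (fc \<alpha>) z u)) (at z)"
    unfolding has_field_derivative_def
    by (rule has_derivative_compose[OF smooth_has_derivative[OF f_smooth]])
  then have "((\<lambda>z. complex_of_real (fc \<alpha> z powr q)) has_derivative (\<lambda>u. of_real (q * fc \<alpha> z powr (q - 1) * dir_deriv (fc \<alpha>) z u))) (at z)"
    by (rule has_derivative_of_real)
  then have "frechet_derivative (val (fv \<alpha>)) (at z) = (\<lambda>u. of_real (q * fc \<alpha> z powr (q - 1) * dir_deriv (fc \<alpha>) z u))"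
    unfolding e by (rule frechet_derivative_at[symmetric])
  moreover have "fc \<alpha> z powr (q - 1) = inverse (fc \<alpha> z) * fc \<alpha> z powr q"
    using fc_pos[of \<alpha> z] by (simp add: powr_diff divide_inverse)
  ultimately show ?thesis by (simp add: d_fs val_fsi val_fv)
qed

lemma tower_chart_flip: "z $ m \<noteq> 0 \<Longrightarrow> tower_chart n (flip m \<alpha>) (ftau n \<alpha> m z) = tower_chart n \<alpha> z"
proof -
  assume z: "z $ m \<noteq> 0"
  then have "tower_chart n \<alpha> z \<in> range (tower_chart n (flip m \<alpha>))"
    by (simp add: tower_chart_in_range overlap_flip)
  from f_inv_into_f[OF this] show ?thesis
    unfolding transition_flip[OF z, symmetric] transition_def comp_def .
qed

lemma fc_flip: "z $ m \<noteq> 0 \<Longrightarrow> fc (flip m \<alpha>) (ftau n \<alpha> m z) = fc \<alpha> z"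
  by (simp add: tower_chart_flip)

lemma iX: "\<i> *s (b *\<^sub>R tower_K n \<alpha> z) = (- 2) *\<^sub>R axis 3 (val (yvf b \<alpha> 3) z)"
proof -
  obtain i j k where \<alpha>: "\<alpha> = (i, j, k)" by (cases \<alpha>)
  show ?thesis
    by (cases k; simp add: \<alpha> tower_K_eq vec_eq_iff axis_def; simp add: scaleR_conv_of_real)
qed

lemma fc_deriv: "dir_deriv (fc \<alpha>) z u = 2 * h \<alpha> z (axis 3 (val (yvf b \<alpha> 3) z)) u"
  using f_pot[of \<alpha> z u] bilinear_lmul[OF K.bil, of \<alpha> z "- 2" "axis 3 (val (yvf b \<alpha> 3) z)" u]
  by (simp add: kaehler_form_def iX)

lemma db_fs: "db k (fs \<alpha>) = (\<Sum>j\<in>UNIV. K.g \<alpha> j k * yvf b \<alpha> j)"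
proof (rule sfun_eqI)
  fix z
  have y: "(\<Sum>j\<in>UNIV. val (K.g \<alpha> j k) z * val (yvf b \<alpha> j) z) = val (K.g \<alpha> 3 k) z * val (yvf b \<alpha> 3) z"
    by (cases \<alpha>) (simp add: sum_3)
  show "val (db k (fs \<alpha>)) z = val (\<Sum>j\<in>UNIV. K.g \<alpha> j k * yvf b \<alpha> j) z"
    unfolding val_simps val_sum y unfolding wdb_def d_fs fc_deriv by (simp add: K.h_axis complex_eq_iff)
qed

definition bracket where
  "bracket \<alpha> = (\<Sum>j\<in>UNIV. yvf b \<alpha> j * dd j (F \<alpha>)) - (\<Sum>j\<in>UNIV. zvf n \<alpha> j * dd j (fs \<alpha>))"

lemma db_bracket: "db m (bracket \<alpha>) = 0"
  unfolding bracket_def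
  by (rule K.db_bracket_zero) (simp_all only: db_fs F_al al_def db_yvf db_zvf yz_commute)

lemma scalar_flip:
  assumes s: "\<And>z. z $ m \<noteq> 0 \<Longrightarrow> val S z = val S' (ftau n \<alpha> m z)" and z: "z $ m \<noteq> 0"
  shows "val (dd j S) z = (\<Sum>a\<in>UNIV. val (dd a S') (ftau n \<alpha> m z) * fjac n \<alpha> m a j z)"
proof -
  have "wd j (val S) z = wd j (\<lambda>z. val S' (ftau n \<alpha> m z)) z"
    by (rule wirtinger_cong(1)[OF open_coord_nz[of m]]) (use z s in auto)
  then show ?thesis using wirtinger_chain(1)[OF ftau_deriv[OF z] val_diff[of S'], of j] by simp
qed

lemma bracket_flip:
  assumes z: "z $ m \<noteq> 0"
  shows "val (bracket \<alpha>) z = val (bracket (flip m \<alpha>)) (ftau n \<alpha> m z)"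
proof -
  have 1: "(\<Sum>j\<in>UNIV. p j * (\<Sum>a\<in>UNIV. s a * fjac n \<alpha> m a j z)) = (\<Sum>a\<in>UNIV. (\<Sum>j\<in>UNIV. fjac n \<alpha> m a j z * p j) * s a)"
    for p s :: "3 \<Rightarrow> complex"
    unfolding sum_distrib_left sum_distrib_right by (subst sum.swap) (simp add: mult_ac)
  have fs': "val (fs \<alpha>) z = val (fs (flip m \<alpha>)) (ftau n \<alpha> m z)" if "z $ m \<noteq> 0" for z
    unfolding val_fs fc_flip[OF that] ..
  have d: "val (dd j (fs \<alpha>)) z = (\<Sum>a\<in>UNIV. val (dd a (fs (flip m \<alpha>))) (ftau n \<alpha> m z) * fjac n \<alpha> m a j z)"
    "val (dd j (F \<alpha>)) z = (\<Sum>a\<in>UNIV. val (dd a (F (flip m \<alpha>))) (ftau n \<alpha> m z) * fjac n \<alpha> m a j z)" for j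
    by (rule scalar_flip[OF _ z], erule fs' F_flip)+
  show ?thesis unfolding bracket_def val_simps(4,6) val_sum d 1 yvf_flip[OF z] zvf_flip[OF z] ..
qed

text \<open>The bracket is a global holomorphic function. It is 0 on \<open>C\<close>, where both
  fields vanish, and constant on fibres, so the value 0 spreads from \<open>C\<close> to the surface
  \<open>z $ 3 = 0\<close> and from there to each chart. This provides the hypothesis
  \<open>YF\<close> of \<open>weighted_chart\<close>.\<close>

lemma bracket_zero: "bracket \<alpha> = 0"
proof (rule sfun_eqI)
  fix z
  have h: "wdb c (val (bracket \<alpha>)) z = 0" for c \<alpha> z
    using arg_cong[OF db_bracket[of c \<alpha>], of "\<lambda>F. val F z"] by simp
  have k: "smooth (\<lambda>w::complex^3. 0 :: complex)" by (rule smooth_const)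
  have g2: "val (bracket (i, j, False)) (put 3 0 z) = 0" for i j z
  proof -
    have f: "val (bracket (i, True, False)) (put 2 t (put 3 0 z)) = val (bracket (i, False, False)) (put 2 (inverse t) (put 3 0 z))" if "t \<noteq> 0" for t
      using bracket_flip[of "put 2 t (put 3 0 z)" 2 "(i, True, False)"] that by (simp add: ftau_2)
    have 0: "val (bracket (i, True, False)) (put 2 0 (put 3 0 z)) = 0"
      by (simp add: bracket_def sum_3)
    note g = fibre_glue[OF val_smooth[of "bracket (i, True, False)"] k val_smooth[of "bracket (i, False, False)"] k, of 1 2 "put 3 0 z" "put 3 0 z"]
    have "val (bracket (i, j, False)) (put 2 t (put 3 0 z)) = 0" for t
      using g(1)[of t, OF _ _ f _ 0] g(2)[of t, OF _ _ f _ 0] by (cases j) (simp_all add: h wirtinger_const)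
    moreover have "put 2 (z $ 2) (put 3 0 z) = put 3 0 z" by (simp add: vec_eq_iff)
    ultimately show ?thesis by metis
  qed
  obtain i j l where \<alpha>: "\<alpha> = (i, j, l)" by (cases \<alpha>)
  have f: "val (bracket (i, j, False)) (put 3 t z) = val (bracket (i, j, True)) (put 3 (inverse t) z)" if "t \<noteq> 0" for t
    using bracket_flip[of "put 3 t z" 3 "(i, j, False)"] that by (simp add: ftau_3)
  note g = fibre_glue[OF val_smooth[of "bracket (i, j, False)"] k val_smooth[of "bracket (i, j, True)"] k, of 1 3 z z]
  have "val (bracket \<alpha>) (put 3 t z) = 0" for t
    using g(1)[of t, OF _ _ f _ g2] g(2)[of t, OF _ _ f _ g2] by (cases l) (simp_all add: \<alpha> h wirtinger_const)
  from this[of "z $ 3"] show "val (bracket \<alpha>) z = val 0 z" by simp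
qed

sublocale L: weighted_chart "K.g \<alpha>" "K.gi \<alpha>" "K.D \<alpha>" "K.Di \<alpha>" "fs \<alpha>" "fsi \<alpha>" "fv \<alpha>" q "yvf b \<alpha>" "zvf n \<alpha>" "F \<alpha>" "of_real (- c0 / 4)" for \<alpha>
proof
  show "cj (fs \<alpha>) = fs \<alpha>" by (rule sfun_eqI) (simp only: val_simps val_fs complex_cnj_complex_of_real)
  show "cj (fv \<alpha>) = fv \<alpha>" by (rule sfun_eqI) (simp only: val_simps val_fv complex_cnj_complex_of_real)
  show "fs \<alpha> * fsi \<alpha> = 1"
    by (rule sfun_eqI) (simp only: val_simps val_fs val_fsi of_real_mult[symmetric] right_inverse[OF fc_nz] of_real_1)
  show "dd k (fv \<alpha>) = cst (of_real q) * fsi \<alpha> * dd k (fs \<alpha>) * fv \<alpha>" for k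
    by (rule sfun_eqI) (simp only: val_simps wd_def d_fv, simp add: algebra_simps diff_divide_distrib)
  show "db k (fs \<alpha>) = (\<Sum>j\<in>UNIV. K.g \<alpha> j k * yvf b \<alpha> j)" for k by (rule db_fs)
  show "db k (F \<alpha>) = (\<Sum>j\<in>UNIV. K.g \<alpha> j k * zvf n \<alpha> j)" for k by (simp only: F_al al_def)
  show "(\<Sum>j\<in>UNIV. yvf b \<alpha> j * dd j (F \<alpha>)) = (\<Sum>j\<in>UNIV. zvf n \<alpha> j * dd j (fs \<alpha>))"
    using bracket_zero[of \<alpha>] by (simp add: bracket_def)
qed (rule db_yvf db_zvf yz_commute)+

lemma val_2: "val 2 z = 2"
proof -
  have "val (1 + 1) z = 2" by (simp only: val_simps) simp
  then show ?thesis by simp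
qed

text \<open>Expanded, the left side is s + 2 (q/f) B + (q (q - 1)/f^2) N. As the scalar curvature is
  - 4 s, the Laplacian of f is - 4 B and the squared length of bK is 4 N (real parts understood),
  multiplication by - 4 f^2 gives exactly the weighted scalar curvature; hence the constant
  \<open>- c0 / 4\<close>.\<close>

lemma constant_trace: "L.trR \<alpha> + L.Q \<alpha> * L.theta \<alpha> = cst (of_real (- c0 / 4)) * fsi \<alpha> * fsi \<alpha>"
proof (rule sfun_eqI)
  fix z
  define s where "s = (\<Sum>j\<in>UNIV. \<Sum>k\<in>UNIV. K.gi \<alpha> j k * db k (K.psi \<alpha> j))"
  define B where "B = K.box \<alpha> (fs \<alpha>)"
  define N where "N = L.app (yvf b \<alpha>) (fs \<alpha>)"
  have up: "L.up \<alpha> (fs \<alpha>) = yvf b \<alpha>" by (rule ext) (rule L.upY)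
  have th: "L.theta \<alpha> = B + L.Q \<alpha> * N"
    using L.dv_up[of \<alpha> "fs \<alpha>"] unfolding L.theta_def up B_def N_def L.appYf .
  have tr: "L.trR \<alpha> = s + L.Q \<alpha> * B - L.Q \<alpha> * fsi \<alpha> * N"
  proof -
    have R: "L.R \<alpha> j k = db k (K.psi \<alpha> j) + L.Q \<alpha> * dd j (db k (fs \<alpha>)) - L.Q \<alpha> * fsi \<alpha> * db k (fs \<alpha>) * dd j (fs \<alpha>)" for j k
      unfolding L.R_def L.Psi_def by (simp add: L.Q_def L.dfib dd_db algebra_simps)
    have "L.trR \<alpha> = s + L.Q \<alpha> * B - (\<Sum>j\<in>UNIV. L.Q \<alpha> * fsi \<alpha> * (L.up \<alpha> (fs \<alpha>) j * dd j (fs \<alpha>)))"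
      unfolding L.trR_def s_def B_def K.box_def L.up_def R
      by (simp add: sum.distrib sum_subtractf sum_distrib_left sum_distrib_right algebra_simps)
    then show ?thesis unfolding up N_def L.app_def by (simp add: sum_distrib_left)
  qed
  show "val (L.trR \<alpha> + L.Q \<alpha> * L.theta \<alpha>) z = val (cst (of_real (- c0 / 4)) * fsi \<alpha> * fsi \<alpha>) z"
  proof (rule complex_eqI)
    have "cj (L.theta \<alpha>) = L.theta \<alpha>"
      unfolding L.theta_def L.cj_dv L.Yb_def[abs_def, symmetric] L.theta_Yb[symmetric] by (simp add: L.theta_def)
    then have "cj (L.trR \<alpha> + L.Q \<alpha> * L.theta \<alpha>) = L.trR \<alpha> + L.Q \<alpha> * L.theta \<alpha>"
      by (simp add: L.cj_trR L.cjQ)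
    from arg_cong[OF this, of "\<lambda>F. val F z"]
    show "Im (val (L.trR \<alpha> + L.Q \<alpha> * L.theta \<alpha>) z) = Im (val (cst (of_real (- c0 / 4)) * fsi \<alpha> * fsi \<alpha>) z)"
      by (simp add: val_fsi complex_eq_iff)
  next
    define x where "x = fc \<alpha> z"
    have x: "x > 0" unfolding x_def by (rule fc_pos)
    have X: "h \<alpha> z (b *\<^sub>R tower_K n \<alpha> z) (b *\<^sub>R tower_K n \<alpha> z) = 4 * Re (val N z)"
    proof -
      let ?y = "val (yvf b \<alpha> 3) z"
      have y: "(\<Sum>j\<in>UNIV. w j * val (yvf b \<alpha> j) z) = w 3 * ?y" for w
        by (cases \<alpha>) (simp add: sum_3)
      have "val (dd 3 (fs \<alpha>)) z = cnj (val (db 3 (fs \<alpha>)) z)"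
        using arg_cong[OF cj_d(2)[of 3 "fs \<alpha>"], of "\<lambda>F. val F z"] by (simp only: L.cjf val_simps(9))
      also have "\<dots> = val (K.g \<alpha> 3 3) z * cnj ?y"
        unfolding db_fs val_sum val_simps(6) y by (simp add: K.val_herm)
      finally have d: "val (dd 3 (fs \<alpha>)) z = val (K.g \<alpha> 3 3) z * cnj ?y" .
      have "h \<alpha> z (b *\<^sub>R tower_K n \<alpha> z) (b *\<^sub>R tower_K n \<alpha> z) = 4 * h \<alpha> z (axis 3 ?y) (axis 3 ?y)"
        unfolding K.Jinv[of \<alpha> z "b *\<^sub>R tower_K n \<alpha> z" "b *\<^sub>R tower_K n \<alpha> z", symmetric] iX
        by (simp only: bilinear_lmul[OF K.bil] bilinear_rmul[OF K.bil]) simp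
      also have "\<dots> = 4 * Re (val N z)"
        using y[of "\<lambda>j. val (dd j (fs \<alpha>)) z"] d
        by (simp only: K.h_axis N_def L.app_def val_sum val_simps(6)) (simp add: mult_ac)
      finally show ?thesis .
    qed
    define y where "y = inverse x"
    have xy: "x * y = 1" using x by (simp add: y_def)
    have "x\<^sup>2 * (- 4 * Re (val s z)) + 2 * q * x * (- 4 * Re (val B z)) - q * (q - 1) * (4 * Re (val N z)) = c0"
      using f_const[of \<alpha> z] unfolding weighted_scal_def X
      unfolding K.scal_eq K.laplacian_eq[OF ext[OF val_fs] f_smooth] s_def B_def x_def .
    then have "(- y * y / 4) * (x\<^sup>2 * (- 4 * Re (val s z)) + 2 * q * x * (- 4 * Re (val B z)) - q * (q - 1) * (4 * Re (val N z))) = - y * y / 4 * c0"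
      by (rule arg_cong)
    then have "(x * y) * (x * y) * Re (val s z) + 2 * q * (x * y) * y * Re (val B z) + q * (q - 1) * y * y * Re (val N z) = - c0 / 4 * y * y"
      by (simp add: power2_eq_square algebra_simps)
    then have "Re (val s z) + 2 * q * y * Re (val B z) + q * (q - 1) * y * y * Re (val N z) = - c0 / 4 * y * y"
      unfolding xy by simp
    then show "Re (val (L.trR \<alpha> + L.Q \<alpha> * L.theta \<alpha>) z) = Re (val (cst (of_real (- c0 / 4)) * fsi \<alpha> * fsi \<alpha>) z)"
      unfolding tr th by (simp add: val_2 L.Q_def val_fsi x_def[symmetric, unfolded comp_def] y_def[symmetric] algebra_simps)
  qed
qed

end

section \<open>Positivity of the integrand\<close>

text \<open>Subtracting the rank one matrix built from column \<open>p\<close> clears row and column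
  \<open>p\<close> and, by completing the square, leaves a form that is positive on the remaining
  indices \<open>S - {p}\<close>.\<close>

lemma cholesky_step:
  fixes M :: "3 \<Rightarrow> 3 \<Rightarrow> complex"
  assumes herm: "\<And>j k. cnj (M j k) = M k j"
    and pos: "\<And>u. u \<noteq> (\<lambda>_. 0) \<Longrightarrow> \<forall>j. j \<notin> S \<longrightarrow> u j = 0 \<Longrightarrow> Re (\<Sum>j\<in>UNIV. \<Sum>k\<in>UNIV. M j k * u j * cnj (u k)) > 0"
    and supp: "\<And>j k. j \<notin> S \<Longrightarrow> M j k = 0" and p: "p \<in> S"
  obtains e N where "\<And>j k. M j k = e j * cnj (e k) + N j k" "\<And>j k. cnj (N j k) = N k j"
    "\<And>u. u \<noteq> (\<lambda>_. 0) \<Longrightarrow> \<forall>j. j \<notin> S - {p} \<longrightarrow> u j = 0 \<Longrightarrow> Re (\<Sum>j\<in>UNIV. \<Sum>k\<in>UNIV. N j k * u j * cnj (u k)) > 0"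
    "\<And>j k. j \<notin> S - {p} \<Longrightarrow> N j k = (0 :: complex)"
proof -
  define Q where "Q M u = (\<Sum>j\<in>UNIV. \<Sum>k\<in>UNIV. M j k * u j * cnj (u k))" for M :: "3 \<Rightarrow> 3 \<Rightarrow> complex" and u :: "3 \<Rightarrow> complex"
  define a where "a = Re (M p p)"
  have Mpp: "M p p = of_real a" using herm[of p p] by (simp add: a_def complex_eq_iff)
  have "Q M (\<lambda>j. if j = p then 1 else 0) = M p p"
  proof -
    have "Q M (\<lambda>j. if j = p then 1 else 0) = (\<Sum>j\<in>UNIV. \<Sum>k\<in>UNIV. if k = p then if j = p then M p p else 0 else 0)"
      unfolding Q_def by (intro sum.cong refl) auto
    then show ?thesis by simp
  qed
  moreover have "Re (Q M (\<lambda>j. if j = p then 1 else 0)) > 0"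
    unfolding Q_def by (rule pos) (use p in \<open>auto simp: fun_eq_iff\<close>)
  ultimately have a: "a > 0" by (simp add: a_def)
  define e where "e j = M j p / of_real (sqrt a)" for j
  define N where "N j k = M j k - e j * cnj (e k)" for j k
  have ee: "e j * cnj (e k) = M j p * M p k / of_real a" for j k
  proof -
    have "complex_of_real (sqrt a) * complex_of_real (sqrt a) = of_real a"
      using a by (simp flip: of_real_mult)
    then show ?thesis by (simp add: e_def herm)
  qed
  have z: "N j k = 0" if "j \<notin> S - {p}" for j k
    using that a supp[of j] Mpp by (cases "j = p") (auto simp: N_def ee)
  have hN: "cnj (N j k) = N k j" for j k by (simp add: N_def herm)
  have "Re (Q N u) > 0" if u: "u \<noteq> (\<lambda>_. 0)" "\<forall>j. j \<notin> S - {p} \<longrightarrow> u j = 0" for u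
  proof -
    \<comment> \<open>\<open>c\<close> is chosen so that \<open>w\<close> is orthogonal to the
      \<open>p\<close>-th basis vector for \<open>M\<close>; then \<open>M\<close> takes on
      \<open>w\<close> the value that \<open>N\<close> takes on \<open>u\<close>.\<close>
    define c where "c = (\<Sum>j\<in>UNIV. M j p * u j) / of_real a"
    define w where "w j = u j - (if j = p then c else 0)" for j
    have up: "u p = 0" using u by blast
    obtain j where j: "u j \<noteq> 0" "j \<in> S - {p}" using u by (auto simp: fun_eq_iff)
    have w0: "w \<noteq> (\<lambda>_. 0)" using j by (auto simp: w_def fun_eq_iff)
    have "Re (Q M w) > 0" unfolding Q_def
      by (rule pos[OF w0]) (use u p in \<open>auto simp: w_def\<close>)
    moreover have "Q M w = Q N u"
    proof -
      have row: "(\<Sum>j\<in>UNIV. N j k * u j) = (\<Sum>j\<in>UNIV. M j k * w j)" for k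
      proof -
        have "(\<Sum>j\<in>UNIV. M j k * w j) = (\<Sum>j\<in>UNIV. M j k * u j) - (\<Sum>j\<in>UNIV. if j = p then M p k * c else 0)"
          unfolding sum_subtractf[symmetric] by (intro sum.cong) (auto simp: w_def algebra_simps)
        moreover have "(\<Sum>j\<in>UNIV. N j k * u j) = (\<Sum>j\<in>UNIV. M j k * u j) - M p k * c"
          unfolding N_def ee c_def by (simp add: left_diff_distrib right_diff_distrib sum_subtractf sum_divide_distrib sum_distrib_left mult_ac)
        ultimately show ?thesis by simp
      qed
      have q: "Q A x = (\<Sum>k\<in>UNIV. (\<Sum>j\<in>UNIV. A j k * x j) * cnj (x k))" for A x
        unfolding Q_def by (subst sum.swap) (simp add: sum_distrib_right)
      have "(\<Sum>j\<in>UNIV. M j p * w j) = 0" using row[of p] z[of p] hN[of p] by (metis (no_types, lifting) DiffD2 complex_cnj_zero insertI1 mult_zero_left sum.neutral)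
      then have "(\<Sum>j\<in>UNIV. M j k * w j) * cnj (w k) = (\<Sum>j\<in>UNIV. N j k * u j) * cnj (u k)" for k
        unfolding row by (auto simp: w_def)
      then show ?thesis unfolding q by simp
    qed
    ultimately show ?thesis by simp
  qed
  then show ?thesis using z hN by (intro that[of e N]) (auto simp: N_def Q_def)
qed

lemma cholesky:
  fixes M :: "3 \<Rightarrow> 3 \<Rightarrow> complex"
  assumes herm: "\<And>j k. cnj (M j k) = M k j"
    and pos: "\<And>u. u \<noteq> (\<lambda>_. 0) \<Longrightarrow> Re (\<Sum>j\<in>UNIV. \<Sum>k\<in>UNIV. M j k * u j * cnj (u k)) > 0"
  obtains E :: "3 \<Rightarrow> 3 \<Rightarrow> complex" where "\<And>j k. M j k = (\<Sum>p\<in>UNIV. E p j * cnj (E p k))"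
proof -
  obtain e1 N1 where 1: "\<And>j k. M j k = e1 j * cnj (e1 k) + N1 j k" "\<And>j k. cnj (N1 j k) = N1 k j"
    "\<And>u. u \<noteq> (\<lambda>_. 0) \<Longrightarrow> \<forall>j. j \<notin> UNIV - {1} \<longrightarrow> u j = 0 \<Longrightarrow> Re (\<Sum>j\<in>UNIV. \<Sum>k\<in>UNIV. N1 j k * u j * cnj (u k)) > 0"
    "\<And>j k. j \<notin> UNIV - {1} \<Longrightarrow> N1 j k = 0"
    by (rule cholesky_step[of M UNIV 1]) (use assms in auto)
  obtain e2 N2 where 2: "\<And>j k. N1 j k = e2 j * cnj (e2 k) + N2 j k" "\<And>j k. cnj (N2 j k) = N2 k j"
    "\<And>u. u \<noteq> (\<lambda>_. 0) \<Longrightarrow> \<forall>j. j \<notin> UNIV - {1} - {2} \<longrightarrow> u j = 0 \<Longrightarrow> Re (\<Sum>j\<in>UNIV. \<Sum>k\<in>UNIV. N2 j k * u j * cnj (u k)) > 0"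
    "\<And>j k. j \<notin> UNIV - {1} - {2} \<Longrightarrow> N2 j k = 0"
    by (rule cholesky_step[of N1 "UNIV - {1}" 2]) (use 1 in auto)
  obtain e3 N3 where 3: "\<And>j k. N2 j k = e3 j * cnj (e3 k) + N3 j k"
    "\<And>j k. j \<notin> UNIV - {1} - {2} - {3} \<Longrightarrow> N3 j k = 0"
    by (rule cholesky_step[of N2 "UNIV - {1} - {2}" 3]) (use 2 in auto)
  have "N3 j k = 0" for j k using 3(2)[of j k] exhaust_3[of j] by auto
  then have "M j k = e1 j * cnj (e1 k) + e2 j * cnj (e2 k) + e3 j * cnj (e3 k)" for j k
    by (simp add: 1 2 3)
  then show ?thesis
    by (intro that[of "\<lambda>p. if p = 1 then e1 else if p = 2 then e2 else e3"]) (simp add: sum_3)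
qed

text \<open>Factoring \<open>M\<close> as a Gram matrix turns the sum into a squared norm of \<open>B\<close>; this needs the
  symmetry of \<open>B\<close>.\<close>

lemma symmetric_trace_norm:
  fixes M N A B :: "3 \<Rightarrow> 3 \<Rightarrow> complex"
  assumes herm: "\<And>j k. cnj (M j k) = M k j"
    and pos: "\<And>u. u \<noteq> (\<lambda>_. 0) \<Longrightarrow> Re (\<Sum>j\<in>UNIV. \<Sum>k\<in>UNIV. M j k * u j * cnj (u k)) > 0"
    and A: "\<And>j m. A j m = (\<Sum>k\<in>UNIV. M j k * B k m)" and B: "\<And>k m. B k m = B m k"
    and N: "\<And>k m. (\<Sum>j\<in>UNIV. M j k * N j m) = (if k = m then 1 else 0)"
  obtains r :: real where "0 \<le> r" "(\<Sum>j\<in>UNIV. \<Sum>m\<in>UNIV. A j m * cnj (A m j)) = of_real r" "\<And>j m. r = 0 \<Longrightarrow> A j m = 0"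
proof -
  obtain E :: "3 \<Rightarrow> 3 \<Rightarrow> complex" where E: "\<And>j k. M j k = (\<Sum>p\<in>UNIV. E p j * cnj (E p k))"
    using cholesky[of M, OF herm pos] by blast
  define Y where "Y p m = (\<Sum>k\<in>UNIV. cnj (E p k) * B k m)" for p m
  \<comment> \<open>\<open>X\<close> is \<open>B\<close> in the frame given by the Gram vectors, and
    symmetric because \<open>B\<close> is. In the sum over \<open>X p q * cnj (X q p)\<close> this
    symmetry turns each term into a squared modulus.\<close>
  define X where "X p q = (\<Sum>m\<in>UNIV. cnj (E q m) * Y p m)" for p q
  have AY: "A j m = (\<Sum>p\<in>UNIV. E p j * Y p m)" for j m
    unfolding A E Y_def sum_distrib_left sum_distrib_right by (subst sum.swap) (simp add: mult_ac)
  have X: "X q p = X p q" for p q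
    unfolding X_def Y_def sum_distrib_left by (subst sum.swap) (simp add: B mult_ac)
  define r where "r = (\<Sum>p\<in>UNIV. \<Sum>q\<in>UNIV. (cmod (X p q))\<^sup>2)"
  have "(\<Sum>j\<in>UNIV. \<Sum>m\<in>UNIV. A j m * cnj (A m j)) = (\<Sum>p\<in>UNIV. \<Sum>q\<in>UNIV. X p q * cnj (X p q))"
  proof -
    have "(\<Sum>j\<in>UNIV. \<Sum>m\<in>UNIV. A j m * cnj (A m j)) = (\<Sum>j\<in>UNIV. \<Sum>m\<in>UNIV. \<Sum>p\<in>UNIV. \<Sum>q\<in>UNIV. (cnj (E q m) * Y p m) * cnj (cnj (E p j) * Y q j))"
      unfolding AY by (simp add: sum_distrib_left sum_distrib_right mult_ac) (intro sum.cong refl sum.swap)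
    also have "\<dots> = (\<Sum>j\<in>UNIV. \<Sum>p\<in>UNIV. \<Sum>q\<in>UNIV. \<Sum>m\<in>UNIV. (cnj (E q m) * Y p m) * cnj (cnj (E p j) * Y q j))"
      by (intro sum.cong refl sum3_rot)
    also have "\<dots> = (\<Sum>p\<in>UNIV. \<Sum>q\<in>UNIV. \<Sum>j\<in>UNIV. \<Sum>m\<in>UNIV. (cnj (E q m) * Y p m) * cnj (cnj (E p j) * Y q j))"
      by (rule sum3_rot)
    also have "\<dots> = (\<Sum>p\<in>UNIV. \<Sum>q\<in>UNIV. X p q * cnj (X q p))"
      unfolding X_def cnj_sum sum_distrib_left sum_distrib_right ..
    also have "\<dots> = (\<Sum>p\<in>UNIV. \<Sum>q\<in>UNIV. X p q * cnj (X p q))"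
      by (intro sum.cong refl) (simp only: X)
    finally show ?thesis .
  qed
  then have "(\<Sum>j\<in>UNIV. \<Sum>m\<in>UNIV. A j m * cnj (A m j)) = of_real r"
    unfolding r_def by (simp add: complex_norm_square del: of_real_power)
  moreover have "0 \<le> r" unfolding r_def by (intro sum_nonneg) auto
  moreover have "A j m = 0" if "r = 0" for j m
  proof -
    have X0: "X p q = 0" for p q
      using that unfolding r_def by (auto simp: sum_nonneg_eq_0_iff sum_nonneg)
    have "(\<Sum>l\<in>UNIV. (\<Sum>m\<in>UNIV. M l m * A j m) * N l m) = (\<Sum>m'\<in>UNIV. A j m' * (\<Sum>l\<in>UNIV. M l m' * N l m))"
      unfolding sum_distrib_left sum_distrib_right by (subst sum.swap) (simp add: mult_ac)
    also have "\<dots> = (\<Sum>m'\<in>UNIV. if m' = m then A j m else 0)" unfolding N by (intro sum.cong) auto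
    finally have "A j m = (\<Sum>l\<in>UNIV. (\<Sum>m\<in>UNIV. M l m * A j m) * N l m)" by simp
    moreover have "(\<Sum>m\<in>UNIV. M l m * A j m) = (\<Sum>p\<in>UNIV. \<Sum>q\<in>UNIV. E p j * E q l * X p q)" for l
    proof -
      have "(\<Sum>m\<in>UNIV. M l m * A j m) = (\<Sum>m\<in>UNIV. \<Sum>p\<in>UNIV. \<Sum>q\<in>UNIV. E p j * E q l * (cnj (E q m) * Y p m))"
        unfolding AY E by (simp add: sum_distrib_left sum_distrib_right mult_ac) (rule sum.cong[OF refl], subst sum.swap, simp add: mult_ac)
      also have "\<dots> = (\<Sum>p\<in>UNIV. \<Sum>q\<in>UNIV. \<Sum>m\<in>UNIV. E p j * E q l * (cnj (E q m) * Y p m))"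
        by (rule sum3_rot)
      finally show ?thesis unfolding X_def sum_distrib_left .
    qed
    ultimately show ?thesis by (simp add: X0)
  qed
  ultimately show ?thesis by (intro that)
qed


text \<open>Writing \<open>u\<close> as the image under the metric of a vector \<open>x\<close>, the
  inverse form on \<open>u\<close> becomes the metric on the conjugate of \<open>x\<close>.\<close>

lemma (in kaehler_local) gi_pos:
  assumes u: "u \<noteq> (\<lambda>_. 0)"
  shows "Re (\<Sum>j\<in>UNIV. \<Sum>k\<in>UNIV. val (gi j k) z * u j * cnj (u k)) > 0"
proof -
  define x where "x k = (\<Sum>j\<in>UNIV. val (gi j k) z * u j)" for k
  define w :: "complex^3" where "w = (\<chi> k. cnj (x k))"
  have ux: "u l = (\<Sum>k\<in>UNIV. val (g l k) z * x k)" for l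
  proof -
    have "(\<Sum>k\<in>UNIV. val (g l k) z * x k) = (\<Sum>j\<in>UNIV. (\<Sum>k\<in>UNIV. val (gi j k) z * val (g l k) z) * u j)"
      unfolding x_def sum_distrib_left sum_distrib_right by (subst sum.swap) (simp add: mult_ac)
    also have "\<dots> = (\<Sum>j\<in>UNIV. if j = l then u l else 0)" unfolding val_inv1 by (intro sum.cong) auto
    finally show ?thesis by simp
  qed
  have "w \<noteq> 0"
  proof
    assume "w = 0"
    then have "x k = 0" for k by (simp add: w_def vec_eq_iff)
    then have "u = (\<lambda>_. 0)" by (intro ext) (simp add: ux)
    with u show False ..
  qed
  have "(\<Sum>j\<in>UNIV. \<Sum>k\<in>UNIV. val (gi j k) z * u j * cnj (u k)) = (\<Sum>k\<in>UNIV. x k * cnj (u k))"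
    unfolding x_def sum_distrib_right by (rule sum.swap)
  also have "\<dots> = (\<Sum>j\<in>UNIV. \<Sum>k\<in>UNIV. val (g j k) z * w $ j * cnj (w $ k))"
  proof -
    have "cnj (u k) = (\<Sum>j\<in>UNIV. val (g j k) z * cnj (x j))" for k
      unfolding ux by (simp add: val_herm)
    then show ?thesis unfolding w_def by (subst sum.swap) (simp add: sum_distrib_left mult_ac)
  qed
  finally show ?thesis using pos[OF \<open>w \<noteq> 0\<close>, of z] by (simp only: h_eq)
qed

context tower_weighted
begin

lemma lower_W: "(\<Sum>j\<in>UNIV. K.g \<alpha> j k * L.W \<alpha> j) = db k (cj (F \<alpha>))"
proof -
  have "(\<Sum>j\<in>UNIV. K.g \<alpha> j k * L.W \<alpha> j) = (\<Sum>l\<in>UNIV. (\<Sum>j\<in>UNIV. K.gi \<alpha> j l * K.g \<alpha> j k) * db l (cj (F \<alpha>)))"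
    unfolding L.W_up L.up_def sum_distrib_left sum_distrib_right by (subst sum.swap) (simp add: mult_ac)
  then show ?thesis unfolding K.inv2 by simp
qed

lemma val_dd_Wb: "val (dd j (L.Wb \<alpha> m)) z = cnj (val (db j (L.W \<alpha> m)) z)"
proof -
  have "cj (db j (L.W \<alpha> m)) = dd j (L.Wb \<alpha> m)" by (simp add: L.W_def)
  from arg_cong[OF this, of "\<lambda>F. val F z"] show ?thesis by (simp only: val_simps(9))
qed

text \<open>Lowering the index of \<open>db m (W j)\<close> gives \<open>B\<close>, a second
  \<open>db\<close>-derivative of \<open>cj F\<close> minus a Christoffel term. It is symmetric
  since derivatives commute and by \<open>kahb\<close>, as \<open>symmetric_trace_norm\<close>
  demands.\<close>

lemma integrand:
  obtains r :: real where "0 \<le> r"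
    "val (\<Sum>j\<in>UNIV. \<Sum>m\<in>UNIV. db m (L.W \<alpha> j) * dd j (L.Wb \<alpha> m)) z = of_real r"
    "\<And>j m. r = 0 \<Longrightarrow> val (db m (L.W \<alpha> j)) z = 0"
proof -
  define A where "A j m = val (db m (L.W \<alpha> j)) z" for j m
  define B where "B k m = (\<Sum>j\<in>UNIV. val (K.g \<alpha> j k) z * A j m)" for k m
  have B_sym: "B k m = B m k" for k m
  proof -
    have b: "B k m = val (db m (db k (cj (F \<alpha>))) - (\<Sum>j\<in>UNIV. db m (K.g \<alpha> j k) * L.W \<alpha> j)) z" for k m
      unfolding B_def A_def lower_W[of \<alpha> k, symmetric] by (simp add: sum.distrib)
    have "db m (K.g \<alpha> j k) = db k (K.g \<alpha> j m)" for j by (rule K.kahb)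
    then show ?thesis unfolding b by (simp only: db_db[of m k])
  qed
  have AB: "A j m = (\<Sum>k\<in>UNIV. val (K.gi \<alpha> j k) z * B k m)" for j m
  proof -
    have "(\<Sum>k\<in>UNIV. val (K.gi \<alpha> j k) z * B k m) = (\<Sum>l\<in>UNIV. (\<Sum>k\<in>UNIV. val (K.gi \<alpha> j k) z * val (K.g \<alpha> l k) z) * A l m)"
      unfolding B_def sum_distrib_left sum_distrib_right by (subst sum.swap) (simp add: mult_ac)
    also have "\<dots> = (\<Sum>l\<in>UNIV. if l = j then A j m else 0)" unfolding K.val_inv1 by (intro sum.cong) auto
    finally show ?thesis by simp
  qed
  have herm: "cnj (val (K.gi \<alpha> j k) z) = val (K.gi \<alpha> k j) z" for j k
    using arg_cong[OF K.hermi[of \<alpha> j k], of "\<lambda>F. val F z"] by simp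
  have e: "val (\<Sum>j\<in>UNIV. \<Sum>m\<in>UNIV. db m (L.W \<alpha> j) * dd j (L.Wb \<alpha> m)) z = (\<Sum>j\<in>UNIV. \<Sum>m\<in>UNIV. A j m * cnj (A m j))"
    by (simp only: val_sum val_simps(6) val_dd_Wb A_def)
  from symmetric_trace_norm[of "\<lambda>j k. val (K.gi \<alpha> j k) z" A B "\<lambda>j k. val (K.g \<alpha> j k) z", OF herm K.gi_pos AB B_sym K.val_inv2]
  obtain r :: real where r: "0 \<le> r" "(\<Sum>j\<in>UNIV. \<Sum>m\<in>UNIV. A j m * cnj (A m j)) = of_real r" "\<And>j m. r = 0 \<Longrightarrow> A j m = 0"
    by blast
  show ?thesis by (rule that[of r, OF r(1) _ r(3)[unfolded A_def]]) (simp only: e r(2))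
qed

section \<open>Integration over the manifold\<close>

lemma chart_change_flip:
  "chart_change (K.g \<alpha>) (K.gi \<alpha>) (K.D \<alpha>) (K.Di \<alpha>) (fs \<alpha>) (fsi \<alpha>) (fv \<alpha>) q (yvf b \<alpha>) (zvf n \<alpha>) (F \<alpha>)
    (K.g (flip m \<alpha>)) (K.gi (flip m \<alpha>)) (K.D (flip m \<alpha>)) (K.Di (flip m \<alpha>)) (fs (flip m \<alpha>)) (fsi (flip m \<alpha>)) (fv (flip m \<alpha>))
    (yvf b (flip m \<alpha>)) (zvf n (flip m \<alpha>)) (F (flip m \<alpha>))
    (ftau n \<alpha> m) (fjac n \<alpha> m) {z. z $ m \<noteq> 0} (fdet n \<alpha> m)
    (\<lambda>k z. (if k = m then of_int (\<Sum>l\<in>UNIV. fexp n \<alpha> m l) else 0) * (z $ m) powi (- 1))"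
proof unfold_locales
  fix z :: "complex^3" assume "z \<in> {z. z $ m \<noteq> 0}"
  then have z: "z $ m \<noteq> 0" by simp
  let ?e = "\<Sum>l\<in>UNIV. fexp n \<alpha> m l"
  have d: "fdet n \<alpha> m = (\<lambda>z. - 1 * (z $ m) powi ?e)" by (rule ext) (simp only: fdet_def)
  show "(ftau n \<alpha> m has_derivative (\<lambda>u. \<chi> l. \<Sum>j\<in>UNIV. fjac n \<alpha> m l j z * u $ j)) (at z)" by (rule ftau_deriv[OF z])
  show "det3 (\<lambda>l j. fjac n \<alpha> m l j z) \<noteq> 0" by (simp only: det3_fjac[OF z] fdet_nz[OF z] not_False_eq_True)
  show "val (F \<alpha>) z = val (F (flip m \<alpha>)) (ftau n \<alpha> m z)" by (rule F_flip[OF z])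
  show "val (K.D \<alpha>) z = fdet n \<alpha> m z * cnj (fdet n \<alpha> m z) * val (K.D (flip m \<alpha>)) (ftau n \<alpha> m z)"
  proof -
    have c: "det3 (\<lambda>j k. cnj (T j k)) = cnj (det3 T)" for T :: "3 \<Rightarrow> 3 \<Rightarrow> complex"
      by (simp add: det3_def cof_def sum_3)
    have "val (K.D \<alpha>) z = det3 (\<lambda>j k. \<Sum>a\<in>UNIV. \<Sum>b\<in>UNIV. fjac n \<alpha> m a j z * cnj (fjac n \<alpha> m b k z) * val (K.g (flip m \<alpha>) a b) (ftau n \<alpha> m z))"
      unfolding K.D_def val_det3 g_flip[OF z] ..
    also have "\<dots> = fdet n \<alpha> m z * cnj (fdet n \<alpha> m z) * val (K.D (flip m \<alpha>)) (ftau n \<alpha> m z)"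
      unfolding det3_mult c det3_fjac[OF z] K.D_def val_det3 ..
    finally show ?thesis .
  qed
  show "fdet n \<alpha> m z \<noteq> 0" by (rule fdet_nz[OF z])
  show "fdet n \<alpha> m differentiable at z" unfolding d by (rule holo_coord_powi[OF z])
  show "wdb k (fdet n \<alpha> m) z = 0" for k unfolding d by (rule holo_coord_powi[OF z])
  show "wd k (fdet n \<alpha> m) z = (if k = m then of_int ?e else 0) * (z $ m) powi - 1 * fdet n \<alpha> m z" for k
    unfolding d holo_coord_powi(3)[OF z] using z by (simp add: power_int_diff power_int_minus divide_inverse)
  show "val (K.g \<alpha> j k) z = (\<Sum>a\<in>UNIV. \<Sum>b\<in>UNIV. fjac n \<alpha> m a j z * cnj (fjac n \<alpha> m b k z) * val (K.g (flip m \<alpha>) a b) (ftau n \<alpha> m z))" for j k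
    by (rule g_flip[OF z])
  show "fjac n \<alpha> m l j differentiable at z" "wdb k (fjac n \<alpha> m l j) z = 0" for l j k by (rule fjac_holo[OF z])+
  show "(\<lambda>z. (if k = m then of_int ?e else 0) * (z $ m) powi - 1) differentiable at z"
    "wdb l (\<lambda>z. (if k = m then of_int ?e else 0) * (z $ m) powi - 1) z = 0" for k l by (rule holo_coord_powi[OF z])+
  show "val (fs \<alpha>) z = val (fs (flip m \<alpha>)) (ftau n \<alpha> m z)" "val (fsi \<alpha>) z = val (fsi (flip m \<alpha>)) (ftau n \<alpha> m z)"
    "val (fv \<alpha>) z = val (fv (flip m \<alpha>)) (ftau n \<alpha> m z)"
    unfolding val_fs val_fsi val_fv fc_flip[OF z] by (rule refl)+
qed (rule open_coord_nz)

lemma V_flip: "z $ m \<noteq> 0 \<Longrightarrow> val (L.V (flip m \<alpha>) j) (ftau n \<alpha> m z) = (\<Sum>k\<in>UNIV. cnj (fjac n \<alpha> m j k z) * val (L.V \<alpha> k) z)"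
  by (rule chart_change.V_t[OF chart_change_flip]) simp

lemma W_flip: "z $ m \<noteq> 0 \<Longrightarrow> val (L.W (flip m \<alpha>) j) (ftau n \<alpha> m z) = (\<Sum>k\<in>UNIV. fjac n \<alpha> m j k z * val (L.W \<alpha> k) z)"
  by (rule chart_change.W_t[OF chart_change_flip]) simp

end

lemma (in kaehler_local) g_diag_nz: "val (g j j) z \<noteq> 0"
proof -
  have "axis j (1::complex) \<noteq> (0 :: complex^3)" by (simp add: vec_eq_iff axis_def)
  from pos[OF this, of z] show ?thesis unfolding h_axis by auto
qed

context tower_weighted
begin

definition current where "current \<alpha> m = K.D \<alpha> * L.V \<alpha> m"

text \<open>On the face the Jacobian determinant has modulus 1, so the densities agree. Row
  \<open>m\<close> of the Jacobian has only its diagonal entry, so component \<open>m\<close> of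
  \<open>V\<close> goes to a multiple of itself; that multiple and the change of \<open>t\<close> in
  \<open>flux\<close> combine to the factor -1.\<close>

lemma flux_current_flip: "flux m (val (current (flip m \<alpha>) m)) = - flux m (val (current \<alpha> m))"
proof (rule flux_cancel[OF smooth_continuous[OF val_smooth] smooth_continuous[OF val_smooth],
      where a = "of_int (fexp n \<alpha> m (nx m))" and b = "of_int (fexp n \<alpha> m (nx (nx m)))"])
  fix \<theta> :: real and s r :: complex
  define z where "z = pt m s r (cis \<theta>)"
  let ?w = "pt m (s * cis (of_int (fexp n \<alpha> m (nx m)) * \<theta>)) (r * cis (of_int (fexp n \<alpha> m (nx (nx m))) * \<theta>)) (cis (- \<theta>))"
  have zm: "z $ m = cis \<theta>" by (simp add: z_def pt_def)
  then have nz: "z $ m \<noteq> 0" and n1: "cmod (z $ m) = 1" by simp_all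
  have w: "ftau n \<alpha> m z = ?w"
    using exhaust_3[of m] unfolding z_def pt_def
    by (elim disjE) (simp_all add: vec_eq_iff forall_3 ftau_nth cis_power_int cis_inverse)
  have D: "val (K.D \<alpha>) z = val (K.D (flip m \<alpha>)) ?w"
    using chart_change.Dt[OF chart_change_flip, of z m \<alpha>] nz fdet_unit[OF n1, of n \<alpha>] by (simp add: w)
  have "fjac n \<alpha> m m k z = (if k = m then - cis (- 2 * \<theta>) else 0)" for k
    using zm by (auto simp: fjac_def cis_power_int)
  then have "val (L.V (flip m \<alpha>) m) ?w = (\<Sum>k\<in>UNIV. if k = m then - cis (2 * \<theta>) * val (L.V \<alpha> m) z else 0)"
    unfolding V_flip[OF nz, of \<alpha> m, unfolded w] by (intro sum.cong) (auto simp: cis_cnj)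
  then have V: "val (L.V (flip m \<alpha>) m) ?w = - cis (2 * \<theta>) * val (L.V \<alpha> m) z" by simp
  have e: "cis (2 * \<theta>) * cis (- \<theta>) = cis \<theta>" by (simp add: cis_mult)
  have alg: "x * (- c * v) * d = - (x * v) * (c * d)" for x c v d :: complex by (simp add: mult_ac)
  show "val (current (flip m \<alpha>) m) ?w * cis (- \<theta>) = - val (current \<alpha> m) (pt m s r (cis \<theta>)) * cis \<theta>"
    unfolding current_def val_simps(6) V D[symmetric] z_def[symmetric] alg e ..
qed

lemma sum_flip: "(\<Sum>\<alpha>\<in>UNIV. \<phi> (flip m \<alpha>)) = (\<Sum>\<alpha>\<in>UNIV. \<phi> \<alpha> :: complex)"
  by (rule sum.reindex_bij_witness[of _ "flip m" "flip m"]) (simp_all del: flip.simps)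

lemma flux_current_sum: "(\<Sum>\<alpha>\<in>UNIV. flux m (val (current \<alpha> m))) = 0"
proof -
  have "(\<Sum>\<alpha>\<in>UNIV. flux m (val (current \<alpha> m))) = (\<Sum>\<alpha>\<in>UNIV. flux m (val (current (flip m \<alpha>) m)))"
    by (rule sum_flip[symmetric])
  then show ?thesis unfolding flux_current_flip by (simp add: sum_negf)
qed

definition density where
  "density \<alpha> = K.D \<alpha> * fv \<alpha> * (\<Sum>j\<in>UNIV. \<Sum>m\<in>UNIV. db m (L.W \<alpha> j) * dd j (L.Wb \<alpha> m))"

lemma density_divergence: "(\<Sum>m\<in>UNIV. db m (current \<alpha> m)) = density \<alpha>"
  unfolding current_def density_def by (rule L.div_V[OF constant_trace])

text \<open>On each polydisc the divergence turns into fluxes through the three families of faces. A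
  flip pairs the eight charts, and paired fluxes are opposite.\<close>

lemma pint_density: "(\<Sum>\<alpha>\<in>UNIV. pint 1 (val (density \<alpha>))) = 0"
proof -
  have c: "continuous_on UNIV (val G)" for G by (rule smooth_continuous[OF val_smooth])
  have p: "pint 1 (val (density \<alpha>)) = (\<Sum>m\<in>UNIV. flux m (val (current \<alpha> m))) / 2" for \<alpha>
  proof -
    have s: "pint 1 (val (G + H)) = pint 1 (val G) + pint 1 (val H)" for G H
      using pint_add[OF c c, of 1 G H] by (simp add: fun_eq_iff[symmetric] val_simps(3)[abs_def])
    have f: "pint 1 (val (db m (current \<alpha> m))) = flux m (val (current \<alpha> m)) / 2" for m
    proof -
      have "pint 1 (val (db m (current \<alpha> m))) = pint m (val (db m (current \<alpha> m)))" by (rule pint_indep[OF c])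
      moreover have "val (db m (current \<alpha> m)) = wdb m (val (current \<alpha> m))" by (rule ext) simp
      ultimately show ?thesis using pint_stokes[OF val_smooth] by simp
    qed
    show ?thesis unfolding density_divergence[symmetric] sum_3 s f by simp
  qed
  have "(\<Sum>\<alpha>\<in>UNIV. \<Sum>m\<in>UNIV. flux m (val (current \<alpha> m))) = (\<Sum>m\<in>UNIV. \<Sum>\<alpha>\<in>UNIV. flux m (val (current \<alpha> m)))"
    by (rule sum.swap)
  then show ?thesis unfolding p by (simp add: flux_current_sum flip: sum_divide_distrib)
qed

lemma density_real:
  obtains r where "0 \<le> r" "val (density \<alpha>) z = of_real r" "\<And>j m. r = 0 \<Longrightarrow> val (db m (L.W \<alpha> j)) z = 0"
proof -
  from integrand[of \<alpha> z] obtain r :: real where r: "0 \<le> r"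
    "val (\<Sum>j\<in>UNIV. \<Sum>m\<in>UNIV. db m (L.W \<alpha> j) * dd j (L.Wb \<alpha> m)) z = of_real r"
    "\<And>j m. r = 0 \<Longrightarrow> val (db m (L.W \<alpha> j)) z = 0" by blast
  define d where "d = Re (val (K.D \<alpha>) z)"
  have D: "val (K.D \<alpha>) z = of_real d" "d > 0" using K.D_pos[of \<alpha> z] by (auto simp: complex_eq_iff d_def)
  define v where "v = fc \<alpha> z powr q"
  have v: "v > 0" using fc_pos[of \<alpha> z] by (simp add: v_def)
  have "val (density \<alpha>) z = of_real (d * v * r)"
    unfolding density_def val_simps(6) r(2) val_fv D v_def[symmetric] by simp
  moreover have "0 \<le> d * v * r" using D v r(1) by simp
  moreover have "d * v * r = 0 \<Longrightarrow> r = 0" using D v by simp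
  ultimately show ?thesis using r(3) by (intro that) auto
qed

text \<open>Eight nonnegative integrals with sum 0 are all 0, and then the continuous density
  vanishes pointwise. The conclusion covers the closed polydisc of each chart, the domain of
  integration; together the polydiscs fill \<open>M\<close>.\<close>

theorem W_holomorphic:
  assumes z: "\<And>i. cmod (z $ i) \<le> 1"
  shows "val (db m (L.W \<alpha> j)) z = 0"
proof -
  define \<rho> where "\<rho> \<alpha> z = Re (val (density \<alpha>) z)" for \<alpha> z
  have c: "continuous_on UNIV (val G)" for G by (rule smooth_continuous[OF val_smooth])
  have c\<rho>: "continuous_on UNIV (\<rho> \<alpha>)" for \<alpha> unfolding \<rho>_def by (intro continuous_intros c)
  have \<rho>: "0 \<le> \<rho> \<alpha> z" "\<rho> \<alpha> z = 0 \<Longrightarrow> val (db m (L.W \<alpha> j)) z = 0" for \<alpha> z j m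
    using density_real[of \<alpha> z] unfolding \<rho>_def by (metis Re_complex_of_real)+
  have "pint 1 (\<rho> \<alpha>) = Re (pint 1 (val (density \<alpha>)))" for \<alpha>
    unfolding \<rho>_def by (rule pint_linear[OF bounded_linear_Re c])
  then have "(\<Sum>\<alpha>\<in>UNIV. pint 1 (\<rho> \<alpha>)) = 0"
    using arg_cong[OF pint_density, of Re] by simp
  then have "\<forall>\<alpha>\<in>UNIV. pint 1 (\<rho> \<alpha>) = 0"
    using pint_nonneg_zero(1)[OF c\<rho> \<rho>(1), of 1] by (subst (asm) sum_nonneg_eq_0_iff) simp_all
  then have "pint 1 (\<rho> \<alpha>) = 0" by blast
  from pint_nonneg_zero(2)[OF c\<rho> \<rho>(1) this z] show ?thesis by (rule \<rho>(2))
qed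

section \<open>The gradient field of the potential along the base curve\<close>

text \<open>Both exponents governing the base flip along \<open>C\<close> equal \<open>n\<close>, so
  a normal component decays at infinity like the \<open>n\<close>-th power of
  \<open>inverse t\<close>, and \<open>n \<ge> 1\<close> gives the limit 0. Holomorphy is known on
  the unit disc of either chart; the relation carries it to the outside, and Liouville's theorem
  finishes.\<close>

lemma W_base_transversal:
  assumes j: "j \<noteq> 1"
  shows "val (L.W (i, True, False) j) (put 1 t 0) = 0"
proof -
  define p where "p i t = val (L.W (i, True, False) j) (put 1 t 0)" for i t
  have rel: "p (\<not> i) (inverse t) = t ^ n * p i t" if t: "t \<noteq> 0" for i t
  proof -
    let ?z = "put 1 t 0 :: complex^3"
    have "ftau n (i, True, False) 1 ?z = put 1 (inverse t) 0"
      by (simp add: vec_eq_iff forall_3 ftau_nth)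
    moreover have "(\<Sum>k\<in>UNIV. fjac n (i, True, False) 1 j k ?z * val (L.W (i, True, False) k) ?z) = t ^ n * p i t"
      using j exhaust_3[of j] by (elim disjE) (simp_all add: sum_3 fjac_def p_def)
    ultimately show ?thesis
      using W_flip[of ?z 1 "(i, True, False)" j] t by (simp add: p_def)
  qed
  have in_disc: "p i field_differentiable at t" if t: "cmod t \<le> 1" for i t
  proof -
    have "val (db 1 (L.W (i, True, False) j)) (put 1 t 0) = 0"
      by (rule W_holomorphic) (use t in \<open>auto\<close>)
    then show ?thesis unfolding p_def[abs_def] field_differentiable_def
      using slice_derivative[OF val_smooth, of 1 "L.W (i, True, False) j" t 0] by auto
  qed
  have inv: "p i t = inverse t ^ n * p (\<not> i) (inverse t)" if "t \<noteq> 0" for i t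
    using rel[OF that, of i] that by (simp add: power_inverse field_simps)
  have "p i field_differentiable at t" for i t
  proof (cases "cmod t \<le> 1")
    case False
    then have t: "t \<noteq> 0" "cmod (inverse t) \<le> 1" by (auto simp: norm_inverse inverse_le_1_iff)
    have "((\<lambda>t. p (\<not> i) (inverse t))) field_differentiable at t"
      using field_differentiable_compose[of inverse t "p (\<not> i)"] in_disc[OF t(2), of "\<not> i"] t(1)
      by (simp add: comp_def field_differentiable_inverse[OF field_differentiable_ident])
    then have "(\<lambda>t. inverse t ^ n * p (\<not> i) (inverse t)) field_differentiable at t"
      by (intro field_differentiable_mult field_differentiable_power field_differentiable_inverse field_differentiable_ident t(1))
    then obtain d where "((\<lambda>t. inverse t ^ n * p (\<not> i) (inverse t)) has_field_derivative d) (at t)"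
      unfolding field_differentiable_def by blast
    then have "(p i has_field_derivative d) (at t)"
    proof (rule has_field_derivative_transform_within_open[of _ _ _ "- {0}"])
      show "inverse x ^ n * p (\<not> i) (inverse x) = p i x" if "x \<in> - {0}" for x
        by (rule inv[symmetric]) (use that in simp)
    qed (use t in auto)
    then show ?thesis by (auto simp: field_differentiable_def)
  qed (rule in_disc)
  then have "p i holomorphic_on UNIV" by (simp add: holomorphic_on_def)
  moreover have "(p i \<longlongrightarrow> 0) at_infinity"
  proof (rule Lim_transform_eventually)
    have "isCont (p (\<not> i)) 0"
      using in_disc[of 0 "\<not> i"] by (auto intro: field_differentiable_imp_continuous_at)
    then have "((\<lambda>t. p (\<not> i) (inverse t)) \<longlongrightarrow> p (\<not> i) 0) at_infinity"
      by (rule isCont_tendsto_compose[OF _ tendsto_inverse_0])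
    from tendsto_mult[OF tendsto_power[OF tendsto_inverse_0, of n] this]
    show "((\<lambda>t. inverse t ^ n * p (\<not> i) (inverse t)) \<longlongrightarrow> 0) at_infinity"
      using n by (simp add: power_0_left)
    show "\<forall>\<^sub>F t in at_infinity. inverse t ^ n * p (\<not> i) (inverse t) = p i t"
    proof -
      have "inverse t ^ n * p (\<not> i) (inverse t) = p i t" if "1 \<le> norm t" for t
        by (rule inv[symmetric]) (use that in auto)
      then show ?thesis unfolding eventually_at_infinity by blast
    qed
  qed
  ultimately have "p i t = 0" by (rule Liouville_weak_0)
  then show ?thesis by (simp add: p_def)
qed

text \<open>\<open>F\<close> vanishes on \<open>C\<close>, so the differential of
  \<open>cj F\<close> has no component along \<open>C\<close>. Lowering \<open>W\<close>, whose
  normal components are already 0, leaves \<open>g 1 1\<close> times the tangential one.\<close>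

lemma W_base: "val (L.W (i, True, False) j) (put 1 t 0) = 0"
proof (cases "j = 1")
  case True
  let ?\<alpha> = "(i, True, False)" and ?z = "put 1 t 0 :: complex^3"
  define G where "G = val (cj (F ?\<alpha>))"
  have sG: "smooth G" unfolding G_def by (rule val_smooth)
  have "(\<lambda>z. G (put 2 0 (put 3 0 z))) = (\<lambda>z. 0)" by (rule ext) (simp add: G_def F_C)
  then have "wdb 1 (\<lambda>z. G (put 2 0 (put 3 0 z))) ?z = 0" by (simp only: wirtinger_const)
  moreover have "wdb 1 (\<lambda>z. G (put 2 0 (put 3 0 z))) ?z = wdb 1 G (put 2 0 (put 3 0 ?z))"
    using wdb_put0[OF smooth_put0[OF sG, of 2], of 1 3 ?z] by (simp add: wdb_put0[OF sG])
  moreover have "put 2 0 (put 3 0 ?z) = ?z" by (simp add: vec_eq_iff)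
  ultimately have "val (db 1 (cj (F ?\<alpha>))) ?z = 0" by (simp add: G_def)
  then have "(\<Sum>j\<in>UNIV. val (K.g ?\<alpha> j 1) ?z * val (L.W ?\<alpha> j) ?z) = 0"
    unfolding lower_W[symmetric] by simp
  then have "val (K.g ?\<alpha> 1 1) ?z * val (L.W ?\<alpha> 1) ?z = 0"
    by (simp add: sum_3 W_base_transversal)
  moreover have "val (K.g ?\<alpha> 1 1) ?z \<noteq> 0" by (rule K.g_diag_nz)
  ultimately show ?thesis using True by simp
qed (rule W_base_transversal)

text \<open>The differential of \<open>F\<close> is known twice: \<open>db\<close> of
  \<open>F\<close> is the metric applied to \<open>Z\<close>, and \<open>dd\<close> of
  \<open>F\<close> is the metric applied to \<open>Wb\<close>. Computed through \<open>Wb\<close>,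
  which is antiholomorphic near \<open>O\<close> and zero to second order there, the derivative
  \<open>dd 2 (db 2 (dd 2 F))\<close> is 0; computed through \<open>Z\<close> it is
  \<open>- 2\<close> times \<open>g 2 2\<close>.\<close>

theorem contradiction: False
proof -
  let ?\<alpha> = "(False, True, False)" and ?O = "0 :: complex^3"
  have Oe: "put 1 0 ?O = ?O" by (simp add: vec_eq_iff)
  have Wb0: "val (L.Wb ?\<alpha> p) ?O = 0" for p
    using W_base[of False p 0] by (simp add: Oe L.W_def)
  have dW: "val (dd l (L.Wb ?\<alpha> p)) z = 0" if "norm z < 1" for l p z
  proof -
    have "cmod (z $ i) \<le> 1" for i using Finite_Cartesian_Product.norm_nth_le[of z i] that by simp
    from W_holomorphic[OF this] show ?thesis unfolding val_dd_Wb by simp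
  qed
  have ddW: "val (dd l (db k (L.Wb ?\<alpha> p))) ?O = 0" for l k p
  proof -
    have "wdb k (val (dd l (L.Wb ?\<alpha> p))) ?O = wdb k (\<lambda>_. 0) ?O"
      by (rule wirtinger_cong(2)[of "ball 0 1"]) (use dW in auto)
    then show ?thesis unfolding dd_db by (simp only: val_simps(8) wirtinger_const)
  qed
  have lF: "dd m (F ?\<alpha>) = (\<Sum>p\<in>UNIV. K.g ?\<alpha> m p * L.Wb ?\<alpha> p)" for m
  proof -
    have "cj (\<Sum>j\<in>UNIV. K.g ?\<alpha> j m * L.W ?\<alpha> j) = cj (db m (cj (F ?\<alpha>)))" by (simp only: lower_W)
    then show ?thesis by (simp add: K.herm L.W_def)
  qed
  have Z0: "val (zvf n ?\<alpha> j) ?O = 0" "val (dd m (zvf n ?\<alpha> j)) ?O = 0" for j m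
    using exhaust_3[of j] by (elim disjE; simp)+
  \<comment> \<open>In this chart the second component of \<open>Z\<close> is
    \<open>- (coord 2 * coord 2)\<close>, and the third is a multiple of
    \<open>coord 2 * coord 3\<close>.\<close>
  have Z2: "val (dd 2 (dd 2 (zvf n ?\<alpha> j))) ?O = (if j = 2 then - 2 else 0)" for j
    using exhaust_3[of j] by (elim disjE; simp add: val_2)
  \<comment> \<open>The double zero of \<open>Z\<close> makes the mixed second derivatives of
    \<open>F\<close> vanish at \<open>O\<close>. As \<open>Wb\<close> is 0 there, they are the
    metric applied to \<open>db k Wb\<close>, and the inverse metric isolates that vector.\<close>
  have dbW: "val (db k (L.Wb ?\<alpha> r)) ?O = 0" for k r
  proof -
    have "val (db k (dd m (F ?\<alpha>))) ?O = val (dd m (\<Sum>j\<in>UNIV. K.g ?\<alpha> j k * zvf n ?\<alpha> j)) ?O" for m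
      by (simp only: L.dF[symmetric] dd_db)
    then have "(\<Sum>p\<in>UNIV. val (K.g ?\<alpha> m p) ?O * val (db k (L.Wb ?\<alpha> p)) ?O) = 0" for m
      unfolding lF d_sum d_mult val_sum val_simps(3,6) Wb0 Z0 by simp
    then have "(\<Sum>m\<in>UNIV. val (K.gi ?\<alpha> m r) ?O * (\<Sum>p\<in>UNIV. val (K.g ?\<alpha> m p) ?O * val (db k (L.Wb ?\<alpha> p)) ?O)) = 0"
      by simp
    moreover have "(\<Sum>m\<in>UNIV. val (K.gi ?\<alpha> m r) ?O * (\<Sum>p\<in>UNIV. val (K.g ?\<alpha> m p) ?O * X p)) = X r" for X :: "3 \<Rightarrow> complex"
    proof -
      have "(\<Sum>m\<in>UNIV. val (K.gi ?\<alpha> m r) ?O * (\<Sum>p\<in>UNIV. val (K.g ?\<alpha> m p) ?O * X p)) =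
          (\<Sum>p\<in>UNIV. (\<Sum>m\<in>UNIV. val (K.gi ?\<alpha> m r) ?O * val (K.g ?\<alpha> m p) ?O) * X p)"
        unfolding sum_distrib_left sum_distrib_right by (subst sum.swap) (simp add: mult_ac)
      also have "\<dots> = (\<Sum>p\<in>UNIV. if p = r then X r else 0)" unfolding K.val_inv2 by (intro sum.cong) auto
      finally show ?thesis by simp
    qed
    ultimately show ?thesis by simp
  qed
  have "val (dd 2 (db 2 (dd 2 (F ?\<alpha>)))) ?O = val (dd 2 (dd 2 (\<Sum>j\<in>UNIV. K.g ?\<alpha> j 2 * zvf n ?\<alpha> j))) ?O"
    by (simp only: L.dF[symmetric] dd_db)
  then have "0 = (\<Sum>j\<in>UNIV. val (K.g ?\<alpha> j 2) ?O * (if j = 2 then - 2 else 0))"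
    unfolding lF d_sum d_mult d_add val_sum val_simps(3,6) Wb0 Z0 Z2 dbW ddW using dW[of 0] by simp
  then have "val (K.g ?\<alpha> 2 2) ?O = 0" by (simp add: sum_3)
  then show False using K.g_diag_nz by blast
qed

end

theorem corollary2:
  fixes n :: nat and b q a :: real
  assumes "n \<ge> 1" and "a > 0"
  shows "\<not> (\<exists>g. constant_weighted_scal_metric (tower n) (tower_chart n)
            (\<lambda>\<alpha> z. b *\<^sub>R tower_K n \<alpha> z) q a g)"
proof
  assume "\<exists>g. constant_weighted_scal_metric (tower n) (tower_chart n)
            (\<lambda>\<alpha> z. b *\<^sub>R tower_K n \<alpha> z) q a g"
  then obtain g f c where g: "kaehler_metric (tower_chart n) g"
    and pot: "normalized_killing_potential (tower_chart n) g (\<lambda>\<alpha> z. b *\<^sub>R tower_K n \<alpha> z) a f"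
    and pos: "\<And>p. p \<in> tower n \<Longrightarrow> f p > 0"
    and c: "\<And>\<alpha> z. weighted_scal (g \<alpha>) (\<lambda>z. b *\<^sub>R tower_K n \<alpha> z) (f \<circ> tower_chart n \<alpha>) q z = c"
    unfolding constant_weighted_scal_metric_def by blast
  interpret T: tower_kaehler n g by unfold_locales (rule assms(1) g)+
  from T.potential_exists obtain G where G: "\<And>\<alpha>. smooth (G \<alpha>)" "\<And>\<alpha> m z. wdb m (G \<alpha>) z = val (T.al \<alpha> m) z"
    "\<And>\<alpha> m z. z $ m \<noteq> 0 \<Longrightarrow> G \<alpha> z = G (flip m \<alpha>) (ftau n \<alpha> m z)"
    "\<And>i z. z $ 2 = 0 \<Longrightarrow> z $ 3 = 0 \<Longrightarrow> G (i, True, False) z = 0"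
    by blast
  define F where "F \<alpha> = mk_sfun (G \<alpha>)" for \<alpha>
  have F: "val (F \<alpha>) = G \<alpha>" for \<alpha> unfolding F_def by (rule val_mk[OF G(1)])
  interpret tower_weighted n g b q c f F
  proof
    show "smooth (f \<circ> tower_chart n \<alpha>)"
      "kaehler_form (g \<alpha>) z (b *\<^sub>R tower_K n \<alpha> z) u = - dir_deriv (f \<circ> tower_chart n \<alpha>) z u" for \<alpha> z u
      using pot unfolding normalized_killing_potential_def by blast+
    show "f (tower_chart n \<alpha> z) > 0" for \<alpha> z
      by (rule pos) (unfold tower_eq_charts, blast)
    show "db m (F \<alpha>) = T.al \<alpha> m" for m \<alpha> by (rule sfun_eqI) (simp add: F G(2))
  qed (use c G(3,4) F in auto)
  show False by (rule contradiction)
qed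

end
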